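(* Let $\mathcal B$ be a terminating monotonicity constraint system (MCS) with $m$ flow-points and $n$ variables per flow-point. There is a global ranking function $\rho$ for $\mathcal B$ where $\rho(f,\sigma)$ is defined by a set of elements (vectors) of $V^{mB_n}$, each one associated with certain inequalities on variables, which define the region where the given vector is the function value (i.e. $\rho(f,\sigma)=\mathbf v\sigma$ when $\sigma$ lies in the region associated with the vector $\mathbf v$ at flow-point $f$). There are at most $B_n$ different vectors for any flow-point. The complexity of constructing $\rho$ is $O(|\mathcal B|\cdot n^{2n+1})$, where $|\mathcal B|$ is the number of monotonicity constraints (abstract transitions) of $\mathcal B$.
   Context: Let $n\ge 1$. A monotonicity constraint (MC) is a conjunction of order constraints $u\rhd v$ with $\rhd\in\{>,\ge\}$ and $u,v\in\{x_1,\dots,x_n,x_1',\dots,x_n'\}$ (unprimed: source state; primed: target state; $u=v$ abbreviates $u\ge v\wedge v\ge u$). An MCS $\mathcal B$ consists of a finite set $F^{\mathcal B}$ of flow-points; a finite directed graph (control-flow graph, parallel arcs allowed) on $F^{\mathcal B}$; for every arc $f\to g$ an MC $G$ associated with it (written $G:f\to g$); and for every flow-point $f$ an invariant $I_f$, a conjunction of order constraints among $x_1,\dots,x_n$. It is assumed without loss of generality that $|\mathcal B|\ge |F^{\mathcal B}|$. Semantics: let $\mathit{Val}$ be a well-ordered set (a well-founded total order). A state is a pair $(f,\sigma)$ with $f\in F^{\mathcal B}$ and $\sigma:\{1,\dots,n\}\to\mathit{Val}$ ($\sigma(i)$ is the value of $x_i$). For $G:f\to g$ in $\mathcal B$, there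 is a transition $(f,\sigma)\mapsto(g,\sigma')$ described by $G$ if $\sigma\models I_f$, $\sigma'\models I_g$ and $\sigma,\sigma'\models G$ (unprimed variables valued by $\sigma$, primed by $\sigma'$). The transition system $T_{\mathcal B}$ is the set of all transitions described by MCs of $\mathcal B$. $\mathcal B$ is terminating if, for every choice of well-ordered set $\mathit{Val}$, $T_{\mathcal B}$ has no infinite run $s_0\mapsto s_1\mapsto\cdots$. A global ranking function for $\mathcal B$ is a function $\rho$ from states to a well-founded set such that $\rho(s)>\rho(s')$ for every $(s,s')\in T_{\mathcal B}$. $B_n$ is the $n$th ordered Bell number, i.e. the number of orderings of $n$ variables with equalities allowed (total preorders). For an integer $B>0$, $V^B$ is the set of tuples $\mathbf v=\langle v_1,v_2,\dots\rangle$ of even length, where every even position is a variable among $\{x_1,\dots,x_n\}$, such that every variable appears at most once, and every odd position is an integer between $0$ and $B$. The value $\mathbf v\sigma$ of $\mathbf v\in V^B$ in state $(f,\sigma)$ is the tuple obtained by replacing each variable $x_i$ by $\sigma(i)$; such tuples are compared lexicographically.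
   Formalization: The requirement that tuples in V^B have even length is dropped: a tuple may also end with an integer. With even length the claim fails, e.g. n=1 with arcs f→g: x≥x' and g→f: x>x'. *)

theory Defs
  imports "HOL-Library.FuncSet" "HOL-Library.Countable_Set"
begin

section \<open>Monotonicity constraint systems\<close>

datatype 'x ocon = Gt 'x 'x | Ge 'x 'x

text \<open>Variables are named by their index: \<open>i\<close> stands for \<open>x\<^sub>i\<close>, and inside a transition
  constraint \<open>Cur i\<close> stands for \<open>x\<^sub>i\<close> and \<open>Nxt i\<close> for \<open>x\<^sub>i'\<close>.\<close>

datatype tvar = Cur nat | Nxt nat

text \<open>The arcs form a list, so that parallel arcs, even with equal constraints, are counted
  separately; a conjunction is the set of its conjuncts.\<close>

record 'f mcs =
  points :: "'f set"
  arcs :: "('f \<times> tvar ocon set \<times> 'f) list"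
  invar :: "'f \<Rightarrow> nat ocon set"

abbreviation mcs_size :: "'f mcs \<Rightarrow> nat" where
  "mcs_size B \<equiv> length (arcs B)"

definition over :: "'x set \<Rightarrow> 'x ocon set \<Rightarrow> bool" where
  "over X C \<longleftrightarrow> (\<forall>c\<in>C. set_ocon c \<subseteq> X)"

definition is_mcs :: "nat \<Rightarrow> 'f mcs \<Rightarrow> bool" where
  "is_mcs n B \<longleftrightarrow> finite (points B) \<and>
     (\<forall>(f, G, g) \<in> set (arcs B).
        f \<in> points B \<and> g \<in> points B \<and> over (Cur ` {1..n} \<union> Nxt ` {1..n}) G) \<and>
     (\<forall>f \<in> points B. over {1..n} (invar B f))"

section \<open>Semantics\<close>

text \<open>A well-ordered set is the field of a relation \<open>r\<close> with \<open>Well_order r\<close>, where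
  \<open>(a, b) \<in> r\<close> means that \<open>a\<close> is at most \<open>b\<close>.\<close>

fun holds :: "'v rel \<Rightarrow> ('x \<Rightarrow> 'v) \<Rightarrow> 'x ocon \<Rightarrow> bool" where
  "holds r a (Ge u v) \<longleftrightarrow> (a v, a u) \<in> r"
| "holds r a (Gt u v) \<longleftrightarrow> (a v, a u) \<in> r \<and> a v \<noteq> a u"

definition models :: "'v rel \<Rightarrow> ('x \<Rightarrow> 'v) \<Rightarrow> 'x ocon set \<Rightarrow> bool" where
  "models r a C \<longleftrightarrow> (\<forall>c\<in>C. holds r a c)"

definition states :: "nat \<Rightarrow> 'v rel \<Rightarrow> 'f mcs \<Rightarrow> ('f \<times> (nat \<Rightarrow> 'v)) set" where
  "states n r B = points B \<times> ({1..n} \<rightarrow>\<^sub>E Field r)"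

definition transitions ::
  "nat \<Rightarrow> 'v rel \<Rightarrow> 'f mcs \<Rightarrow> (('f \<times> (nat \<Rightarrow> 'v)) \<times> ('f \<times> (nat \<Rightarrow> 'v))) set" where
  "transitions n r B =
     {((f, \<sigma>), (g, \<sigma>')) | f \<sigma> g \<sigma>'.
        (f, \<sigma>) \<in> states n r B \<and> (g, \<sigma>') \<in> states n r B \<and>
        (\<exists>G. (f, G, g) \<in> set (arcs B) \<and>
          models r \<sigma> (invar B f) \<and> models r \<sigma>' (invar B g) \<and> models r (case_tvar \<sigma> \<sigma>') G)}"

definition no_infinite_run :: "nat \<Rightarrow> 'v rel \<Rightarrow> 'f mcs \<Rightarrow> bool" where
  "no_infinite_run n r B \<longleftrightarrow> \<not> (\<exists>s. \<forall>i::nat. (s i, s (Suc i)) \<in> transitions n r B)"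

text \<open>HOL cannot quantify over all types inside a formula. Well-orders on subsets of \<open>nat\<close>
  suffice: a run meets only countably many values; see \<open>terminating_any\<close> below.\<close>

definition terminating :: "nat \<Rightarrow> 'f mcs \<Rightarrow> bool" where
  "terminating n B \<longleftrightarrow> (\<forall>r :: nat rel. Well_order r \<longrightarrow> no_infinite_run n r B)"

definition global_ranking_function ::
  "nat \<Rightarrow> 'v rel \<Rightarrow> 'f mcs \<Rightarrow> 'w set \<Rightarrow> 'w rel \<Rightarrow> ('f \<times> (nat \<Rightarrow> 'v) \<Rightarrow> 'w) \<Rightarrow> bool" where
  "global_ranking_function n r B W lt \<rho> \<longleftrightarrow>
     \<rho> ` states n r B \<subseteq> W \<and> wf (lt \<inter> W \<times> W) \<and>
     (\<forall>(s, s') \<in> transitions n r B. (\<rho> s', \<rho> s) \<in> lt)"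

section \<open>Vectors\<close>

definition ordered_bell :: "nat \<Rightarrow> nat" where
  "ordered_bell n =
     card {R. preorder_on {1..n} R \<and> total_on {1..n} R}"

text \<open>\<open>Inl c\<close> is the integer \<open>c\<close>, \<open>Inr i\<close> the variable \<open>x\<^sub>i\<close>. List positions count from 0, so
  integers are at the even list positions.

  The length of a vector is not required to be even: a vector may end with an integer. With
  vectors of even length only, ranking functions of this form need not exist; see
  \<open>even_length_insufficient\<close> below.\<close>

definition vectors :: "nat \<Rightarrow> nat \<Rightarrow> (nat + nat) list set" where
  "vectors n b =
     {v. (\<forall>k < length v. v ! k \<in> (if even k then Inl ` {0..b} else Inr ` {1..n})) \<and>
         distinct (filter (\<lambda>e. \<not> isl e) v)}"

definition val :: "(nat \<Rightarrow> 'v) \<Rightarrow> (nat + nat) list \<Rightarrow> (nat + 'v) list" where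
  "val \<sigma> v = map (map_sum id \<sigma>) v"

definition entry_less :: "'v rel \<Rightarrow> (nat + 'v) rel" where
  "entry_less r = {(Inl a, Inl b) | a b. a < b} \<union> {(Inr x, Inr y) | x y. (x, y) \<in> r \<and> x \<noteq> y}"

definition vector_values :: "nat \<Rightarrow> nat \<Rightarrow> 'v rel \<Rightarrow> (nat + 'v) list set" where
  "vector_values n b r = {val \<sigma> v | \<sigma> v. \<sigma> \<in> {1..n} \<rightarrow>\<^sub>E Field r \<and> v \<in> vectors n b}"

text \<open>A description assigns to each flow-point finitely many pairs of a region (a conjunction of
  constraints on the variables) and the vector used there. Regions may overlap only where
  their vectors have the same value.\<close>

type_synonym 'f description = "'f \<Rightarrow> (nat ocon set \<times> (nat + nat) list) list"

definition description_over :: "nat \<Rightarrow> nat \<Rightarrow> 'f mcs \<Rightarrow> 'f description \<Rightarrow> bool" where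
  "description_over n b B D \<longleftrightarrow>
     (\<forall>f \<in> points B. \<forall>(R, v) \<in> set (D f). over {1..n} R \<and> v \<in> vectors n b)"

definition defined_by ::
  "nat \<Rightarrow> 'v rel \<Rightarrow> 'f mcs \<Rightarrow> ('f \<times> (nat \<Rightarrow> 'v) \<Rightarrow> (nat + 'v) list) \<Rightarrow> 'f description \<Rightarrow> bool" where
  "defined_by n r B \<rho> D \<longleftrightarrow>
     (\<forall>(f, \<sigma>) \<in> states n r B.
        (\<exists>(R, v) \<in> set (D f). models r \<sigma> R) \<and>
        (\<forall>(R, v) \<in> set (D f). models r \<sigma> R \<longrightarrow> \<rho> (f, \<sigma>) = val \<sigma> v))"

section \<open>Programs and their running time\<close>

text \<open>The machine model is a random access machine with the uniform cost measure, in structured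
  form: the memory consists of arrays of natural numbers (a program uses finitely many), and the
  arithmetic operations are addition and truncated subtraction. As expressions are part of the
  fixed program, counting one step per command and test agrees with counting the single
  operations up to a constant factor.\<close>

type_synonym mem = "nat \<Rightarrow> nat \<Rightarrow> nat"

datatype exp = Const nat | Read nat exp | Plus exp exp | Minus exp exp

fun eval_exp :: "exp \<Rightarrow> mem \<Rightarrow> nat" where
  "eval_exp (Const c) M = c"
| "eval_exp (Read a e) M = M a (eval_exp e M)"
| "eval_exp (Plus d e) M = eval_exp d M + eval_exp e M"
| "eval_exp (Minus d e) M = eval_exp d M - eval_exp e M"

datatype com = Skip | Write nat exp exp | Seq com com | If exp com com | While exp com

inductive exec :: "com \<Rightarrow> mem \<Rightarrow> nat \<Rightarrow> mem \<Rightarrow> bool" where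
  Skip: "exec Skip M 1 M"
| Write: "exec (Write a i e) M 1 (M(a := (M a)(eval_exp i M := eval_exp e M)))"
| Seq: "exec c M s M' \<Longrightarrow> exec d M' t M'' \<Longrightarrow> exec (Seq c d) M (s + t) M''"
| IfTrue: "eval_exp e M \<noteq> 0 \<Longrightarrow> exec c M t M' \<Longrightarrow> exec (If e c d) M (Suc t) M'"
| IfFalse: "eval_exp e M = 0 \<Longrightarrow> exec d M t M' \<Longrightarrow> exec (If e c d) M (Suc t) M'"
| WhileFalse: "eval_exp e M = 0 \<Longrightarrow> exec (While e c) M 1 M"
| WhileTrue: "eval_exp e M \<noteq> 0 \<Longrightarrow> exec c M s M' \<Longrightarrow> exec (While e c) M' t M'' \<Longrightarrow>
    exec (While e c) M (Suc (s + t)) M''"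

text \<open>The input is in array 0 (all other memory is 0), the output is read off array 1.\<close>

definition input_mem :: "nat list \<Rightarrow> mem" where
  "input_mem w = (\<lambda>a i. if a = 0 \<and> i < length w then w ! i else 0)"

definition computes :: "com \<Rightarrow> nat list \<Rightarrow> nat \<Rightarrow> nat list \<Rightarrow> bool" where
  "computes P w t out \<longleftrightarrow>
     (\<exists>M. exec P (input_mem w) t M \<and> (\<forall>i < length out. M 1 i = out ! i))"

text \<open>A conjunction is encoded as a square matrix, listed row by row, that tells for each pair of
  variables which of the two constraints between them are present. Flow-points are numbered by
  an enumeration \<open>fs\<close>.\<close>

definition encode_ocons :: "'x list \<Rightarrow> 'x ocon set \<Rightarrow> nat list" where
  "encode_ocons xs C =
     [(if Ge u v \<in> C then 1 else 0) + (if Gt u v \<in> C then 2 else 0). u \<leftarrow> xs, v \<leftarrow> xs]"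

definition index_of :: "'f list \<Rightarrow> 'f \<Rightarrow> nat" where
  "index_of fs f = (LEAST i. i < length fs \<and> fs ! i = f)"

definition encode_mcs :: "nat \<Rightarrow> 'f list \<Rightarrow> 'f mcs \<Rightarrow> nat list" where
  "encode_mcs n fs B =
     [n, length fs, mcs_size B] @
     concat (map (\<lambda>f. encode_ocons [1..<Suc n] (invar B f)) fs) @
     concat (map (\<lambda>(f, G, g). index_of fs f # index_of fs g #
        encode_ocons (map Cur [1..<Suc n] @ map Nxt [1..<Suc n]) G) (arcs B))"

definition encode_description :: "nat \<Rightarrow> 'f list \<Rightarrow> 'f description \<Rightarrow> nat list" where
  "encode_description n fs D =
     concat (map (\<lambda>f. length (D f) #
        concat (map (\<lambda>(R, v). encode_ocons [1..<Suc n] R @ length v # map (case_sum id id) v)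
          (D f))) fs)"

section \<open>Adequacy\<close>

lemma terminating_any:
  fixes r :: "'v rel"
  assumes tm: "terminating n B" and wo: "Well_order r" and mcs: "is_mcs n B"
  shows "no_infinite_run n r B"
  unfolding no_infinite_run_def
proof
  assume "\<exists>s. \<forall>i::nat. (s i, s (Suc i)) \<in> transitions n r B"
  then obtain s where s: "\<And>i::nat. (s i, s (Suc i)) \<in> transitions n r B" by blast
  define A where "A = (\<Union>i. snd (s i) ` {1..n})"
  define h where "h = to_nat_on A"
  define q where "q = Restr r A"
  define r' where "r' = dir_image q h"
  have inj: "inj_on h A"
    unfolding h_def by (rule inj_on_to_nat_on) (auto simp: A_def)
  have woq: "Well_order q" unfolding q_def by (rule Well_order_Restr[OF wo])
  have "Field q \<subseteq> A" by (auto simp: q_def Field_def)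
  with inj have inj': "inj_on h (Field q)" by (rule inj_on_subset)
  have wo': "Well_order r'" unfolding r'_def by (rule Well_order_dir_image[OF woq inj'])
  have in_r': "(h a, h b) \<in> r' \<longleftrightarrow> (a, b) \<in> r" if "a \<in> A" "b \<in> A" for a b
    using inj that by (auto simp: r'_def dir_image_def q_def inj_on_eq_iff)
  define s' where "s' i = (fst (s i), restrict (h \<circ> snd (s i)) {1..n})" for i
  have state: "s i \<in> states n r B" for i
    using s[of i] by (auto simp: transitions_def)
  have inA: "snd (s i) k \<in> A" if "k \<in> {1..n}" for i k
    unfolding A_def using that by blast
  have state': "s' i \<in> states n r' B" for i
  proof -
    have "h (snd (s i) k) \<in> Field r'" if k: "k \<in> {1..n}" for k
    proof -
      have "snd (s i) k \<in> Field r" using state[of i] k by (auto simp: states_def mem_Times_iff)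
      then have "(snd (s i) k, snd (s i) k) \<in> r"
        using wo by (auto simp: order_on_defs well_order_on_def refl_on_def)
      then have "(h (snd (s i) k), h (snd (s i) k)) \<in> r'" using in_r' inA k by blast
      then show ?thesis by (auto simp: Field_def)
    qed
    then show ?thesis using state[of i] by (auto simp: s'_def states_def)
  qed
  have transfer: "models r' b C"
    if "models r a C" "over X C" "\<And>x. x \<in> X \<Longrightarrow> a x \<in> A \<and> b x = h (a x)"
    for a :: "'x \<Rightarrow> 'v" and b C X
    unfolding models_def
  proof
    fix c assume c: "c \<in> C"
    then have "holds r a c" "set_ocon c \<subseteq> X" using that(1,2) by (auto simp: models_def over_def)
    then show "holds r' b c"
      using that(3) in_r' inj by (cases c) (auto simp: inj_on_eq_iff)
  qed
  have "(s' i, s' (Suc i)) \<in> transitions n r' B" for i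
  proof -
    obtain f \<sigma> g \<sigma>' G where *: "s i = (f, \<sigma>)" "s (Suc i) = (g, \<sigma>')" "(f, G, g) \<in> set (arcs B)"
      "models r \<sigma> (invar B f)" "models r \<sigma>' (invar B g)" "models r (case_tvar \<sigma> \<sigma>') G"
      using s[of i] unfolding transitions_def by auto
    have A: "k \<in> {1..n} \<Longrightarrow> \<sigma> k \<in> A" "k \<in> {1..n} \<Longrightarrow> \<sigma>' k \<in> A" for k
      using inA[of k i] inA[of k "Suc i"] *(1,2) by auto
    have ov: "over {1..n} (invar B f)" "over {1..n} (invar B g)"
      "over (Cur ` {1..n} \<union> Nxt ` {1..n}) G"
      using mcs *(3) by (auto simp: is_mcs_def)
    let ?a = "restrict (h \<circ> \<sigma>) {1..n}" and ?b = "restrict (h \<circ> \<sigma>') {1..n}"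
    have "models r' ?a (invar B f)" by (rule transfer[OF *(4) ov(1)]) (use A in auto)
    moreover have "models r' ?b (invar B g)" by (rule transfer[OF *(5) ov(2)]) (use A in auto)
    moreover have "models r' (case_tvar ?a ?b) G"
      by (rule transfer[OF *(6) ov(3)]) (use A in auto)
    moreover have "s' i = (f, ?a)" "s' (Suc i) = (g, ?b)" using * by (auto simp: s'_def)
    ultimately show ?thesis
      using *(3) state'[of i] state'[of "Suc i"] unfolding transitions_def by auto
  qed
  then show False
    using tm wo' unfolding terminating_def no_infinite_run_def by blast
qed

text \<open>Two flow-points and one variable, with \<open>x \<ge> x'\<close> from 0 to 1 and \<open>x > x'\<close> back.\<close>

definition two_cycle :: "nat mcs" where
  "two_cycle = \<lparr>points = {0, 1},
     arcs = [(0, {Ge (Cur 1) (Nxt 1)}, 1), (1, {Gt (Cur 1) (Nxt 1)}, 0)], invar = \<lambda>_. {}\<rparr>"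

lemma is_mcs_two_cycle: "is_mcs 1 two_cycle"
  by (auto simp: is_mcs_def two_cycle_def over_def)

lemma terminating_two_cycle: "terminating 1 two_cycle"
  unfolding terminating_def no_infinite_run_def
proof (intro allI impI notI)
  fix r :: "nat rel"
  assume wo: "Well_order r" and "\<exists>s. \<forall>i. (s i, s (Suc i)) \<in> transitions 1 r two_cycle"
  then obtain s where s: "\<And>i. (s i, s (Suc i)) \<in> transitions 1 r two_cycle" by blast
  let ?x = "\<lambda>i. snd (s i) 1"
  have step: "(?x (Suc i), ?x i) \<in> r"
    "fst (s i) = 0 \<and> fst (s (Suc i)) = 1 \<or>
      fst (s i) = 1 \<and> fst (s (Suc i)) = 0 \<and> ?x (Suc i) \<noteq> ?x i" for i
    using s[of i] by (auto simp: transitions_def two_cycle_def models_def)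
  have tr: "trans r" and an: "antisym r" and wf: "wf (r - Id)"
    using wo by (auto simp: well_order_on_def order_on_defs)
  have "(?x (Suc (Suc i)), ?x i) \<in> r - Id" for i
    using step[of i] step[of "Suc i"] transD[OF tr step(1)[of "Suc i"] step(1)[of i]] an
    by (auto dest: antisymD)
  then have "\<forall>i. (?x (2 * Suc i), ?x (2 * i)) \<in> r - Id" by simp
  then have "\<exists>f. \<forall>i. (f (Suc i), f i) \<in> r - Id" by (rule exI[of _ "\<lambda>i. ?x (2 * i)"])
  then show False using wf unfolding wf_iff_no_infinite_down_chain by blast
qed

lemma even_length_insufficient:
  assumes D: "description_over 1 b two_cycle D" "defined_by 1 natLeq two_cycle \<rho> D"
    and ev: "\<forall>f \<in> points two_cycle. \<forall>(R, v) \<in> set (D f). even (length v)"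
  shows "\<not> global_ranking_function 1 natLeq two_cycle W (lexord (entry_less natLeq)) \<rho>"
proof
  assume G: "global_ranking_function 1 natLeq two_cycle W (lexord (entry_less natLeq)) \<rho>"
  define st :: "nat \<Rightarrow> nat \<Rightarrow> nat" where "st k = (\<lambda>i\<in>{1..1}. k)" for k
  have st1: "st k 1 = k" for k by (simp add: st_def)
  have state: "(f, st k) \<in> states 1 natLeq two_cycle" if "f \<in> {0, 1}" for f k
    using that by (auto simp: states_def two_cycle_def st_def Field_natLeq)
  text \<open>As any constraint on the single variable is either valid or unsatisfiable, the vector
    depends on the flow-point only.\<close>
  have form: "\<exists>v. (v = [] \<or> (\<exists>c. v = [Inl c, Inr 1])) \<and> (\<forall>k. \<rho> (f, st k) = val (st k) v)"
    if f: "f \<in> {0, 1}" for f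
  proof -
    obtain R v where Rv: "(R, v) \<in> set (D f)" "models natLeq (st 0) R"
      using D(2) state[OF f, of 0] unfolding defined_by_def by fastforce
    have fp: "f \<in> points two_cycle" using f by (simp add: two_cycle_def)
    have ov: "over {1..1} R" and v: "v \<in> vectors 1 b" and e: "even (length v)"
      using D(1) ev fp Rv(1) by (auto simp: description_over_def)
    have "models natLeq (st k) R" for k
      unfolding models_def
    proof
      fix c assume c: "c \<in> R"
      then have "holds natLeq (st 0) c" "set_ocon c \<subseteq> {1}"
        using Rv(2) ov by (auto simp: models_def over_def)
      then show "holds natLeq (st k) c" by (cases c) (auto simp: natLeq_def)
    qed
    then have "\<rho> (f, st k) = val (st k) v" for k
      using D(2) state[OF f, of k] Rv(1) unfolding defined_by_def by fastforce
    moreover have "v = [] \<or> (\<exists>c. v = [Inl c, Inr 1])"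
    proof (cases v)
      case (Cons x xs)
      then obtain y ys where w: "v = x # y # ys" using e by (cases xs) auto
      have pos: "\<And>k. k < length v \<Longrightarrow> v ! k \<in> (if even k then Inl ` {0..b} else Inr ` {1..1})"
        and dist: "distinct (filter (\<lambda>e. \<not> isl e) v)" using v by (auto simp: vectors_def)
      have x: "\<exists>c. x = Inl c" and y: "y = Inr 1" using pos[of 0] pos[of 1] w by auto
      have "ys = []"
      proof (cases ys)
        case (Cons z zs)
        then obtain u us where "ys = z # u # us" using e w by (cases zs) auto
        then have "u = Inr 1" using pos[of 3] w by (auto simp: numeral_3_eq_3)
        then show ?thesis using dist w x y \<open>ys = z # u # us\<close> by (cases "isl z") auto
      qed auto
      then show ?thesis using w x y by auto
    qed simp
    ultimately show ?thesis by blast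
  qed
  obtain v where v: "v = [] \<or> (\<exists>c. v = [Inl c, Inr 1])" "\<And>k. \<rho> (0, st k) = val (st k) v"
    using form[of 0] by auto
  obtain w where w: "w = [] \<or> (\<exists>c. w = [Inl c, Inr 1])" "\<And>k. \<rho> (1, st k) = val (st k) w"
    using form[of 1] by auto
  have "((0, st 0), (1, st 0)) \<in> transitions 1 natLeq two_cycle"
    "((1, st 1), (0, st 0)) \<in> transitions 1 natLeq two_cycle"
    using state[of 0 0] state[of 1 0] state[of 1 1]
    by (auto simp: transitions_def two_cycle_def models_def natLeq_def st1[unfolded One_nat_def])
  then have "(\<rho> (1, st 0), \<rho> (0, st 0)) \<in> lexord (entry_less natLeq)"
    "(\<rho> (0, st 0), \<rho> (1, st 1)) \<in> lexord (entry_less natLeq)"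
    using G unfolding global_ranking_function_def by blast+
  then have "(val (st 0) w, val (st 0) v) \<in> lexord (entry_less natLeq)"
    "(val (st 0) v, val (st 1) w) \<in> lexord (entry_less natLeq)"
    by (simp_all only: v(2) w(2))
  then show False
    using v(1) w(1) by (auto simp: val_def entry_less_def)
qed

end

theory Submission
  imports Defs
begin

text \<open>Each flow-point is split into one node for every ordering of its variables, and each arc
  accordingly, so that at a node the order of the variables is known. The vectors are then built
  level by level. The strongly connected components of the arcs that are still satisfiable, numbered
  in topological order, provide the integer of the level, which drops along the arcs between
  components. On the remaining arcs, follow each variable to the highest target variable that it
  bounds. A variable is unsafe if this can lead to a dead end or to a variable chosen before. If
  all variables of a node on a cycle were unsafe, then some closed path through it would end every
  such thread, and could be traversed forever with suitable values; so termination yields a safe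
  variable. The lowest safe variable does not increase along the remaining arcs and is the next
  entry of the vector; the constraint that it keeps its value is added for the next level. The
  variables chosen at a node are distinct, so no arc remains after \<open>n + 1\<close> levels.

  With \<open>L\<close> arcs and \<open>K\<close> orderings, this takes \<open>O(L K\<^sup>2 n\<^sup>6)\<close> steps, and \<open>K\<^sup>2 n\<^sup>6\<close> is
  \<open>O(n\<^sup>2\<^sup>n\<^sup>+\<^sup>1)\<close>.\<close>

section \<open>A program logic with time bounds\<close>

text \<open>Monotonicity constraints may also bound an old value by a new one, so the threads of a
  path alone do not show how large its values must be. Valuations along an infinite path are
  therefore built from all paths through occurrences (time, variable), which run forward and
  backward in time. Two facts make this work. The order of the variables at a node is total, so the
  thread through the highest targets dominates every other path from the same occurrence: when it
  dies, all of them are bounded. And the variables chosen at earlier levels keep their values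
  forever; they cut the occurrences into finitely many zones, so a value is a pair of a zone and a
  height within it. Such values lie in a well-order of type omega^2, coded in \<open>nat\<close>
  because \<open>terminating\<close> quantifies over orders on \<open>nat\<close>. The dominating
  cost is the closure of a 2n by 2n matrix, of order n^5 for each arc and level; the
  \<open>n + 1\<close> levels make this n^6, and each arc has \<open>K^2\<close> copies.\<close>

definition wr :: "mem \<Rightarrow> nat \<Rightarrow> nat \<Rightarrow> nat \<Rightarrow> mem" where
  "wr M a i x = M(a := (M a)(i := x))"

lemma wr_apply [simp]: "wr M a i x b = (if b = a then (M a)(i := x) else M b)"
  by (simp add: wr_def)

fun mods :: "com \<Rightarrow> nat set" where
  "mods Skip = {}"
| "mods (Write a i e) = {a}"
| "mods (Seq c d) = mods c \<union> mods d"
| "mods (If e c d) = mods c \<union> mods d"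
| "mods (While e c) = mods c"

lemma exec_mods: "exec c M t M' \<Longrightarrow> a \<notin> mods c \<Longrightarrow> M' a = M a"
  by (induction rule: exec.induct) auto

text \<open>The judgement is about one given start memory instead of a precondition, so that
  assertions can refer to the initial contents by name.\<close>

definition ho :: "com \<Rightarrow> mem \<Rightarrow> nat \<Rightarrow> (mem \<Rightarrow> bool) \<Rightarrow> bool" where
  "ho c M b Q \<longleftrightarrow> (\<exists>t M'. exec c M t M' \<and> t \<le> b \<and> Q M')"

text \<open>The frame condition is part of the rule: the new postcondition may use that arrays
  outside \<open>mods c\<close> are as before, so invariants never have to restate what a command
  leaves alone.\<close>

lemma ho_conseq:
  assumes "ho c M b R" "\<And>M'. R M' \<Longrightarrow> (\<And>a. a \<notin> mods c \<Longrightarrow> M' a = M a) \<Longrightarrow> Q M'" "b \<le> b'"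
  shows "ho c M b' Q"
  using assms exec_mods unfolding ho_def by (meson order_trans)

lemma ho_Seq:
  assumes "ho c M b1 R"
    and "\<And>M'. R M' \<Longrightarrow> (\<And>a. a \<notin> mods c \<Longrightarrow> M' a = M a) \<Longrightarrow> ho d M' b2 Q"
    and "b1 + b2 \<le> b"
  shows "ho (Seq c d) M b Q"
proof -
  obtain t M' where 1: "exec c M t M'" "t \<le> b1" "R M'" using assms(1) unfolding ho_def by blast
  then obtain s M'' where 2: "exec d M' s M''" "s \<le> b2" "Q M''"
    using assms(2) exec_mods unfolding ho_def by blast
  have "exec (Seq c d) M (t + s) M''" using 1 2 by (blast intro: exec.Seq)
  then show ?thesis unfolding ho_def using 1 2 assms(3) by (metis add_mono order_trans)
qed

lemma ho_If:
  assumes "eval_exp e M \<noteq> 0 \<Longrightarrow> ho c M b Q" "eval_exp e M = 0 \<Longrightarrow> ho d M b Q" "Suc b \<le> b'"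
  shows "ho (If e c d) M b' Q"
proof (cases "eval_exp e M = 0")
  case True
  then obtain t M' where "exec d M t M'" "t \<le> b" "Q M'" using assms(2) unfolding ho_def by blast
  then show ?thesis unfolding ho_def using True assms(3)
    by (intro exI[of _ "Suc t"] exI[of _ M']) (auto intro: exec.IfFalse)
next
  case False
  then obtain t M' where "exec c M t M'" "t \<le> b" "Q M'" using assms(1) unfolding ho_def by blast
  then show ?thesis unfolding ho_def using False assms(3)
    by (intro exI[of _ "Suc t"] exI[of _ M']) (auto intro: exec.IfTrue)
qed

fun loop_free :: "com \<Rightarrow> bool" where
  "loop_free Skip = True"
| "loop_free (Write a i e) = True"
| "loop_free (Seq c d) = (loop_free c \<and> loop_free d)"
| "loop_free (If e c d) = (loop_free c \<and> loop_free d)"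
| "loop_free (While e c) = False"

text \<open>Code without loops is run by rewriting instead of by proof rules. The clause for
  \<open>While\<close> is a dummy value, excluded by \<open>loop_free\<close>.\<close>

fun sem :: "com \<Rightarrow> mem \<Rightarrow> mem" where
  "sem Skip M = M"
| "sem (Write a i e) M = wr M a (eval_exp i M) (eval_exp e M)"
| "sem (Seq c d) M = sem d (sem c M)"
| "sem (If e c d) M = (if eval_exp e M \<noteq> 0 then sem c M else sem d M)"
| "sem (While e c) M = M"

fun steps :: "com \<Rightarrow> nat" where
  "steps Skip = 1"
| "steps (Write a i e) = 1"
| "steps (Seq c d) = steps c + steps d"
| "steps (If e c d) = Suc (max (steps c) (steps d))"
| "steps (While e c) = 0"

lemma exec_sem: "loop_free c \<Longrightarrow> \<exists>t. exec c M t (sem c M) \<and> t \<le> steps c"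
proof (induction c arbitrary: M)
  case (Seq c d)
  then obtain s t where "exec c M s (sem c M)" "s \<le> steps c"
    "exec d (sem c M) t (sem d (sem c M))" "t \<le> steps d" by fastforce
  then show ?case by (auto intro!: exI[of _ "s + t"] exec.Seq)
next
  case (If e c d)
  then show ?case by (cases "eval_exp e M = 0") (fastforce intro: exec.intros simp: le_max_iff_disj)+
qed (auto simp: wr_def intro: exec.intros)

lemma ho_loop_free:
  assumes "loop_free c" "Q (sem c M)" "steps c \<le> b"
  shows "ho c M b Q"
  using exec_sem[OF assms(1), of M] assms unfolding ho_def by (meson order_trans)

lemma ho_Seq_loop_free:
  assumes "loop_free c" "ho d (sem c M) b2 Q" "steps c + b2 \<le> b"
  shows "ho (Seq c d) M b Q"
  using ho_Seq[OF ho_loop_free[OF assms(1), where Q = "\<lambda>M'. M' = sem c M" and M = M] _ assms(3)] assms(2)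
  by auto

text \<open>The ghost parameter \<open>k\<close> is a potential that bounds the number of remaining iterations.\<close>

lemma ho_While_ghost:
  assumes I: "I k M"
    and step: "\<And>k M'. I k M' \<Longrightarrow> (\<And>a. a \<notin> mods c \<Longrightarrow> M' a = M a) \<Longrightarrow> eval_exp e M' \<noteq> 0 \<Longrightarrow>
      ho c M' b (\<lambda>M''. \<exists>k'<k. I k' M'')"
    and fin: "\<And>k M'. I k M' \<Longrightarrow> (\<And>a. a \<notin> mods c \<Longrightarrow> M' a = M a) \<Longrightarrow> eval_exp e M' = 0 \<Longrightarrow> Q M'"
    and b: "k * (b + 1) + 1 \<le> b'"
  shows "ho (While e c) M b' Q"
proof -
  have "\<exists>t M''. exec (While e c) M' t M'' \<and> t \<le> k * (b + 1) + 1 \<and> Q M''"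
    if "I k M'" "\<And>a. a \<notin> mods c \<Longrightarrow> M' a = M a" for k M'
    using that
  proof (induction k arbitrary: M' rule: less_induct)
    case (less k)
    show ?case
    proof (cases "eval_exp e M' = 0")
      case True
      then show ?thesis using less.prems fin exec.WhileFalse by (metis le_add2)
    next
      case False
      from step[OF less.prems False]
      obtain s M1 k' where 1: "exec c M' s M1" "s \<le> b" "I k' M1" "k' < k" unfolding ho_def by blast
      have "\<And>a. a \<notin> mods c \<Longrightarrow> M1 a = M a" using exec_mods[OF 1(1)] less.prems(2) by simp
      from less.IH[OF 1(4) 1(3) this]
      obtain t M2 where 2: "exec (While e c) M1 t M2" "t \<le> k' * (b + 1) + 1" "Q M2" by blast
      have "exec (While e c) M' (Suc (s + t)) M2" by (rule exec.WhileTrue[OF False 1(1) 2(1)])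
      moreover have "Suc (s + t) \<le> k * (b + 1) + 1"
      proof -
        have "Suc k' * (b + 1) \<le> k * (b + 1)" using 1(4) by (intro mult_right_mono) auto
        then show ?thesis using 1(2) 2(2) by simp
      qed
      ultimately show ?thesis using 2(3) by blast
    qed
  qed
  from this[OF I] show ?thesis unfolding ho_def using b by (meson order_trans)
qed

lemma ho_While:
  assumes I: "I M"
    and step: "\<And>M'. I M' \<Longrightarrow> (\<And>a. a \<notin> mods c \<Longrightarrow> M' a = M a) \<Longrightarrow> eval_exp e M' \<noteq> 0 \<Longrightarrow>
      ho c M' b (\<lambda>M''. I M'' \<and> m M'' < (m M' :: nat))"
    and fin: "\<And>M'. I M' \<Longrightarrow> (\<And>a. a \<notin> mods c \<Longrightarrow> M' a = M a) \<Longrightarrow> eval_exp e M' = 0 \<Longrightarrow> Q M'"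
    and b: "m M * (b + 1) + 1 \<le> b'"
  shows "ho (While e c) M b' Q"
proof (rule ho_While_ghost[where I = "\<lambda>k M'. I M' \<and> m M' = k"])
  fix k M' assume "I M' \<and> m M' = k" "\<And>a. a \<notin> mods c \<Longrightarrow> M' a = M a" "eval_exp e M' \<noteq> 0"
  then show "ho c M' b (\<lambda>M''. \<exists>k'<k. I M'' \<and> m M'' = k')"
    using step[of M'] by (auto elim: ho_conseq)
qed (use I fin b in auto)

definition Set :: "nat \<Rightarrow> exp \<Rightarrow> com" where
  "Set x e = Write x (Const 0) e"

abbreviation Var :: "nat \<Rightarrow> exp" where
  "Var x \<equiv> Read x (Const 0)"

text \<open>Truncated subtraction serves as the test \<open>x < N\<close>. As \<open>N\<close> is
  evaluated anew before each round, \<open>ho_For\<close> asks that its value survive whatever the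
  body changes.\<close>

definition For :: "nat \<Rightarrow> exp \<Rightarrow> com \<Rightarrow> com" where
  "For x N c = Seq (Set x (Const 0)) (While (Minus N (Var x)) (Seq c (Set x (Plus (Var x) (Const 1)))))"

lemma mods_Set [simp]: "mods (Set x e) = {x}"
  and sem_Set [simp]: "sem (Set x e) M = wr M x 0 (eval_exp e M)"
  and steps_Set [simp]: "steps (Set x e) = 1"
  and loop_free_Set [simp]: "loop_free (Set x e)"
  and mods_For [simp]: "mods (For x N c) = insert x (mods c)"
  and loop_free_For [simp]: "\<not> loop_free (For x N c)"
  by (auto simp: Set_def For_def)

text \<open>The invariant gets the round number as an argument and, by \<open>stable\<close>, does
  not look at the counter, so it survives the increment. A round costs the body, the increment and
  the test, hence \<open>b + 2\<close>; the initial assignment and the last test add 2.\<close>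

lemma ho_For:
  assumes x: "x \<notin> mods c"
    and N: "\<And>M'. (\<And>a. a \<notin> mods c \<Longrightarrow> a \<noteq> x \<Longrightarrow> M' a = M a) \<Longrightarrow> eval_exp N M' = k"
    and stable: "\<And>i j M'. I i (wr M' x 0 j) = I i M'"
    and init: "I 0 M"
    and step: "\<And>i M'. i < k \<Longrightarrow> M' x 0 = i \<Longrightarrow> (\<And>a. a \<notin> mods c \<Longrightarrow> a \<noteq> x \<Longrightarrow> M' a = M a) \<Longrightarrow>
      I i M' \<Longrightarrow> ho c M' b (I (Suc i))"
    and fin: "\<And>M'. I k M' \<Longrightarrow> (\<And>a. a \<notin> mods c \<Longrightarrow> a \<noteq> x \<Longrightarrow> M' a = M a) \<Longrightarrow> Q M'"
    and b: "k * (b + 2) + 2 \<le> b'"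
  shows "ho (For x N c) M b' Q"
  unfolding For_def
proof (rule ho_Seq[where ?b1.0 = 1 and ?b2.0 = "k * (b + 2) + 1"])
  let ?J = "\<lambda>M'. (\<forall>a. a \<notin> mods c \<longrightarrow> a \<noteq> x \<longrightarrow> M' a = M a) \<and> M' x 0 \<le> k \<and> I (M' x 0) M'"
  show "ho (Set x (Const 0)) M 1 (\<lambda>M'. ?J M' \<and> M' x 0 = 0)"
    using stable init by (intro ho_loop_free) auto
  fix M1 assume M1: "?J M1 \<and> M1 x 0 = 0"
  show "ho (While (Minus N (Var x)) (Seq c (Set x (Plus (Var x) (Const 1))))) M1 (k * (b + 2) + 1) Q"
  proof (rule ho_While[where I = ?J and b = "b + 1" and m = "\<lambda>M'. k - M' x 0"])
    show "?J M1" using M1 by blast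
    fix M' assume J: "?J M'"
    then have ev: "eval_exp N M' = k" using N by blast
    { assume "eval_exp (Minus N (Var x)) M' \<noteq> 0"
      then have lt: "M' x 0 < k" using ev by simp
      show "ho (Seq c (Set x (Plus (Var x) (Const 1)))) M' (b + 1)
        (\<lambda>M''. ?J M'' \<and> k - M'' x 0 < k - M' x 0)"
      proof (rule ho_Seq)
        show "ho c M' b (I (Suc (M' x 0)))" using step[OF lt] J by blast
        fix M2 assume 2: "I (Suc (M' x 0)) M2" "\<And>a. a \<notin> mods c \<Longrightarrow> M2 a = M' a"
        show "ho (Set x (Plus (Var x) (Const 1))) M2 1 (\<lambda>M''. ?J M'' \<and> k - M'' x 0 < k - M' x 0)"
          using J 2 x lt stable[of "Suc (M' x 0)" M2 "Suc (M' x 0)"]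
          by (intro ho_loop_free) auto
      qed simp
    }
    { assume "eval_exp (Minus N (Var x)) M' = 0"
      then have "M' x 0 = k" using ev J by simp
      then show "Q M'" using fin J by auto }
  next
    show "(k - M1 x 0) * (b + 1 + 1) + 1 \<le> k * (b + 2) + 1" using M1 by simp
  qed
qed (use b in simp)

instantiation exp :: "{plus, minus}"
begin
definition plus_exp where "plus_exp = Plus"
definition minus_exp where "minus_exp = Minus"
instance ..
end

lemma eval_exp_arith [simp]:
  "eval_exp (d + e) M = eval_exp d M + eval_exp e M"
  "eval_exp (d - e) M = eval_exp d M - eval_exp e M"
  by (simp_all add: plus_exp_def minus_exp_def)

notation Seq (infixr ";;" 60)

section \<open>Constraint matrices\<close>

text \<open>Entry 0 of a matrix stands for no constraint, 1 for \<open>\<ge>\<close> and 2 for \<open>>\<close>. In the matrix of a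
  transition, index \<open>i < n\<close> is a source variable and \<open>n + i\<close> the corresponding target variable.\<close>

type_synonym mat = "nat \<Rightarrow> nat \<Rightarrow> nat"

text \<open>The flag says whether the derived constraint is strict; a strict entry also yields its
  weak form.\<close>

inductive der :: "nat \<Rightarrow> mat \<Rightarrow> bool \<Rightarrow> nat \<Rightarrow> nat \<Rightarrow> bool" for N m where
  base: "u < N \<Longrightarrow> v < N \<Longrightarrow> m u v \<noteq> 0 \<Longrightarrow> (s \<Longrightarrow> 2 \<le> m u v) \<Longrightarrow> der N m s u v"
| trans: "der N m s u v \<Longrightarrow> der N m s' v w \<Longrightarrow> der N m (s \<or> s') u w"

lemma der_trans: "der N m s u v \<Longrightarrow> der N m s' v w \<Longrightarrow> s'' = (s \<or> s') \<Longrightarrow> der N m s'' u w"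
  by (hypsubst, rule der.trans)

lemma der_bound: "der N m s u v \<Longrightarrow> u < N \<and> v < N"
  by (induction rule: der.induct) auto

lemma der_weaken: "der N m s u v \<Longrightarrow> (s' \<Longrightarrow> s) \<Longrightarrow> der N m s' u v"
proof (induction arbitrary: s' rule: der.induct)
  case (base u v s)
  then show ?case by (auto intro: der.base)
next
  case (trans s u v t w)
  then have "der N m (s \<and> s') u v" "der N m (t \<and> s') v w" by simp_all
  from der.trans[OF this] show ?case using trans.prems by (cases s') auto
qed

text \<open>The usual criterion for satisfiability of order constraints: no cycle contains a strict
  one.\<close>

definition consistent :: "nat \<Rightarrow> mat \<Rightarrow> bool" where
  "consistent N m \<longleftrightarrow> (\<forall>u. \<not> der N m True u u)"

definition ranked :: "nat \<Rightarrow> nat \<Rightarrow> (nat \<Rightarrow> nat) \<Rightarrow> mat \<Rightarrow> bool" where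
  "ranked n z r m \<longleftrightarrow> (\<forall>i<n. \<forall>j<n. (r j \<le> r i \<longrightarrow> m (z + i) (z + j) \<noteq> 0) \<and>
     (r j < r i \<longrightarrow> 2 \<le> m (z + i) (z + j)))"

text \<open>The ranks already compare any two variables of the block, so a derived constraint that
  they do not give would close a strict cycle with one of theirs. Thus nothing new is derivable
  within one side of an arc.\<close>

lemma der_ranked:
  assumes c: "consistent N m" and r: "ranked n z r m" and N: "z + n \<le> N" and ij: "i < n" "j < n"
  shows "der N m s (z + i) (z + j) \<longleftrightarrow> r j \<le> r i \<and> (s \<longrightarrow> r j < r i)"
proof
  assume d: "der N m s (z + i) (z + j)"
  have 1: "\<not> r i < r j"
  proof
    assume "r i < r j"
    then have "der N m True (z + j) (z + i)" using r N ij by (intro der.base) (auto simp: ranked_def)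
    then show False using der_trans[OF _ d, of True "z + j" True] c unfolding consistent_def by simp
  qed
  have "s \<Longrightarrow> r i \<noteq> r j"
  proof
    assume "s" "r i = r j"
    then have "der N m False (z + j) (z + i)" using r N ij by (intro der.base) (auto simp: ranked_def)
    then show False using der_trans[OF _ d, of False "z + j" True] c \<open>s\<close> unfolding consistent_def by simp
  qed
  then show "r j \<le> r i \<and> (s \<longrightarrow> r j < r i)" using 1 by auto
next
  assume "r j \<le> r i \<and> (s \<longrightarrow> r j < r i)"
  then show "der N m s (z + i) (z + j)" using r N ij by (intro der.base) (auto simp: ranked_def)
qed

definition sat :: "'v rel \<Rightarrow> nat \<Rightarrow> mat \<Rightarrow> (nat \<Rightarrow> 'v) \<Rightarrow> (nat \<Rightarrow> 'v) \<Rightarrow> bool" where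
  "sat r n m \<sigma> \<sigma>' \<longleftrightarrow> (let x = \<lambda>u. if u < n then \<sigma> u else \<sigma>' (u - n) in
     \<forall>u<2*n. \<forall>v<2*n. (m u v \<noteq> 0 \<longrightarrow> (x v, x u) \<in> r) \<and> (2 \<le> m u v \<longrightarrow> x v \<noteq> x u))"

text \<open>The highest target variable that is bounded by \<open>i\<close>, plus 1; 0 if there is none.\<close>

definition is_target :: "nat \<Rightarrow> mat \<Rightarrow> (nat \<Rightarrow> nat) \<Rightarrow> nat \<Rightarrow> nat \<Rightarrow> bool" where
  "is_target n m r i t \<longleftrightarrow>
     (if t = 0 then \<forall>j<n. \<not> der (2*n) m False i (n + j)
      else t \<le> n \<and> der (2*n) m False i (n + (t - 1)) \<and>
        (\<forall>j<n. der (2*n) m False i (n + j) \<longrightarrow> r j \<le> r (t - 1)))"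

section \<open>Well-founded valuations along an infinite path\<close>

text \<open>The lexicographic order on pairs, moved to \<open>nat\<close> by
  \<open>prod_decode\<close>, for values that consist of a zone and a height.\<close>

definition lex_nat :: "nat rel" where
  "lex_nat = {(x, y). fst (prod_decode x) < fst (prod_decode y) \<or>
     fst (prod_decode x) = fst (prod_decode y) \<and> snd (prod_decode x) \<le> snd (prod_decode y)}"

lemma Well_order_lex_nat: "Well_order lex_nat" "Field lex_nat = UNIV"
proof -
  show F: "Field lex_nat = UNIV" by (auto simp: Field_def lex_nat_def)
  have "lex_nat - Id \<subseteq> inv_image (less_than <*lex*> less_than) prod_decode"
  proof
    fix z assume z: "z \<in> lex_nat - Id"
    obtain x y where [simp]: "z = (x, y)" by (cases z)
    have "prod_decode x \<noteq> prod_decode y" using z prod_decode_eq by auto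
    then show "z \<in> inv_image (less_than <*lex*> less_than) prod_decode"
      using z by (cases "prod_decode x"; cases "prod_decode y") (auto simp: lex_nat_def)
  qed
  then have "wf (lex_nat - Id)"
    by (rule wf_subset[rotated]) (auto intro!: wf_inv_image)
  moreover have "antisym lex_nat"
  proof (rule antisymI)
    fix x y assume "(x, y) \<in> lex_nat" "(y, x) \<in> lex_nat"
    then have "prod_decode x = prod_decode y" by (auto simp: lex_nat_def prod_eq_iff)
    then show "x = y" using prod_decode_eq by blast
  qed
  moreover have "refl lex_nat" "trans lex_nat" "total lex_nat"
    by (auto simp: refl_on_def trans_def total_on_def lex_nat_def)
  ultimately show "Well_order lex_nat"
    unfolding F well_order_on_def linear_order_on_def partial_order_on_def preorder_on_def
    by auto
qed

text \<open>\<open>f l t\<close> is the variable frozen by level \<open>l\<close> at time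
  \<open>t\<close>. \<open>tok t i d\<close> follows the thread of variable \<open>i\<close> from
  time \<open>t\<close> for \<open>d\<close> steps along the highest targets; it ends at a dead end
  or in the class of a frozen variable. That every thread ends is what the closed path in
  \<open>safe_exists\<close> provides.\<close>

locale dying_path =
  fixes n k :: nat and r :: "nat \<Rightarrow> nat \<Rightarrow> nat" and m :: "nat \<Rightarrow> mat" and f :: "nat \<Rightarrow> nat \<Rightarrow> nat"
    and T :: "nat \<Rightarrow> nat \<Rightarrow> nat" and tok :: "nat \<Rightarrow> nat \<Rightarrow> nat \<Rightarrow> nat option"
  assumes cons: "consistent (2*n) (m t)"
    and rs: "ranked n 0 (r t) (m t)" and rt: "ranked n n (r (Suc t)) (m t)"
    and f: "l < k \<Longrightarrow> f l t < n"
    and fz: "l < k \<Longrightarrow> m t (f l t) (n + f l (Suc t)) \<noteq> 0"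
      "l < k \<Longrightarrow> m t (n + f l (Suc t)) (f l t) \<noteq> 0"
    and T: "i < n \<Longrightarrow> is_target n (m t) (r (Suc t)) i (T t i)"
    and tok0: "tok t i 0 = Some i"
    and tok: "tok t i (Suc d) = (case tok t i d of None \<Rightarrow> None | Some x \<Rightarrow>
      if (\<exists>l<k. r (t + d) x = r (t + d) (f l (t + d))) \<or> T (t + d) x = 0 then None
      else Some (T (t + d) x - 1))"
    and die: "i < n \<Longrightarrow> \<exists>d. tok t i d = None"
begin

text \<open>An edge leads from an occurrence to one that is at most as high, at the same time, one
  step later or one step earlier. The last kind comes from constraints that bound a source variable
  from above by a target variable.\<close>

definition edge :: "bool \<Rightarrow> nat \<times> nat \<Rightarrow> nat \<times> nat \<Rightarrow> bool" where
  "edge s a b \<longleftrightarrow> snd a < n \<and> snd b < n \<and>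
     (fst b = fst a \<and> r (fst a) (snd b) \<le> r (fst a) (snd a) \<and>
        (s \<longrightarrow> r (fst a) (snd b) < r (fst a) (snd a)) \<or>
      fst b = Suc (fst a) \<and> der (2*n) (m (fst a)) s (snd a) (n + snd b) \<or>
      fst a = Suc (fst b) \<and> der (2*n) (m (fst b)) s (n + snd a) (snd b))"

lemma src_der: "i < n \<Longrightarrow> j < n \<Longrightarrow> der (2*n) (m t) s i j \<longleftrightarrow> r t j \<le> r t i \<and> (s \<longrightarrow> r t j < r t i)"
  using der_ranked[OF cons[of t] rs[of t], where i = i and j = j and s = s] by simp

lemma tgt_der: "i < n \<Longrightarrow> j < n \<Longrightarrow>
    der (2*n) (m t) s (n + i) (n + j) \<longleftrightarrow> r (Suc t) j \<le> r (Suc t) i \<and> (s \<longrightarrow> r (Suc t) j < r (Suc t) i)"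
  using der_ranked[OF cons[of t] rt[of t], where i = i and j = j and s = s] by simp

lemma edge_same: "edge s (t, i) (t, j) \<longleftrightarrow> i < n \<and> j < n \<and> r t j \<le> r t i \<and> (s \<longrightarrow> r t j < r t i)"
  by (auto simp: edge_def)

text \<open>The index of an occurrence at time \<open>t\<close> or \<open>t + 1\<close> in the matrix of step \<open>t\<close>.\<close>

definition pos :: "nat \<Rightarrow> nat \<times> nat \<Rightarrow> nat" where
  "pos t a = (if fst a = t then snd a else n + snd a)"

text \<open>Restricted to two adjacent times, all kinds of edges are derivability in a single
  matrix; this turns transitivity of edges into \<open>der.trans\<close>.\<close>

lemma edge_pos:
  assumes "fst a \<in> {t, Suc t}" "fst b \<in> {t, Suc t}"
  shows "edge s a b \<longleftrightarrow> snd a < n \<and> snd b < n \<and> der (2*n) (m t) s (pos t a) (pos t b)"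
proof -
  consider "fst a = t" "fst b = t" | "fst a = t" "fst b = Suc t" | "fst a = Suc t" "fst b = t"
    | "fst a = Suc t" "fst b = Suc t" using assms by blast
  then show ?thesis
    by cases (simp_all add: edge_def pos_def src_der tgt_der cong: conj_cong)
qed

lemma edge_trans:
  assumes "edge s a b" "edge s' b c"
    "fst a \<in> {t, Suc t}" "fst b \<in> {t, Suc t}" "fst c \<in> {t, Suc t}"
  shows "edge (s \<or> s') a c"
  using assms(1,2) der.trans[of "2*n" "m t" s "pos t a" "pos t b" s' "pos t c"]
  by (simp add: edge_pos[OF assms(3,4)] edge_pos[OF assms(4,5)] edge_pos[OF assms(3,5)])

lemma edge_snd: "edge s a b \<Longrightarrow> snd a < n \<and> snd b < n"
  by (auto simp: edge_def)

lemma edge_level: "edge s a b \<Longrightarrow> fst b = fst a \<or> fst b = Suc (fst a) \<or> fst a = Suc (fst b)"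
  by (auto simp: edge_def)

text \<open>\<open>S\<close> bounds the times that the path visits; the following inductions lower
  this bound step by step.\<close>

inductive pth :: "nat \<Rightarrow> bool \<Rightarrow> nat \<times> nat \<Rightarrow> nat \<times> nat \<Rightarrow> bool" for S where
  edge: "edge s a b \<Longrightarrow> fst a \<le> S \<Longrightarrow> fst b \<le> S \<Longrightarrow> pth S s a b"
| step: "pth S s a b \<Longrightarrow> edge s' b c \<Longrightarrow> fst c \<le> S \<Longrightarrow> pth S (s \<or> s') a c"

lemma pth_trans: "pth S s' b c \<Longrightarrow> pth S s a b \<Longrightarrow> pth S (s \<or> s') a c"
proof (induction rule: pth.induct)
  case (edge s' b c)
  then show ?case using pth.step by blast
next
  case (step s1 b c s2 d)
  then show ?case using pth.step[of S "s \<or> s1" a c s2 d] by (simp add: disj_assoc)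
qed

lemma pth_mono: "pth S s a b \<Longrightarrow> S \<le> S' \<Longrightarrow> pth S' s a b"
  by (induction rule: pth.induct) (auto intro: pth.edge pth.step)

lemma pth_bound: "pth S s a b \<Longrightarrow> fst a \<le> S \<and> fst b \<le> S \<and> snd a < n \<and> snd b < n"
  by (induction rule: pth.induct) (auto dest: edge_snd)

text \<open>An excursion from time \<open>S\<close> to \<open>Suc S\<close> and back shrinks to one
  edge, since the matrix between the two times is used up to derivability. So \<open>Suc S\<close>
  need be visited only at the very end.\<close>

lemma pth_upper:
  assumes "pth (Suc S) s a b" "fst a \<le> S"
  shows "(fst b \<le> S \<and> pth S s a b) \<or>
    (fst b = Suc S \<and> (\<exists>c s1 s2. fst c = S \<and> pth S s1 a c \<and> edge s2 c b \<and> s = (s1 \<or> s2)))"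
  using assms
proof (induction rule: pth.induct)
  case (edge s a b)
  show ?case
  proof (cases "fst b \<le> S")
    case True
    then show ?thesis using edge pth.edge by blast
  next
    case False
    then have b: "fst b = Suc S" "fst a = S" using edge edge_level[OF edge(1)] by auto
    have "edge False a a" using edge_snd[OF edge(1)] by (simp add: edge_def)
    then have "pth S False a a" using b by (auto intro: pth.edge)
    then show ?thesis using b edge(1) by (intro disjI2 conjI exI[of _ a] exI[of _ False] exI[of _ s]) auto
  qed
next
  case (step s a b s' c)
  from step.IH[OF step.prems] show ?case
  proof
    assume b: "fst b \<le> S \<and> pth S s a b"
    show ?thesis
    proof (cases "fst c \<le> S")
      case True
      then show ?thesis using b step.hyps(2) pth.step by blast
    next
      case False
      then have "fst c = Suc S" "fst b = S" using step.hyps b edge_level[OF step.hyps(2)] by auto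
      then show ?thesis using b step.hyps(2) by blast
    qed
  next
    assume "fst b = Suc S \<and> (\<exists>c s1 s2. fst c = S \<and> pth S s1 a c \<and> edge s2 c b \<and> s = (s1 \<or> s2))"
    then obtain d s1 s2 where d: "fst b = Suc S" "fst d = S" "pth S s1 a d" "edge s2 d b" "s = (s1 \<or> s2)"
      by blast
    have c: "fst c \<in> {S, Suc S}" using d(1) step.hyps(3) edge_level[OF step.hyps(2)] by auto
    have e: "edge (s2 \<or> s') d c" using edge_trans[OF d(4) step.hyps(2), of S] d(1,2) c by auto
    show ?thesis
    proof (cases "fst c = Suc S")
      case True
      then show ?thesis using d e
        by (intro disjI2 conjI exI[of _ d] exI[of _ s1] exI[of _ "s2 \<or> s'"]) auto
    next
      case False
      then have "fst c = S" using c by auto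
      then show ?thesis using pth.step[OF d(3) e] d(5) by (simp add: disj_assoc)
    qed
  qed
qed

text \<open>The mirror image for excursions into the past: they are removed from the earliest time
  upwards, until a single edge within time \<open>t\<close> is left.\<close>

lemma pth_lower: "pth t s a b \<Longrightarrow> fst a = t \<Longrightarrow> fst b = t \<Longrightarrow> edge s a b"
proof (induction t arbitrary: s a b)
  case 0
  then show ?case
  proof (induction rule: pth.induct)
    case (step s a b s' c)
    then have "fst b = 0" using pth_bound by fastforce
    then show ?case using step edge_trans[of s a b s' c 0] by auto
  qed auto
next
  case (Suc t)
  \<comment> \<open>The claim for all prefixes of the path: so far it is one edge within
    \<open>Suc t\<close>, or an edge down to \<open>t\<close> followed by a path at or below
    \<open>t\<close>. On return to \<open>Suc t\<close>, the induction hypothesis shrinks the lower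
    part to an edge.\<close>
  have "(fst b = Suc t \<and> edge s a b) \<or>
    (fst b \<le> t \<and> (\<exists>c s1 s2. fst c = t \<and> edge s1 a c \<and> pth t s2 c b \<and> s = (s1 \<or> s2)))"
    if "pth (Suc t) s a b" "fst a = Suc t" for s a b
    using that
  proof (induction rule: pth.induct)
    case (edge s a b)
    show ?case
    proof (cases "fst b = Suc t")
      case False
      then have b: "fst b = t" using edge edge_level[OF edge(1)] by auto
      have "edge False b b" using edge_snd[OF edge(1)] by (simp add: edge_def)
      then have "pth t False b b" using b by (auto intro: pth.edge)
      then show ?thesis using b edge(1)
        by (intro disjI2 conjI exI[of _ b] exI[of _ s] exI[of _ False]) auto
    qed (use edge in auto)
  next
    case (step s a b s' c)
    from step.IH[OF step.prems] show ?case
    proof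
      assume b: "fst b = Suc t \<and> edge s a b"
      then have c: "fst c \<in> {t, Suc t}" using step.hyps(3) edge_level[OF step.hyps(2)] by auto
      then have e: "edge (s \<or> s') a c"
        using edge_trans[of s a b s' c t] b step.hyps(2) step.prems by auto
      have "edge False c c" using edge_snd[OF step.hyps(2)] by (simp add: edge_def)
      then have "fst c = t \<Longrightarrow> pth t False c c" by (auto intro: pth.edge)
      then show ?thesis using c e
        by (cases "fst c = Suc t")
          (simp, intro disjI2 conjI exI[of _ c] exI[of _ "s \<or> s'"] exI[of _ False], auto)
    next
      assume "fst b \<le> t \<and> (\<exists>c s1 s2. fst c = t \<and> edge s1 a c \<and> pth t s2 c b \<and> s = (s1 \<or> s2))"
      then obtain d s1 s2 where d: "fst b \<le> t" "fst d = t" "edge s1 a d" "pth t s2 d b" "s = (s1 \<or> s2)"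
        by blast
      show ?thesis
      proof (cases "fst c \<le> t")
        case True
        then show ?thesis using d pth.step[OF d(4) step.hyps(2)]
          by (intro disjI2 conjI exI[of _ d] exI[of _ s1] exI[of _ "s2 \<or> s'"]) auto
      next
        case False
        then have c: "fst c = Suc t" "fst b = t"
          using d(1) step.hyps(3) edge_level[OF step.hyps(2)] by auto
        have 1: "edge s2 d b" by (rule Suc.IH[OF d(4) d(2) c(2)])
        have "edge (s1 \<or> s2) a b" using edge_trans[OF d(3) 1, of t] d(2) c step.prems by auto
        then have "edge ((s1 \<or> s2) \<or> s') a c"
          using edge_trans[OF _ step.hyps(2), of "s1 \<or> s2" a t] c step.prems by auto
        then show ?thesis using c d(5) by auto
      qed
    qed
  qed
  from this[OF Suc.prems(1,2)] show ?case using Suc.prems(3) by auto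
qed

text \<open>Repeated use of \<open>pth_upper\<close> removes every excursion above the later of the
  two ends.\<close>

lemma pth_cap:
  assumes "pth S s a b" "fst a \<le> S'" "fst b \<le> S'"
  shows "pth S' s a b"
proof (cases "S \<le> S'")
  case True
  then show ?thesis using assms(1) pth_mono by blast
next
  case False
  have "pth (S' + d) s a b \<Longrightarrow> pth S' s a b" for d
  proof (induction d)
    case (Suc d)
    then have "pth (Suc (S' + d)) s a b" by simp
    from pth_upper[OF this] Suc.IH assms(2,3) show ?case by fastforce
  qed simp
  from this[of "S - S'"] show ?thesis using False assms(1) by simp
qed

text \<open>Consistency of each single matrix excludes strict cycles in the whole unfolded path:
  such a cycle would shrink to a strict edge from an occurrence to itself.\<close>

lemma pth_irrefl: "\<not> pth S True a a"
proof
  assume "pth S True a a"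
  from pth_lower[OF pth_cap[OF this order_refl order_refl]] have "edge True a a" by simp
  then show False by (auto simp: edge_def)
qed

definition above :: "nat \<times> nat \<Rightarrow> nat set" where
  "above a = {l. l < k \<and> r (fst a) (f l (fst a)) \<le> r (fst a) (snd a)}"

definition sabove :: "nat \<times> nat \<Rightarrow> nat set" where
  "sabove a = {l. l < k \<and> r (fst a) (f l (fst a)) < r (fst a) (snd a)}"

definition zone :: "nat \<times> nat \<Rightarrow> nat" where
  "zone a = card (above a) + card (sabove a)"

lemma finite_above [simp]: "finite (above a)" "finite (sabove a)"
  by (auto simp: above_def sabove_def)

lemma frozen_edge:
  assumes "l < k"
  shows "edge False (t, f l t) (Suc t, f l (Suc t))" "edge False (Suc t, f l (Suc t)) (t, f l t)"
  using fz[OF assms, of t] f[OF assms, of t] f[OF assms, of "Suc t"]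
  by (simp_all add: edge_def der.base)

text \<open>The occurrences of a frozen variable at adjacent times are joined by weak edges in both
  directions. A descent from \<open>a\<close> to \<open>b\<close> and on to a frozen variable can
  thus be moved back to the time of \<open>a\<close>.\<close>

lemma edge_above:
  assumes e: "edge s a b" and l: "l \<in> above b"
  shows "l \<in> above a" "s \<or> l \<in> sabove b \<Longrightarrow> l \<in> sabove a"
proof -
  have lk: "l < k" using l by (simp add: above_def)
  let ?F = "\<lambda>t. (t, f l t)"
  obtain t where t: "fst a \<in> {t, Suc t}" "fst b \<in> {t, Suc t}" using edge_level[OF e] by (metis insertI1 insertI2)
  have 1: "edge (l \<in> sabove b) b (?F (fst b))"
    using l lk f edge_snd[OF e] by (auto simp: edge_def above_def sabove_def)
  have 2: "edge False (?F (fst b)) (?F (fst a))"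
    using edge_level[OF e] frozen_edge[OF lk] f[OF lk] by (auto simp: edge_same)
  have "edge (s \<or> l \<in> sabove b) a (?F (fst b))"
    using edge_trans[OF e 1] t by auto
  then have 3: "edge (s \<or> l \<in> sabove b) a (?F (fst a))"
    using edge_trans[OF _ 2, of _ a t] t by force
  then show "l \<in> above a" "s \<or> l \<in> sabove b \<Longrightarrow> l \<in> sabove a"
    using lk by (auto simp: edge_def above_def sabove_def)
qed

lemma sabove_above: "l \<in> sabove a \<Longrightarrow> l \<in> above a"
  by (auto simp: above_def sabove_def)

lemma pth_above:
  "pth S s a b \<Longrightarrow> l \<in> above b \<Longrightarrow> l \<in> above a \<and> (s \<or> l \<in> sabove b \<longrightarrow> l \<in> sabove a)"
proof (induction rule: pth.induct)
  case (edge s a b)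
  then show ?case using edge_above by blast
next
  case (step s a b s' c)
  then show ?case using edge_above[OF step.hyps(2) step.prems] by blast
qed

lemma pth_subset: "pth S s a b \<Longrightarrow> above b \<subseteq> above a \<and> sabove b \<subseteq> sabove a"
  using pth_above[of S s a b] sabove_above[of _ b] by auto

lemma pth_zone: "pth S s a b \<Longrightarrow> zone b \<le> zone a"
  using pth_subset[of S s a b] by (simp add: zone_def add_mono card_mono)

text \<open>Both sets can only shrink along a path, so an unchanged sum of their sizes means that
  neither does.\<close>

lemma zone_eq:
  assumes "pth S s a b" "zone a = zone b"
  shows "above a = above b \<and> sabove a = sabove b"
proof -
  have s: "above b \<subseteq> above a" "sabove b \<subseteq> sabove a"
    using pth_subset[OF assms(1)] by auto
  then have "card (above b) \<le> card (above a)" "card (sabove b) \<le> card (sabove a)"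
    by (auto intro: card_mono)
  then have "card (above b) = card (above a)" "card (sabove b) = card (sabove a)"
    using assms(2) by (auto simp: zone_def)
  then show ?thesis using s by (metis card_subset_eq finite_above)
qed

definition frozen :: "nat \<times> nat \<Rightarrow> bool" where
  "frozen a \<longleftrightarrow> (\<exists>l<k. r (fst a) (snd a) = r (fst a) (f l (fst a)))"

lemma frozen_iff: "frozen a \<longleftrightarrow> (\<exists>l. l \<in> above a \<and> l \<notin> sabove a)"
  by (auto simp: frozen_def above_def sabove_def)

text \<open>Domination: while the thread through the highest targets is alive, no path from its
  start gets above it. Once it is dead, a path can go on only in a lower zone, unless the start is
  itself in a frozen class.\<close>

lemma pth_tok:
  assumes i: "i < n"
  shows "pth (t + d) s (t, i) b \<Longrightarrow> fst b = t + d \<Longrightarrow>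
    (case tok t i d of Some x \<Rightarrow> x < n \<and> r (t + d) (snd b) \<le> r (t + d) x
      | None \<Rightarrow> zone b < zone (t, i) \<or> frozen (t, i))"
proof -
  have pt: "tok t i d = Some x \<Longrightarrow> x < n \<and> pth (t + d) False (t, i) (t + d, x)" for d x
  proof (induction d arbitrary: x)
    case 0
    then show ?case using i by (auto simp: tok0 edge_same intro!: pth.edge)
  next
    case (Suc d)
    then obtain y where y: "tok t i d = Some y" "T (t + d) y \<noteq> 0" "x = T (t + d) y - 1"
      by (auto simp: tok split: option.splits if_splits)
    have yn: "y < n" "pth (t + d) False (t, i) (t + d, y)" using Suc.IH[OF y(1)] by auto
    have x: "x < n" "der (2*n) (m (t + d)) False y (n + x)"
      using T[OF yn(1), of "t + d"] y by (auto simp: is_target_def)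
    have "edge False (t + d, y) (Suc (t + d), x)" using x yn by (simp add: edge_def)
    then have "pth (Suc (t + d)) False (t, i) (Suc (t + d), x)"
      using pth.step[of "Suc (t + d)" False "(t, i)" "(t + d, y)" False] pth_mono[OF yn(2), of "Suc (t + d)"]
      by auto
    then show ?case using x by auto
  qed
  show "pth (t + d) s (t, i) b \<Longrightarrow> fst b = t + d \<Longrightarrow> ?thesis"
  proof (induction d arbitrary: s b)
    case 0
    then have "edge s (t, i) b" using pth_lower[of t s "(t, i)" b] by simp
    then show ?case using 0 i by (auto simp: tok0 edge_def)
  next
    case (Suc d)
    have "pth (Suc (t + d)) s (t, i) b" using Suc.prems by simp
    from pth_upper[OF this] have "\<exists>c s1 s2. fst c = t + d \<and> pth (t + d) s1 (t, i) c \<and> edge s2 c b"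
      using Suc.prems(2) by fastforce
    then obtain c s1 s2 where
      c: "fst c = t + d" "pth (t + d) s1 (t, i) c" "edge s2 c b" by blast
    note IH = Suc.IH[OF c(2) c(1)]
    have cb: "snd c < n" "snd b < n" using edge_snd[OF c(3)] by auto
    have zbc: "zone b \<le> zone c"
      by (rule pth_zone[of "Suc (t + d)" s2]) (use c Suc.prems in \<open>auto intro: pth.edge\<close>)
    show ?case
    proof (cases "tok t i d")
      case None
      then show ?thesis using IH zbc by (auto simp: tok)
    next
      case (Some x)
      then have x: "x < n" "r (t + d) (snd c) \<le> r (t + d) x" using IH by auto
      have xc: "edge False (t + d, x) c" using x cb c(1) by (simp add: edge_def)
      have xb: "edge s2 (t + d, x) b"
        using edge_trans[OF xc c(3), of "t + d"] c(1) Suc.prems(2) by auto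
      then have dx: "der (2*n) (m (t + d)) False x (n + snd b)"
        using Suc.prems(2) by (auto simp: edge_def intro: der_weaken)
      have px: "pth (t + d) False (t, i) (t + d, x)" using pt[OF Some] by blast
      consider (fr) "frozen (t + d, x)" | (no) "\<not> frozen (t + d, x)" "T (t + d) x = 0"
        | (ok) "\<not> frozen (t + d, x)" "T (t + d) x \<noteq> 0" by blast
      then show ?thesis
      proof cases
        \<comment> \<open>The thread ends in a frozen class. Either it has dropped to a lower zone
          on the way, taking the path with it, or it is still in the zone of its start, which is
          then frozen too.\<close>
        case fr
        have "pth (t + d) False (t + d, x) c" using xc c(1) by (auto intro: pth.edge)
        from pth_zone[OF this] zbc have zbx: "zone b \<le> zone (t + d, x)" by simp
        have "frozen (t, i)" if "zone (t, i) \<le> zone (t + d, x)"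
          using zone_eq[OF px] pth_zone[OF px] that fr by (simp add: frozen_iff)
        then have "zone b < zone (t, i) \<or> frozen (t, i)" using zbx pth_zone[OF px] by linarith
        then show ?thesis using fr Some by (simp add: tok frozen_def)
      next
        \<comment> \<open>Impossible: the path goes on to \<open>b\<close>, and \<open>x\<close>
          lies at least as high as its last occurrence, so \<open>x\<close> bounds a target
          variable.\<close>
        case no
        then show ?thesis using T[OF x(1), of "t + d"] dx cb by (auto simp: is_target_def)
      next
        case ok
        then have "tok t i (Suc d) = Some (T (t + d) x - 1)" using Some by (simp add: tok frozen_def)
        then show ?thesis using T[OF x(1), of "t + d"] dx cb ok
          by (auto simp: is_target_def)
      qed
    qed
  qed
qed

definition below :: "nat \<times> nat \<Rightarrow> (nat \<times> nat) set" where
  "below a = {b. (\<exists>S. pth S True a b) \<and> zone b = zone a}"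

text \<open>Nothing lies strictly below an occurrence within a frozen class. Otherwise the thread is
  dead after \<open>d\<close> steps, and from then on no path from \<open>a\<close> remains in its
  zone; so \<open>below a\<close> lies before time \<open>t + d\<close>, where there are finitely
  many occurrences.\<close>

lemma finite_below:
  assumes "snd a < n"
  shows "finite (below a)"
proof (cases "frozen a")
  case True
  then obtain l where l: "l \<in> above a" "l \<notin> sabove a" by (auto simp: frozen_iff)
  have "b \<notin> below a" for b
  proof
    assume "b \<in> below a"
    then obtain S where "pth S True a b" "zone a = zone b" by (auto simp: below_def)
    then show False using zone_eq pth_above l by metis
  qed
  then show ?thesis by (metis equals0I finite.emptyI)
next
  case False
  obtain t i where a: "a = (t, i)" by (cases a)
  then have i: "i < n" using assms by simp
  obtain d where d: "tok t i d = None" using die[OF i] by blast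
  have d': "tok t i (d + x) = None" for x
    using d by (induction x) (auto simp: tok)
  have "below a \<subseteq> {..<t + d} \<times> {..<n}"
  proof
    fix b assume "b \<in> below a"
    then obtain S where S: "pth S True a b" "zone a = zone b" by (auto simp: below_def)
    have "fst b < t + d"
    proof (rule ccontr)
      assume "\<not> fst b < t + d"
      then obtain x where x: "fst b = t + (d + x)" by (metis add.assoc le_Suc_ex not_less)
      have "pth (t + (d + x)) True (t, i) b" using pth_cap[OF S(1)[unfolded a], of "t + (d + x)"] x by simp
      from pth_tok[OF i this x] d' show False using S(2) False a by simp
    qed
    then show "b \<in> {..<t + d} \<times> {..<n}" using pth_bound[OF S(1)] by (cases b) auto
  qed
  then show ?thesis by (rule finite_subset) auto
qed

text \<open>The number of strictly lower occurrences serves as height. The zone has to come first,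
  since infinitely many occurrences may lie below in lower zones.\<close>

definition value_at :: "nat \<Rightarrow> nat \<Rightarrow> nat" where
  "value_at t i = prod_encode (zone (t, i), card (below (t, i)))"

text \<open>Within a zone, the sets \<open>below\<close> shrink along edges; a strict edge also
  loses its own end, which is not below itself by \<open>pth_irrefl\<close>.\<close>

lemma edge_value:
  assumes e: "edge s (t, i) (t', j)"
  shows "(value_at t' j, value_at t i) \<in> lex_nat" "s \<Longrightarrow> value_at t' j \<noteq> value_at t i"
proof -
  let ?a = "(t, i)" and ?b = "(t', j)"
  have p: "pth (max t t') s ?a ?b" using e by (auto intro: pth.edge)
  have z: "zone ?b \<le> zone ?a" by (rule pth_zone[OF p])
  have fin: "finite (below ?a)" using finite_below edge_snd[OF e] by auto
  have sub: "below ?b \<subseteq> below ?a" if "zone ?a = zone ?b"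
  proof
    fix c assume "c \<in> below ?b"
    then obtain S where S: "pth S True ?b c" "zone c = zone ?b" by (auto simp: below_def)
    have "pth (max S (max t t')) (s \<or> True) ?a c"
      by (rule pth_trans[OF pth_mono[OF S(1)] pth_mono[OF p]]) auto
    then show "c \<in> below ?a" using S(2) that by (auto simp: below_def)
  qed
  have "card (below ?b) \<le> card (below ?a)" if "zone ?a = zone ?b"
    using sub[OF that] fin by (rule card_mono[rotated])
  then show "(value_at t' j, value_at t i) \<in> lex_nat"
    using z by (auto simp: lex_nat_def value_at_def)
  have "card (below ?b) < card (below ?a)" if "zone ?a = zone ?b" "s"
  proof (rule psubset_card_mono[OF fin])
    have "?b \<in> below ?a" "?b \<notin> below ?b" using p that pth_irrefl by (auto simp: below_def)
    then show "below ?b \<subset> below ?a" using sub[OF that(1)] by blast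
  qed
  then show "s \<Longrightarrow> value_at t' j \<noteq> value_at t i"
    using z by (auto simp: value_at_def)
qed

lemma sat_value: "sat lex_nat n (m t) (value_at t) (value_at (Suc t))"
proof -
  have "(let x = \<lambda>u. if u < n then value_at t u else value_at (Suc t) (u - n) in
      (m t u v \<noteq> 0 \<longrightarrow> (x v, x u) \<in> lex_nat) \<and> (2 \<le> m t u v \<longrightarrow> x v \<noteq> x u))"
    if uv: "u < 2*n" "v < 2*n" for u v
  proof -
    define nd where "nd u = (if u < n then (t, u) else (Suc t, u - n))" for u
    have pos: "pos t (nd u) = u" "fst (nd u) \<in> {t, Suc t}" for u by (auto simp: pos_def nd_def)
    have sn: "u < 2*n \<Longrightarrow> snd (nd u) < n" for u by (auto simp: nd_def)
    have e: "edge s (nd u) (nd v)" if "m t u v \<noteq> 0" "s \<longrightarrow> 2 \<le> m t u v" for s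
      using that uv sn pos by (auto simp: edge_pos[of _ t] intro: der.base)
    have va: "(if u < n then value_at t u else value_at (Suc t) (u - n)) =
      value_at (fst (nd u)) (snd (nd u))" for u by (simp add: nd_def)
    show ?thesis
      unfolding Let_def va using e[of False] e[of True]
        edge_value[of _ "fst (nd u)" "snd (nd u)" "fst (nd v)" "snd (nd v)"] by auto
  qed
  then show ?thesis unfolding sat_def Let_def by blast
qed

end

section \<open>The levels of the ranking function\<close>

definition arc_rel :: "(nat \<Rightarrow> nat) \<Rightarrow> (nat \<Rightarrow> nat) \<Rightarrow> nat set \<Rightarrow> nat rel" where
  "arc_rel src dst A = (\<lambda>e. (src e, dst e)) ` A"

text \<open>\<open>rk q i\<close> is the rank of variable \<open>i\<close> in the ordering of the variables at node \<open>q\<close>.\<close>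

locale elab =
  fixes n V E :: nat and src dst :: "nat \<Rightarrow> nat" and rk :: "nat \<Rightarrow> nat \<Rightarrow> nat" and m0 :: "nat \<Rightarrow> mat"
  assumes n1: "1 \<le> n"
    and ends: "e < E \<Longrightarrow> src e < V" "e < E \<Longrightarrow> dst e < V"
    and rank0: "e < E \<Longrightarrow> ranked n 0 (rk (src e)) (m0 e)"
      "e < E \<Longrightarrow> ranked n n (rk (dst e)) (m0 e)"
begin

text \<open>\<open>vv l q\<close> is the variable (counted from 1) chosen at level \<open>l\<close> for node \<open>q\<close>, or 0. At level
  \<open>l\<close>, the variables chosen at earlier levels are assumed to keep their values.\<close>

definition lmat :: "(nat \<Rightarrow> nat \<Rightarrow> nat) \<Rightarrow> nat \<Rightarrow> nat \<Rightarrow> mat" where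
  "lmat vv l e u v = max (m0 e u v) (if \<exists>l'<l.
     u = vv l' (src e) - 1 \<and> v = n + (vv l' (dst e) - 1) \<or>
     u = n + (vv l' (dst e) - 1) \<and> v = vv l' (src e) - 1 then 1 else 0)"

lemma lmat_Suc: "lmat vv (Suc l) e u v = max (lmat vv l e u v) (if
     u = vv l (src e) - 1 \<and> v = n + (vv l (dst e) - 1) \<or>
     u = n + (vv l (dst e) - 1) \<and> v = vv l (src e) - 1 then 1 else 0)"
  unfolding lmat_def less_Suc_eq by (simp add: max.assoc ex_disj_distrib conj_disj_distribR) blast

text \<open>Ranks are compared instead of variables: a variable in the class of a chosen one has the
  same value, so it would add nothing to the vector.\<close>

definition fixed :: "(nat \<Rightarrow> nat \<Rightarrow> nat) \<Rightarrow> nat \<Rightarrow> nat \<Rightarrow> nat \<Rightarrow> bool" where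
  "fixed vv l q i \<longleftrightarrow> (\<exists>l'<l. rk q i = rk q (vv l' q - 1))"

text \<open>One bad arc suffices. So along every path the thread of a safe variable goes on forever
  and never meets the class of a variable chosen before.\<close>

inductive unsafe for vv l A T where
  fixed: "q < V \<Longrightarrow> i < n \<Longrightarrow> fixed vv l q i \<Longrightarrow> unsafe vv l A T q i"
| dead: "e \<in> A \<Longrightarrow> i < n \<Longrightarrow> T e i = 0 \<Longrightarrow> unsafe vv l A T (src e) i"
| pred: "e \<in> A \<Longrightarrow> i < n \<Longrightarrow> T e i = Suc j \<Longrightarrow> unsafe vv l A T (dst e) j \<Longrightarrow> unsafe vv l A T (src e) i"

text \<open>Conditions rather than a function: the numbering of the components and the choice among
  variables of equal rank are left to the program.\<close>

definition is_level where
  "is_level l As cp vv T \<longleftrightarrow>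
     (let B = {e \<in> As l. consistent (2*n) (lmat vv l e)}; A = As (Suc l) in
       (\<forall>q<V. cp l q < V) \<and> (\<forall>e\<in>B. cp l (dst e) \<le> cp l (src e)) \<and>
       (\<forall>q<V. \<forall>q'<V. cp l q = cp l q' \<longrightarrow> (q, q') \<in> (arc_rel src dst B)\<^sup>*) \<and>
       A = {e \<in> B. cp l (src e) = cp l (dst e)} \<and>
       (\<forall>e\<in>A. \<forall>i<n. is_target n (lmat vv l e) (rk (dst e)) i (T e i)) \<and>
       (\<forall>q<V. vv l q \<le> n \<and> (vv l q = 0 \<longrightarrow> (\<forall>i<n. unsafe vv l A T q i)) \<and>
          (vv l q \<noteq> 0 \<longrightarrow> \<not> unsafe vv l A T q (vv l q - 1) \<and>
             (\<forall>j<n. \<not> unsafe vv l A T q j \<longrightarrow> rk q (vv l q - 1) \<le> rk q j))))"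

text \<open>The second number is fuel. With \<open>n + 1\<close> levels it does not run out before a
  level without a choice, by \<open>exists_vv_zero\<close>, so the vector ends with an
  integer.\<close>

fun vector_from :: "(nat \<Rightarrow> nat \<Rightarrow> nat) \<Rightarrow> (nat \<Rightarrow> nat \<Rightarrow> nat) \<Rightarrow> nat \<Rightarrow> nat \<Rightarrow> nat \<Rightarrow> (nat + nat) list" where
  "vector_from cp vv 0 l q = []"
| "vector_from cp vv (Suc d) l q = Inl (cp l q) #
     (if vv l q = 0 then [] else Inr (vv l q) # vector_from cp vv d (Suc l) q)"

end

lemma ranked_mono:
  assumes "ranked n z r m" "\<And>u v. m u v \<le> m' u v"
  shows "ranked n z r m'"
proof -
  have "(m (z + i) (z + j) \<noteq> 0 \<longrightarrow> m' (z + i) (z + j) \<noteq> 0) \<and>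
      (2 \<le> m (z + i) (z + j) \<longrightarrow> 2 \<le> m' (z + i) (z + j))" for i j
    using assms(2)[of "z + i" "z + j"] by linarith
  then show ?thesis using assms(1) unfolding ranked_def by blast
qed

lemma der_sat:
  assumes "der (2*n) m s u v" "sat r n m \<sigma> \<sigma>'" "Well_order r"
  shows "((if v < n then \<sigma> v else \<sigma>' (v - n)), (if u < n then \<sigma> u else \<sigma>' (u - n))) \<in> r \<and>
    (s \<longrightarrow> (if v < n then \<sigma> v else \<sigma>' (v - n)) \<noteq> (if u < n then \<sigma> u else \<sigma>' (u - n)))"
proof -
  define x where "x u = (if u < n then \<sigma> u else \<sigma>' (u - n))" for u
  have tr: "Relation.trans r" and an: "antisym r"
    using assms(3) by (auto simp: well_order_on_def order_on_defs)
  have "(x v, x u) \<in> r \<and> (s \<longrightarrow> x v \<noteq> x u)"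
    using assms(1)
  proof (induction rule: der.induct)
    case (base u v s)
    then show ?case using assms(2) by (auto simp: sat_def x_def Let_def)
  next
    case (trans s u v s' w)
    then show ?case using tr an by (metis antisymD transD)
  qed
  then show ?thesis by (simp add: x_def)
qed

text \<open>Termination enters only through \<open>norun\<close>, stated for matrices and for the
  single well-order \<open>lex_nat\<close>; it is supplied by \<open>no_sat_run\<close>.\<close>

locale levels = elab +
  fixes As :: "nat \<Rightarrow> nat set" and cp vv :: "nat \<Rightarrow> nat \<Rightarrow> nat" and T :: "nat \<Rightarrow> nat \<Rightarrow> nat \<Rightarrow> nat"
  assumes As0: "As 0 = {..<E}"
    and level: "l \<le> n \<Longrightarrow> is_level l As cp vv (T l)"
    and norun: "\<not> (\<exists>es x. (\<forall>t. es t < E \<and> dst (es t) = src (es (Suc t))) \<and>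
      (\<forall>t::nat. sat lex_nat n (m0 (es t)) (x t) (x (Suc t))))"
begin

lemmas level' = level[unfolded is_level_def Let_def]

lemma As_Suc: "l \<le> n \<Longrightarrow> As (Suc l) \<subseteq> As l"
  using level'[of l] by blast

lemma As_E: "l \<le> Suc n \<Longrightarrow> As l \<subseteq> {..<E}"
proof (induction l)
  case (Suc l)
  then show ?case using As_Suc[of l] by auto
qed (simp add: As0)

lemma vv_less: "l \<le> n \<Longrightarrow> q < V \<Longrightarrow> vv l q - 1 < n"
proof -
  assume "l \<le> n" "q < V"
  then have "vv l q \<le> n" using level'[of l] by blast
  then show ?thesis using n1 by linarith
qed

section \<open>Safe variables on cycles\<close>

context
  fixes l :: nat assumes l: "l \<le> n"
begin

abbreviation "A \<equiv> As (Suc l)"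
abbreviation "R \<equiv> arc_rel src dst A"
abbreviation "uns \<equiv> unsafe vv l A (T l)"

fun path :: "nat \<Rightarrow> nat list \<Rightarrow> nat \<Rightarrow> bool" where
  "path q [] q' = (q = q')"
| "path q (e # p) q' = (e \<in> A \<and> src e = q \<and> path (dst e) p q')"

lemma path_append: "path q (p @ p') q'' \<longleftrightarrow> (\<exists>q'. path q p q' \<and> path q' p' q'')"
  by (induction p arbitrary: q) auto

lemma path_A: "path q p q' \<Longrightarrow> e \<in> set p \<Longrightarrow> e \<in> A"
  by (induction p arbitrary: q) auto

lemma A_less: "e \<in> A \<Longrightarrow> e < E"
  using As_E[of "Suc l"] l by auto

lemma path_of_rtrancl: "(q, q') \<in> R\<^sup>* \<Longrightarrow> \<exists>p. path q p q'"
proof (induction rule: converse_rtrancl_induct)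
  case base
  then show ?case by (intro exI[of _ "[]"]) simp
next
  case (step q r)
  then obtain p e where "path r p q'" "e \<in> A" "src e = q" "dst e = r" by (auto simp: arc_rel_def)
  then show ?case by (intro exI[of _ "e # p"]) simp
qed

text \<open>Component numbers never increase along the consistent arcs, so a path back to a node of
  the same number keeps that number throughout and uses only arcs that remain.\<close>

lemma arc_reversible:
  assumes "e \<in> A"
  shows "(dst e, src e) \<in> R\<^sup>*"
proof -
  let ?B = "{e \<in> As l. consistent (2*n) (lmat vv l e)}"
  have e: "cp l (src e) = cp l (dst e)" "src e < V" "dst e < V"
    using level'[OF l] assms ends A_less by auto
  then have "(dst e, src e) \<in> (arc_rel src dst ?B)\<^sup>*" using level'[OF l] by metis
  then have "cp l (src e) \<le> cp l (dst e) \<and> (cp l (src e) = cp l (dst e) \<longrightarrow> (dst e, src e) \<in> R\<^sup>*)"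
  proof (induction rule: rtrancl_induct)
    case (step q q')
    then obtain e' where e': "e' \<in> ?B" "q = src e'" "q' = dst e'" by (auto simp: arc_rel_def)
    have le: "cp l q' \<le> cp l q" using level'[OF l] e' by blast
    have "(dst e, q') \<in> R\<^sup>*" if "cp l q' = cp l (dst e)"
    proof -
      have "cp l q = cp l (dst e)" "cp l q' = cp l q" using le that step.IH by auto
      then have "e' \<in> A" using level'[OF l] e' by simp
      then have "(q, q') \<in> R" using e' by (auto simp: arc_rel_def)
      then show ?thesis using step.IH \<open>cp l q = cp l (dst e)\<close> by auto
    qed
    then show ?case using step.IH le by auto
  qed simp
  then show ?thesis using e by simp
qed

lemma path_reversible: "path q p q' \<Longrightarrow> (q', q) \<in> R\<^sup>*"
proof (induction p arbitrary: q)
  case (Cons e p)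
  then show ?case using arc_reversible[of e] by (metis path.simps(2) rtrancl_trans)
qed simp

lemma out_arc:
  assumes "e \<in> A"
  shows "\<exists>e'\<in>A. src e' = dst e"
  using arc_reversible[OF assms] assms
  by (cases rule: converse_rtranclE) (auto simp: arc_rel_def)

definition tstep :: "nat \<Rightarrow> nat \<Rightarrow> nat option" where
  "tstep e i = (if fixed vv l (src e) i \<or> T l e i = 0 then None else Some (T l e i - 1))"

definition trun :: "nat list \<Rightarrow> nat option \<Rightarrow> nat option" where
  "trun p = fold (\<lambda>e z. Option.bind z (tstep e)) p"

lemma trun_simps [simp]: "trun [] z = z" "trun (e # p) z = trun p (Option.bind z (tstep e))"
  "trun (p @ p') z = trun p' (trun p z)"
  by (simp_all add: trun_def)

lemma trun_None [simp]: "trun p None = None"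
  by (induction p) auto

lemma T_target: "e \<in> A \<Longrightarrow> i < n \<Longrightarrow> is_target n (lmat vv l e) (rk (dst e)) i (T l e i)"
  using level'[OF l] by blast

lemma T_le: "e \<in> A \<Longrightarrow> i < n \<Longrightarrow> T l e i \<le> n"
  using T_target[of e i] by (auto simp: is_target_def split: if_splits)

lemma trun_less: "path q p q' \<Longrightarrow> i < n \<Longrightarrow> trun p (Some i) = Some j \<Longrightarrow> j < n"
proof (induction p arbitrary: q i)
  case (Cons e p)
  have e: "T l e i \<le> n" using Cons.prems T_le by simp
  have "\<not> fixed vv l (src e) i \<and> T l e i \<noteq> 0" using Cons.prems(3) by (auto simp: tstep_def split: if_splits)
  then have "trun p (Some (T l e i - 1)) = Some j" "T l e i - 1 < n"
    using Cons.prems(3) e by (auto simp: tstep_def)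
  then show ?case using Cons.IH[of "dst e"] Cons.prems(1) by simp
qed simp

lemma safe_step:
  assumes "e \<in> A" "i < n" "\<not> uns (src e) i"
  shows "T l e i \<noteq> 0" "T l e i - 1 < n" "\<not> uns (dst e) (T l e i - 1)"
proof -
  show 1: "T l e i \<noteq> 0" using assms unsafe.dead by metis
  show "T l e i - 1 < n" using T_le[OF assms(1,2)] 1 by simp
  show "\<not> uns (dst e) (T l e i - 1)" using assms 1 unsafe.pred[of e A i "T l" "T l e i - 1"] by fastforce
qed

lemma safe_path: "path q p q' \<Longrightarrow> i < n \<Longrightarrow> \<not> uns q i \<Longrightarrow> \<exists>j<n. \<not> uns q' j"
proof (induction p arbitrary: q i)
  case (Cons e p)
  then show ?case using safe_step[of e i] Cons.IH[of "dst e" "T l e i - 1"] by simp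
qed auto

text \<open>A thread on a fixed variable dies only with its next step; this is why \<open>q\<close>
  must have an outgoing arc and the path is nonempty.\<close>

lemma unsafe_killed: "uns q i \<Longrightarrow> \<exists>e\<in>A. src e = q \<Longrightarrow>
    \<exists>p q'. path q p q' \<and> p \<noteq> [] \<and> trun p (Some i) = None"
proof (induction rule: unsafe.induct)
  case (fixed q i)
  then obtain e where "e \<in> A" "src e = q" by blast
  then show ?case using fixed by (intro exI[of _ "[e]"] exI[of _ "dst e"]) (simp add: tstep_def)
next
  case (dead e i)
  then show ?case by (intro exI[of _ "[e]"] exI[of _ "dst e"]) (simp add: tstep_def)
next
  case (pred e i j)
  then obtain p q' where "path (dst e) p q'" "trun p (Some j) = None" using out_arc by blast
  then show ?case using pred by (intro exI[of _ "e # p"] exI[of _ q']) (auto simp: tstep_def)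
qed

text \<open>A safe variable at the end could be carried along a path back to \<open>q\<close>, as
  paths can be reversed within a component.\<close>

lemma all_unsafe_path:
  assumes "path q p q'" "\<forall>i<n. uns q i"
  shows "\<forall>i<n. uns q' i"
  using path_of_rtrancl[OF path_reversible[OF assms(1)]] safe_path assms(2) by blast

text \<open>The threads are killed one after the other by prolonging the path. Those already dead
  stay dead, and the next one, if still alive, sits on some variable of the end node, where again
  everything is unsafe.\<close>

lemma kill_all:
  assumes q: "\<forall>i<n. uns q i" "\<exists>e\<in>A. src e = q"
  shows "set xs \<subseteq> {..<n} \<Longrightarrow> \<exists>p q'. path q p q' \<and> p \<noteq> [] \<and> (\<forall>i\<in>set xs. trun p (Some i) = None)"
proof (induction xs)
  case Nil
  then show ?case using q(2) by (metis path.simps list.distinct(1) empty_iff empty_set)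
next
  case (Cons x xs)
  then obtain p q' where p: "path q p q'" "p \<noteq> []" "\<forall>i\<in>set xs. trun p (Some i) = None" by auto
  show ?case
  proof (cases "trun p (Some x)")
    case None
    then show ?thesis using p by auto
  next
    case (Some y)
    then have "y < n" using trun_less[OF p(1)] Cons.prems by auto
    moreover have "\<exists>e\<in>A. src e = q'"
    proof -
      obtain p1 e where "p = p1 @ [e]" using p(2) by (metis rev_exhaust)
      then have "e \<in> A" "q' = dst e" using p(1) by (auto simp: path_append)
      then show ?thesis using out_arc by blast
    qed
    ultimately obtain p2 q2 where "path q' p2 q2" "trun p2 (Some y) = None"
      using unsafe_killed[of q' y] all_unsafe_path[OF p(1) q(1)] by blast
    then show ?thesis using p Some by (intro exI[of _ "p @ p2"] exI[of _ q2]) (auto simp: path_append)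
  qed
qed

text \<open>If every variable of a node on a cycle is unsafe, then going around a suitable closed path
  forever ends every thread, so that the constraints along it can be satisfied.\<close>

theorem safe_exists:
  assumes e: "e \<in> A"
  shows "\<exists>i<n. \<not> uns (src e) i"
proof (rule ccontr)
  define q where "q = src e"
  assume "\<not> ?thesis"
  then have q: "\<forall>i<n. uns q i" "\<exists>e\<in>A. src e = q" using e by (auto simp: q_def)
  obtain p1 q1 where p1: "path q p1 q1" "p1 \<noteq> []" "\<forall>i<n. trun p1 (Some i) = None"
    using kill_all[OF q, of "[0..<n]"] by (auto simp: subset_eq)
  obtain p2 where p2: "path q1 p2 q" using path_of_rtrancl[OF path_reversible[OF p1(1)]] by blast
  define p where "p = p1 @ p2"
  define N where "N = length p"
  have p: "path q p q" "N > 0" and kill: "trun p z = None" if "\<forall>i. z = Some i \<longrightarrow> i < n" for z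
    using p1 p2 that by (cases z; auto simp: p_def N_def path_append)+
  have p: "path q p q" "N > 0" using p[of None] by auto
  define es where "es t = p ! (t mod N)" for t
  have es_A: "es t \<in> A" for t
    using path_A[OF p(1), of "es t"] p(2) by (auto simp: es_def N_def)
  have src0: "path a p' b \<Longrightarrow> p' \<noteq> [] \<Longrightarrow> src (p' ! 0) = a" for a p' b by (cases p') auto
  have nth_path: "path a p' b \<Longrightarrow> i < length p' \<Longrightarrow>
      dst (p' ! i) = (if Suc i < length p' then src (p' ! Suc i) else b)" for a p' b i
  proof (induction p' arbitrary: a i)
    case (Cons x p')
    then show ?case by (cases i; cases p') auto
  qed simp
  have es: "dst (es t) = src (es (Suc t))" for t
  proof -
    have "t mod N < N" using p(2) by simp
    from nth_path[OF p(1), of "t mod N"] this have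
      "dst (es t) = (if Suc (t mod N) < N then src (p ! Suc (t mod N)) else q)"
      by (simp add: es_def N_def)
    moreover have "p \<noteq> []" using p(2) by (auto simp: N_def)
    ultimately show ?thesis using src0[OF p(1)] \<open>t mod N < N\<close>
      by (cases "Suc (t mod N) = N") (auto simp: es_def mod_Suc)
  qed
  define tok where "tok t i d = trun (map es [t..<t + d]) (Some i)" for t i d
  have block: "map es [c * N..<c * N + N] = p" for c
    by (rule nth_equalityI) (auto simp: es_def N_def)
  have path_es: "path (src (es a)) (map es [a..<a + d]) (src (es (a + d)))" for a d
    using es es_A by (induction d) (auto simp: path_append)
  interpret D: dying_path n l "\<lambda>t. rk (src (es t))" "\<lambda>t. lmat vv l (es t)"
    "\<lambda>l' t. vv l' (src (es t)) - 1" "\<lambda>t. T l (es t)" tok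
  proof
    fix t
    show "consistent (2 * n) (lmat vv l (es t))" using level'[OF l] es_A[of t] by simp
    show "ranked n 0 (rk (src (es t))) (lmat vv l (es t))"
      using rank0(1)[OF A_less[OF es_A[of t]]] by (rule ranked_mono) (simp add: lmat_def)
    show "ranked n n (rk (src (es (Suc t)))) (lmat vv l (es t))"
      using rank0(2)[OF A_less[OF es_A[of t]], unfolded es] by (rule ranked_mono) (simp add: lmat_def)
  next
    fix l' t assume l': "l' < l"
    show "vv l' (src (es t)) - 1 < n" using vv_less l l' ends A_less[OF es_A[of t]] by simp
    show "lmat vv l (es t) (vv l' (src (es t)) - 1) (n + (vv l' (src (es (Suc t))) - 1)) \<noteq> 0"
      "lmat vv l (es t) (n + (vv l' (src (es (Suc t))) - 1)) (vv l' (src (es t)) - 1) \<noteq> 0"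
      using l' unfolding lmat_def es[symmetric] by auto
  next
    fix i t assume i: "i < n"
    show "is_target n (lmat vv l (es t)) (rk (src (es (Suc t)))) i (T l (es t) i)"
      using T_target[OF es_A i] by (simp add: es)
    \<comment> \<open>A thread may start in the middle of a round. The next full round starts at
      time \<open>c * N\<close>, and it kills whatever thread is still alive.\<close>
    define c where "c = Suc (t div N)"
    have c: "t \<le> c * N" using p(2) by (simp add: c_def dividend_less_div_times order_less_imp_le)
    have "[t..<c * N + N] = [t..<c * N] @ [c * N..<c * N + N]"
      using c by (metis le_add1 upt_add_eq_append ordered_cancel_comm_monoid_diff_class.add_diff_inverse)
    moreover have "trun p (trun (map es [t..<c * N]) (Some i)) = None"
      using kill trun_less[OF path_es[of t "c * N - t"] i] c by auto
    ultimately have "tok t i (c * N + N - t) = None" using c by (simp add: tok_def block)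
    then show "\<exists>d. tok t i d = None" by blast
  next
    fix t i d
    show "tok t i 0 = Some i" by (simp add: tok_def)
    show "tok t i (Suc d) = (case tok t i d of None \<Rightarrow> None | Some x \<Rightarrow>
        if (\<exists>l'<l. rk (src (es (t + d))) x = rk (src (es (t + d))) (vv l' (src (es (t + d))) - 1)) \<or>
          T l (es (t + d)) x = 0 then None else Some (T l (es (t + d)) x - 1))"
      by (auto simp: tok_def tstep_def fixed_def split: option.splits)
  qed
  \<comment> \<open>\<open>lmat\<close> only adds constraints to \<open>m0\<close>, so the valuation
    also satisfies the arcs themselves, which contradicts \<open>norun\<close>.\<close>
  have "sat lex_nat n (m0 (es t)) (D.value_at t) (D.value_at (Suc t))" for t
    using D.sat_value[of t] unfolding sat_def Let_def lmat_def by fastforce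
  moreover have "es t < E" for t using A_less[OF es_A] .
  ultimately show False using norun es by blast
qed

text \<open>The highest target of a safe variable is safe, so it ranks at least as high as the
  lowest safe variable of the target node. Hence each chosen variable bounds the next one along the
  arc.\<close>

lemma vv_nonzero:
  assumes e: "e \<in> A"
  shows "vv l (src e) \<noteq> 0" "vv l (dst e) \<noteq> 0"
    "der (2*n) (lmat vv l e) False (vv l (src e) - 1) (n + (vv l (dst e) - 1))"
    "\<not> fixed vv l (src e) (vv l (src e) - 1)"
proof -
  have V: "src e < V" "dst e < V" "e < E" using ends A_less[OF e] by auto
  have *: "vv l q \<noteq> 0 \<and> vv l q \<le> n \<and> \<not> uns q (vv l q - 1) \<and>
    (\<forall>j<n. \<not> uns q j \<longrightarrow> rk q (vv l q - 1) \<le> rk q j)" if "q < V" "\<exists>i<n. \<not> uns q i" for q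
    using level'[OF l] that by blast
  note s = *[OF V(1) safe_exists[OF e]]
  have i: "vv l (src e) - 1 < n" using s by auto
  note t = safe_step[OF e i]
  have d: "\<exists>i<n. \<not> uns (dst e) i" using t s by blast
  note d = *[OF V(2) d]
  show "vv l (src e) \<noteq> 0" "vv l (dst e) \<noteq> 0" using s d by auto
  show "\<not> fixed vv l (src e) (vv l (src e) - 1)" using s i V unsafe.fixed by metis
  let ?t = "T l e (vv l (src e) - 1)"
  have 1: "der (2*n) (lmat vv l e) False (vv l (src e) - 1) (n + (?t - 1))"
    using T_target[OF e i] t s by (auto simp: is_target_def)
  have rkle: "rk (dst e) (vv l (dst e) - 1) \<le> rk (dst e) (?t - 1)" using d t s by blast
  have lt: "?t - 1 < n" "vv l (dst e) - 1 < n" using d t s by linarith+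
  then have "m0 e (n + (?t - 1)) (n + (vv l (dst e) - 1)) \<noteq> 0"
    using rank0(2)[OF V(3)] rkle unfolding ranked_def by blast
  then have "lmat vv l e (n + (?t - 1)) (n + (vv l (dst e) - 1)) \<noteq> 0"
    unfolding lmat_def by linarith
  then have "der (2*n) (lmat vv l e) False (n + (?t - 1)) (n + (vv l (dst e) - 1))"
    using lt by (intro der.base) simp_all
  from der.trans[OF 1 this]
  show "der (2*n) (lmat vv l e) False (vv l (src e) - 1) (n + (vv l (dst e) - 1))" by simp
qed

end

text \<open>An arc that survives level \<open>n\<close> would give its source node
  \<open>n + 1\<close> different variables, since a chosen variable is never in the class of an
  earlier choice.\<close>

lemma As_last: "As (Suc n) = {}"
proof (rule ccontr)
  assume "As (Suc n) \<noteq> {}"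
  then obtain e where e: "e \<in> As (Suc n)" by auto
  have e': "e \<in> As (Suc l)" if "l \<le> n" for l
    using that
  proof (induction rule: inc_induct)
    case (step m)
    then show ?case using As_Suc[of "Suc m"] by auto
  qed (rule e)
  let ?f = "\<lambda>l. vv l (src e) - 1"
  have "inj_on ?f {..n}"
  proof (rule linorder_inj_onI')
    fix i j assume "i \<in> {..n}" "j \<in> {..n}" "i < j"
    then show "?f i \<noteq> ?f j" using vv_nonzero(4)[OF _ e', of j] by (auto simp: fixed_def)
  qed
  moreover have "?f ` {..n} \<subseteq> {..<n}" using vv_less ends A_less[OF _ e'] by auto
  ultimately have "card {..n} \<le> card {..<n}" by (metis card_inj_on_le finite_lessThan)
  then show False by simp
qed

text \<open>At each level the integer drops, or the arc remains and the chosen variable drops, or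
  the variable keeps its value; then the transition also satisfies the constraints added for the
  next level.\<close>

theorem vector_decreases:
  assumes wo: "Well_order r"
  shows "l \<le> n \<Longrightarrow> e \<in> As l \<Longrightarrow> sat r n (lmat vv l e) (\<lambda>i. \<sigma> (Suc i)) (\<lambda>i. \<sigma>' (Suc i)) \<Longrightarrow>
    (val \<sigma>' (vector_from cp vv (Suc n - l) l (dst e)), val \<sigma> (vector_from cp vv (Suc n - l) l (src e)))
      \<in> lexord (entry_less r)"
proof (induction "n - l" arbitrary: l)
  case (0 l)
  have [simp]: "l = n" using 0 by simp
  have "consistent (2*n) (lmat vv l e)"
    unfolding consistent_def using der_sat[OF _ 0(4) wo] by fastforce
  \<comment> \<open>No arc survives level \<open>n\<close>, so equal component numbers are
    impossible here.\<close>
  then have "cp l (dst e) \<le> cp l (src e) \<and> cp l (dst e) \<noteq> cp l (src e)"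
    using level'[of l] 0 As_last by auto
  then show ?case by (simp add: val_def entry_less_def)
next
  case (Suc d l)
  have "consistent (2*n) (lmat vv l e)"
    unfolding consistent_def using der_sat[OF _ Suc.prems(3) wo] by fastforce
  then have c: "cp l (dst e) \<le> cp l (src e)" "cp l (dst e) = cp l (src e) \<Longrightarrow> e \<in> As (Suc l)"
    using level'[of l] Suc.prems by auto
  have f: "Suc n - l = Suc (Suc n - Suc l)" using Suc by simp
  show ?case
  proof (cases "cp l (dst e) = cp l (src e)")
    case False
    then show ?thesis unfolding f using c by (simp add: val_def entry_less_def)
  next
    case True
    note v = vv_nonzero[OF Suc.prems(1) c(2)[OF True]]
    have ve: "vv l (src e) - 1 < n" "vv l (dst e) - 1 < n"
      using vv_less Suc.prems ends As_E[of l] by auto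
    have sv: "Suc (vv l (src e) - 1) = vv l (src e)" "Suc (vv l (dst e) - 1) = vv l (dst e)"
      using v(1,2) by auto
    have le: "(\<sigma>' (vv l (dst e)), \<sigma> (vv l (src e))) \<in> r"
    proof -
      obtain i j where "vv l (src e) = Suc i" "vv l (dst e) = Suc j" using sv by metis
      then show ?thesis using der_sat[OF v(3) Suc.prems(3) wo] ve by simp
    qed
    have "(val \<sigma>' (vector_from cp vv (Suc n - Suc l) (Suc l) (dst e)),
        val \<sigma> (vector_from cp vv (Suc n - Suc l) (Suc l) (src e))) \<in> lexord (entry_less r)"
      if eq: "\<sigma>' (vv l (dst e)) = \<sigma> (vv l (src e))"
    proof (rule Suc.hyps(1))
      show "d = n - Suc l" "Suc l \<le> n" "e \<in> As (Suc l)" using Suc.hyps(2) c(2)[OF True] by auto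
      show "sat r n (lmat vv (Suc l) e) (\<lambda>i. \<sigma> (Suc i)) (\<lambda>i. \<sigma>' (Suc i))"
        unfolding sat_def Let_def
      proof (intro allI impI conjI)
        let ?x = "\<lambda>u. if u < n then \<sigma> (Suc u) else \<sigma>' (Suc (u - n))"
        fix u w assume uw: "u < 2 * n" "w < 2 * n"
        have s: "lmat vv l e u w \<noteq> 0 \<longrightarrow> (?x w, ?x u) \<in> r" "2 \<le> lmat vv l e u w \<longrightarrow> ?x w \<noteq> ?x u"
          using Suc.prems(3) uw by (auto simp: sat_def Let_def)
        { assume "2 \<le> lmat vv (Suc l) e u w"
          then have "2 \<le> lmat vv l e u w" by (simp add: lmat_Suc le_max_iff_disj split: if_splits)
          then show "?x w \<noteq> ?x u" using s(2) by blast }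
        assume "lmat vv (Suc l) e u w \<noteq> 0"
        then have "lmat vv l e u w \<noteq> 0 \<or> u = vv l (src e) - 1 \<and> w = n + (vv l (dst e) - 1) \<or>
          u = n + (vv l (dst e) - 1) \<and> w = vv l (src e) - 1"
          by (simp add: lmat_Suc split: if_splits)
        then show "(?x w, ?x u) \<in> r" using s(1) le eq ve sv by auto
      qed
    qed
    then show ?thesis unfolding f using True v(1,2) le by (auto simp: val_def entry_less_def)
  qed
qed

end

section \<open>Depth-first search\<close>

locale dfs_graph =
  fixes N :: nat and adj :: "nat \<Rightarrow> nat list" and roots :: "nat list"
  assumes adj: "u < N \<Longrightarrow> v \<in> set (adj u) \<Longrightarrow> v < N"
    and roots: "set roots \<subseteq> {..<N}"
begin

definition edges :: "nat rel" where
  "edges = {(u, v). u < N \<and> v \<in> set (adj u)}"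

text \<open>\<open>post\<close> lists the finished nodes in the order of completion, \<open>stk\<close> the active ones (the
  innermost first), and \<open>rem u\<close> the unexplored successors of \<open>u\<close>. The nodes reached from the
  \<open>r\<close>-th root (counted from 1) are labelled \<open>r\<close>. In the order \<open>post @ stk\<close>, in which the nodes
  met so far will be completed, the last node reachable from \<open>u\<close> reaches \<open>u\<close>.\<close>

definition forefathers :: "nat list \<Rightarrow> bool" where
  "forefathers zs \<longleftrightarrow> (\<forall>u\<in>set zs. \<exists>xs v ys. zs = xs @ v # ys \<and>
     (u, v) \<in> edges\<^sup>* \<and> (v, u) \<in> edges\<^sup>* \<and> (\<forall>y\<in>set ys. (u, y) \<notin> edges\<^sup>*))"

text \<open>The labels of explored successors are at most \<open>lab u\<close>, because a node met
  while \<open>u\<close> is active has been reached from the same root or an earlier one. This is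
  what makes the labels usable as component numbers that never increase along arcs.\<close>

definition dinv :: "nat \<Rightarrow> nat list \<Rightarrow> nat list \<Rightarrow> (nat \<Rightarrow> nat list) \<Rightarrow> (nat \<Rightarrow> nat) \<Rightarrow> bool" where
  "dinv c post stk rem lab \<longleftrightarrow>
     c \<le> length roots \<and> distinct (post @ stk) \<and> set (post @ stk) = {v. v < N \<and> lab v \<noteq> 0} \<and>
     (\<forall>u\<in>set post. rem u = []) \<and>
     (\<forall>u<N. \<exists>seen. adj u = seen @ rem u \<and> (\<forall>v\<in>set seen. 0 < lab v \<and> lab v \<le> lab u)) \<and>
     sorted_wrt (\<lambda>a b. (b, a) \<in> edges\<^sup>*) stk \<and>
     forefathers (post @ stk) \<and>
     (\<forall>u<N. lab u \<noteq> 0 \<longrightarrow> lab u \<le> c \<and> (roots ! (lab u - 1), u) \<in> edges\<^sup>*) \<and>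
     (\<forall>u\<in>set stk. lab u = c) \<and>
     (\<forall>j<c. 0 < lab (roots ! j) \<and> lab (roots ! j) \<le> Suc j)"

text \<open>A visit moves a node from the unlabelled ones to the stack and is paid for by the edge
  that it uses up; finishing a node shortens the stack. Starting a root is free here and is charged
  to the root counter in \<open>dfs_potential\<close>.\<close>

definition potential :: "nat list \<Rightarrow> (nat \<Rightarrow> nat list) \<Rightarrow> (nat \<Rightarrow> nat) \<Rightarrow> nat" where
  "potential stk rem lab = (\<Sum>v<N. length (rem v)) + card {v. v < N \<and> lab v = 0} + length stk"

lemma sum_shrink:
  assumes "u < N" "rem u = v # vs"
  shows "(\<Sum>x<N. length ((rem(u := vs)) x)) < (\<Sum>x<N. length (rem x))"
  by (rule sum_strict_mono_ex1) (use assms in \<open>auto intro!: bexI[of _ u]\<close>)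

lemma dinv_init: "(\<And>v. v < N \<Longrightarrow> lab v = 0) \<Longrightarrow> (\<And>v. v < N \<Longrightarrow> rem v = adj v) \<Longrightarrow> dinv 0 [] [] rem lab"
  by (auto simp: dinv_def forefathers_def)

text \<open>All successors of a finished node have been met, so a path from \<open>u\<close> can
  leave the finished nodes only through an active one.\<close>

lemma closed_post:
  assumes d: "dinv c post stk rem lab" and u: "u \<in> set post"
    and no: "\<And>y. y \<in> set stk \<Longrightarrow> (u, y) \<notin> edges\<^sup>*" and x: "(u, x) \<in> edges\<^sup>*"
  shows "x \<in> set post"
  using x
proof (induction rule: rtrancl_induct)
  case base
  show ?case by (rule u)
next
  case (step y z)
  then have y: "y < N" "rem y = []" "z \<in> set (adj y)" using d by (auto simp: dinv_def edges_def)
  obtain seen where "adj y = seen @ rem y" "\<forall>v\<in>set seen. 0 < lab v"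
    using d y(1) unfolding dinv_def by metis
  then have "lab z \<noteq> 0" using y by auto
  then have "z \<in> set (post @ stk)" using d adj[OF y(1,3)] by (auto simp: dinv_def)
  moreover have "(u, z) \<in> edges\<^sup>*" using step by auto
  ultimately show ?case using no by auto
qed

lemma dinv_finish:
  assumes "dinv c post (u # stk) rem lab" "rem u = []"
  shows "dinv c (post @ [u]) stk rem lab" "potential stk rem lab < potential (u # stk) rem lab"
  using assms by (auto simp: dinv_def potential_def)

lemma dinv_skip:
  assumes d: "dinv c post (u # stk) rem lab" and r: "rem u = v # vs" and v: "lab v \<noteq> 0"
  shows "dinv c post (u # stk) (rem(u := vs)) lab"
    "potential (u # stk) (rem(u := vs)) lab < potential (u # stk) rem lab"
proof -
  have uN: "u < N" "lab u = c" "u \<notin> set post" using d by (auto simp: dinv_def)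
  obtain seen where s: "adj u = seen @ rem u" "\<forall>v\<in>set seen. 0 < lab v \<and> lab v \<le> lab u"
    using d uN unfolding dinv_def by metis
  have "v < N" using adj[OF uN(1), of v] s r by simp
  then have "lab v \<le> lab u" using d v uN(2) by (simp add: dinv_def)
  then have seen: "\<exists>seen. adj u = seen @ vs \<and> (\<forall>v\<in>set seen. 0 < lab v \<and> lab v \<le> lab u)"
    using s r v by (intro exI[of _ "seen @ [v]"]) auto
  have rm: "\<forall>x\<in>set post. (rem(u := vs)) x = []" using d uN(3) unfolding dinv_def by auto
  have "\<forall>y<N. \<exists>seen. adj y = seen @ (rem(u := vs)) y \<and> (\<forall>x\<in>set seen. 0 < lab x \<and> lab x \<le> lab y)"
  proof (intro allI impI)
    fix y assume "y < N"
    then show "\<exists>seen. adj y = seen @ (rem(u := vs)) y \<and> (\<forall>x\<in>set seen. 0 < lab x \<and> lab x \<le> lab y)"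
      using d seen unfolding dinv_def by (cases "y = u") simp_all
  qed
  with rm show "dinv c post (u # stk) (rem(u := vs)) lab" using d unfolding dinv_def by blast
  show "potential (u # stk) (rem(u := vs)) lab < potential (u # stk) rem lab"
    unfolding potential_def using sum_shrink[where u = u and rem = rem and v = v and vs = vs, OF uN(1) r] by simp
qed

text \<open>Covers both ways to start a node: as a successor of the innermost active node, with
  \<open>c' = c\<close>, and as the next root on an empty stack, with
  \<open>c' = Suc c\<close>.\<close>

lemma dinv_push:
  assumes d: "dinv c post stk rem lab" and v: "v < N" "lab v = 0"
    and reach: "\<And>x. x \<in> set stk \<Longrightarrow> (x, v) \<in> edges\<^sup>*" and root: "(roots ! (c' - 1), v) \<in> edges\<^sup>*"
    and c': "c \<le> c'" "0 < c'" "c' \<le> length roots" "stk = [] \<or> c' = c"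
    and j: "\<And>j. c \<le> j \<Longrightarrow> j < c' \<Longrightarrow> j = c \<and> roots ! j = v"
  shows "dinv c' post (v # stk) rem (lab(v := c'))"
proof -
  let ?Z = "post @ v # stk"
  have vZ: "v \<notin> set (post @ stk)" using d v unfolding dinv_def by blast
  have remv: "rem v = adj v"
  proof -
    obtain seen where s: "adj v = seen @ rem v" "\<forall>x\<in>set seen. 0 < lab x \<and> lab x \<le> lab v"
      using d v(1) unfolding dinv_def by metis
    then have "seen = []" using v(2) by (cases seen) auto
    then show ?thesis using s by simp
  qed
  have "\<exists>seen. adj u = seen @ rem u \<and> (\<forall>x\<in>set seen. 0 < (lab(v := c')) x \<and> (lab(v := c')) x \<le> (lab(v := c')) u)"
    if uN: "u < N" for u
  proof (cases "u = v")
    case True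
    then show ?thesis using remv by (intro exI[of _ "[]"]) simp
  next
    case False
    obtain seen where s: "adj u = seen @ rem u" "\<forall>x\<in>set seen. 0 < lab x \<and> lab x \<le> lab u"
      using d uN unfolding dinv_def by metis
    have "v \<notin> set seen" using s(2) v(2) by auto
    then show ?thesis using s False by auto
  qed
  moreover have "forefathers ?Z"
    unfolding forefathers_def
  proof
    fix u assume u: "u \<in> set ?Z"
    show "\<exists>xs w ys. ?Z = xs @ w # ys \<and> (u, w) \<in> edges\<^sup>* \<and> (w, u) \<in> edges\<^sup>* \<and>
      (\<forall>y\<in>set ys. (u, y) \<notin> edges\<^sup>*)"
  proof (cases "u = v")
    case True
    \<comment> \<open>All active nodes reach \<open>v\<close>, so the outermost of them that
      \<open>v\<close> reaches is in the same component and will be completed last.\<close>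
    have "\<exists>x\<in>set (v # stk). (v, x) \<in> edges\<^sup>*" by auto
    from split_list_last_prop[OF this] obtain ys x zs where
      x: "v # stk = ys @ x # zs" "(v, x) \<in> edges\<^sup>*" "\<forall>z\<in>set zs. (v, z) \<notin> edges\<^sup>*" by blast
    have "x \<in> set (v # stk)" using x(1) by simp
    then have "(x, v) \<in> edges\<^sup>*" using reach by auto
    then show ?thesis using x True by (intro exI[of _ "post @ ys"] exI[of _ x] exI[of _ zs]) auto
  next
    case False
    then have "u \<in> set (post @ stk)" using u by auto
    then obtain xs w ys where w: "post @ stk = xs @ w # ys" "(u, w) \<in> edges\<^sup>*" "(w, u) \<in> edges\<^sup>*"
      "\<forall>y\<in>set ys. (u, y) \<notin> edges\<^sup>*" using d unfolding dinv_def forefathers_def by blast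
    show ?thesis
    proof (cases "length post \<le> length xs")
      case True
      then obtain xs' where "xs = post @ xs'" "stk = xs' @ w # ys"
        using w(1) by (auto simp: append_eq_append_conv2)
      then show ?thesis using w by (intro exI[of _ "post @ v # xs'"] exI[of _ w] exI[of _ ys]) auto
    next
      case False
      then obtain ys' where ys': "post = xs @ w # ys'" "ys = ys' @ stk"
        using w(1) by (auto simp: append_eq_append_conv2 append_eq_Cons_conv)
      \<comment> \<open>The witness for \<open>u\<close> is already finished, so \<open>u\<close>
        reaches no active node; by \<open>closed_post\<close> it does not reach the new node
        \<open>v\<close> either, and \<open>v\<close> may be put behind the witness.\<close>
      have "\<And>y. y \<in> set stk \<Longrightarrow> (u, y) \<notin> edges\<^sup>*" using w(4) ys' by auto
      moreover from this have "u \<in> set post" using \<open>u \<in> set (post @ stk)\<close> by auto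
      ultimately have "(u, v) \<notin> edges\<^sup>*" using closed_post[OF d, of u v] vZ by auto
      then show ?thesis using w ys' by (intro exI[of _ xs] exI[of _ w] exI[of _ "ys' @ v # stk"]) auto
    qed
  qed
  qed
  moreover have "distinct ?Z" "set ?Z = {x. x < N \<and> (lab(v := c')) x \<noteq> 0}"
  proof -
    have "distinct (post @ stk)" "set (post @ stk) = {x. x < N \<and> lab x \<noteq> 0}"
      using d unfolding dinv_def by blast+
    then show "set ?Z = {x. x < N \<and> (lab(v := c')) x \<noteq> 0}" using v(1) c'(2) by auto
    show "distinct ?Z" using \<open>distinct (post @ stk)\<close> vZ by auto
  qed
  moreover have "c' \<le> length roots" by (rule c'(3))
  moreover have "\<forall>u\<in>set post. rem u = []" "sorted_wrt (\<lambda>a b. (b, a) \<in> edges\<^sup>*) (v # stk)"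
    using d reach unfolding dinv_def by auto
  moreover have "\<forall>u<N. (lab(v := c')) u \<noteq> 0 \<longrightarrow> (lab(v := c')) u \<le> c' \<and>
      (roots ! ((lab(v := c')) u - 1), u) \<in> edges\<^sup>*"
  proof (intro allI impI)
    fix u assume u: "u < N" "(lab(v := c')) u \<noteq> 0"
    show "(lab(v := c')) u \<le> c' \<and> (roots ! ((lab(v := c')) u - 1), u) \<in> edges\<^sup>*"
    proof (cases "u = v")
      case False
      then have "lab u \<le> c \<and> (roots ! (lab u - 1), u) \<in> edges\<^sup>*" using d u unfolding dinv_def by simp
      then show ?thesis using False c'(1) by simp
    qed (use root in simp)
  qed
  moreover have "\<forall>u\<in>set (v # stk). (lab(v := c')) u = c'"
    using d c'(4) unfolding dinv_def by auto
  moreover have "\<forall>i<c'. 0 < (lab(v := c')) (roots ! i) \<and> (lab(v := c')) (roots ! i) \<le> Suc i"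
  proof (intro allI impI)
    fix i assume i: "i < c'"
    show "0 < (lab(v := c')) (roots ! i) \<and> (lab(v := c')) (roots ! i) \<le> Suc i"
    proof (cases "i < c")
      case True
      then have "0 < lab (roots ! i) \<and> lab (roots ! i) \<le> Suc i" using d unfolding dinv_def by blast
      then show ?thesis using v(2) by auto
    next
      case False
      then have "i = c" "roots ! i = v" using j[of i] i by auto
      moreover have "c' - 1 = c" using j[of "c' - 1"] i False by simp
      ultimately show ?thesis using c' by simp
    qed
  qed
  ultimately show ?thesis unfolding dinv_def by blast
qed

lemma dinv_visit:
  assumes d: "dinv c post (u # stk) rem lab" and r: "rem u = v # vs" and v: "lab v = 0"
  shows "dinv c post (v # u # stk) (rem(u := vs)) (lab(v := c))"
    "potential (v # u # stk) (rem(u := vs)) (lab(v := c)) < potential (u # stk) rem lab"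
proof -
  have uN: "u < N" "lab u = c" "u \<notin> set post" "c \<le> length roots" using d by (auto simp: dinv_def)
  obtain seen where s: "adj u = seen @ rem u" "\<forall>v\<in>set seen. 0 < lab v \<and> lab v \<le> lab u"
    using d uN unfolding dinv_def by metis
  have vN: "v < N" "(u, v) \<in> edges" using adj[OF uN(1), of v] s r uN by (auto simp: edges_def)
  have c: "0 < c" "(roots ! (c - 1), u) \<in> edges\<^sup>*" using d uN unfolding dinv_def by auto
  have "\<And>x. x \<in> set stk \<Longrightarrow> (x, u) \<in> edges\<^sup>*" using d by (simp add: dinv_def)
  then have "dinv c post (v # u # stk) rem (lab(v := c))"
    using vN c uN(4) by (intro dinv_push[OF d vN(1) v]) (auto intro: rtrancl_into_rtrancl)
  moreover have "v \<noteq> u" using v uN(2) c by auto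
  ultimately show "dinv c post (v # u # stk) (rem(u := vs)) (lab(v := c))"
  proof -
    let ?l = "lab(v := c)"
    assume a: "dinv c post (v # u # stk) rem ?l" "v \<noteq> u"
    have lu: "?l u = c" "?l v = c" using a(2) uN(2) by auto
    have "\<forall>x\<in>set seen. 0 < ?l x \<and> ?l x \<le> ?l u" using s(2) lu c uN(2) by auto
    then have seen: "\<exists>seen. adj u = seen @ vs \<and> (\<forall>x\<in>set seen. 0 < ?l x \<and> ?l x \<le> ?l u)"
      using s(1) r lu c by (intro exI[of _ "seen @ [v]"]) auto
    have rm: "\<forall>x\<in>set post. (rem(u := vs)) x = []" using a(1) uN(3) unfolding dinv_def by auto
    have "\<forall>y<N. \<exists>seen. adj y = seen @ (rem(u := vs)) y \<and> (\<forall>x\<in>set seen. 0 < ?l x \<and> ?l x \<le> ?l y)"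
    proof (intro allI impI)
      fix y assume "y < N"
      then show "\<exists>seen. adj y = seen @ (rem(u := vs)) y \<and> (\<forall>x\<in>set seen. 0 < ?l x \<and> ?l x \<le> ?l y)"
      proof (cases "y = u")
        case False
        then have "(rem(u := vs)) y = rem y" by simp
        then show ?thesis using a(1) \<open>y < N\<close> unfolding dinv_def by metis
      qed (use seen in simp)
    qed
    with rm show ?thesis using a(1) unfolding dinv_def by blast
  qed
  have "{x. x < N \<and> lab x = 0} = insert v {x. x < N \<and> (lab(v := c)) x = 0}"
    using vN v c by auto
  then have "card {x. x < N \<and> lab x = 0} = Suc (card {x. x < N \<and> (lab(v := c)) x = 0})"
    using c by simp
  moreover have "(\<Sum>x<N. length ((rem(u := vs)) x)) < (\<Sum>x<N. length (rem x))"
    by (rule sum_shrink[where u = u and rem = rem and v = v and vs = vs, OF uN(1) r])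
  ultimately show "potential (v # u # stk) (rem(u := vs)) (lab(v := c)) < potential (u # stk) rem lab"
    unfolding potential_def by simp
qed

lemma dinv_root:
  assumes d: "dinv c post [] rem lab" and c: "c < length roots"
  shows "lab (roots ! c) \<noteq> 0 \<Longrightarrow> dinv (Suc c) post [] rem lab"
    "lab (roots ! c) = 0 \<Longrightarrow> dinv (Suc c) post [roots ! c] rem (lab(roots ! c := Suc c))"
    "lab (roots ! c) = 0 \<Longrightarrow>
      potential [roots ! c] rem (lab(roots ! c := Suc c)) \<le> potential [] rem lab"
proof -
  have r: "roots ! c < N" using roots c by (meson lessThan_iff nth_mem subsetD)
  show "lab (roots ! c) \<noteq> 0 \<Longrightarrow> dinv (Suc c) post [] rem lab"
    using d c r unfolding dinv_def by (auto simp: less_Suc_eq le_SucI)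
  show "lab (roots ! c) = 0 \<Longrightarrow> dinv (Suc c) post [roots ! c] rem (lab(roots ! c := Suc c))"
    using d c r by (intro dinv_push) (auto simp: le_less_Suc_eq)
  assume z: "lab (roots ! c) = 0"
  let ?l = "lab(roots ! c := Suc c)"
  have "{x. x < N \<and> lab x = 0} = insert (roots ! c) {x. x < N \<and> ?l x = 0}" using r z by auto
  then have "card {x. x < N \<and> lab x = 0} = Suc (card {x. x < N \<and> ?l x = 0})" by simp
  then show "potential [roots ! c] rem ?l \<le> potential [] rem lab" by (simp add: potential_def)
qed

definition dfs_result :: "nat list \<Rightarrow> (nat \<Rightarrow> nat) \<Rightarrow> bool" where
  "dfs_result post lab \<longleftrightarrow>
     distinct post \<and> set post = {v. v < N \<and> lab v \<noteq> 0} \<and>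
     (\<forall>u<N. \<forall>v. lab u \<noteq> 0 \<longrightarrow> (u, v) \<in> edges\<^sup>* \<longrightarrow> 0 < lab v \<and> lab v \<le> lab u) \<and>
     forefathers post \<and>
     (\<forall>u<N. lab u \<noteq> 0 \<longrightarrow> lab u \<le> length roots \<and> (roots ! (lab u - 1), u) \<in> edges\<^sup>*) \<and>
     (\<forall>j<length roots. 0 < lab (roots ! j) \<and> lab (roots ! j) \<le> Suc j)"

lemma dinv_result:
  assumes d: "dinv (length roots) post [] rem lab"
  shows "dfs_result post lab"
proof -
  have "0 < lab v \<and> lab v \<le> lab u" if "u < N" "lab u \<noteq> 0" "(u, v) \<in> edges\<^sup>*" for u v
    using that(3)
  proof (induction rule: rtrancl_induct)
    case (step y z)
    have yN: "y < N" "z \<in> set (adj y)" using step by (auto simp: edges_def)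
    then have "y \<in> set post" using d step by (auto simp: dinv_def)
    then have "rem y = []" using d by (auto simp: dinv_def)
    moreover obtain seen where "adj y = seen @ rem y" "\<forall>v\<in>set seen. 0 < lab v \<and> lab v \<le> lab y"
      using d yN unfolding dinv_def by metis
    ultimately have "0 < lab z \<and> lab z \<le> lab y" using yN by auto
    then show ?case using step by auto
  qed (use that in simp)
  then show ?thesis using d unfolding dinv_def dfs_result_def by auto
qed

end

text \<open>Kosaraju's algorithm: searching the graph with the nodes in reverse order of completion in
  the reversed graph as roots yields the strongly connected components, the sinks first.\<close>

lemma kosaraju:
  assumes "dfs_graph N adj' [0..<N]" "dfs_graph N adj roots"
    and rev: "dfs_graph.edges N adj' = (dfs_graph.edges N adj)\<inverse>"
    and r1: "dfs_graph.dfs_result N adj' [0..<N] post lab'"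
    and r2: "dfs_graph.dfs_result N adj roots post2 lab" and roots: "roots = rev post"
    and u: "u < N" "v < N" "lab u = lab v"
  shows "lab u \<noteq> 0" "(u, v) \<in> (dfs_graph.edges N adj)\<^sup>*"
proof -
  interpret G': dfs_graph N adj' "[0..<N]" by fact
  interpret G: dfs_graph N adj roots by fact
  have rev': "(x, y) \<in> G'.edges\<^sup>* \<longleftrightarrow> (y, x) \<in> G.edges\<^sup>*" for x y
    by (simp add: rev rtrancl_converse)
  have post: "set post = {..<N}" using r1 unfolding G'.dfs_result_def by force
  have nz: "lab x \<noteq> 0" if "x < N" for x
  proof -
    have "x \<in> set roots" using post roots that by simp
    then obtain j where "j < length roots" "roots ! j = x" by (meson in_set_conv_nth)
    then show ?thesis using r2 unfolding G.dfs_result_def by auto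
  qed
  show "lab u \<noteq> 0" by (rule nz[OF u(1)])
  have root: "lab x \<le> length roots" "(roots ! (lab x - 1), x) \<in> G.edges\<^sup>*" if "x < N" for x
    using r2 nz[OF that] that unfolding G.dfs_result_def by auto
  have to_root: "(x, roots ! (lab x - 1)) \<in> G.edges\<^sup>*" if x: "x < N" for x
  proof -
    let ?i = "lab x - 1"
    have i: "?i < length roots" using root(1)[OF x] nz[OF x] by simp
    \<comment> \<open>\<open>w\<close> is the last node in completion order that reaches
      \<open>x\<close>, and it stands at position \<open>length ys\<close> among the roots. The root
      of \<open>x\<close> reaches \<open>x\<close>, so it stands no earlier; as \<open>w\<close>
      also reaches \<open>x\<close>, it stands no later. So \<open>w\<close> is the root of
      \<open>x\<close>.\<close>
    obtain xs w ys where w: "post = xs @ w # ys" "(x, w) \<in> G'.edges\<^sup>*" "(w, x) \<in> G'.edges\<^sup>*"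
      "\<forall>y\<in>set ys. (x, y) \<notin> G'.edges\<^sup>*"
      using r1 x post unfolding G'.dfs_result_def G'.forefathers_def by blast
    have rt: "roots = rev ys @ w # rev xs" using roots w(1) by simp
    have "roots ! ?i \<notin> set ys" using w(4) root(2)[OF x] rev' by blast
    then have le: "length ys \<le> ?i" using i rt by (metis in_set_conv_nth length_rev nth_append not_le set_rev)
    have "lab w \<le> Suc (length ys)"
      using r2 rt unfolding G.dfs_result_def by (metis length_append length_rev nth_append_length less_add_same_cancel1 length_Cons zero_less_Suc)
    moreover have "w < N" using post w(1) by auto
    moreover have "lab x \<le> lab w" using r2 rev' w(2) \<open>w < N\<close> nz unfolding G.dfs_result_def by blast
    ultimately have "?i = length ys" using le nz[OF x] by simp
    then have "roots ! ?i = w" using rt by (metis length_rev nth_append_length)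
    then show ?thesis using w(3) rev' by simp
  qed
  show "(u, v) \<in> G.edges\<^sup>*"
    using to_root[OF u(1)] root(2)[OF u(2)] u(3) by simp
qed

text \<open>The successors of the nodes are given by linked lists: \<open>HD v\<close> is the first cell of the list
  of \<open>v\<close>, 0 is the end of a list, and cell \<open>h\<close> has the entry \<open>TG h\<close> and the next cell \<open>NX h\<close>.\<close>

abbreviation (input) HD :: nat where "HD \<equiv> 10"
abbreviation (input) NX :: nat where "NX \<equiv> 11"
abbreviation (input) TG :: nat where "TG \<equiv> 12"
abbreviation (input) LB :: nat where "LB \<equiv> 13"
abbreviation (input) STK :: nat where "STK \<equiv> 14"
abbreviation (input) PO :: nat where "PO \<equiv> 15"
abbreviation (input) RT :: nat where "RT \<equiv> 16"
abbreviation (input) SP :: nat where "SP \<equiv> 17"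
abbreviation (input) PC :: nat where "PC \<equiv> 18"
abbreviation (input) RI :: nat where "RI \<equiv> 19"
abbreviation (input) NR :: nat where "NR \<equiv> 20"
abbreviation (input) X :: nat where "X \<equiv> 21"
abbreviation (input) Y :: nat where "Y \<equiv> 22"

text \<open>The bound \<open>c\<close> on the cells guarantees that writing cell
  \<open>c + 1\<close> leaves the list intact, see \<open>lst_cong\<close>.\<close>

fun lst :: "nat \<Rightarrow> (nat \<Rightarrow> nat) \<Rightarrow> (nat \<Rightarrow> nat) \<Rightarrow> nat \<Rightarrow> nat list \<Rightarrow> bool" where
  "lst c nx tg h [] = (h = 0)"
| "lst c nx tg h (x # xs) = (0 < h \<and> h \<le> c \<and> tg h = x \<and> lst c nx tg (nx h) xs)"

text \<open>The recursion is unrolled with an explicit stack. \<open>HD\<close> doubles as the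
  pointer to the next unexplored successor, so the search consumes the lists. \<open>RI\<close> is
  advanced before a root is labelled, which makes labels start from 1.\<close>

definition dfs_step :: com where
  "dfs_step =
    If (Var SP)
      (Set X (Read STK (Var SP - Const 1)) ;;
       If (Read HD (Var X))
         (Set Y (Read TG (Read HD (Var X))) ;;
          Write HD (Var X) (Read NX (Read HD (Var X))) ;;
          If (Read LB (Var Y)) Skip
            (Write LB (Var Y) (Var RI) ;; Write STK (Var SP) (Var Y) ;; Set SP (Var SP + Const 1)))
         (Write PO (Var PC) (Var X) ;; Set PC (Var PC + Const 1) ;; Set SP (Var SP - Const 1)))
      (Set X (Read RT (Var RI)) ;; Set RI (Var RI + Const 1) ;;
       If (Read LB (Var X)) Skip
         (Write LB (Var X) (Var RI) ;; Write STK (Const 0) (Var X) ;; Set SP (Const 1)))"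

definition dfs :: com where
  "dfs = Set SP (Const 0) ;; Set PC (Const 0) ;; Set RI (Const 0) ;;
     While (Var SP + (Var NR - Var RI)) dfs_step"

lemma mods_dfs_step [simp]: "mods dfs_step = {HD, LB, STK, PO, RI, SP, PC, X, Y}"
  by (auto simp: dfs_step_def)

lemma mods_dfs [simp]: "mods dfs = {HD, LB, STK, PO, RI, SP, PC, X, Y}"
  by (auto simp: dfs_def)

context dfs_graph
begin

definition dfs_state :: "nat \<Rightarrow> nat list \<Rightarrow> nat list \<Rightarrow> (nat \<Rightarrow> nat list) \<Rightarrow> mem \<Rightarrow> bool" where
  "dfs_state c post stk rem M \<longleftrightarrow>
     dinv (M RI 0) post stk rem (M LB) \<and>
     (\<forall>v<N. lst c (M NX) (M TG) (M HD v) (rem v)) \<and>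
     M SP 0 = length stk \<and> (\<forall>i<length stk. M STK i = rev stk ! i) \<and>
     M PC 0 = length post \<and> (\<forall>i<length post. M PO i = post ! i) \<and>
     M NR 0 = length roots \<and> (\<forall>i<length roots. M RT i = roots ! i)"

definition dfs_potential :: "nat list \<Rightarrow> (nat \<Rightarrow> nat list) \<Rightarrow> mem \<Rightarrow> nat" where
  "dfs_potential stk rem M = potential stk rem (M LB) + (length roots - M RI 0)"

lemma dfs_step_correct:
  assumes st: "dfs_state c post stk rem M" and go: "M SP 0 + (M NR 0 - M RI 0) \<noteq> 0"
  shows "\<exists>post' stk' rem'. dfs_state c post' stk' rem' (sem dfs_step M) \<and>
    dfs_potential stk' rem' (sem dfs_step M) < dfs_potential stk rem M"
proof (cases stk)
  case Nil
  note s = st[unfolded dfs_state_def Nil]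
  let ?r = "roots ! M RI 0"
  have lt: "M RI 0 < length roots" using s go by simp
  have d: "dinv (M RI 0) post [] rem (M LB)" using s by simp
  note root = dinv_root[OF d lt]
  have X: "M RT (M RI 0) = ?r" "M SP 0 = 0" using s lt by auto
  show ?thesis
  proof (cases "M LB ?r = 0")
    case True
    then have "dfs_state c post [?r] rem (sem dfs_step M)"
      "dfs_potential [?r] rem (sem dfs_step M) < dfs_potential stk rem M"
      using s X root(2,3) lt by (auto simp: dfs_state_def dfs_step_def dfs_potential_def Nil)
    then show ?thesis by blast
  next
    case False
    then have "dfs_state c post [] rem (sem dfs_step M)"
      "dfs_potential [] rem (sem dfs_step M) < dfs_potential stk rem M"
      using s X root(1) lt by (auto simp: dfs_state_def dfs_step_def dfs_potential_def Nil)
    then show ?thesis by blast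
  qed
next
  case (Cons u stk')
  note s = st[unfolded dfs_state_def Cons]
  have SP: "M SP 0 = Suc (length stk')" "M STK (length stk') = u"
    using s by (auto simp: nth_append)
  have uN: "u < N" using s by (auto simp: dinv_def)
  have STK: "\<forall>i<length stk'. M STK i = rev stk' ! i" using s by (auto simp: nth_append)
  have lu: "lst c (M NX) (M TG) (M HD u) (rem u)" using s uN by blast
  have d: "dinv (M RI 0) post (u # stk') rem (M LB)" using s by simp
  show ?thesis
  proof (cases "rem u")
    case Nil
    then have h: "M HD u = 0" using lu by simp
    have "dfs_state c (post @ [u]) stk' rem (sem dfs_step M)"
      using s SP h STK dinv_finish(1)[OF d Nil] by (auto simp: dfs_state_def dfs_step_def nth_append)
    moreover have "dfs_potential stk' rem (sem dfs_step M) < dfs_potential stk rem M"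
      using dinv_finish(2)[OF d Nil] SP h by (simp add: dfs_potential_def Cons dfs_step_def)
    ultimately show ?thesis by blast
  next
    case vs: (Cons v vs)
    then have h: "M HD u \<noteq> 0" "M TG (M HD u) = v" "lst c (M NX) (M TG) (M NX (M HD u)) vs"
      using lu by auto
    show ?thesis
    proof (cases "M LB v = 0")
      case True
      have "dfs_state c post (v # u # stk') (rem(u := vs)) (sem dfs_step M)"
        using s SP h STK dinv_visit(1)[OF d vs True] True
        by (auto simp: dfs_state_def dfs_step_def nth_append less_Suc_eq)
      moreover have "dfs_potential (v # u # stk') (rem(u := vs)) (sem dfs_step M) < dfs_potential stk rem M"
        using dinv_visit(2)[OF d vs True] SP h True by (simp add: dfs_potential_def Cons dfs_step_def)
      ultimately show ?thesis by blast
    next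
      case False
      have "dfs_state c post (u # stk') (rem(u := vs)) (sem dfs_step M)"
        using s SP h STK dinv_skip(1)[OF d vs False] False
        by (auto simp: dfs_state_def dfs_step_def nth_append less_Suc_eq)
      moreover have "dfs_potential (u # stk') (rem(u := vs)) (sem dfs_step M) < dfs_potential stk rem M"
        using dinv_skip(2)[OF d vs False] SP h False by (simp add: dfs_potential_def Cons dfs_step_def)
      ultimately show ?thesis by blast
    qed
  qed
qed

theorem ho_dfs:
  assumes "\<And>v. v < N \<Longrightarrow> lst c (M NX) (M TG) (M HD v) (adj v)" "\<And>v. v < N \<Longrightarrow> M LB v = 0"
    and "M NR 0 = length roots" "\<And>i. i < length roots \<Longrightarrow> M RT i = roots ! i"
    and b: "10 * ((\<Sum>v<N. length (adj v)) + N + length roots) + 4 \<le> b"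
  shows "ho dfs M b (\<lambda>M'. \<exists>post. dfs_result post (M' LB) \<and> M' PC 0 = length post \<and>
    (\<forall>i<length post. M' PO i = post ! i))" (is "ho dfs M b ?Q")
proof -
  define M1 where "M1 = sem (Set SP (Const 0) ;; Set PC (Const 0) ;; Set RI (Const 0)) M"
  let ?I = "\<lambda>k M'. \<exists>post stk rem. dfs_state c post stk rem M' \<and> dfs_potential stk rem M' = k"
  have "dinv 0 [] [] adj (M LB)" by (rule dinv_init) (use assms in auto)
  then have I0: "dfs_state c [] [] adj M1"
    using assms by (auto simp: dfs_state_def M1_def)
  have k: "dfs_potential [] adj M1 \<le> (\<Sum>v<N. length (adj v)) + N + length roots"
  proof -
    have "card {v. v < N \<and> M LB v = 0} \<le> card {..<N}" by (intro card_mono) auto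
    then show ?thesis by (simp add: dfs_potential_def potential_def M1_def)
  qed
  have "ho (While (Var SP + (Var NR - Var RI)) dfs_step) M1 (dfs_potential [] adj M1 * (9 + 1) + 1) ?Q"
  proof (rule ho_While_ghost[where I = ?I])
    show "?I (dfs_potential [] adj M1) M1" using I0 by blast
  next
    fix k M' assume I: "?I k M'" and e: "eval_exp (Var SP + (Var NR - Var RI)) M' \<noteq> 0"
    then obtain post stk rem where st: "dfs_state c post stk rem M'" "dfs_potential stk rem M' = k" by blast
    have "\<exists>k'<k. ?I k' (sem dfs_step M')" using dfs_step_correct[OF st(1)] e st(2) by force
    then show "ho dfs_step M' 9 (\<lambda>M''. \<exists>k'<k. ?I k' M'')"
      by (intro ho_loop_free) (simp_all add: dfs_step_def)
  next
    fix k M' assume I: "?I k M'" and e: "eval_exp (Var SP + (Var NR - Var RI)) M' = 0"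
    then obtain post stk rem where st: "dfs_state c post stk rem M'" by blast
    then have "M' RI 0 \<le> length roots" "M' SP 0 = length stk" "M' NR 0 = length roots"
      by (auto simp: dfs_state_def dinv_def)
    moreover have "M' SP 0 = 0 \<and> M' NR 0 \<le> M' RI 0" using e by simp
    ultimately have "stk = []" "M' RI 0 = length roots" by simp_all
    then have "dfs_result post (M' LB)" using st dinv_result by (auto simp: dfs_state_def)
    then show "?Q M'" using st unfolding dfs_state_def by blast
  qed simp
  then have "ho (Set SP (Const 0) ;; Set PC (Const 0) ;; Set RI (Const 0) ;;
     While (Var SP + (Var NR - Var RI)) dfs_step) M b ?Q"
    using k b unfolding M1_def
    by (intro ho_Seq_loop_free[OF _ ho_Seq_loop_free[OF _ ho_Seq_loop_free]]) auto
  then show ?thesis by (simp add: dfs_def)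
qed

end

section \<open>Constraint matrices in memory\<close>

text \<open>The ranks of node \<open>q\<close> are in array \<open>RK\<close> from position \<open>QR q\<close> on. \<open>QI q\<close> and \<open>EG e\<close> are the
  positions of the matrices of node \<open>q\<close> and arc \<open>e\<close> in the input, \<open>ES\<close> and \<open>ED\<close> the ends of the
  arcs, \<open>EA\<close> marks the remaining arcs, \<open>MX\<close> is the matrix of the current arc and \<open>TT\<close> has the
  highest bounded target variables. \<open>VV\<close> and \<open>CP\<close> collect the chosen variables and the component
  numbers, from position \<open>q (n + 1)\<close> on for node \<open>q\<close>. As the machine cannot multiply, \<open>TN\<close> is a
  table of the multiples of \<open>n\<close>. Most of the other arrays are scalars, stored at index 0.\<close>

abbreviation (input) RK :: nat where "RK \<equiv> 2"
abbreviation (input) QR :: nat where "QR \<equiv> 3"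
abbreviation (input) QI :: nat where "QI \<equiv> 4"
abbreviation (input) ES :: nat where "ES \<equiv> 5"
abbreviation (input) ED :: nat where "ED \<equiv> 6"
abbreviation (input) EG :: nat where "EG \<equiv> 7"
abbreviation (input) EA :: nat where "EA \<equiv> 8"
abbreviation (input) TN :: nat where "TN \<equiv> 9"
abbreviation (input) TT :: nat where "TT \<equiv> 23"
abbreviation (input) MX :: nat where "MX \<equiv> 24"
abbreviation (input) VV :: nat where "VV \<equiv> 25"
abbreviation (input) CP :: nat where "CP \<equiv> 26"
abbreviation (input) NN :: nat where "NN \<equiv> 27"
abbreviation (input) VN :: nat where "VN \<equiv> 28"
abbreviation (input) EN :: nat where "EN \<equiv> 29"
abbreviation (input) LV :: nat where "LV \<equiv> 30"
abbreviation (input) I :: nat where "I \<equiv> 31"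
abbreviation (input) J :: nat where "J \<equiv> 32"
abbreviation (input) H :: nat where "H \<equiv> 33"
abbreviation (input) EI :: nat where "EI \<equiv> 35"
abbreviation (input) FL :: nat where "FL \<equiv> 37"
abbreviation (input) Q1 :: nat where "Q1 \<equiv> 38"
abbreviation (input) Q2 :: nat where "Q2 \<equiv> 39"
abbreviation (input) A :: nat where "A \<equiv> 40"
abbreviation (input) B :: nat where "B \<equiv> 41"
abbreviation (input) C :: nat where "C \<equiv> 42"
abbreviation (input) NM :: nat where "NM \<equiv> 44"

definition Min2 :: "exp \<Rightarrow> exp" where "Min2 x = x - (x - Const 2)"
definition Max :: "exp \<Rightarrow> exp \<Rightarrow> exp" where "Max x y = x + (y - x)"

lemma eval_Min2 [simp]: "eval_exp (Min2 x) M = min (eval_exp x M) 2"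
  and eval_Max [simp]: "eval_exp (Max x y) M = max (eval_exp x M) (eval_exp y M)"
  by (simp_all add: Min2_def Max_def)

lemma index_less: "(u :: nat) < N' \<Longrightarrow> v < N \<Longrightarrow> u * N + v < N' * N"
  using mult_le_mono1[of "Suc u" N' N] by simp

text \<open>A lexicographic descent in one number: a drop of the first component outweighs a reset
  of the second, which is at most \<open>T\<close>.\<close>

lemma potential_less:
  fixes X Y T a b :: nat
  assumes "Suc Y \<le> X"
  shows "Y * (T + 1) + (T - a) < X * (T + 1) + b"
proof -
  have "Suc Y * (T + 1) \<le> X * (T + 1)" using assms by (rule mult_le_mono1)
  then show ?thesis by simp
qed

lemma index_inj: "(v :: nat) < N \<Longrightarrow> v' < N \<Longrightarrow> u * N + v = u' * N + v' \<longleftrightarrow> u = u' \<and> v = v'"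
  by (metis add_right_cancel add_left_cancel div_mult_self3 div_less add.right_neutral add.commute
      less_nat_zero_code mod_less mod_mult_self3)

definition rank_exp :: "nat \<Rightarrow> exp \<Rightarrow> exp" where
  "rank_exp q i = Read RK (Read QR (Var q) + i)"

text \<open>\<open>Suc (rank i) - rank j\<close>, capped at 2, is the matrix entry of the ordering:
  0, 1 or 2 as the rank of \<open>i\<close> is less than, equal to or greater than that of
  \<open>j\<close>. The maximum adds the invariant of the node.\<close>

definition order_exp :: "nat \<Rightarrow> exp \<Rightarrow> exp \<Rightarrow> exp" where
  "order_exp q i j = Max (Min2 ((rank_exp q i + Const 1) - rank_exp q j))
     (Min2 (Read 0 (Read QI (Var q) + (Read TN i + j))))"

text \<open>A row has length \<open>2 * n\<close>, while the table holds multiples of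
  \<open>n\<close>; hence the argument \<open>i + i\<close>.\<close>

definition cell :: "exp \<Rightarrow> exp \<Rightarrow> exp" where
  "cell i j = Read TN (i + i) + j"

definition base_entry :: com where
  "base_entry =
     Write MX (cell (Var I) (Var J)) (Min2 (Read 0 (Read EG (Var EI) + cell (Var I) (Var J)))) ;;
     If (Var NN - Var I)
       (If (Var NN - Var J)
          (Write MX (cell (Var I) (Var J))
            (Max (Read MX (cell (Var I) (Var J))) (order_exp Q1 (Var I) (Var J)))) Skip)
       (If (Var NN - Var J) Skip
          (Write MX (cell (Var I) (Var J))
            (Max (Read MX (cell (Var I) (Var J))) (order_exp Q2 (Var I - Var NN) (Var J - Var NN)))))"

definition build_base :: com where
  "build_base = For I (Var NM) (For J (Var NM) base_entry)"

definition build_fixed :: com where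
  "build_fixed = For H (Var LV)
    (Set A (Read VV (Read TN (Var Q1) + Var Q1 + Var H) - Const 1) ;;
     Set B (Var NN + (Read VV (Read TN (Var Q2) + Var Q2 + Var H) - Const 1)) ;;
     Write MX (cell (Var A) (Var B)) (Max (Read MX (cell (Var A) (Var B))) (Const 1)) ;;
     Write MX (cell (Var B) (Var A)) (Max (Read MX (cell (Var B) (Var A))) (Const 1)))"

text \<open>The scan over all triples starts again from the beginning after every improvement, so
  everything before the current position is always closed. As an entry improves at most twice, a
  matrix with \<open>N\<close> rows needs at most \<open>2 * N^2\<close> restarts of a scan of
  length \<open>N^3\<close>.\<close>

definition closure_step :: com where
  "closure_step =
    Set A (Read MX (cell (Var I) (Var J))) ;; Set B (Read MX (cell (Var J) (Var H))) ;;
    If (Var A) (If (Var B) (Set C (Max (Var A) (Var B))) (Set C (Const 0))) (Set C (Const 0)) ;;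
    If (Var C - Read MX (cell (Var I) (Var H)))
      (Write MX (cell (Var I) (Var H)) (Var C) ;;
       Set I (Const 0) ;; Set J (Const 0) ;; Set H (Const 0))
      (Set H (Var H + Const 1) ;;
       If (Var NM - Var H) Skip
         (Set H (Const 0) ;; Set J (Var J + Const 1) ;;
          If (Var NM - Var J) Skip (Set J (Const 0) ;; Set I (Var I + Const 1))))"

lemma closure_step_simple: "loop_free closure_step" "steps closure_step \<le> 13"
  by (simp_all add: closure_step_def)

definition closure :: com where
  "closure = Set I (Const 0) ;; Set J (Const 0) ;; Set H (Const 0) ;;
     While (Var NM - Var I) closure_step"

definition check :: com where
  "check = Set FL (Const 1) ;;
     For I (Var NM) (If (Read MX (cell (Var I) (Var I)) - Const 1) (Set FL (Const 0)) Skip)"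

definition target_entry :: com where
  "target_entry =
     If (Read MX (cell (Var I) (Var NN + Var J)))
       (If (Var C)
         (If (rank_exp Q2 (Var J) - rank_exp Q2 (Var C - Const 1)) (Set C (Var J + Const 1)) Skip)
         (Set C (Var J + Const 1)))
       Skip"

definition target_row :: com where
  "target_row = For J (Var NN) target_entry"

definition targets :: com where
  "targets = For I (Var NN)
     (Set C (Const 0) ;; target_row ;; Write TT (Read TN (Var EI) + Var I) (Var C))"

definition arc_body :: com where
  "arc_body = If (Read EA (Var EI))
     (Set Q1 (Read ES (Var EI)) ;; Set Q2 (Read ED (Var EI)) ;;
      build_base ;; build_fixed ;; closure ;; check ;;
      If (Var FL) targets (Write EA (Var EI) (Const 0)))
     Skip"

definition arc_phase :: com where
  "arc_phase = For EI (Var EN) arc_body"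

lemma mods_arc_parts [simp]:
  "mods base_entry = {MX}" "mods build_base = {I, J, MX}" "mods build_fixed = {H, A, B, MX}"
  "mods closure_step = {I, J, H, A, B, C, MX}" "mods closure = {I, J, H, A, B, C, MX}"
  "mods check = {I, FL}" "mods target_row = {J, C}" "mods targets = {I, J, C, TT}"
  "mods arc_body = {Q1, Q2, I, J, H, A, B, C, MX, FL, TT, EA}"
  "mods arc_phase = {EI, Q1, Q2, I, J, H, A, B, C, MX, FL, TT, EA}"
  by (auto simp: base_entry_def build_base_def build_fixed_def closure_def closure_step_def check_def targets_def
      target_row_def target_entry_def
      arc_body_def arc_phase_def)

definition holds_mat :: "nat \<Rightarrow> mem \<Rightarrow> mat \<Rightarrow> bool" where
  "holds_mat N M m \<longleftrightarrow> (\<forall>u<N. \<forall>v<N. M MX (u * N + v) = m u v)"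

text \<open>\<open>g\<close> and \<open>ic\<close> are the codes of arcs and invariants as they
  stand in the input. \<open>L\<close> is the range of the table of multiples.\<close>

locale program_data =
  fixes n V E :: nat and src dst :: "nat \<Rightarrow> nat" and rk :: "nat \<Rightarrow> nat \<Rightarrow> nat"
    and g ic :: "nat \<Rightarrow> mat" and L :: nat
  assumes n1: "1 \<le> n"
    and ends: "e < E \<Longrightarrow> src e < V" "e < E \<Longrightarrow> dst e < V"
    and limit: "4 * n \<le> L" "V \<le> L" "E \<le> L"
begin

text \<open>Capping at 2 turns an input code into a matrix entry: code 3, for both constraints,
  amounts to the strict one. The maximum of entries is their conjunction.\<close>

definition m0 :: "nat \<Rightarrow> mat" where
  "m0 e u v = max (min (g e u v) 2)
     (if u < n \<and> v < n
      then max (min (Suc (rk (src e) u) - rk (src e) v) 2) (min (ic (src e) u v) 2)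
      else if n \<le> u \<and> n \<le> v
      then max (min (Suc (rk (dst e) (u - n)) - rk (dst e) (v - n)) 2)
        (min (ic (dst e) (u - n) (v - n)) 2)
      else 0)"

sublocale elab n V E src dst rk m0
proof
  fix e assume "e < E"
  show "ranked n 0 (rk (src e)) (m0 e)" "ranked n n (rk (dst e)) (m0 e)"
    unfolding ranked_def m0_def by (auto simp: le_max_iff_disj max_def min_def)
qed (use n1 ends in auto)

definition static :: "mem \<Rightarrow> bool" where
  "static M \<longleftrightarrow> M NN 0 = n \<and> M NM 0 = 2 * n \<and> M VN 0 = V \<and> M EN 0 = E \<and>
     (\<forall>x\<le>L. M TN x = x * n) \<and>
     (\<forall>q<V. \<forall>i<n. M RK (M QR q + i) = rk q i) \<and>
     (\<forall>q<V. \<forall>i<n. \<forall>j<n. M 0 (M QI q + (i * n + j)) = ic q i j) \<and>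
     (\<forall>e<E. M ES e = src e \<and> M ED e = dst e \<and>
        (\<forall>u<2*n. \<forall>v<2*n. M 0 (M EG e + (u * (2 * n) + v)) = g e u v))"

lemma static_cong:
  assumes "static M" "\<And>a. a \<in> {0, RK, QR, QI, ES, ED, EG, TN, NN, VN, EN, NM} \<Longrightarrow> M' a = M a"
  shows "static M'"
  using assms(1) by (simp add: static_def assms(2))

lemma TN: "static M \<Longrightarrow> x \<le> L \<Longrightarrow> M TN x = x * n"
  by (simp add: static_def)

definition vv_mem :: "mem \<Rightarrow> (nat \<Rightarrow> nat \<Rightarrow> nat) \<Rightarrow> nat \<Rightarrow> bool" where
  "vv_mem M vv k \<longleftrightarrow> k \<le> n \<and> M LV 0 = k \<and> (\<forall>q<V. \<forall>l<k. vv l q \<le> n \<and> M VV (q * n + q + l) = vv l q)"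

lemma vv_mem_cong:
  assumes "vv_mem M vv k" "\<And>a. a \<in> {LV, VV} \<Longrightarrow> M' a = M a"
  shows "vv_mem M' vv k"
  using assms(1) by (simp add: vv_mem_def assms(2))

lemma ho_build_base:
  assumes s: "static M" and e: "e < E" "M EI 0 = e" "M Q1 0 = src e" "M Q2 0 = dst e"
  shows "ho build_base M (40 * n^2) (\<lambda>M'. holds_mat (2*n) M' (m0 e))"
proof -
  let ?N = "2 * n"
  let ?IJ = "\<lambda>i j M'. \<forall>u v. u < ?N \<longrightarrow> v < ?N \<longrightarrow> u < i \<or> u = i \<and> v < j \<longrightarrow> M' MX (u * ?N + v) = m0 e u v"
  have ev: "M TN (x + x) = x * ?N" if "x < ?N" for x
    using TN[OF s, of "x + x"] that limit by simp
  show ?thesis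
    unfolding build_base_def
  proof (rule ho_For[where k = ?N and I = "\<lambda>i. ?IJ i 0" and b = "?N * 6 + 2"], goal_cases)
    case (5 i M1)
    show ?case
    proof (rule ho_For[where k = ?N and I = "?IJ i" and b = 4], goal_cases)
      case (5 j M2)
      have i: "i < ?N" "M1 I 0 = i" and j: "j < ?N" "M2 J 0 = j" and I2: "?IJ i j M2"
        using 5 \<open>i < ?N\<close> \<open>M1 I 0 = i\<close> by auto
      have fr: "a \<notin> {MX, I, J} \<Longrightarrow> M2 a = M a" for a
        using 5(3)[of a] \<open>\<And>a. a \<notin> mods (For J (Var NM) base_entry) \<Longrightarrow> a \<noteq> I \<Longrightarrow> M1 a = M a\<close>[of a] by simp
      have s2: "static M2" by (rule static_cong[OF s]) (use fr in auto)
      have I2': "M2 I 0 = i" using 5(3)[of I] i by simp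
      have vals: "M2 EI 0 = e" "M2 Q1 0 = src e" "M2 Q2 0 = dst e" "M2 NN 0 = n" "M2 TN (i + i) = i * ?N"
        using e fr s2 ev[of i] i by (auto simp: static_def)
      have G: "M2 0 (M2 EG e + (i * ?N + j)) = g e i j" using s2 e i j by (simp add: static_def)
      have V: "src e < V" "dst e < V" using ends e by auto
      have O: "q < V \<Longrightarrow> a < n \<Longrightarrow> b < n \<Longrightarrow> M2 RK (M2 QR q + a) = rk q a \<and>
        M2 0 (M2 QI q + (M2 TN a + b)) = ic q a b" for q a b
        using s2 TN[OF s2, of a] limit by (simp add: static_def)
      have "sem base_entry M2 MX = (M2 MX)(i * ?N + j := m0 e i j)"
        using i j O[of "src e" i j] O[of "src e" j j] O[of "dst e" "i - n" "j - n"] O[of "dst e" "j - n" "j - n"] V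
        by (auto simp: base_entry_def cell_def order_exp_def rank_exp_def vals I2' j(2) G m0_def)
      then have "?IJ i (Suc j) (sem base_entry M2)"
        using I2 j(1) i(1) by (auto simp: index_inj less_Suc_eq)
      then show ?case by (intro ho_loop_free) (auto simp: base_entry_def)
    qed (use s 5 in \<open>auto simp: static_def less_Suc_eq\<close>)
  next
    case 7
    obtain k where "n = Suc k" using n1 by (cases n) auto
    then show ?case by (simp add: power2_eq_square algebra_simps)
  qed (use s in \<open>auto simp: static_def holds_mat_def\<close>)
qed

lemma ho_build_fixed:
  assumes s: "static M" and e: "e < E" "M Q1 0 = src e" "M Q2 0 = dst e"
    and vv: "vv_mem M vv k" and m: "holds_mat (2*n) M (m0 e)"
  shows "ho build_fixed M (k * 6 + 2) (\<lambda>M'. holds_mat (2*n) M' (lmat vv k e))"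
  unfolding build_fixed_def
proof (rule ho_For[where k = k and I = "\<lambda>h M'. holds_mat (2*n) M' (lmat vv h e)" and b = 4], goal_cases)
  case (5 h M1)
  let ?N = "2 * n"
  have fr: "a \<notin> {A, B, MX, H} \<Longrightarrow> M1 a = M a" for a using 5(3)[of a] by simp
  have s1: "static M1" by (rule static_cong[OF s]) (use fr in auto)
  have vv1: "vv_mem M1 vv k" by (rule vv_mem_cong[OF vv]) (use fr in auto)
  have q: "src e < V" "dst e < V" using ends e by auto
  let ?a = "vv h (src e) - 1" and ?b = "n + (vv h (dst e) - 1)"
  have kn: "k \<le> n" "vv h (src e) \<le> n" "vv h (dst e) \<le> n" using vv1 q 5(1) by (auto simp: vv_mem_def)
  have ab: "?a < n" "?b < ?N" using kn n1 by linarith+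
  have vals: "M1 H 0 = h" "M1 Q1 0 = src e" "M1 Q2 0 = dst e" "M1 NN 0 = n"
    "M1 TN (src e) = src e * n" "M1 TN (dst e) = dst e * n"
    "M1 VV (src e * n + src e + h) = vv h (src e)" "M1 VV (dst e * n + dst e + h) = vv h (dst e)"
    "M1 TN (?a + ?a) = ?a * ?N" "M1 TN (?b + ?b) = ?b * ?N"
    using 5(1,2) e fr s1 vv1 q TN[OF s1] limit ab
    by (auto simp: static_def vv_mem_def algebra_simps)
  have i: "?a * ?N + ?b \<noteq> ?b * ?N + ?a" using ab by (subst index_inj) auto
  let ?c = "Set A (Read VV (Read TN (Var Q1) + Var Q1 + Var H) - Const 1) ;;
     Set B (Var NN + (Read VV (Read TN (Var Q2) + Var Q2 + Var H) - Const 1)) ;;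
     Write MX (cell (Var A) (Var B)) (Max (Read MX (cell (Var A) (Var B))) (Const 1)) ;;
     Write MX (cell (Var B) (Var A)) (Max (Read MX (cell (Var B) (Var A))) (Const 1))"
  have "sem ?c M1 MX = (M1 MX)(?a * ?N + ?b := max (M1 MX (?a * ?N + ?b)) 1,
      ?b * ?N + ?a := max (M1 MX (?b * ?N + ?a)) 1)"
    using i by (simp add: cell_def vals del: One_nat_def)
  moreover have "?a < ?N" using ab by simp
  ultimately have "holds_mat (2*n) (sem ?c M1) (lmat vv (Suc h) e)"
    using 5(4) ab i unfolding holds_mat_def lmat_Suc
    by (auto simp: index_inj simp del: sem.simps One_nat_def)
  then show ?case by (intro ho_loop_free) (auto simp: numeral_eq_Suc)
qed (use vv m in \<open>auto simp: vv_mem_def holds_mat_def lmat_def\<close>)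

end

text \<open>That every entry is derivable is kept as an invariant. Conversely, once a scan has
  passed all triples without improvement, the matrix is closed under the rule \<open>trans\<close>
  of \<open>der\<close>.\<close>

lemma ho_closure:
  fixes N :: nat and m :: mat
  assumes N: "M NM 0 = N" and tn: "\<And>x. x < N \<Longrightarrow> M TN (x + x) = x * N"
    and m: "holds_mat N M m" and m2: "\<And>u v. u < N \<Longrightarrow> v < N \<Longrightarrow> m u v \<le> 2"
    and b: "14 * (2 * N^2 * (N^3 + 1) + N^3) + 4 \<le> b"
  shows "ho closure M b (\<lambda>M'. \<exists>m'. holds_mat N M' m' \<and> (\<forall>u<N. \<forall>v<N. m' u v \<le> 2 \<and>
    (m' u v \<noteq> 0 \<longleftrightarrow> der N m False u v) \<and> (2 \<le> m' u v \<longleftrightarrow> der N m True u v)))"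
    (is "ho closure M b ?Q")
proof -
  define ok where "ok m' i j h \<longleftrightarrow> (m' i j \<noteq> 0 \<longrightarrow> m' j h \<noteq> 0 \<longrightarrow> max (m' i j) (m' j h) \<le> m' i h)"
    for m' :: mat and i j h
  define p where "p i j h = (i * N + j) * N + h" for i j h
  define S where "S m' = (\<Sum>u<N. \<Sum>v<N. m' u v)" for m' :: mat
  define inv where "inv M' m' \<longleftrightarrow> holds_mat N M' m' \<and> M' NM 0 = N \<and> (\<forall>x<N. M' TN (x + x) = x * N) \<and>
      (\<forall>u<N. \<forall>v<N. m u v \<le> m' u v \<and> m' u v \<le> 2 \<and>
        (m' u v \<noteq> 0 \<longrightarrow> der N m False u v) \<and> (2 \<le> m' u v \<longrightarrow> der N m True u v)) \<and>
      (M' I 0 < N \<longrightarrow> M' J 0 < N \<and> M' H 0 < N) \<and> (M' I 0 \<ge> N \<longrightarrow> M' I 0 = N \<and> M' J 0 = 0 \<and> M' H 0 = 0) \<and>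
      (\<forall>i<N. \<forall>j<N. \<forall>h<N. p i j h < p (M' I 0) (M' J 0) (M' H 0) \<longrightarrow> ok m' i j h)" for M' m'
  \<comment> \<open>An improvement raises the sum \<open>S\<close> of the entries and may send the
    scan back to the start; any other step advances the position \<open>p\<close> of the scan, read
    as a number in base \<open>N\<close>.\<close>
  define pot where "pot M' m' = (2 * N^2 - S m') * (N^3 + 1) + (N^3 - p (M' I 0) (M' J 0) (M' H 0))"
    for M' :: mem and m'
  have p_less: "p i j h < N^3" if "i < N" "j < N" "h < N" for i j h
    using index_less[OF index_less[OF that(1,2)] that(3)] by (simp add: p_def power3_eq_cube)
  have S_le: "S m' \<le> 2 * N^2" if "\<forall>u<N. \<forall>v<N. m' u v \<le> 2" for m'
  proof -
    have "S m' \<le> (\<Sum>u<N. \<Sum>v<N. 2)" unfolding S_def using that by (intro sum_mono) auto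
    then show ?thesis by (simp add: power2_eq_square)
  qed
  have S_less: "S m' < S (m'(i := (m' i)(h := c)))" if "m' i h < c" "i < N" "h < N" for m' i h c
  proof -
    have row: "(\<Sum>v<N. m' i v) < (\<Sum>v<N. ((m' i)(h := c)) v)"
      by (rule sum_strict_mono_ex1) (use that in \<open>auto intro!: bexI[of _ h]\<close>)
    show ?thesis unfolding S_def
      by (rule sum_strict_mono_ex1) (use that row in \<open>auto intro!: bexI[of _ i]\<close>)
  qed
  have step: "\<exists>m''. inv (sem closure_step M') m'' \<and> pot (sem closure_step M') m'' < pot M' m'"
    if iv: "inv M' m'" and lt: "M' I 0 < N" for M' m'
  proof -
    define i j h where "i = M' I 0" "j = M' J 0" "h = M' H 0"
    note ijh = i_j_h_def
    have l: "i < N" "j < N" "h < N" using iv lt unfolding inv_def ijh by auto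
    have hm: "\<And>u v. u < N \<Longrightarrow> v < N \<Longrightarrow> M' MX (u * N + v) = m' u v"
      using iv by (auto simp: inv_def holds_mat_def)
    have tn': "\<And>x. x < N \<Longrightarrow> M' TN (x + x) = x * N" "M' NM 0 = N" using iv by (auto simp: inv_def)
    define c where "c = (if m' i j \<noteq> 0 \<and> m' j h \<noteq> 0 then max (m' i j) (m' j h) else 0)"
    let ?M = "sem closure_step M'"
    note vals = ijh[symmetric] tn'(1)[OF l(1)] tn'(1)[OF l(2)] hm[OF l(1,2)] hm[OF l(2,3)] hm[OF l(1,3)]
    have oth: "?M NM = M' NM" "?M TN = M' TN" by (simp_all add: closure_step_def)
    show ?thesis
    proof (cases "m' i h < c")
      case True
      then have c: "c = max (m' i j) (m' j h)" "m' i j \<noteq> 0" "m' j h \<noteq> 0"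
        by (auto simp: c_def split: if_splits)
      have r: "?M MX = (M' MX)(i * N + h := c)" "?M I 0 = 0" "?M J 0 = 0" "?M H 0 = 0"
        using True c unfolding closure_step_def by (auto simp: cell_def vals less_max_iff_disj)
      let ?m = "m'(i := (m' i)(h := c))"
      have snd: "\<forall>u<N. \<forall>v<N. (m' u v \<noteq> 0 \<longrightarrow> der N m False u v) \<and> (2 \<le> m' u v \<longrightarrow> der N m True u v) \<and> m' u v \<le> 2 \<and> m u v \<le> m' u v"
        using iv by (simp add: inv_def)
      have d: "der N m False i j" "der N m False j h" "2 \<le> m' i j \<Longrightarrow> der N m True i j"
        "2 \<le> m' j h \<Longrightarrow> der N m True j h" "c \<le> 2" using snd l c by auto
      have d1: "der N m False i h" using der.trans[OF d(1,2)] by simp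
      have d2: "2 \<le> c \<Longrightarrow> der N m True i h"
        using der.trans[OF d(3) d(2)] der.trans[OF d(1) d(4)] c(1) by (auto simp: le_max_iff_disj)
      have le: "m i h \<le> c" using snd l True by (meson less_imp_le order_trans)
      have hm': "holds_mat N ?M ?m"
        using hm l unfolding holds_mat_def r(1) by (auto simp: index_inj)
      have "\<forall>u<N. \<forall>v<N. m u v \<le> ?m u v \<and> ?m u v \<le> 2 \<and>
        (?m u v \<noteq> 0 \<longrightarrow> der N m False u v) \<and> (2 \<le> ?m u v \<longrightarrow> der N m True u v)"
        using snd d1 d2 d(5) le by auto
      then have "inv ?M ?m"
        using iv l hm' unfolding inv_def oth r(2-) by (auto simp: p_def)
      moreover have "pot ?M ?m < pot M' m'"
      proof -
        have "S m' < S ?m" by (rule S_less[of m' i h c]) (use True l in auto)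
        moreover have "S ?m \<le> 2 * N^2" using \<open>inv ?M ?m\<close> S_le unfolding inv_def by blast
        ultimately have "Suc (2 * N^2 - S ?m) \<le> 2 * N^2 - S m'" by linarith
        then show ?thesis unfolding pot_def by (rule potential_less)
      qed
      ultimately show ?thesis by blast
    next
      case False
      have rM: "?M MX = M' MX"
        using False unfolding closure_step_def c_def by (auto simp: cell_def vals)
      have r: "(?M I 0, ?M J 0, ?M H 0) = (if Suc h < N then (i, j, Suc h) else
          if Suc j < N then (i, Suc j, 0) else (Suc i, 0, 0))"
        using False l unfolding closure_step_def c_def by (auto simp: cell_def vals tn'(2))
      have pS: "p (?M I 0) (?M J 0) (?M H 0) = Suc (p i j h)"
      proof -
        consider "Suc h < N" | "N = Suc h" "Suc j < N" | "N = Suc h" "N = Suc j" using l by linarith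
        then show ?thesis
        proof cases
          case 3
          then have "j = h" by simp
          then show ?thesis using r 3 unfolding p_def by (simp add: algebra_simps)
        qed (use r in \<open>auto simp: p_def algebra_simps\<close>)
      qed
      have rng: "(?M I 0 < N \<longrightarrow> ?M J 0 < N \<and> ?M H 0 < N) \<and>
        (?M I 0 \<ge> N \<longrightarrow> ?M I 0 = N \<and> ?M J 0 = 0 \<and> ?M H 0 = 0)"
        using r l by (auto split: if_splits)
      have okc: "ok m' i j h" using False by (auto simp: ok_def c_def split: if_splits)
      have "\<forall>i'<N. \<forall>j'<N. \<forall>h'<N. p i' j' h' < Suc (p i j h) \<longrightarrow> ok m' i' j' h'"
      proof (intro allI impI)
        fix i' j' h' assume *: "i' < N" "j' < N" "h' < N" "p i' j' h' < Suc (p i j h)"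
        show "ok m' i' j' h'"
        proof (cases "p i' j' h' = p i j h")
          case True
          then have "i' = i \<and> j' = j \<and> h' = h" using * l unfolding p_def by (simp add: index_inj)
          then show ?thesis using okc by simp
        next
          case False
          then have "p i' j' h' < p i j h" using *(4) by simp
          then show ?thesis using iv * unfolding inv_def ijh by blast
        qed
      qed
      then have "inv ?M m'" using iv rng unfolding inv_def oth pS holds_mat_def rM by simp
      moreover have "pot ?M m' < pot M' m'"
        using p_less[OF l] unfolding pot_def pS ijh[symmetric] by linarith
      ultimately show ?thesis by blast
    qed
  qed
  define M1 where "M1 = sem (Set I (Const 0) ;; Set J (Const 0) ;; Set H (Const 0)) M"
  have base: "m u v \<noteq> 0 \<longrightarrow> der N m False u v" "2 \<le> m u v \<longrightarrow> der N m True u v" if "u < N" "v < N" for u v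
    using that by (auto intro: der.base)
  have inv0: "inv M1 m"
    using m m2 N tn base by (auto simp: inv_def M1_def holds_mat_def p_def)
  have pot0: "pot M1 m \<le> 2 * N^2 * (N^3 + 1) + N^3" unfolding pot_def
    by (intro add_mono mult_le_mono1) auto
  have "ho (While (Var NM - Var I) closure_step) M1 (pot M1 m * (13 + 1) + 1) ?Q"
  proof (rule ho_While_ghost[where I = "\<lambda>k M'. \<exists>m'. inv M' m' \<and> pot M' m' = k"])
    show "\<exists>m'. inv M1 m' \<and> pot M1 m' = pot M1 m" using inv0 by blast
  next
    fix k M' assume "\<exists>m'. inv M' m' \<and> pot M' m' = k" and e: "eval_exp (Var NM - Var I) M' \<noteq> 0"
    then obtain m' where m': "inv M' m'" "pot M' m' = k" by blast
    then have "M' I 0 < N" using e by (simp add: inv_def)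
    from step[OF m'(1) this] m'(2)
    have "\<exists>k'<k. \<exists>m'. inv (sem closure_step M') m' \<and> pot (sem closure_step M') m' = k'" by auto
    then show "ho closure_step M' 13 (\<lambda>M''. \<exists>k'<k. \<exists>m'. inv M'' m' \<and> pot M'' m' = k')"
      by (rule ho_loop_free[rotated]) (simp_all only: closure_step_simple)
  next
    fix k M' assume "\<exists>m'. inv M' m' \<and> pot M' m' = k" and e: "eval_exp (Var NM - Var I) M' = 0"
    then obtain m' where m': "inv M' m'" by blast
    then have e': "M' I 0 = N" "M' J 0 = 0" "M' H 0 = 0" using e by (auto simp: inv_def)
    \<comment> \<open>The final position lies beyond all triples, so every triple has been checked
      since the last improvement.\<close>
    have "p N 0 0 = N^3" by (simp add: p_def power3_eq_cube)
    then have ok: "ok m' i j h" if "i < N" "j < N" "h < N" for i j h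
      using m' p_less that unfolding inv_def e' by metis
    have iv: "m u v \<le> m' u v \<and> m' u v \<le> 2 \<and>
        (m' u v \<noteq> 0 \<longrightarrow> der N m False u v) \<and> (2 \<le> m' u v \<longrightarrow> der N m True u v)" if "u < N" "v < N" for u v
      using m' that by (simp add: inv_def)
    have "m' u v \<noteq> 0 \<and> (s \<longrightarrow> 2 \<le> m' u v)" if "der N m s u v" for s u v
      using that
    proof (induction rule: der.induct)
      case (base u v s)
      then show ?case using iv[of u v] by (metis le_zero_eq order_trans)
    next
      case (trans s u v s' w)
      then have "u < N" "v < N" "w < N" using der_bound by blast+
      then show ?case using trans ok[of u v w] unfolding ok_def by (auto simp: max_def split: if_splits)
    qed
    then show "?Q M'" using iv m' unfolding inv_def by blast
  qed simp
  then have "ho closure M (Suc (Suc (Suc (pot M1 m * (13 + 1) + 1)))) ?Q"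
    unfolding closure_def M1_def
    by (intro ho_Seq_loop_free[OF _ ho_Seq_loop_free[OF _ ho_Seq_loop_free]]) auto
  moreover have "Suc (Suc (Suc (pot M1 m * (13 + 1) + 1))) \<le> b"
    using order_trans[OF add_le_mono1[OF mult_le_mono2[OF pot0, of 14], of 4] b] by simp
  ultimately show ?thesis by (elim ho_conseq)
qed

lemma ho_check:
  assumes N: "M NM 0 = N" and tn: "\<And>x. x < N \<Longrightarrow> M TN (x + x) = x * N" and m: "holds_mat N M m"
  shows "ho check M (N * 4 + 3) (\<lambda>M'. M' FL 0 = (if \<exists>u<N. 2 \<le> m u u then 0 else 1))"
  unfolding check_def
proof (rule ho_Seq_loop_free)
  show "ho (For I (Var NM) (If (Read MX (cell (Var I) (Var I)) - Const 1) (Set FL (Const 0)) Skip))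
    (sem (Set FL (Const 1)) M) (N * 4 + 2) (\<lambda>M'. M' FL 0 = (if \<exists>u<N. 2 \<le> m u u then 0 else 1))"
  proof (rule ho_For[where k = N and b = 2 and I = "\<lambda>i M'. M' FL 0 = (if \<exists>u<i. 2 \<le> m u u then 0 else 1)"],
      goal_cases)
    case (5 i M')
    have v: "M' TN (i + i) = i * N" "M' MX (i * N + i) = m i i" "M' I 0 = i"
      using 5(1-3) tn m by (auto simp: holds_mat_def)
    show ?case using 5(4) by (intro ho_loop_free) (auto simp: cell_def v less_Suc_eq)
  qed (use N in auto)
qed simp_all

context program_data
begin

lemma ho_target_row:
  assumes s: "static M" and e: "e < E" "M Q2 0 = dst e" and i: "i < n" "M I 0 = i"
    and m: "holds_mat (2*n) M m" and C0: "M C 0 = 0"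
    and d: "\<And>u v. u < 2*n \<Longrightarrow> v < 2*n \<Longrightarrow> m u v \<noteq> 0 \<longleftrightarrow> der (2*n) m' False u v"
  shows "ho target_row M (n * 6 + 2) (\<lambda>M'. is_target n m' (rk (dst e)) i (M' C 0))"
proof -
  let ?best = "\<lambda>j t. if t = 0 then \<forall>j'<j. \<not> der (2*n) m' False i (n + j')
    else t \<le> j \<and> der (2*n) m' False i (n + (t - 1)) \<and>
      (\<forall>j'<j. der (2*n) m' False i (n + j') \<longrightarrow> rk (dst e) j' \<le> rk (dst e) (t - 1))"
  show ?thesis
    unfolding target_row_def
  proof (rule ho_For[where k = n and b = 4 and I = "\<lambda>j M'. ?best j (M' C 0)"], goal_cases)
    case (5 j M2)
    have fr: "a \<notin> {C, J} \<Longrightarrow> M2 a = M a" for a using 5(3)[of a] by (simp add: target_entry_def)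
    have s2: "static M2" by (rule static_cong[OF s]) (use fr in auto)
    have v: "M2 I 0 = i" "M2 J 0 = j" "M2 NN 0 = n" "M2 TN (i + i) = i * (2 * n)" "M2 Q2 0 = dst e"
      using 5(2) i fr e s2 TN[OF s2, of "i + i"] limit by (auto simp: static_def)
    have "M2 MX (i * (2 * n) + (n + j)) = m i (n + j)"
      using m i 5(1) fr by (simp add: holds_mat_def)
    then have mx: "M2 MX (i * (2 * n) + (n + j)) \<noteq> 0 \<longleftrightarrow> der (2*n) m' False i (n + j)"
      using d i 5(1) by simp
    have rkv: "M2 RK (M2 QR (dst e) + j') = rk (dst e) j'" if "j' < n" for j'
      using s2 that ends e by (simp add: static_def)
    have best: "?best j (M2 C 0)" by (rule 5(4))
    have c: "M2 C 0 - 1 < n" using best 5(1) by (auto split: if_splits)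
    have "?best (Suc j) (sem target_entry M2 C 0)"
    proof (cases "der (2*n) m' False i (n + j)")
      case False
      then show ?thesis using best mx by (auto simp: target_entry_def cell_def v less_Suc_eq)
    next
      case True
      then have t: "M2 MX (i * (2 * n) + (n + j)) \<noteq> 0" using mx by simp
      show ?thesis
        using best t True rkv[OF c] rkv[OF 5(1)]
        by (auto simp: target_entry_def cell_def v less_Suc_eq rank_exp_def split: if_splits)
    qed
    then show ?case by (intro ho_loop_free) (simp_all add: target_entry_def)
  next
    case (6 M')
    then show ?case by (simp add: is_target_def split: if_splits)
  qed (use s C0 in \<open>auto simp: static_def target_entry_def\<close>)
qed

lemma ho_targets:
  assumes s: "static M" and e: "e < E" "M EI 0 = e" "M Q2 0 = dst e" and m: "holds_mat (2*n) M m"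
    and d: "\<And>u v. u < 2*n \<Longrightarrow> v < 2*n \<Longrightarrow> m u v \<noteq> 0 \<longleftrightarrow> der (2*n) m' False u v"
  shows "ho targets M (n * (n * 6 + 6) + 2) (\<lambda>M'. (\<forall>i<n. is_target n m' (rk (dst e)) i (M' TT (e * n + i))) \<and>
     (\<forall>x. (\<forall>i<n. x \<noteq> e * n + i) \<longrightarrow> M' TT x = M TT x))"
proof -
  let ?T = "\<lambda>i M'. (\<forall>i'<i. is_target n m' (rk (dst e)) i' (M' TT (e * n + i'))) \<and>
     (\<forall>x. (\<forall>i<n. x \<noteq> e * n + i) \<longrightarrow> M' TT x = M TT x)"
  show ?thesis
    unfolding targets_def
  proof (rule ho_For[where k = n and b = "n * 6 + 4" and I = ?T], goal_cases)
    case (5 i M1)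
    have fr: "a \<notin> {C, J, I, TT} \<Longrightarrow> M1 a = M a" for a using 5(3)[of a] by simp
    let ?M = "sem (Set C (Const 0)) M1"
    have s1: "static ?M" by (rule static_cong[OF s]) (use fr in auto)
    have h1: "holds_mat (2*n) ?M m" using m fr by (simp add: holds_mat_def)
    have Q: "?M Q2 0 = dst e" "?M I 0 = i" "?M C 0 = 0" using fr e 5(2) by auto
    have "ho (target_row ;; Write TT (Read TN (Var EI) + Var I) (Var C)) ?M (n * 6 + 2 + 1) (?T (Suc i))"
    proof (rule ho_Seq[OF ho_target_row[OF s1 e(1) Q(1) 5(1) Q(2) h1 Q(3) d]])
      fix M3 assume b: "is_target n m' (rk (dst e)) i (M3 C 0)"
        and fr3: "\<And>a. a \<notin> mods target_row \<Longrightarrow> M3 a = ?M a"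
      have v: "M3 EI 0 = e" "M3 I 0 = i" "M3 TN e = e * n" "M3 TT = M1 TT"
        using fr fr3 e 5(2) TN[OF s] limit by auto
      show "ho (Write TT (Read TN (Var EI) + Var I) (Var C)) M3 1 (?T (Suc i))"
        using 5(1,4) b by (intro ho_loop_free) (auto simp: v less_Suc_eq)
    qed simp_all
    then show ?case by (rule ho_Seq_loop_free[rotated]) simp_all
  qed (use s e in \<open>auto simp: static_def\<close>)
qed

text \<open>The first summand is the bound of \<open>ho_closure\<close> for
  \<open>N = 2 * n\<close>; the others cover the quadratic loops around it.\<close>

definition arc_cost :: nat where
  "arc_cost = 14 * (2 * (2*n)^2 * ((2*n)^3 + 1) + (2*n)^3) + 70 * n^2 + 30"

lemma ho_arc_body:
  assumes s: "static M" and vv: "vv_mem M vv k" and e: "e < E" "M EI 0 = e"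
  shows "ho arc_body M arc_cost (\<lambda>M'. (M' EA e \<noteq> 0 \<longleftrightarrow> M EA e \<noteq> 0 \<and> consistent (2*n) (lmat vv k e)) \<and>
     (\<forall>x. x \<noteq> e \<longrightarrow> M' EA x = M EA x) \<and>
     (M' EA e \<noteq> 0 \<longrightarrow> (\<forall>i<n. is_target n (lmat vv k e) (rk (dst e)) i (M' TT (e * n + i)))) \<and>
     (\<forall>x. (\<forall>i<n. x \<noteq> e * n + i) \<longrightarrow> M' TT x = M TT x))"
    (is "ho _ _ _ ?Q")
proof (cases "M EA e = 0")
  case True
  then show ?thesis unfolding arc_body_def
    using e by (intro ho_If[where b = 1]) (auto intro!: ho_loop_free simp: arc_cost_def)
next
  case False
  have kn: "k \<le> n" using vv by (simp add: vv_mem_def)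
  let ?N = "2 * n" and ?m = "lmat vv k e"
  let ?bc = "14 * (2 * (2*n)^2 * ((2*n)^3 + 1) + (2*n)^3) + 4"
  let ?bt = "n * (n * 6 + 6) + 2"
  define M1 where "M1 = sem (Set Q1 (Read ES (Var EI)) ;; Set Q2 (Read ED (Var EI))) M"
  have fr1: "a \<notin> {Q1, Q2} \<Longrightarrow> M1 a = M a" for a by (simp add: M1_def)
  have s1: "static M1" by (rule static_cong[OF s]) (use fr1 in auto)
  have Q: "M1 Q1 0 = src e" "M1 Q2 0 = dst e" "M1 EI 0 = e" using s e by (auto simp: M1_def static_def)
  have m2: "?m u v \<le> 2" for u v by (auto simp: lmat_def m0_def)
  have tn: "x < ?N \<Longrightarrow> M' TN (x + x) = x * ?N" if "static M'" for M' x
    using TN[OF that, of "x + x"] limit by simp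
  have main: "ho (build_base ;; build_fixed ;; closure ;; check ;; If (Var FL) targets (Write EA (Var EI) (Const 0)))
    M1 (40 * n^2 + (k * 6 + 2 + (?bc + (?N * 4 + 3 + Suc ?bt)))) ?Q"
  proof (rule ho_Seq[OF ho_build_base[OF s1 e(1) Q(3,1,2)]])
    fix M2 assume 2: "holds_mat ?N M2 (m0 e)" and "\<And>a. a \<notin> mods build_base \<Longrightarrow> M2 a = M1 a"
    then have fr2: "a \<notin> {I, J, MX} \<Longrightarrow> M2 a = M1 a" for a by simp
    have s2: "static M2" by (rule static_cong[OF s1]) (use fr2 in auto)
    have vv2: "vv_mem M2 vv k" by (rule vv_mem_cong[OF vv]) (use fr1 fr2 in auto)
    have Q2: "M2 Q1 0 = src e" "M2 Q2 0 = dst e" using Q fr2 by auto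
    show "ho (build_fixed ;; closure ;; check ;; If (Var FL) targets (Write EA (Var EI) (Const 0)))
      M2 (k * 6 + 2 + (?bc + (?N * 4 + 3 + Suc ?bt))) ?Q"
    proof (rule ho_Seq[OF ho_build_fixed[OF s2 e(1) Q2 vv2 2]])
      fix M3 assume 3: "holds_mat ?N M3 ?m" and "\<And>a. a \<notin> mods build_fixed \<Longrightarrow> M3 a = M2 a"
      then have fr3: "a \<notin> {H, A, B, I, J, MX} \<Longrightarrow> M3 a = M1 a" for a using fr2 by simp
      have s3: "static M3" by (rule static_cong[OF s1]) (use fr3 in auto)
      have NM: "M3 NM 0 = ?N" using s3 by (simp add: static_def)
      show "ho (closure ;; check ;; If (Var FL) targets (Write EA (Var EI) (Const 0)))
        M3 (?bc + (?N * 4 + 3 + Suc ?bt)) ?Q"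
      proof (rule ho_Seq[OF ho_closure[OF NM tn[OF s3] 3 m2 order_refl]])
        fix M4 assume "\<exists>m'. holds_mat ?N M4 m' \<and> (\<forall>u<?N. \<forall>v<?N. m' u v \<le> 2 \<and>
          (m' u v \<noteq> 0 \<longleftrightarrow> der ?N ?m False u v) \<and> (2 \<le> m' u v \<longleftrightarrow> der ?N ?m True u v))"
          and fr4: "\<And>a. a \<notin> mods closure \<Longrightarrow> M4 a = M3 a"
        then obtain m' where 4: "holds_mat ?N M4 m'"
          "\<And>u v. u < ?N \<Longrightarrow> v < ?N \<Longrightarrow> m' u v \<noteq> 0 \<longleftrightarrow> der ?N ?m False u v"
          "\<And>u v. u < ?N \<Longrightarrow> v < ?N \<Longrightarrow> 2 \<le> m' u v \<longleftrightarrow> der ?N ?m True u v" by auto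
        have fr4: "a \<notin> {H, A, B, C, I, J, MX} \<Longrightarrow> M4 a = M1 a" for a using fr3 fr4 by simp
        have s4: "static M4" by (rule static_cong[OF s1]) (use fr4 in auto)
        have NM: "M4 NM 0 = ?N" using s4 by (simp add: static_def)
        have cons: "(\<exists>u<?N. 2 \<le> m' u u) \<longleftrightarrow> \<not> consistent ?N ?m"
          using 4(3) der_bound unfolding consistent_def by blast
        show "ho (check ;; If (Var FL) targets (Write EA (Var EI) (Const 0)))
          M4 (?N * 4 + 3 + Suc ?bt) ?Q"
        proof (rule ho_Seq[OF ho_check[OF NM tn[OF s4] 4(1)]])
          fix M5 assume 5: "M5 FL 0 = (if \<exists>u<?N. 2 \<le> m' u u then 0 else 1)"
            and "\<And>a. a \<notin> mods check \<Longrightarrow> M5 a = M4 a"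
          then have fr5: "a \<notin> {I, FL} \<Longrightarrow> M5 a = M4 a" for a by simp
          have s5: "static M5" by (rule static_cong[OF s4]) (use fr5 in auto)
          have v5: "M5 EI 0 = e" "M5 Q2 0 = dst e" "M5 EA = M EA" "M5 TT = M TT"
            using fr5 fr4 fr1 Q by auto
          have h5: "holds_mat ?N M5 m'" using 4(1) fr5 by (simp add: holds_mat_def)
          show "ho (If (Var FL) targets (Write EA (Var EI) (Const 0))) M5 (Suc ?bt) ?Q"
          proof (rule ho_If[where b = ?bt])
            assume "eval_exp (Var FL) M5 \<noteq> 0"
            then have c: "consistent ?N ?m" using 5 cons by (auto split: if_splits)
            show "ho targets M5 ?bt ?Q"
              by (rule ho_conseq[OF ho_targets[OF s5 e(1) v5(1,2) h5 4(2)]])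
                (use c v5 False in auto)
          next
            assume "eval_exp (Var FL) M5 = 0"
            then have c: "\<not> consistent ?N ?m" using 5 cons by (auto split: if_splits)
            then show "ho (Write EA (Var EI) (Const 0)) M5 ?bt ?Q"
              using v5 by (intro ho_loop_free) auto
          qed simp
        qed simp_all
      qed simp_all
    qed simp_all
  qed simp_all
  let ?b = "40 * n^2 + (k * 6 + 2 + (?bc + (?N * 4 + 3 + Suc ?bt)))"
  have cost: "Suc (Suc (Suc ?b)) \<le> arc_cost"
  proof -
    have "k * 6 \<le> n * 6" "n \<le> n^2" using kn n1 by (auto simp: power2_eq_square)
    then have "40 * n^2 + (k * 6 + 2 + (X + 4 + (?N * 4 + 3 + Suc (6 * n^2 + 6 * n + 2)))) + 3
      \<le> X + 70 * n^2 + 30" for X using n1 by linarith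
    moreover have "n * (n * 6 + 6) = 6 * n^2 + 6 * n" by (simp add: power2_eq_square algebra_simps)
    ultimately show ?thesis unfolding arc_cost_def by simp
  qed
  show ?thesis unfolding arc_body_def
  proof (rule ho_If[OF _ _ cost])
    show "ho (Set Q1 (Read ES (Var EI)) ;; Set Q2 (Read ED (Var EI)) ;;
        build_base ;; build_fixed ;; closure ;; check ;;
        If (Var FL) targets (Write EA (Var EI) (Const 0))) M (Suc (Suc ?b)) ?Q"
      by (rule ho_Seq_loop_free[OF _ ho_Seq_loop_free[OF _ main[unfolded M1_def sem.simps] order_refl]]) simp_all
  qed (use False e in simp)
qed

lemma ho_arc_phase:
  assumes s: "static M" and vv: "vv_mem M vv k"
  shows "ho arc_phase M (E * (arc_cost + 2) + 2) (\<lambda>M'. \<forall>e<E.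
     (M' EA e \<noteq> 0 \<longleftrightarrow> M EA e \<noteq> 0 \<and> consistent (2*n) (lmat vv k e)) \<and>
     (M' EA e \<noteq> 0 \<longrightarrow> (\<forall>i<n. is_target n (lmat vv k e) (rk (dst e)) i (M' TT (e * n + i)))))"
  unfolding arc_phase_def
proof (rule ho_For[where k = E and b = arc_cost and I = "\<lambda>j M'. \<forall>e<E. if e < j then
    (M' EA e \<noteq> 0 \<longleftrightarrow> M EA e \<noteq> 0 \<and> consistent (2*n) (lmat vv k e)) \<and>
     (M' EA e \<noteq> 0 \<longrightarrow> (\<forall>i<n. is_target n (lmat vv k e) (rk (dst e)) i (M' TT (e * n + i))))
    else M' EA e = M EA e"], goal_cases)
  case (5 j M1)
  have s1: "static M1" by (rule static_cong[OF s]) (use 5(3) in auto)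
  have vv1: "vv_mem M1 vv k" by (rule vv_mem_cong[OF vv]) (use 5(3) in auto)
  show ?case
  proof (rule ho_conseq[OF ho_arc_body[OF s1 vv1 5(1,2)]], goal_cases)
    case (1 M2)
    have other: "e \<noteq> j \<Longrightarrow> i < n \<Longrightarrow> M2 TT (e * n + i) = M1 TT (e * n + i)" for e i
      using 1(1) by (metis index_inj)
    show ?case
    proof (intro allI impI)
      fix e assume e: "e < E"
      show "if e < Suc j then
        (M2 EA e \<noteq> 0 \<longleftrightarrow> M EA e \<noteq> 0 \<and> consistent (2*n) (lmat vv k e)) \<and>
         (M2 EA e \<noteq> 0 \<longrightarrow> (\<forall>i<n. is_target n (lmat vv k e) (rk (dst e)) i (M2 TT (e * n + i))))
        else M2 EA e = M EA e"
        using 5(4) 1(1) e other by (cases "e = j") (auto simp: less_Suc_eq)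
    qed
  qed simp
qed (use s in \<open>auto simp: static_def\<close>)

end

section \<open>Graphs in memory\<close>

abbreviation (input) QQ :: nat where "QQ \<equiv> 36"
abbreviation (input) CNT :: nat where "CNT \<equiv> 45"
abbreviation (input) DV :: nat where "DV \<equiv> 46"
abbreviation (input) BS :: nat where "BS \<equiv> 47"
abbreviation (input) GN :: nat where "GN \<equiv> 48"

lemma lst_cong:
  "lst c nx tg h xs \<Longrightarrow> (\<And>h. 0 < h \<Longrightarrow> h \<le> c \<Longrightarrow> nx' h = nx h \<and> tg' h = tg h) \<Longrightarrow> c \<le> c' \<Longrightarrow>
    lst c' nx' tg' h xs"
  by (induction xs arbitrary: h) auto

text \<open>\<open>c\<close> bounds the number of list cells, not of pairs in \<open>R\<close>:
  parallel arcs store the same pair several times, and the search pays for each.\<close>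

definition graph :: "mem \<Rightarrow> nat \<Rightarrow> nat rel \<Rightarrow> nat \<Rightarrow> bool" where
  "graph M N R c \<longleftrightarrow> R \<subseteq> {..<N} \<times> {..<N} \<and> (\<exists>adj. (\<forall>v<N. lst (M CNT 0) (M NX) (M TG) (M HD v) (adj v)) \<and>
     R = {(u, v). u < N \<and> v \<in> set (adj u)} \<and> (\<Sum>u<N. length (adj u)) \<le> c)"

lemma graph_cong:
  assumes "graph M N R c" "\<And>a. a \<in> {HD, NX, TG, CNT} \<Longrightarrow> M' a = M a"
  shows "graph M' N R c"
  using assms(1) by (simp add: graph_def assms(2))

definition add_edge :: "exp \<Rightarrow> exp \<Rightarrow> com" where
  "add_edge u v = Set CNT (Var CNT + Const 1) ;; Write NX (Var CNT) (Read HD u) ;;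
     Write TG (Var CNT) v ;; Write HD u (Var CNT)"

lemma add_edge_simps [simp]:
  "mods (add_edge u v) = {HD, NX, TG, CNT}" "loop_free (add_edge u v)" "steps (add_edge u v) = 4"
  by (auto simp: add_edge_def)

text \<open>The two expressions are evaluated between the writes, so their values must not depend on
  the arrays of the lists.\<close>

lemma graph_add_edge:
  assumes g: "graph M N R c" and uv: "u < N" "v < N"
    and e: "\<And>M'. (\<And>a. a \<notin> {HD, NX, TG, CNT} \<Longrightarrow> M' a = M a) \<Longrightarrow> eval_exp eu M' = u \<and> eval_exp ev M' = v"
  shows "graph (sem (add_edge eu ev) M) N (insert (u, v) R) (Suc c)"
proof -
  obtain adj where adj: "\<And>v. v < N \<Longrightarrow> lst (M CNT 0) (M NX) (M TG) (M HD v) (adj v)"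
    "R = {(u, v). u < N \<and> v \<in> set (adj u)}" "(\<Sum>u<N. length (adj u)) \<le> c" "R \<subseteq> {..<N} \<times> {..<N}"
    using g by (auto simp: graph_def)
  let ?c = "Suc (M CNT 0)"
  let ?M = "sem (add_edge eu ev) M"
  have "eval_exp eu M' = u" "eval_exp ev M' = v"
    if "\<And>a. a \<notin> {HD, NX, TG, CNT} \<Longrightarrow> M' a = M a" for M'
    using e[of M'] that by auto
  then have ev: "eval_exp eu (wr M CNT 0 ?c) = u" "eval_exp ev (wr (wr M CNT 0 ?c) NX ?c x) = v"
    "eval_exp eu (wr (wr (wr M CNT 0 ?c) NX ?c x) TG ?c y) = u" for x y by simp_all
  have M: "?M CNT 0 = ?c" "?M NX = (M NX)(?c := M HD u)" "?M TG = (M TG)(?c := v)" "?M HD = (M HD)(u := ?c)"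
    unfolding add_edge_def by (simp_all add: ev)
  have "lst (?M CNT 0) (?M NX) (?M TG) (?M HD w) ((adj(u := v # adj u)) w)" if "w < N" for w
  proof -
    have "lst ?c (?M NX) (?M TG) (M HD w) (adj w)"
      by (rule lst_cong[OF adj(1)[OF that]]) (auto simp: M)
    then show ?thesis by (cases "w = u") (auto simp: M)
  qed
  moreover have "(\<Sum>w<N. length ((adj(u := v # adj u)) w)) = Suc (\<Sum>w<N. length (adj w))"
  proof -
    have "(\<Sum>w<N. length ((adj(u := v # adj u)) w)) = (\<Sum>w<N. length (adj w) + (if w = u then 1 else 0))"
      by (rule sum.cong) auto
    then show ?thesis using uv(1) by (simp add: sum.distrib sum.delta)
  qed
  moreover have "insert (u, v) R = {(x, y). x < N \<and> y \<in> set ((adj(u := v # adj u)) x)}"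
    using adj(2) uv by (auto split: if_splits)
  moreover have "insert (u, v) R \<subseteq> {..<N} \<times> {..<N}" using adj(4) uv by simp
  ultimately show ?thesis using adj(3) unfolding graph_def
    by (intro conjI exI[of _ "adj(u := v # adj u)"]) simp_all
qed

section \<open>Building graphs and searching them\<close>

definition clear :: com where
  "clear = Set CNT (Const 0) ;; For I (Var GN) (Write HD (Var I) (Const 0) ;; Write LB (Var I) (Const 0))"

lemma mods_clear [simp]: "mods clear = {CNT, I, HD, LB}"
  by (auto simp: clear_def)

lemma ho_clear:
  assumes "M GN 0 = N"
  shows "ho clear M (N * 4 + 3) (\<lambda>M'. graph M' N {} 0 \<and> (\<forall>v<N. M' LB v = 0))"
  unfolding clear_def
proof (rule ho_Seq_loop_free)
  show "ho (For I (Var GN) (Write HD (Var I) (Const 0) ;; Write LB (Var I) (Const 0)))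
    (sem (Set CNT (Const 0)) M) (N * 4 + 2) (\<lambda>M'. graph M' N {} 0 \<and> (\<forall>v<N. M' LB v = 0))"
    by (rule ho_For[where k = N and b = 2 and I = "\<lambda>i M'. \<forall>v<i. M' HD v = 0 \<and> M' LB v = 0"])
      (auto intro!: ho_loop_free exI[of _ "\<lambda>_. []"] simp: assms less_Suc_eq graph_def)
qed simp_all

text \<open>The adjacency lists are hidden: what the callers use of a search depends only on the
  relation.\<close>

definition dfs_post :: "nat \<Rightarrow> nat rel \<Rightarrow> nat list \<Rightarrow> nat list \<Rightarrow> (nat \<Rightarrow> nat) \<Rightarrow> bool" where
  "dfs_post N R roots post lab \<longleftrightarrow>
     (\<exists>adj. dfs_graph N adj roots \<and> dfs_graph.edges N adj = R \<and> dfs_graph.dfs_result N adj roots post lab)"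

lemma ho_dfs_graph:
  assumes g: "graph M N R c" and lb: "\<And>v. v < N \<Longrightarrow> M LB v = 0" and nr: "M NR 0 = length roots"
    and rt: "\<And>i. i < length roots \<Longrightarrow> M RT i = roots ! i" and roots: "set roots \<subseteq> {..<N}"
  shows "ho dfs M (10 * (c + N + length roots) + 4) (\<lambda>M'. \<exists>post. dfs_post N R roots post (M' LB) \<and>
    (\<forall>i<length post. M' PO i = post ! i))"
proof -
  obtain adj where a: "\<And>v. v < N \<Longrightarrow> lst (M CNT 0) (M NX) (M TG) (M HD v) (adj v)"
    "R = {(u, v). u < N \<and> v \<in> set (adj u)}" "(\<Sum>u<N. length (adj u)) \<le> c" "R \<subseteq> {..<N} \<times> {..<N}"
    using g by (auto simp: graph_def)
  interpret D: dfs_graph N adj roots by unfold_locales (use a roots in auto)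
  have R: "D.edges = R" by (simp add: D.edges_def a(2))
  have "ho dfs M (10 * (c + N + length roots) + 4) (\<lambda>M'. \<exists>post. D.dfs_result post (M' LB) \<and>
      M' PC 0 = length post \<and> (\<forall>i<length post. M' PO i = post ! i))"
    by (rule D.ho_dfs[OF a(1) lb nr rt]) (use a(3) in auto)
  then show ?thesis
    by (rule ho_conseq) (use R D.dfs_graph_axioms in \<open>auto simp: dfs_post_def\<close>)
qed

text \<open>The labels run from 1 to \<open>N\<close>. One less gives the component numbers, which
  are below the number of nodes, as the integers of the vectors have to be bounded.\<close>

lemma scc_labels:
  assumes 1: "dfs_post N (R\<inverse>) [0..<N] post lab'" and 2: "dfs_post N R (rev post) post2 lab"
    and u: "u < N"
  shows "lab u \<noteq> 0" "lab u \<le> N" "(u, v) \<in> R \<Longrightarrow> lab v \<le> lab u"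
    "v < N \<Longrightarrow> lab u = lab v \<Longrightarrow> (u, v) \<in> R\<^sup>*"
proof -
  obtain adj' where a': "dfs_graph N adj' [0..<N]" "dfs_graph.edges N adj' = R\<inverse>"
    "dfs_graph.dfs_result N adj' [0..<N] post lab'" using 1 unfolding dfs_post_def by blast
  obtain adj where a: "dfs_graph N adj (rev post)" "dfs_graph.edges N adj = R"
    "dfs_graph.dfs_result N adj (rev post) post2 lab" using 2 unfolding dfs_post_def by blast
  have ed: "dfs_graph.edges N adj' = (dfs_graph.edges N adj)\<inverse>" using a' a by simp
  note k = kosaraju[OF a'(1) a(1) ed a'(3) a(3) refl]
  show nz: "lab u \<noteq> 0" using k(1)[OF u u refl] .
  show "v < N \<Longrightarrow> lab u = lab v \<Longrightarrow> (u, v) \<in> R\<^sup>*" using k(2)[OF u] a(2) by simp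
  have "set post \<subseteq> {..<N}" "distinct post"
    using a'(3) unfolding dfs_graph.dfs_result_def[OF a'(1)] by auto
  then have "length post \<le> N" by (metis card_lessThan card_mono distinct_card finite_lessThan)
  then show "lab u \<le> N"
    using a(3) nz u unfolding dfs_graph.dfs_result_def[OF a(1)] by fastforce
  show "lab v \<le> lab u" if "(u, v) \<in> R"
  proof -
    have "(u, v) \<in> (dfs_graph.edges N adj)\<^sup>*" using that a(2) by auto
    then show ?thesis using a(3) nz u unfolding dfs_graph.dfs_result_def[OF a(1)] by blast
  qed
qed

text \<open>A search from a single root labels exactly what this root reaches.\<close>

lemma reachable_labels:
  assumes "dfs_post N R [d] post lab" "d < N" "v < N"
  shows "lab v \<noteq> 0 \<longleftrightarrow> (d, v) \<in> R\<^sup>*"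
proof -
  obtain adj where a: "dfs_graph N adj [d]" "dfs_graph.edges N adj = R"
    "dfs_graph.dfs_result N adj [d] post lab" using assms unfolding dfs_post_def by blast
  note r = a(3)[unfolded dfs_graph.dfs_result_def[OF a(1)] a(2)]
  have "(d, v) \<in> R\<^sup>*" if "lab v \<noteq> 0"
  proof -
    have 1: "lab v \<le> length [d]" "([d] ! (lab v - 1), v) \<in> R\<^sup>*" using r assms(3) that by blast+
    then have "lab v = 1" using that by simp
    then show ?thesis using 1(2) by simp
  qed
  moreover have "lab v \<noteq> 0" if "(d, v) \<in> R\<^sup>*"
  proof -
    have "lab ([d] ! 0) \<noteq> 0" using r by simp
    then show ?thesis using r assms(2) that by simp
  qed
  ultimately show ?thesis by blast
qed

definition arcs_loop :: "nat \<Rightarrow> nat \<Rightarrow> com" where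
  "arcs_loop x y = For EI (Var EN)
     (If (Read EA (Var EI)) (add_edge (Read x (Var EI)) (Read y (Var EI))) Skip)"

lemma mods_arcs_loop [simp]: "mods (arcs_loop x y) = {EI, HD, NX, TG, CNT}"
  by (auto simp: arcs_loop_def)

lemma ho_arcs_loop:
  assumes xy: "x \<in> {ES, ED}" "y \<in> {ES, ED}" and E: "M EN 0 = E" and g: "graph M N {} 0"
    and fh: "\<And>e. e < E \<Longrightarrow> M x e = f e \<and> M y e = h e \<and> f e < N \<and> h e < N"
  shows "ho (arcs_loop x y) M (E * 7 + 2) (\<lambda>M'. graph M' N (arc_rel f h {e. e < E \<and> M EA e \<noteq> 0}) E)"
  unfolding arcs_loop_def
proof (rule ho_For[where k = E and b = 5 and I = "\<lambda>i M'. graph M' N (arc_rel f h {e. e < i \<and> M EA e \<noteq> 0}) i"],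
    goal_cases)
  case (3 i j M')
  show ?case by (simp add: graph_def)
next
  case (5 i M')
  have e: "M' EA i = M EA i" "M' EI 0 = i" "M' x i = f i" "M' y i = h i" "f i < N" "h i < N"
    using 5(1,2) 5(3)[of EA] 5(3)[of x] 5(3)[of y] fh[OF 5(1)] xy by auto
  let ?c = "If (Read EA (Var EI)) (add_edge (Read x (Var EI)) (Read y (Var EI))) Skip"
  have "graph (sem ?c M') N (arc_rel f h {e. e < Suc i \<and> M EA e \<noteq> 0}) (Suc i)"
  proof (cases "M EA i = 0")
    case True
    then have "{e. e < Suc i \<and> M EA e \<noteq> 0} = {e. e < i \<and> M EA e \<noteq> 0}" by (auto simp: less_Suc_eq)
    then show ?thesis using 5(4) True e by (auto simp: graph_def)
  next
    case False
    then have "{e. e < Suc i \<and> M EA e \<noteq> 0} = insert i {e. e < i \<and> M EA e \<noteq> 0}" by (auto simp: less_Suc_eq)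
    then have "arc_rel f h {e. e < Suc i \<and> M EA e \<noteq> 0} = insert (f i, h i) (arc_rel f h {e. e < i \<and> M EA e \<noteq> 0})"
      by (simp add: arc_rel_def)
    moreover have "graph (sem (add_edge (Read x (Var EI)) (Read y (Var EI))) M') N
      (insert (f i, h i) (arc_rel f h {e. e < i \<and> M EA e \<noteq> 0})) (Suc i)"
      by (rule graph_add_edge[OF 5(4) e(5,6)]) (use e xy in auto)
    ultimately show ?thesis using False e by simp
  qed
  then show ?case by (intro ho_loop_free) simp_all
qed (use E g in \<open>auto simp: arc_rel_def\<close>)

section \<open>Strongly connected components by two searches\<close>

definition scc1 :: com where
  "scc1 = Set GN (Var VN) ;; clear ;; arcs_loop ED ES ;; For I (Var VN) (Write RT (Var I) (Var I)) ;;
     Set NR (Var VN) ;; dfs"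

definition scc2 :: com where
  "scc2 = clear ;; arcs_loop ES ED ;;
     For I (Var VN) (Write RT (Var I) (Read PO (Var VN - Const 1 - Var I))) ;; dfs"

lemma mods_scc [simp]:
  "mods scc1 = {GN, CNT, I, HD, LB, EI, NX, TG, RT, NR, STK, PO, RI, SP, PC, X, Y}"
  "mods scc2 = {CNT, I, HD, LB, EI, NX, TG, RT, STK, PO, RI, SP, PC, X, Y}"
  by (auto simp: scc1_def scc2_def)

lemma ho_roots_loop:
  assumes "M VN 0 = N" "\<And>i M'. i < N \<Longrightarrow> M' I 0 = i \<Longrightarrow> (\<And>a. a \<notin> {RT, I} \<Longrightarrow> M' a = M a) \<Longrightarrow> eval_exp x M' = rs ! i"
  shows "ho (For I (Var VN) (Write RT (Var I) x)) M (N * 3 + 2) (\<lambda>M'. \<forall>i<N. M' RT i = rs ! i)"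
proof (rule ho_For[where k = N and b = 1 and I = "\<lambda>i M'. \<forall>j<i. M' RT j = rs ! j"], goal_cases)
  case (5 i M')
  have "eval_exp x M' = rs ! i" by (rule assms(2)[where i = i and M' = M']) (use 5 in auto)
  then show ?case using 5(2,4) by (intro ho_loop_free) (auto simp: less_Suc_eq)
qed (use assms(1) in auto)

context program_data
begin

lemma static_arcs: "static M \<Longrightarrow> M VN 0 = V \<and> M EN 0 = E \<and> (\<forall>e<E. M ES e = src e \<and> M ED e = dst e)"
  by (auto simp: static_def)

lemma ho_scc1:
  assumes s: "static M"
  shows "ho scc1 M (17 * E + 27 * V + 20) (\<lambda>M'. M' GN 0 = V \<and> M' NR 0 = V \<and> (\<exists>post lab.
    dfs_post V ((arc_rel src dst {e. e < E \<and> M EA e \<noteq> 0})\<inverse>) [0..<V] post lab \<and>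
    (\<forall>i<length post. M' PO i = post ! i)))" (is "ho scc1 M _ ?Q")
proof -
  define M1 where "M1 = sem (Set GN (Var VN)) M"
  have M1: "M1 GN 0 = V" "a \<noteq> GN \<Longrightarrow> M1 a = M a" for a using s by (auto simp: M1_def static_def)
  let ?A = "{e. e < E \<and> M EA e \<noteq> 0}"
  have "ho (clear ;; arcs_loop ED ES ;; For I (Var VN) (Write RT (Var I) (Var I)) ;; Set NR (Var VN) ;; dfs)
     M1 (V * 4 + 3 + (E * 7 + 2 + (V * 3 + 2 + (1 + (10 * (E + V + V) + 4))))) ?Q"
  proof (rule ho_Seq[OF ho_clear[where M = M1 and N = V, OF M1(1)]])
    fix M2 assume 2: "graph M2 V {} 0 \<and> (\<forall>v<V. M2 LB v = 0)" and fr2: "\<And>a. a \<notin> mods clear \<Longrightarrow> M2 a = M1 a"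
    have s2: "static M2" by (rule static_cong[OF s]) (use fr2 M1 in auto)
    show "ho (arcs_loop ED ES ;; For I (Var VN) (Write RT (Var I) (Var I)) ;; Set NR (Var VN) ;; dfs)
       M2 (E * 7 + 2 + (V * 3 + 2 + (1 + (10 * (E + V + V) + 4)))) ?Q"
    proof (rule ho_Seq[OF ho_arcs_loop[where f = dst and h = src and N = V and E = E]])
      fix M3 assume 3: "graph M3 V (arc_rel dst src {e. e < E \<and> M2 EA e \<noteq> 0}) E"
        and fr3: "\<And>a. a \<notin> mods (arcs_loop ED ES) \<Longrightarrow> M3 a = M2 a"
      have EA: "M2 EA = M EA" using fr2 M1 by simp
      have s3: "static M3" by (rule static_cong[OF s2]) (use fr3 in auto)
      show "ho (For I (Var VN) (Write RT (Var I) (Var I)) ;; Set NR (Var VN) ;; dfs)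
         M3 (V * 3 + 2 + (1 + (10 * (E + V + V) + 4))) ?Q"
      proof (rule ho_Seq[OF ho_roots_loop[where N = V and rs = "[0..<V]"]])
        fix M4 assume 4: "\<forall>i<V. M4 RT i = [0..<V] ! i"
          and fr4: "\<And>a. a \<notin> mods (For I (Var VN) (Write RT (Var I) (Var I))) \<Longrightarrow> M4 a = M3 a"
        have s4: "static M4" by (rule static_cong[OF s3]) (use fr4 in auto)
        let ?M = "sem (Set NR (Var VN)) M4"
        have g: "graph ?M V ((arc_rel src dst ?A)\<inverse>) E"
        proof -
          have "arc_rel dst src ?A = (arc_rel src dst ?A)\<inverse>" by (auto simp: arc_rel_def)
          then have "graph M3 V ((arc_rel src dst ?A)\<inverse>) E" using 3 EA by simp
          then show ?thesis by (rule graph_cong) (auto simp: fr4)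
        qed
        show "ho (Set NR (Var VN) ;; dfs) M4 (1 + (10 * (E + V + V) + 4)) ?Q"
        proof (rule ho_Seq_loop_free[where ?b2.0 = "10 * (E + V + V) + 4",
              OF _ ho_conseq[OF ho_dfs_graph[OF g, of "[0..<V]"]]])
          show "?M LB v = 0" if "v < V" for v using 2 fr3 fr4 that by simp
          have "M4 VN 0 = V" using s4 by (simp add: static_def)
          then show "?M NR 0 = length [0..<V]" "\<And>i. i < length [0..<V] \<Longrightarrow> ?M RT i = [0..<V] ! i"
            using 4 by auto
          fix M5 assume 5: "\<exists>post. dfs_post V ((arc_rel src dst ?A)\<inverse>) [0..<V] post (M5 LB) \<and>
            (\<forall>i<length post. M5 PO i = post ! i)" and fr5: "\<And>a. a \<notin> mods dfs \<Longrightarrow> M5 a = ?M a"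
          have "M5 GN 0 = V" "M5 NR 0 = V" using fr5 fr4 fr3 fr2 M1 \<open>M4 VN 0 = V\<close> by auto
          then show "?Q M5" using 5 by blast
        qed (auto simp: subset_eq)
      qed (use s3 in \<open>auto simp: static_def\<close>)
    qed (use 2 static_arcs[OF s2] ends in auto)
  qed simp
  then show ?thesis unfolding scc1_def M1_def
    by (rule ho_Seq_loop_free[rotated]) simp_all
qed

lemma ho_scc2:
  assumes s: "static M" and GN: "M GN 0 = V" "M NR 0 = V" and post: "set post \<subseteq> {..<V}" "length post = V"
    and PO: "\<forall>i<V. M PO i = post ! i"
  shows "ho scc2 M (17 * E + 27 * V + 20) (\<lambda>M'. \<exists>post2.
    dfs_post V (arc_rel src dst {e. e < E \<and> M EA e \<noteq> 0}) (rev post) post2 (M' LB))" (is "ho scc2 M _ ?Q")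
proof -
  let ?A = "{e. e < E \<and> M EA e \<noteq> 0}"
  let ?r = "For I (Var VN) (Write RT (Var I) (Read PO (Var VN - Const 1 - Var I)))"
  have "ho (clear ;; arcs_loop ES ED ;; ?r ;; dfs)
     M (V * 4 + 3 + (E * 7 + 2 + (V * 3 + 2 + (10 * (E + V + V) + 4)))) ?Q"
  proof (rule ho_Seq[OF ho_clear[where M = M and N = V, OF GN(1)]])
    fix M2 assume 2: "graph M2 V {} 0 \<and> (\<forall>v<V. M2 LB v = 0)" and fr2: "\<And>a. a \<notin> mods clear \<Longrightarrow> M2 a = M a"
    have s2: "static M2" by (rule static_cong[OF s]) (use fr2 in auto)
    show "ho (arcs_loop ES ED ;; ?r ;; dfs) M2 (E * 7 + 2 + (V * 3 + 2 + (10 * (E + V + V) + 4))) ?Q"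
    proof (rule ho_Seq[OF ho_arcs_loop[where f = src and h = dst and N = V and E = E]])
      fix M3 assume 3: "graph M3 V (arc_rel src dst {e. e < E \<and> M2 EA e \<noteq> 0}) E"
        and fr3: "\<And>a. a \<notin> mods (arcs_loop ES ED) \<Longrightarrow> M3 a = M2 a"
      have EA: "M2 EA = M EA" using fr2 by simp
      have s3: "static M3" by (rule static_cong[OF s2]) (use fr3 in auto)
      have PO3: "\<forall>i<V. M3 PO i = post ! i" "M3 VN 0 = V" using PO fr3 fr2 s3 by (auto simp: static_def)
      show "ho (?r ;; dfs) M3 (V * 3 + 2 + (10 * (E + V + V) + 4)) ?Q"
      proof (rule ho_Seq[OF ho_roots_loop[where N = V and rs = "rev post"]])
        show "eval_exp (Read PO (Var VN - Const 1 - Var I)) M' = rev post ! i"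
          if "i < V" "M' I 0 = i" "\<And>a. a \<notin> {RT, I} \<Longrightarrow> M' a = M3 a" for i M'
          using that PO3 post by (simp add: rev_nth)
        fix M4 assume 4: "\<forall>i<V. M4 RT i = rev post ! i" and fr4: "\<And>a. a \<notin> mods ?r \<Longrightarrow> M4 a = M3 a"
        have g: "graph M4 V (arc_rel src dst ?A) E"
        proof -
          have "graph M3 V (arc_rel src dst ?A) E" using 3 EA by simp
          then show ?thesis by (rule graph_cong) (auto simp: fr4)
        qed
        show "ho dfs M4 (10 * (E + V + V) + 4) ?Q"
        proof (rule ho_conseq[OF ho_dfs_graph[OF g, of "rev post"]])
          show "M4 LB v = 0" if "v < V" for v using 2 fr3 fr4 that by simp
          show "M4 NR 0 = length (rev post)" "\<And>i. i < length (rev post) \<Longrightarrow> M4 RT i = rev post ! i"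
            using 4 GN post fr4 fr3 fr2 by auto
        qed (use post in auto)
      qed (use PO3 in auto)
    qed (use 2 static_arcs[OF s2] ends in auto)
  qed simp
  then show ?thesis unfolding scc2_def by (rule ho_conseq) simp_all
qed

end

section \<open>One level of the construction\<close>

text \<open>With truncated subtraction, \<open>(a - b) + (b - a)\<close> is nonzero exactly if
  \<open>a\<close> and \<open>b\<close> differ; the arcs between components are deactivated.\<close>

definition record_labels :: com where
  "record_labels =
     For QQ (Var VN) (Write CP (Read TN (Var QQ) + Var QQ + Var LV) (Read LB (Var QQ) - Const 1)) ;;
     For EI (Var EN) (If (Read EA (Var EI))
       (If ((Read LB (Read ES (Var EI)) - Read LB (Read ED (Var EI))) +
            (Read LB (Read ED (Var EI)) - Read LB (Read ES (Var EI))))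
         (Write EA (Var EI) (Const 0)) Skip) Skip)"

text \<open>The graph searched for unsafe variables has a node \<open>q * n + i\<close> for every variable of
  every node and a further node \<open>V * n\<close> from which exactly the unsafe variables are reachable.\<close>

definition target_edge :: com where
  "target_edge = Set C (Read TT (Read TN (Var EI) + Var I)) ;;
     If (Var C)
       (add_edge (Read TN (Read ED (Var EI)) + (Var C - Const 1)) (Read TN (Read ES (Var EI)) + Var I))
       (add_edge (Var DV) (Read TN (Read ES (Var EI)) + Var I))"

definition target_edges :: com where
  "target_edges = For EI (Var EN) (If (Read EA (Var EI)) (For I (Var NN) target_edge) Skip)"

definition fixed_edge :: com where
  "fixed_edge = Set A (rank_exp QQ (Var I)) ;;
     Set B (rank_exp QQ (Read VV (Read TN (Var QQ) + Var QQ + Var H) - Const 1)) ;;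
     If ((Var A - Var B) + (Var B - Var A)) Skip (add_edge (Var DV) (Read TN (Var QQ) + Var I))"

definition fixed_edges :: com where
  "fixed_edges = For QQ (Var VN) (For I (Var NN) (For H (Var LV) fixed_edge))"

definition unsafe_search :: com where
  "unsafe_search = Set DV (Read TN (Var VN)) ;; Set GN (Var DV + Const 1) ;; clear ;;
     target_edges ;; fixed_edges ;; Write RT (Const 0) (Var DV) ;; Set NR (Const 1) ;; dfs"

definition choose_entry :: com where
  "choose_entry = If (Read LB (Read TN (Var QQ) + Var I)) Skip
     (If (Var BS)
       (If (rank_exp QQ (Var BS - Const 1) - rank_exp QQ (Var I)) (Set BS (Var I + Const 1)) Skip)
       (Set BS (Var I + Const 1)))"

definition choose_vars :: com where
  "choose_vars = For QQ (Var VN) (Set BS (Const 0) ;; For I (Var NN) choose_entry ;;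
     Write VV (Read TN (Var QQ) + Var QQ + Var LV) (Var BS))"

definition level_body :: com where
  "level_body = arc_phase ;; scc1 ;; scc2 ;; record_labels ;; unsafe_search ;; choose_vars"

definition all_levels :: com where
  "all_levels = For LV (Var NN + Const 1) level_body"

lemma mods_level_parts [simp]:
  "mods record_labels = {QQ, EI, CP, EA}" "mods target_edge = {C, HD, NX, TG, CNT}"
  "mods target_edges = {EI, I, C, HD, NX, TG, CNT}" "mods fixed_edge = {A, B, HD, NX, TG, CNT}"
  "mods fixed_edges = {QQ, I, H, A, B, HD, NX, TG, CNT}"
  "mods unsafe_search = {DV, GN, EI, QQ, I, H, A, B, C, HD, NX, TG, CNT, RT, NR, LB, STK, PO, RI, SP, PC, X, Y}"
  "mods choose_entry = {BS}" "mods choose_vars = {QQ, BS, I, VV}"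
  by (auto simp: record_labels_def target_edge_def target_edges_def fixed_edge_def fixed_edges_def
      unsafe_search_def choose_entry_def choose_vars_def)

lemma loop_free_level_parts [simp]:
  "loop_free target_edge" "loop_free fixed_edge" "loop_free choose_entry"
  "steps target_edge = 6" "steps fixed_edge = 7" "steps choose_entry = 4"
  by (simp_all add: target_edge_def fixed_edge_def choose_entry_def)

lemma mods_level_body [simp]:
  "mods level_body = {EI, Q1, Q2, I, J, H, A, B, C, MX, FL, TT, EA, GN, CNT, HD, LB, NX, TG, RT, NR,
     STK, PO, RI, SP, PC, X, Y, QQ, CP, DV, BS, VV}"
  by (auto simp: level_body_def)

lemma graph_mono: "graph M N R c \<Longrightarrow> c \<le> c' \<Longrightarrow> graph M N R c'"
proof -
  assume "graph M N R c" "c \<le> c'"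
  then obtain adj where "R \<subseteq> {..<N} \<times> {..<N}" "\<forall>v<N. lst (M CNT 0) (M NX) (M TG) (M HD v) (adj v)"
    "R = {(u, v). u < N \<and> v \<in> set (adj u)}" "(\<Sum>u<N. length (adj u)) \<le> c"
    unfolding graph_def by (elim conjE exE)
  moreover from this(4) \<open>c \<le> c'\<close> have "(\<Sum>u<N. length (adj u)) \<le> c'" by (rule order_trans)
  ultimately show ?thesis unfolding graph_def by (intro conjI exI[of _ adj])
qed

context program_data
begin

lemma ho_record_labels:
  assumes s: "static M" and k: "M LV 0 = k" "k \<le> n"
  shows "ho record_labels M (V * 3 + E * 5 + 4) (\<lambda>M'.
    (\<forall>q<V. M' CP (q * n + q + k) = M LB q - 1) \<and>
    (\<forall>q<V. \<forall>l<k. M' CP (q * n + q + l) = M CP (q * n + q + l)) \<and>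
    (\<forall>e<E. M' EA e \<noteq> 0 \<longleftrightarrow> M EA e \<noteq> 0 \<and> M LB (src e) = M LB (dst e)))" (is "ho _ _ _ ?Q")
  unfolding record_labels_def
proof (rule ho_Seq[where ?b1.0 = "V * 3 + 2" and ?b2.0 = "E * 5 + 2" and
      R = "\<lambda>M'. \<forall>q<V. \<forall>l\<le>k. M' CP (q * n + q + l) = (if l = k then M LB q - 1 else M CP (q * n + q + l))"])
  have inj: "q * n + q + l = q' * n + q' + l' \<longleftrightarrow> q = q' \<and> l = l'" if "l \<le> n" "l' \<le> n" for q q' l l'
    using index_inj[of l "Suc n" l' q q'] that by (simp add: add.commute[of _ "_ * n"])
  show "ho (For QQ (Var VN) (Write CP (Read TN (Var QQ) + Var QQ + Var LV) (Read LB (Var QQ) - Const 1))) M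
    (V * 3 + 2) (\<lambda>M'. \<forall>q<V. \<forall>l\<le>k. M' CP (q * n + q + l) = (if l = k then M LB q - 1 else M CP (q * n + q + l)))"
  proof (rule ho_For[where k = V and b = 1 and I = "\<lambda>i M'. \<forall>q<V. \<forall>l\<le>k. M' CP (q * n + q + l) =
      (if l = k \<and> q < i then M LB q - 1 else M CP (q * n + q + l))"], goal_cases)
    case (5 i M')
    have "M' LV 0 = k" "M' TN i = i * n" "M' LB i = M LB i"
      using 5(1) 5(3)[of LV] 5(3)[of TN] 5(3)[of LB] k TN[OF s, of i] limit by auto
    then show ?case using 5(2,4) k by (intro ho_loop_free) (auto simp: inj less_Suc_eq)
  qed (use s in \<open>auto simp: static_def\<close>)
next
  fix M1 assume 1: "\<forall>q<V. \<forall>l\<le>k. M1 CP (q * n + q + l) = (if l = k then M LB q - 1 else M CP (q * n + q + l))"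
    and fr: "\<And>a. a \<notin> mods (For QQ (Var VN) (Write CP (Read TN (Var QQ) + Var QQ + Var LV) (Read LB (Var QQ) - Const 1))) \<Longrightarrow>
      M1 a = M a"
  have s1: "static M1" by (rule static_cong[OF s]) (use fr in auto)
  show "ho (For EI (Var EN) (If (Read EA (Var EI))
       (If ((Read LB (Read ES (Var EI)) - Read LB (Read ED (Var EI))) +
            (Read LB (Read ED (Var EI)) - Read LB (Read ES (Var EI))))
         (Write EA (Var EI) (Const 0)) Skip) Skip)) M1 (E * 5 + 2) ?Q"
  proof (rule ho_For[where k = E and b = 3 and I = "\<lambda>i M'. \<forall>e<E. M' EA e \<noteq> 0 \<longleftrightarrow> M EA e \<noteq> 0 \<and>
      (e < i \<longrightarrow> M LB (src e) = M LB (dst e))"], goal_cases)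
    case (5 i M')
    have "M' ES i = src i" "M' ED i = dst i" "M' LB = M LB"
      using 5(1) 5(3)[of ES] 5(3)[of ED] 5(3)[of LB] fr[of LB] s1 by (auto simp: static_def)
    then show ?case using 5(1,2,4) by (intro ho_loop_free) (auto simp: less_Suc_eq)
  next
    case (6 M')
    then show ?case using 1 6(2)[of CP] by auto
  qed (use s1 fr[of EA] in \<open>auto simp: static_def\<close>)
qed simp

section \<open>Unsafety as reachability\<close>

definition unsafe_edges :: "(nat \<Rightarrow> nat \<Rightarrow> nat) \<Rightarrow> nat \<Rightarrow> nat set \<Rightarrow> (nat \<Rightarrow> nat \<Rightarrow> nat) \<Rightarrow> nat rel" where
  "unsafe_edges vv k act T =
     {(if T e i = 0 then V * n else dst e * n + (T e i - 1), src e * n + i) | e i. e \<in> act \<and> i < n} \<union>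
     {(V * n, q * n + i) | q i. q < V \<and> i < n \<and> fixed vv k q i}"

text \<open>Edges lead from a cause of unsafety to its consequence, so each rule of
  \<open>unsafe\<close> is one edge: from the extra node for \<open>fixed\<close> and
  \<open>dead\<close>, and from the target variable for \<open>pred\<close>. No pair has the number
  \<open>V * n\<close>, so the extra node is not confused with a variable.\<close>

lemma unsafe_reachable:
  assumes act: "act \<subseteq> {..<E}" and T: "\<And>e i. e \<in> act \<Longrightarrow> i < n \<Longrightarrow> T e i \<le> n" and qi: "q < V" "i < n"
  shows "unsafe vv k act T q i \<longleftrightarrow> (V * n, q * n + i) \<in> (unsafe_edges vv k act T)\<^sup>*"
proof
  assume "unsafe vv k act T q i"
  then show "(V * n, q * n + i) \<in> (unsafe_edges vv k act T)\<^sup>*"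
  proof (induction rule: unsafe.induct)
    case (fixed q i)
    then show ?case by (auto simp: unsafe_edges_def)
  next
    case (dead e i)
    then have "(V * n, src e * n + i) \<in> unsafe_edges vv k act T" unfolding unsafe_edges_def by force
    then show ?case by auto
  next
    case (pred e i j)
    then have "(dst e * n + j, src e * n + i) \<in> unsafe_edges vv k act T" unfolding unsafe_edges_def by force
    then show ?case using pred.IH by auto
  qed
next
  have lt: "q * n + i < V * n" if "q < V" "i < n" for q i using index_less[OF that] .
  have "\<forall>q<V. \<forall>i<n. x = q * n + i \<longrightarrow> unsafe vv k act T q i" if "(V * n, x) \<in> (unsafe_edges vv k act T)\<^sup>*" for x
    using that
  proof (induction rule: rtrancl_induct)
    case base
    then show ?case using lt by fastforce
  next
    case (step y z)
    show ?case
    proof (intro allI impI)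
      fix q i assume qi: "q < V" "i < n" "z = q * n + i"
      from step.hyps(2) consider
        (a) e j where "y = (if T e j = 0 then V * n else dst e * n + (T e j - 1))" "z = src e * n + j" "e \<in> act" "j < n"
        | (b) q' i' where "z = q' * n + i'" "q' < V" "i' < n" "fixed vv k q' i'"
        unfolding unsafe_edges_def by blast
      then show "unsafe vv k act T q i"
      proof cases
        case a
        then have e: "q = src e" "i = j" using qi by (auto simp: index_inj)
        show ?thesis
        proof (cases "T e j")
          case 0
          then show ?thesis using a e unsafe.dead by blast
        next
          case (Suc t)
          then have "t < n" "dst e < V" using T[OF a(3,4)] act a(3) ends by auto
          then have "unsafe vv k act T (dst e) t" using step.IH a(1) Suc by auto
          then show ?thesis using a e Suc unsafe.pred by blast
        qed
      next
        case b
        then have "q' = q" "i' = i" using qi by (auto simp: index_inj)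
        then show ?thesis using b unsafe.fixed by blast
      qed
    qed
  qed
  then show "(V * n, q * n + i) \<in> (unsafe_edges vv k act T)\<^sup>* \<Longrightarrow> unsafe vv k act T q i" using qi by blast
qed

lemma ho_target_edges:
  assumes s: "static M" and g: "graph M N {} 0" and N: "N = V * n + 1" and DV: "M DV 0 = V * n"
    and act: "act = {e. e < E \<and> M EA e \<noteq> 0}" and T: "\<And>e i. e \<in> act \<Longrightarrow> i < n \<Longrightarrow> M TT (e * n + i) = T e i \<and> T e i \<le> n"
  shows "ho target_edges M (E * (n * 8 + 5) + 2) (\<lambda>M'. graph M' N
    {(if T e i = 0 then V * n else dst e * n + (T e i - 1), src e * n + i) | e i. e \<in> act \<and> i < n} (E * n))"
proof -
  define x where "x e i = (if T e i = 0 then V * n else dst e * n + (T e i - 1), src e * n + i)" for e i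
  let ?R = "\<lambda>j. {x e i | e i. e \<in> act \<and> e < j \<and> i < n}"
  have "ho target_edges M (E * (n * 8 + 5) + 2) (\<lambda>M'. graph M' N (?R E) (E * n))"
    unfolding target_edges_def
  proof (rule ho_For[where k = E and b = "n * 8 + 3" and I = "\<lambda>j M'. graph M' N (?R j) (j * n)"], goal_cases)
    case (3 i j M')
    show ?case by (simp add: graph_def)
  next
    case (5 j M1)
    have fr1: "a \<notin> {EI, I, C, HD, NX, TG, CNT} \<Longrightarrow> M1 a = M a" for a using 5(3)[of a] by simp
    have R: "?R (Suc j) = ?R j \<union> (if j \<in> act then {x j i | i. i < n} else {})"
      by (auto simp: less_Suc_eq)
    show ?case
    proof (rule ho_If[where b = "n * 8 + 2"])
      assume "eval_exp (Read EA (Var EI)) M1 = 0"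
      then have "j \<notin> act" using act 5(2) fr1[of EA] by simp
      then show "ho Skip M1 (n * 8 + 2) (\<lambda>M'. graph M' N (?R (Suc j)) (Suc j * n))"
        using 5(4) R by (intro ho_loop_free) (auto simp: graph_def)
    next
      assume "eval_exp (Read EA (Var EI)) M1 \<noteq> 0"
      then have j: "j \<in> act" using act 5(1,2) fr1[of EA] by simp
      show "ho (For I (Var NN) target_edge) M1 (n * 8 + 2) (\<lambda>M'. graph M' N (?R (Suc j)) (Suc j * n))"
      proof (rule ho_For[where k = n and b = 6 and I = "\<lambda>i M'. graph M' N (?R j \<union> {x j i' | i'. i' < i}) (j * n + i)"],
          goal_cases)
        case (3 i j M')
        show ?case by (simp add: graph_def)
      next
        case (5 i M2)
        have fr2: "a \<notin> {EI, I, C, HD, NX, TG, CNT} \<Longrightarrow> M2 a = M a" for a using 5(3)[of a] fr1[of a] by simp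
        have s2: "static M2" by (rule static_cong[OF s]) (use fr2 in auto)
        have jE: "j < E" "src j < V" "dst j < V" using j act ends by auto
        have vals: "M2 EI 0 = j" "M2 I 0 = i" "M2 TN j = j * n" "M2 TT (j * n + i) = T j i" "M2 ES j = src j"
          "M2 ED j = dst j" "M2 TN (src j) = src j * n" "M2 TN (dst j) = dst j * n" "M2 DV 0 = V * n"
          using 5(1,2) 5(3)[of EI] \<open>M1 EI 0 = j\<close> fr2 TN[OF s2] limit T[OF j 5(1)] jE DV s2
          by (auto simp: static_def)
        define M3 where "M3 = sem (Set C (Read TT (Read TN (Var EI) + Var I))) M2"
        have v3: "M3 C 0 = T j i" "a \<noteq> C \<Longrightarrow> M3 a = M2 a" for a using vals by (auto simp: M3_def)
        have lt: "q * n + i < N" if "q < V" "i < n" for q i using index_less[OF that] N by simp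
        have g3: "graph M3 N (?R j \<union> {x j i' | i'. i' < i}) (j * n + i)"
          using 5(4) by (rule graph_cong) (auto simp: v3)
        have "graph (sem target_edge M2) N (insert (x j i) (?R j \<union> {x j i' | i'. i' < i})) (Suc (j * n + i))"
        proof (cases "T j i = 0")
          case True
          have "graph (sem (add_edge (Var DV) (Read TN (Read ES (Var EI)) + Var I)) M3) N
            (insert (V * n, src j * n + i) (?R j \<union> {x j i' | i'. i' < i})) (Suc (j * n + i))"
            by (rule graph_add_edge[OF g3]) (use N lt jE 5(1) v3 vals in auto)
          then show ?thesis using True v3 by (simp add: target_edge_def M3_def x_def)
        next
          case False
          then have t: "T j i - 1 < n" using T[OF j 5(1)] by linarith
          have "graph (sem (add_edge (Read TN (Read ED (Var EI)) + (Var C - Const 1)) (Read TN (Read ES (Var EI)) + Var I)) M3) N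
            (insert (dst j * n + (T j i - 1), src j * n + i) (?R j \<union> {x j i' | i'. i' < i})) (Suc (j * n + i))"
            by (rule graph_add_edge[OF g3]) (use N lt[OF _ t] lt jE 5(1) v3 vals in auto)
          then show ?thesis using False v3 by (simp add: target_edge_def M3_def x_def)
        qed
        moreover have "insert (x j i) (?R j \<union> {x j i' | i'. i' < i}) = ?R j \<union> {x j i' | i'. i' < Suc i}"
          by (auto simp: less_Suc_eq)
        ultimately show ?case by (intro ho_loop_free) simp_all
      next
        case (6 M')
        then show ?case using R j by (simp add: add.commute)
      qed (use 5(4) s fr1 in \<open>auto simp: static_def\<close>)
    qed simp
  qed (use s g in \<open>auto simp: static_def\<close>)
  moreover have "?R E = {x e i | e i. e \<in> act \<and> i < n}" using act by auto
  ultimately show ?thesis by (simp add: x_def)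
qed

lemma ho_fixed_edges:
  assumes s: "static M" and vv: "vv_mem M vv k" and g: "graph M N R0 c" and N: "N = V * n + 1"
    and DV: "M DV 0 = V * n"
  shows "ho fixed_edges M (V * (n * (k * 9 + 4) + 4) + 2) (\<lambda>M'. graph M' N
    (R0 \<union> {(V * n, q * n + i) | q i. q < V \<and> i < n \<and> fixed vv k q i}) (c + V * (n * k)))"
proof -
  \<comment> \<open>Invariants of the three nested loops: \<open>?R\<close> collects the edges of
    the nodes done, \<open>?P\<close> those of the variables done at the current node, and
    \<open>?S\<close> those of the levels done for the current variable.\<close>
  let ?S = "\<lambda>q i h. {(V * n, q * n + i) | l. l < h \<and> rk q i = rk q (vv l q - 1)}"
  let ?R = "\<lambda>q. R0 \<union> {(V * n, q' * n + i) | q' i. q' < q \<and> i < n \<and> fixed vv k q' i}"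
  let ?P = "\<lambda>q i. {(V * n, q * n + i') | i'. i' < i \<and> fixed vv k q i'}"
  have gc: "graph M' N R c \<Longrightarrow> R = R' \<Longrightarrow> c \<le> c' \<Longrightarrow> graph M' N R' c'" for M' R R' c c'
    using graph_mono by simp
  have gw: "a \<notin> {HD, NX, TG, CNT} \<Longrightarrow> graph (wr M' a 0 j) N R c = graph M' N R c" for M' a j R c
    by (simp add: graph_def)
  have kn: "k \<le> n" using vv by (simp add: vv_mem_def)
  show ?thesis
    unfolding fixed_edges_def
  proof (rule ho_For[where k = V and b = "n * (k * 9 + 4) + 2" and I = "\<lambda>q M'. graph M' N (?R q) (c + q * (n * k))"],
      goal_cases)
    case (5 q M1)
    have fr1: "a \<notin> {QQ, I, H, A, B, HD, NX, TG, CNT} \<Longrightarrow> M1 a = M a" for a using 5(3)[of a] by simp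
    have q: "q < V" "M1 QQ 0 = q" by fact+
    show ?case
    proof (rule ho_For[where k = n and b = "k * 9 + 2" and
          I = "\<lambda>i M'. graph M' N (?R q \<union> ?P q i) (c + q * (n * k) + i * k)"], goal_cases)
      case (5 i M2)
      have fr2: "a \<notin> {QQ, I, H, A, B, HD, NX, TG, CNT} \<Longrightarrow> M2 a = M a" for a using 5(3)[of a] fr1[of a] by simp
      have i: "i < n" "M2 I 0 = i" "M2 QQ 0 = q" using 5(1,2) 5(3)[of QQ] q by auto
      show ?case
      proof (rule ho_For[where k = k and b = 7 and
            I = "\<lambda>h M'. graph M' N (?R q \<union> ?P q i \<union> ?S q i h) (c + q * (n * k) + i * k + h)"], goal_cases)
        case (5 h M3)
        have fr3: "a \<notin> {QQ, I, H, A, B, HD, NX, TG, CNT} \<Longrightarrow> M3 a = M a" for a using 5(3)[of a] fr2[of a] by simp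
        have s3: "static M3" by (rule static_cong[OF s]) (use fr3 in auto)
        have vv3: "vv_mem M3 vv k" by (rule vv_mem_cong[OF vv]) (use fr3 in auto)
        have iq: "M3 I 0 = i" "M3 QQ 0 = q" "M3 H 0 = h" using 5(2) 5(3)[of I] 5(3)[of QQ] i by auto
        have vq: "vv h q \<le> n" "M3 VV (q * n + q + h) = vv h q" using vv3 q 5(1) by (auto simp: vv_mem_def)
        have lt: "vv h q - 1 < n" using vq n1 by linarith
        have vals: "M3 TN q = q * n" "M3 RK (M3 QR q + i) = rk q i"
          "M3 RK (M3 QR q + (vv h q - 1)) = rk q (vv h q - 1)" "M3 DV 0 = V * n"
          using s3 q i lt TN[OF s3] limit fr3 DV by (auto simp: static_def)
        define M4 where "M4 = sem (Set A (rank_exp QQ (Var I)) ;;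
          Set B (rank_exp QQ (Read VV (Read TN (Var QQ) + Var QQ + Var H) - Const 1))) M3"
        have v4: "M4 A 0 = rk q i" "M4 B 0 = rk q (vv h q - 1)" "a \<notin> {A, B} \<Longrightarrow> M4 a = M3 a" for a
          using vals iq vq by (auto simp: M4_def rank_exp_def)
        have g4: "graph M4 N (?R q \<union> ?P q i \<union> ?S q i h) (c + q * (n * k) + i * k + h)"
          using 5(4) by (rule graph_cong) (auto simp: v4)
        have sq: "sem fixed_edge M3 = (if rk q i = rk q (vv h q - 1)
            then sem (add_edge (Var DV) (Read TN (Var QQ) + Var I)) M4 else M4)"
          using v4(1,2) unfolding fixed_edge_def M4_def by auto
        have "graph (sem fixed_edge M3) N (?R q \<union> ?P q i \<union> ?S q i (Suc h)) (c + q * (n * k) + i * k + Suc h)"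
        proof (cases "rk q i = rk q (vv h q - 1)")
          case True
          have "graph (sem (add_edge (Var DV) (Read TN (Var QQ) + Var I)) M4) N
            (insert (V * n, q * n + i) (?R q \<union> ?P q i \<union> ?S q i h)) (Suc (c + q * (n * k) + i * k + h))"
            by (rule graph_add_edge[OF g4]) (use N index_less[OF q(1) i(1)] v4 vals iq in auto)
          then show ?thesis unfolding sq using True by (auto simp: less_Suc_eq elim!: gc)
        next
          case False
          then show ?thesis unfolding sq using g4 by (auto simp: less_Suc_eq elim!: gc)
        qed
        then show ?case by (intro ho_loop_free) simp_all
      next
        case (6 M')
        have "?S q i k = (if fixed vv k q i then {(V * n, q * n + i)} else {})" by (auto simp: fixed_def)
        then have "?R q \<union> ?P q i \<union> ?S q i k = ?R q \<union> ?P q (Suc i)" by (auto simp: less_Suc_eq)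
        then show ?case using 6(1) by (elim gc) auto
      next
        case 4
        show ?case by (rule gc[OF \<open>graph M2 N (?R q \<union> ?P q i) (c + q * (n * k) + i * k)\<close>]) auto
      next
        case 2
        then show ?case using fr2 vv by (simp add: vv_mem_def)
      qed (auto simp: gw)
    next
      case (6 M')
      have "?R q \<union> ?P q n = ?R (Suc q)" by (auto simp: less_Suc_eq)
      then show ?case using 6(1) by (elim gc) (auto simp: algebra_simps)
    next
      case 4
      show ?case by (rule gc[OF \<open>graph M1 N (?R q) (c + q * (n * k))\<close>]) auto
    next
      case 2
      then show ?case using fr1 s by (simp add: static_def)
    qed (auto simp: gw algebra_simps)
  next
    case 4
    show ?case by (rule gc[OF g]) auto
  qed (use s in \<open>auto simp: gw static_def algebra_simps\<close>)
qed

end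

context program_data
begin

lemma ho_unsafe_search:
  assumes s: "static M" and vv: "vv_mem M vv k"
    and act: "act = {e. e < E \<and> M EA e \<noteq> 0}"
    and T: "\<And>e i. e \<in> act \<Longrightarrow> i < n \<Longrightarrow> M TT (e * n + i) = T e i \<and> T e i \<le> n"
  shows "ho unsafe_search M (E * (n * 18 + 5) + V * (n * (k * 19 + 18) + 4) + 40)
    (\<lambda>M'. \<forall>q<V. \<forall>i<n. M' LB (q * n + i) \<noteq> 0 \<longleftrightarrow> unsafe vv k act T q i)" (is "ho _ _ _ ?Q")
proof -
  let ?N = "V * n + 1"
  let ?R1 = "{(if T e i = 0 then V * n else dst e * n + (T e i - 1), src e * n + i) | e i. e \<in> act \<and> i < n}"
  let ?c = "E * n + V * (n * k)"
  let ?d = "10 * (?c + ?N + 1) + 4"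
  define M1 where "M1 = sem (Set DV (Read TN (Var VN)) ;; Set GN (Var DV + Const 1)) M"
  have M1: "M1 DV 0 = V * n" "M1 GN 0 = ?N" "a \<notin> {DV, GN} \<Longrightarrow> M1 a = M a" for a
    using s TN[OF s, of V] limit by (auto simp: M1_def static_def)
  have "ho (clear ;; target_edges ;; fixed_edges ;; Write RT (Const 0) (Var DV) ;; Set NR (Const 1) ;; dfs) M1
    (?N * 4 + 3 + (E * (n * 8 + 5) + 2 + (V * (n * (k * 9 + 4) + 4) + 2 + (2 + ?d)))) ?Q"
  proof (rule ho_Seq[OF ho_clear[where M = M1 and N = ?N, OF M1(2)]])
    fix M2 assume 2: "graph M2 ?N {} 0 \<and> (\<forall>v<?N. M2 LB v = 0)" and fr2: "\<And>a. a \<notin> mods clear \<Longrightarrow> M2 a = M1 a"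
    have s2: "static M2" by (rule static_cong[OF s]) (use fr2 M1 in auto)
    have g2: "graph M2 ?N {} 0" using 2 by blast
    have DV2: "M2 DV 0 = V * n" using fr2 M1 by simp
    have act2: "act = {e. e < E \<and> M2 EA e \<noteq> 0}" using act fr2 M1 by simp
    have T2: "\<And>e i. e \<in> act \<Longrightarrow> i < n \<Longrightarrow> M2 TT (e * n + i) = T e i \<and> T e i \<le> n" using T fr2 M1 by simp
    show "ho (target_edges ;; fixed_edges ;; Write RT (Const 0) (Var DV) ;; Set NR (Const 1) ;; dfs) M2
      (E * (n * 8 + 5) + 2 + (V * (n * (k * 9 + 4) + 4) + 2 + (2 + ?d))) ?Q"
    proof (rule ho_Seq[OF ho_target_edges[OF s2 g2 refl DV2 act2 T2]])
      fix M3 assume 3: "graph M3 ?N ?R1 (E * n)" and fr3: "\<And>a. a \<notin> mods target_edges \<Longrightarrow> M3 a = M2 a"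
      have s3: "static M3" by (rule static_cong[OF s2]) (use fr3 in auto)
      have vv3: "vv_mem M3 vv k" by (rule vv_mem_cong[OF vv]) (use fr3 fr2 M1 in auto)
      have DV3: "M3 DV 0 = V * n" using fr3 DV2 by simp
      show "ho (fixed_edges ;; Write RT (Const 0) (Var DV) ;; Set NR (Const 1) ;; dfs) M3
        (V * (n * (k * 9 + 4) + 4) + 2 + (2 + ?d)) ?Q"
      proof (rule ho_Seq[OF ho_fixed_edges[OF s3 vv3 3 refl DV3]])
        fix M4 assume "graph M4 ?N (?R1 \<union> {(V * n, q * n + i) | q i. q < V \<and> i < n \<and> fixed vv k q i}) ?c"
          and fr4: "\<And>a. a \<notin> mods fixed_edges \<Longrightarrow> M4 a = M3 a"
        then have g4: "graph M4 ?N (unsafe_edges vv k act T) ?c" by (simp add: unsafe_edges_def)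
        define M5 where "M5 = sem (Write RT (Const 0) (Var DV) ;; Set NR (Const 1)) M4"
        have g5: "graph M5 ?N (unsafe_edges vv k act T) ?c"
          using g4 by (rule graph_cong) (auto simp: M5_def)
        have DV4: "M4 DV 0 = V * n" using fr4 DV3 by simp
        have main: "ho dfs M5 ?d ?Q"
        proof (rule ho_conseq[OF ho_dfs_graph[OF g5, of "[V * n]"]])
          show "M5 LB v = 0" if "v < ?N" for v using 2 fr3 fr4 that by (simp add: M5_def)
          show "M5 NR 0 = length [V * n]" "\<And>i. i < length [V * n] \<Longrightarrow> M5 RT i = [V * n] ! i"
            using DV4 by (auto simp: M5_def)
          show "set [V * n] \<subseteq> {..<?N}" by simp
          fix M6 assume "\<exists>post. dfs_post ?N (unsafe_edges vv k act T) [V * n] post (M6 LB) \<and>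
            (\<forall>i<length post. M6 PO i = post ! i)"
          then obtain post where p: "dfs_post ?N (unsafe_edges vv k act T) [V * n] post (M6 LB)" by blast
          show "?Q M6"
          proof (intro allI impI)
            fix q i assume qi: "q < V" "i < n"
            have lt: "q * n + i < ?N" "V * n < ?N" using index_less[OF qi] by simp_all
            have sub: "act \<subseteq> {..<E}" using act by auto
            show "M6 LB (q * n + i) \<noteq> 0 \<longleftrightarrow> unsafe vv k act T q i"
              using reachable_labels[OF p lt(2,1)] unsafe_reachable[OF sub _ qi, of T vv k] T by blast
          qed
        qed simp_all
        show "ho (Write RT (Const 0) (Var DV) ;; Set NR (Const 1) ;; dfs) M4 (2 + ?d) ?Q"
          by (rule ho_Seq_loop_free[OF _ ho_Seq_loop_free[OF _ main[unfolded M5_def sem.simps(3)] order_refl]]) simp_all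
      qed simp_all
    qed simp_all
  qed simp_all
  note main = this[unfolded M1_def sem.simps(3)]
  have "ho unsafe_search M (2 + (?N * 4 + 3 + (E * (n * 8 + 5) + 2 + (V * (n * (k * 9 + 4) + 4) + 2 + (2 + ?d))))) ?Q"
    unfolding unsafe_search_def
    by (rule ho_Seq_loop_free[OF _ ho_Seq_loop_free[OF _ main order_refl]]) simp_all
  then show ?thesis by (rule ho_conseq) (simp_all add: algebra_simps)
qed

lemma ho_choose_vars:
  assumes s: "static M" and k: "M LV 0 = k" "k \<le> n"
  shows "ho choose_vars M (V * (n * 6 + 6) + 2) (\<lambda>M'.
    (\<forall>q<V. \<forall>l<k. M' VV (q * n + q + l) = M VV (q * n + q + l)) \<and>
    (\<forall>q<V. let v = M' VV (q * n + q + k); U = \<lambda>i. M LB (q * n + i) \<noteq> 0 in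
       v \<le> n \<and> (v = 0 \<longrightarrow> (\<forall>i<n. U i)) \<and>
       (v \<noteq> 0 \<longrightarrow> \<not> U (v - 1) \<and> (\<forall>j<n. \<not> U j \<longrightarrow> rk q (v - 1) \<le> rk q j))))"
proof -
  define U where "U q i \<longleftrightarrow> M LB (q * n + i) \<noteq> 0" for q i
  define best where "best q j v \<longleftrightarrow> v \<le> j \<and> (v = 0 \<longrightarrow> (\<forall>i<j. U q i)) \<and>
       (v \<noteq> 0 \<longrightarrow> \<not> U q (v - 1) \<and> (\<forall>i<j. \<not> U q i \<longrightarrow> rk q (v - 1) \<le> rk q i))" for q j v
  have inj: "q * n + q + l = q' * n + q' + l' \<longleftrightarrow> q = q' \<and> l = l'" if "l \<le> n" "l' \<le> n" for q q' l l'
    using index_inj[of l "Suc n" l' q q'] that by (simp add: add.commute[of _ "_ * n"])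
  have "ho choose_vars M (V * (n * 6 + 6) + 2) (\<lambda>M'.
    (\<forall>q<V. \<forall>l<k. M' VV (q * n + q + l) = M VV (q * n + q + l)) \<and>
    (\<forall>q<V. best q n (M' VV (q * n + q + k))))"
    unfolding choose_vars_def
  proof (rule ho_For[where k = V and b = "n * 6 + 4" and I = "\<lambda>q0 M'.
      (\<forall>q<V. \<forall>l<k. M' VV (q * n + q + l) = M VV (q * n + q + l)) \<and>
      (\<forall>q<q0. best q n (M' VV (q * n + q + k)))"], goal_cases)
    case (5 q M1)
    have fr1: "a \<notin> {QQ, BS, I, VV} \<Longrightarrow> M1 a = M a" for a using 5(3)[of a] by simp
    let ?M = "sem (Set BS (Const 0)) M1"
    have "ho (For I (Var NN) choose_entry) ?M (n * 6 + 2) (\<lambda>M'. best q n (M' BS 0))"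
    proof (rule ho_For[where k = n and b = 4 and I = "\<lambda>j M'. best q j (M' BS 0)"], goal_cases)
      case (5 j M2)
      have fr2: "a \<notin> {QQ, BS, I, VV} \<Longrightarrow> M2 a = M a" for a using 5(3)[of a] fr1[of a] by simp
      have s2: "static M2" by (rule static_cong[OF s]) (use fr2 in auto)
      have q: "M2 QQ 0 = q" "q < V" using 5(3)[of QQ] \<open>M1 QQ 0 = q\<close> \<open>q < V\<close> by auto
      have v: "M2 I 0 = j" "M2 TN q = q * n" "M2 LB = M LB" using 5(2) TN[OF s2] q limit fr2 by auto
      have b: "best q j (M2 BS 0)" by (rule 5(4))
      have rkv: "M2 RK (M2 QR q + i) = rk q i" if "i < n" for i using s2 q that by (simp add: static_def)
      have c: "M2 BS 0 - 1 < n" using b 5(1) n1 by (auto simp: best_def)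
      have "best q (Suc j) (sem choose_entry M2 BS 0)"
      proof (cases "U q j")
        case True
        then have "sem choose_entry M2 BS 0 = M2 BS 0" by (simp add: choose_entry_def q v U_def)
        then show ?thesis using b True by (auto simp: best_def less_Suc_eq)
      next
        case False
        then have "sem choose_entry M2 BS 0 =
          (if M2 BS 0 \<noteq> 0 \<and> rk q (M2 BS 0 - 1) \<le> rk q j then M2 BS 0 else Suc j)"
          using rkv[OF c] rkv[OF 5(1)] by (auto simp: choose_entry_def q v U_def rank_exp_def)
        then show ?thesis using b False by (auto simp: best_def less_Suc_eq)
      qed
      then show ?case by (intro ho_loop_free) simp_all
    qed (use s fr1 in \<open>auto simp: static_def best_def\<close>)
    then have "ho (For I (Var NN) choose_entry ;; Write VV (Read TN (Var QQ) + Var QQ + Var LV) (Var BS)) ?M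
      (n * 6 + 2 + 1) (\<lambda>M'. (\<forall>q'<V. \<forall>l<k. M' VV (q' * n + q' + l) = M VV (q' * n + q' + l)) \<and>
        (\<forall>q'<Suc q. best q' n (M' VV (q' * n + q' + k))))"
    proof (rule ho_Seq)
      fix M3 assume b: "best q n (M3 BS 0)" and fr3: "\<And>a. a \<notin> mods (For I (Var NN) choose_entry) \<Longrightarrow> M3 a = ?M a"
      have v: "M3 QQ 0 = q" "M3 TN q = q * n" "M3 LV 0 = k" "M3 VV = M1 VV"
        using fr3 fr1 5(1,2) TN[OF s] limit k by auto
      show "ho (Write VV (Read TN (Var QQ) + Var QQ + Var LV) (Var BS)) M3 1
        (\<lambda>M'. (\<forall>q'<V. \<forall>l<k. M' VV (q' * n + q' + l) = M VV (q' * n + q' + l)) \<and>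
        (\<forall>q'<Suc q. best q' n (M' VV (q' * n + q' + k))))"
        using 5(4) b k by (intro ho_loop_free) (auto simp: v inj inj[of 0 0, simplified] less_Suc_eq)
    qed simp
    then show ?case by (rule ho_Seq_loop_free[rotated]) simp_all
  qed (use s in \<open>auto simp: static_def\<close>)
  then show ?thesis by (rule ho_conseq) (simp_all add: best_def U_def Let_def)
qed

section \<open>Appending a level to those already built\<close>

lemma lmat_cong:
  "(\<And>l q. l < k \<Longrightarrow> vv' l q = vv l q) \<Longrightarrow> lmat vv' k = lmat vv k"
  unfolding lmat_def by (intro ext) (auto cong: conj_cong)

lemma fixed_cong:
  assumes "\<And>l q. l < k \<Longrightarrow> vv' l q = vv l q"
  shows "fixed vv' k = fixed vv k"
proof (intro ext)
  fix q i show "fixed vv' k q i = fixed vv k q i" unfolding fixed_def by (metis assms)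
qed

lemma unsafe_cong:
  assumes "\<And>l q. l < k \<Longrightarrow> vv' l q = vv l q"
  shows "unsafe vv' k act T = unsafe vv k act T"
proof -
  have f: "fixed vv' k = fixed vv k" by (rule fixed_cong) (rule assms)
  have "unsafe vv' k act T q i \<Longrightarrow> unsafe vv k act T q i" for q i
    by (induction rule: unsafe.induct) (auto simp: f intro: unsafe.intros)
  moreover have "unsafe vv k act T q i \<Longrightarrow> unsafe vv' k act T q i" for q i
    by (induction rule: unsafe.induct) (auto simp: f intro: unsafe.intros)
  ultimately show ?thesis by blast
qed

text \<open>A level refers only to the variables chosen up to it, so entering the results of a later
  level leaves it valid.\<close>

lemma is_level_cong:
  assumes "As' l = As l" "As' (Suc l) = As (Suc l)" "\<And>q. cp' l q = cp l q"
    and "\<And>l' q. l' \<le> l \<Longrightarrow> vv' l' q = vv l' q"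
  shows "is_level l As' cp' vv' T = is_level l As cp vv T"
proof -
  have c: "\<And>l' q. l' < l \<Longrightarrow> vv' l' q = vv l' q" using assms(4) by simp
  have "lmat vv' l = lmat vv l" "unsafe vv' l A T = unsafe vv l A T" for A
    by (intro lmat_cong unsafe_cong c; assumption)+
  then show ?thesis unfolding is_level_def by (simp add: assms)
qed

definition levels_done :: "nat \<Rightarrow> mem \<Rightarrow> bool" where
  "levels_done k M \<longleftrightarrow> (\<exists>As cp vv T. As 0 = {..<E} \<and> (\<forall>l<k. is_level l As cp vv (T l)) \<and>
     As k = {e. e < E \<and> M EA e \<noteq> 0} \<and>
     (\<forall>q<V. \<forall>l<k. vv l q \<le> n \<and> M VV (q * n + q + l) = vv l q \<and> M CP (q * n + q + l) = cp l q))"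

definition level_cost :: nat where
  "level_cost = E * (arc_cost + n * 18 + 100) + V * (n * (n * 19 + 30) + 100) + 200"

lemma ho_level_body:
  assumes s: "static M" and k: "M LV 0 = k" "k \<le> n" and d: "levels_done k M"
  shows "ho level_body M level_cost (levels_done (Suc k))"
proof -
  obtain As cp vv T where L': "As 0 = {..<E}" "\<forall>l<k. is_level l As cp vv (T l)"
    "As k = {e. e < E \<and> M EA e \<noteq> 0}"
    "\<forall>q<V. \<forall>l<k. vv l q \<le> n \<and> M VV (q * n + q + l) = vv l q \<and> M CP (q * n + q + l) = cp l q"
    using d unfolding levels_done_def by (elim exE conjE)
  then have L: "As 0 = {..<E}" "\<And>l. l < k \<Longrightarrow> is_level l As cp vv (T l)"
    "As k = {e. e < E \<and> M EA e \<noteq> 0}"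
    "\<And>q l. q < V \<Longrightarrow> l < k \<Longrightarrow> vv l q \<le> n \<and> M VV (q * n + q + l) = vv l q \<and> M CP (q * n + q + l) = cp l q"
    by simp_all
  have vv: "vv_mem M vv k" using k L(4) by (auto simp: vv_mem_def)
  let ?m = "lmat vv k"
  define Bk where "Bk = {e \<in> As k. consistent (2*n) (?m e)}"
  let ?Q = "levels_done (Suc k)"
  let ?c1 = "E * (arc_cost + 2) + 2" and ?c2 = "17 * E + 27 * V + 20" and ?c3 = "V * 3 + E * 5 + 4"
  let ?c4 = "E * (n * 18 + 5) + V * (n * (k * 19 + 18) + 4) + 40" and ?c5 = "V * (n * 6 + 6) + 2"
  have "ho level_body M (?c1 + (?c2 + (?c2 + (?c3 + (?c4 + ?c5))))) ?Q"
    unfolding level_body_def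
  proof (rule ho_Seq[OF ho_arc_phase[OF s vv]])
    fix M1 assume 1: "\<forall>e<E. (M1 EA e \<noteq> 0 \<longleftrightarrow> M EA e \<noteq> 0 \<and> consistent (2*n) (?m e)) \<and>
      (M1 EA e \<noteq> 0 \<longrightarrow> (\<forall>i<n. is_target n (?m e) (rk (dst e)) i (M1 TT (e * n + i))))"
      and fr1: "\<And>a. a \<notin> mods arc_phase \<Longrightarrow> M1 a = M a"
    have s1: "static M1" by (rule static_cong[OF s]) (use fr1 in auto)
    have B1: "{e. e < E \<and> M1 EA e \<noteq> 0} = Bk" using 1 L(3) by (auto simp: Bk_def)
    show "ho (scc1 ;; scc2 ;; record_labels ;; unsafe_search ;; choose_vars) M1
      (?c2 + (?c2 + (?c3 + (?c4 + ?c5)))) ?Q"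
    proof (rule ho_Seq[OF ho_scc1[OF s1]])
      fix M2 assume "M2 GN 0 = V \<and> M2 NR 0 = V \<and> (\<exists>post lab.
          dfs_post V ((arc_rel src dst {e. e < E \<and> M1 EA e \<noteq> 0})\<inverse>) [0..<V] post lab \<and>
          (\<forall>i<length post. M2 PO i = post ! i))" and fr2: "\<And>a. a \<notin> mods scc1 \<Longrightarrow> M2 a = M1 a"
      then obtain post lab where 2: "M2 GN 0 = V" "M2 NR 0 = V"
        "dfs_post V ((arc_rel src dst Bk)\<inverse>) [0..<V] post lab" "\<forall>i<length post. M2 PO i = post ! i"
        using B1 by auto
      have s2: "static M2" by (rule static_cong[OF s1]) (use fr2 in auto)
      have B2: "{e. e < E \<and> M2 EA e \<noteq> 0} = Bk" using B1 fr2 by simp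
      have post: "set post = {..<V}" "length post = V"
      proof -
        obtain adj where a: "dfs_graph V adj [0..<V]" "dfs_graph.dfs_result V adj [0..<V] post lab"
          using 2(3) unfolding dfs_post_def by blast
        note r = a(2)[unfolded dfs_graph.dfs_result_def[OF a(1)]]
        have "lab v \<noteq> 0" if "v < V" for v
        proof -
          have "\<forall>j<length [0..<V]. 0 < lab ([0..<V] ! j)" using r by blast
          then show ?thesis using that by auto
        qed
        then show p: "set post = {..<V}" using r by auto
        show "length post = V" using r p by (metis card_lessThan distinct_card)
      qed
      have PO2: "\<forall>i<V. M2 PO i = post ! i" using 2(4) post by simp
      have sub: "set post \<subseteq> {..<V}" using post by simp
      show "ho (scc2 ;; record_labels ;; unsafe_search ;; choose_vars) M2 (?c2 + (?c3 + (?c4 + ?c5))) ?Q"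
      proof (rule ho_Seq[OF ho_scc2[OF s2 2(1,2) sub post(2) PO2]])
        fix M3 assume "\<exists>post2. dfs_post V (arc_rel src dst {e. e < E \<and> M2 EA e \<noteq> 0}) (rev post) post2 (M3 LB)"
          and fr3: "\<And>a. a \<notin> mods scc2 \<Longrightarrow> M3 a = M2 a"
        then obtain post2 where 3: "dfs_post V (arc_rel src dst Bk) (rev post) post2 (M3 LB)" using B2 by auto
        note lab = scc_labels[OF 2(3) 3]
        have s3: "static M3" by (rule static_cong[OF s2]) (use fr3 in auto)
        have B3: "{e. e < E \<and> M3 EA e \<noteq> 0} = Bk" using B2 fr3 by simp
        have LV3: "M3 LV 0 = k" using fr3 fr2 fr1 k by simp
        define c where "c q = M3 LB q - 1" for q
        have ceq: "c q = c q' \<longleftrightarrow> M3 LB q = M3 LB q'" if "q < V" "q' < V" for q q'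
          using lab(1)[OF that(1)] lab(1)[OF that(2)] by (auto simp: c_def)
        define A' where "A' = {e \<in> Bk. c (src e) = c (dst e)}"
        have BE: "e < E" if "e \<in> Bk" for e using that B3 by auto
        show "ho (record_labels ;; unsafe_search ;; choose_vars) M3 (?c3 + (?c4 + ?c5)) ?Q"
        proof (rule ho_Seq[OF ho_record_labels[OF s3 LV3 k(2)]], elim conjE)
          fix M4 assume 4: "\<forall>q<V. M4 CP (q * n + q + k) = M3 LB q - 1"
            "\<forall>q<V. \<forall>l<k. M4 CP (q * n + q + l) = M3 CP (q * n + q + l)"
            "\<forall>e<E. M4 EA e \<noteq> 0 \<longleftrightarrow> M3 EA e \<noteq> 0 \<and> M3 LB (src e) = M3 LB (dst e)"
            and fr4: "\<And>a. a \<notin> mods record_labels \<Longrightarrow> M4 a = M3 a"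
          have s4: "static M4" by (rule static_cong[OF s3]) (use fr4 in auto)
          have A4: "A' = {e. e < E \<and> M4 EA e \<noteq> 0}" using 4(3) B3 ends ceq by (auto simp: A'_def)
          define t where "t e i = M4 TT (e * n + i)" for e i
          have tt: "t e i = M1 TT (e * n + i)" for e i using fr4 fr3 fr2 by (simp add: t_def)
          have tg: "is_target n (?m e) (rk (dst e)) i (t e i)" if "e \<in> A'" "i < n" for e i
          proof -
            have "e < E" "M1 EA e \<noteq> 0" using that B1 by (auto simp: A'_def)
            then show ?thesis using 1 that(2) tt by simp
          qed
          have T4: "M4 TT (e * n + i) = t e i \<and> t e i \<le> n" if "e \<in> A'" "i < n" for e i
            using tg[OF that] by (cases "t e i = 0") (simp_all add: t_def is_target_def)
          have vv4: "vv_mem M4 vv k" by (rule vv_mem_cong[OF vv]) (use fr4 fr3 fr2 fr1 in auto)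
          show "ho (unsafe_search ;; choose_vars) M4 (?c4 + ?c5) ?Q"
          proof (rule ho_Seq[OF ho_unsafe_search[OF s4 vv4 A4 T4]])
            fix M5 assume 5: "\<forall>q<V. \<forall>i<n. M5 LB (q * n + i) \<noteq> 0 \<longleftrightarrow> unsafe vv k A' t q i"
              and fr5: "\<And>a. a \<notin> mods unsafe_search \<Longrightarrow> M5 a = M4 a"
            have s5: "static M5" by (rule static_cong[OF s4]) (use fr5 in auto)
            have LV5: "M5 LV 0 = k" using fr5 fr4 LV3 by simp
            show "ho choose_vars M5 ?c5 ?Q"
            proof (rule ho_conseq[OF ho_choose_vars[OF s5 LV5 k(2)]], elim conjE)
              fix M6 assume 6: "\<forall>q<V. \<forall>l<k. M6 VV (q * n + q + l) = M5 VV (q * n + q + l)"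
                "\<forall>q<V. let v = M6 VV (q * n + q + k); U = \<lambda>i. M5 LB (q * n + i) \<noteq> 0 in
                   v \<le> n \<and> (v = 0 \<longrightarrow> (\<forall>i<n. U i)) \<and>
                   (v \<noteq> 0 \<longrightarrow> \<not> U (v - 1) \<and> (\<forall>j<n. \<not> U j \<longrightarrow> rk q (v - 1) \<le> rk q j))"
                and fr6: "\<And>a. a \<notin> mods choose_vars \<Longrightarrow> M6 a = M5 a"
              define v where "v q = M6 VV (q * n + q + k)" for q
              have v: "v q \<le> n \<and> (v q = 0 \<longrightarrow> (\<forall>i<n. unsafe vv k A' t q i)) \<and>
                   (v q \<noteq> 0 \<longrightarrow> \<not> unsafe vv k A' t q (v q - 1) \<and>
                     (\<forall>j<n. \<not> unsafe vv k A' t q j \<longrightarrow> rk q (v q - 1) \<le> rk q j))" if q: "q < V" for q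
              proof -
                have w: "v q \<le> n \<and> (v q = 0 \<longrightarrow> (\<forall>i<n. M5 LB (q * n + i) \<noteq> 0)) \<and>
                   (v q \<noteq> 0 \<longrightarrow> \<not> M5 LB (q * n + (v q - 1)) \<noteq> 0 \<and>
                     (\<forall>j<n. \<not> M5 LB (q * n + j) \<noteq> 0 \<longrightarrow> rk q (v q - 1) \<le> rk q j))"
                  using 6(2) q unfolding Let_def v_def by blast
                then have lt: "v q - 1 < n" using n1 by linarith
                have u: "M5 LB (q * n + i) \<noteq> 0 \<longleftrightarrow> unsafe vv k A' t q i" if "i < n" for i
                  using 5 q that by blast
                show ?thesis using w u[OF lt] u by blast
              qed
              \<comment> \<open>The new results are entered at index \<open>k\<close>, the remaining
                arcs at \<open>Suc k\<close>. The matrices and the unsafe variables of level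
                \<open>k\<close> use only choices below \<open>k\<close>, so they are the same for
                the updated functions.\<close>
              let ?As = "As(Suc k := A')" and ?cp = "cp(k := c)" and ?vv = "vv(k := v)"
              have lm: "lmat ?vv k = lmat vv k" by (rule lmat_cong) simp
              have un: "unsafe ?vv k A T' = unsafe vv k A T'" for A T' by (rule unsafe_cong) simp
              have cV: "c q < V" if "q < V" for q using lab(1,2)[OF that] by (simp add: c_def)
              have cd: "c (dst e) \<le> c (src e)" if "e \<in> Bk" for e
              proof -
                have "(src e, dst e) \<in> arc_rel src dst Bk" using that by (auto simp: arc_rel_def)
                then show ?thesis using lab(3)[OF ends(1)[OF BE[OF that]]] by (simp add: c_def diff_le_mono)
              qed
              have "is_level k ?As ?cp ?vv t"
                unfolding is_level_def Let_def lm
                using cV cd ceq lab(4) tg v by (auto simp: un Bk_def[symmetric] A'_def[symmetric])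
              moreover have "is_level l ?As ?cp ?vv (T l)" if "l < k" for l
                using L(2)[OF that] that by (subst is_level_cong[of _ _ As _ cp _ vv]) auto
              ultimately have lev: "\<forall>l<Suc k. is_level l ?As ?cp ?vv ((T(k := t)) l)"
                by (auto simp: less_Suc_eq)
              have mem: "\<forall>q<V. \<forall>l<Suc k. ?vv l q \<le> n \<and> M6 VV (q * n + q + l) = ?vv l q \<and>
                M6 CP (q * n + q + l) = ?cp l q"
                using 6(1) 4(1,2) L(4) v fr6 fr5 fr4 fr3 fr2 fr1
                by (auto simp: less_Suc_eq v_def c_def)
              have "?As (Suc k) = {e. e < E \<and> M6 EA e \<noteq> 0}" using A4 fr6 fr5 by simp
              moreover have "?As 0 = {..<E}" using L(1) by simp
              ultimately show "levels_done (Suc k) M6"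
                unfolding levels_done_def using lev mem
                by (intro exI[of _ ?As] exI[of _ ?cp] exI[of _ ?vv] exI[of _ "T(k := t)"] conjI)
            qed simp
          qed simp_all
        qed simp_all
      qed simp_all
    qed simp_all
  qed simp_all
  moreover have "?c1 + (?c2 + (?c2 + (?c3 + (?c4 + ?c5)))) \<le> level_cost"
  proof -
    have le: "V * (k * (n * 19)) \<le> V * (n * (n * 19))" using k(2) by simp
    show ?thesis unfolding level_cost_def by (simp add: algebra_simps, insert le, linarith)
  qed
  ultimately show ?thesis by (elim ho_conseq)
qed

theorem ho_all_levels:
  assumes s: "static M" and a: "\<And>e. e < E \<Longrightarrow> M EA e \<noteq> 0"
  shows "ho all_levels M ((n + 1) * (level_cost + 2) + 2) (levels_done (n + 1))"
  unfolding all_levels_def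
proof (rule ho_For[where k = "n + 1" and b = level_cost and I = levels_done], goal_cases)
  case (5 k M')
  have "static M'" by (rule static_cong[OF s]) (use 5(3) in auto)
  then show ?case using ho_level_body 5 by simp
next
  case 4
  show ?case unfolding levels_done_def using a by (intro exI[of _ "\<lambda>_. {..<E}"]) auto
qed (use s in \<open>auto simp: static_def levels_done_def\<close>)

end

section \<open>Orderings of the variables\<close>

text \<open>An ordering with \<open>p\<close> classes is a pair \<open>(p, w)\<close> where \<open>w\<close> lists the ranks, which are the numbers
  below \<open>p\<close>. A further variable either opens a new class at position \<open>c \<le> p\<close> or joins class \<open>c < p\<close>.\<close>

definition shift :: "nat \<Rightarrow> nat \<Rightarrow> nat" where
  "shift c r = (if c \<le> r then Suc r else r)"

definition insertions :: "nat \<Rightarrow> nat list \<Rightarrow> nat \<Rightarrow> (nat \<times> nat list) list" where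
  "insertions p w c = (Suc p, map (shift c) w @ [c]) # (if c < p then [(p, w @ [c])] else [])"

definition extensions :: "nat \<times> nat list \<Rightarrow> (nat \<times> nat list) list" where
  "extensions pw = concat (map (insertions (fst pw) (snd pw)) [0..<Suc (fst pw)])"

primrec orderings :: "nat \<Rightarrow> (nat \<times> nat list) list" where
  "orderings 0 = [(0, [])]"
| "orderings (Suc m) = concat (map extensions (orderings m))"

lemma set_extensions: "u \<in> set (extensions (p, w)) \<longleftrightarrow>
    (\<exists>c\<le>p. u = (Suc p, map (shift c) w @ [c])) \<or> (\<exists>c<p. u = (p, w @ [c]))"
  by (force simp: extensions_def insertions_def less_Suc_eq_le split: if_splits)

lemma shift_image:
  assumes "c \<le> p"
  shows "insert c (shift c ` {0..<p}) = {0..<Suc p}"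
proof
  show "insert c (shift c ` {0..<p}) \<subseteq> {0..<Suc p}" using assms by (auto simp: shift_def)
  show "{0..<Suc p} \<subseteq> insert c (shift c ` {0..<p})"
  proof
    fix x assume "x \<in> {0..<Suc p}"
    then consider "x < c" | "x = c" | "c < x" "x \<le> p" by force
    then show "x \<in> insert c (shift c ` {0..<p})"
    proof cases
      case 1
      then show ?thesis using assms by (auto simp: shift_def intro!: image_eqI[of _ _ x])
    next
      case 3
      then show ?thesis by (auto simp: shift_def intro!: image_eqI[of _ _ "x - 1"])
    qed simp
  qed
qed

lemma orderings_wf: "(p, w) \<in> set (orderings m) \<Longrightarrow> length w = m \<and> p \<le> m \<and> set w = {0..<p}"
proof (induction m arbitrary: p w)
  case (Suc m)
  then obtain p' w' where pw: "(p', w') \<in> set (orderings m)" "(p, w) \<in> set (extensions (p', w'))" by auto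
  note IH = Suc.IH[OF pw(1)]
  from pw(2) show ?case unfolding set_extensions
  proof
    assume "\<exists>c\<le>p'. (p, w) = (Suc p', map (shift c) w' @ [c])"
    then show ?thesis using IH shift_image by auto
  next
    assume "\<exists>c<p'. (p, w) = (p', w' @ [c])"
    then obtain c where "c < p'" "p = p'" "w = w' @ [c]" by blast
    then show ?thesis using IH by (simp add: insert_absorb)
  qed
qed simp

text \<open>Undoes an extension: the last variable is dropped, and if it had a class of its own, the
  gap in the ranks is closed.\<close>

definition restriction :: "nat list \<Rightarrow> nat list" where
  "restriction u = (let c = last u; w = butlast u in
     if c \<in> set w then w else map (\<lambda>r. if c < r then r - 1 else r) w)"

lemma restriction_extension:
  assumes "set w = {0..<p}" "u \<in> set (extensions (p, w))"
  shows "restriction (snd u) = w"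
  using assms(2) unfolding set_extensions
proof
  assume "\<exists>c\<le>p. u = (Suc p, map (shift c) w @ [c])"
  then obtain c where u: "snd u = map (shift c) w @ [c]" by auto
  have "c \<notin> set (map (shift c) w)" by (auto simp: shift_def)
  moreover have "map (\<lambda>r. if c < r then r - 1 else r) (map (shift c) w) = w"
    by (auto simp: shift_def intro!: map_idI)
  ultimately show ?thesis unfolding restriction_def u by (simp add: Let_def)
next
  assume "\<exists>c<p. u = (p, w @ [c])"
  then show ?thesis using assms(1) by (auto simp: restriction_def Let_def)
qed

lemma distinct_concat_map:
  assumes "distinct xs" "\<And>x. x \<in> set xs \<Longrightarrow> distinct (f x)"
    and "\<And>x u. x \<in> set xs \<Longrightarrow> u \<in> set (f x) \<Longrightarrow> g u = x"
  shows "distinct (concat (map f xs))"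
  using assms
proof (induction xs)
  case (Cons x xs)
  have "set (f x) \<inter> set (f y) = {}" if "y \<in> set xs" for y
  proof -
    have "y \<noteq> x" using Cons.prems(1) that by auto
    then show ?thesis using Cons.prems(3)[of x] Cons.prems(3)[of y] that by fastforce
  qed
  then show ?case using Cons by auto
qed simp

text \<open>\<open>restriction\<close> recovers the ordering that was extended. Among its
  extensions, the last rank tells the position, and the number of classes tells whether a class was
  opened or joined.\<close>

lemma distinct_orderings: "distinct (orderings m)"
proof (induction m)
  case (Suc m)
  have d: "distinct (extensions (p, w))" for p w
    unfolding extensions_def
    by (rule distinct_concat_map[where g = "\<lambda>u. last (snd u)"])
      (auto simp: insertions_def split: if_splits)
  have p: "(p, w) \<in> set (orderings m) \<Longrightarrow> p = card (set w)" for p w using orderings_wf by fastforce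
  show ?case unfolding orderings.simps
  proof (rule distinct_concat_map[where g = "\<lambda>u. (card (set (restriction (snd u))), restriction (snd u))"])
    fix x u assume "x \<in> set (orderings m)" "u \<in> set (extensions x)"
    show "(card (set (restriction (snd u))), restriction (snd u)) = x"
    proof (cases x)
      case (Pair p' w)
      then have "set w = {0..<p'}" "p' = card (set w)" "u \<in> set (extensions (p', w))"
        using orderings_wf[of p' w m] p \<open>x \<in> _\<close> \<open>u \<in> _\<close> by auto
      then show ?thesis using restriction_extension Pair by auto
    qed
  qed (use Suc d in auto)
qed simp

text \<open>Ranks without gaps can be read off the order. By induction on the rank: an element of
  rank \<open>v\<close> lies above the elements of rank \<open>v - 1\<close>, so it cannot get a
  smaller rank in \<open>w'\<close>; were its rank larger, an element of rank \<open>v\<close> in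
  \<open>w'\<close> would have a smaller rank in \<open>w\<close>.\<close>

lemma rank_unique:
  fixes w w' :: "nat list"
  assumes w: "set w = {0..<p}" "length w = m" and w': "set w' = {0..<p'}" "length w' = m"
    and eq: "\<And>i j. i < m \<Longrightarrow> j < m \<Longrightarrow> w ! i \<le> w ! j \<longleftrightarrow> w' ! i \<le> w' ! j"
  shows "w = w'"
proof -
  have "\<forall>i<m. w ! i = v \<longrightarrow> w' ! i = v" for v :: nat
  proof (induction v rule: less_induct)
    case (less v)
    show ?case
    proof (intro allI impI)
      fix i assume i: "i < m" "w ! i = v"
      have "\<not> w' ! i < v"
      proof
        assume lt: "w' ! i < v"
        then have vlt: "v - 1 < v" "v \<in> set w" using i w(2) nth_mem by fastforce+
        have "v - 1 \<in> set w" using vlt w(1) by auto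
        then obtain j where j: "j < m" "w ! j = v - 1" using w(2) by (auto simp: in_set_conv_nth)
        then have "w' ! j = v - 1" using less.IH lt by auto
        moreover have "\<not> w' ! i \<le> w' ! j" using eq[OF i(1) j(1)] i j vlt by simp
        ultimately show False using lt by simp
      qed
      moreover have "\<not> v < w' ! i"
      proof
        assume lt: "v < w' ! i"
        have "w' ! i \<in> set w'" using i w'(2) by simp
        then have "v \<in> set w'" using w'(1) lt by auto
        then obtain j where j: "j < m" "w' ! j = v" using w'(2) by (auto simp: in_set_conv_nth)
        then have "w ! j < v" using eq[OF i(1) j(1)] lt i by simp
        then show False using less.IH j by auto
      qed
      ultimately show "w' ! i = v" by simp
    qed
  qed
  then show ?thesis using w(2) w'(2) by (intro nth_equalityI) auto
qed

text \<open>By \<open>rank_unique\<close>, different orderings induce different total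
  preorders.\<close>

lemma orderings_le_bell: "length (orderings n) \<le> ordered_bell n"
proof -
  define rel where "rel w = {(i, j). i \<in> {1..n} \<and> j \<in> {1..n} \<and> w ! (i - 1) \<le> w ! (j - 1)}" for w :: "nat list"
  let ?P = "{R. preorder_on {1..n} R \<and> total_on {1..n} R}"
  have "inj_on (rel \<circ> snd) (set (orderings n))"
  proof (rule inj_onI)
    fix x y assume x: "x \<in> set (orderings n)" and y: "y \<in> set (orderings n)" and eq: "(rel \<circ> snd) x = (rel \<circ> snd) y"
    obtain p w p' w' where xy: "x = (p, w)" "y = (p', w')" by (cases x, cases y) auto
    note W = orderings_wf[OF x[unfolded xy]] orderings_wf[OF y[unfolded xy]]
    have "w ! i \<le> w ! j \<longleftrightarrow> w' ! i \<le> w' ! j" if "i < n" "j < n" for i j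
    proof -
      have "(Suc i, Suc j) \<in> rel w \<longleftrightarrow> (Suc i, Suc j) \<in> rel w'" using eq xy by simp
      then show ?thesis using that by (simp add: rel_def)
    qed
    then have "w = w'" using W by (intro rank_unique[of w p n w' p']) auto
    moreover have "p = card (set w)" "p' = card (set w')" using W by auto
    ultimately show "x = y" using xy by simp
  qed
  moreover have "(rel \<circ> snd) ` set (orderings n) \<subseteq> ?P"
    by (auto simp: rel_def preorder_on_def refl_on_def trans_def total_on_def)
  moreover have "finite ?P"
  proof (rule finite_subset)
    show "?P \<subseteq> Pow ({1..n} \<times> {1..n})" by (auto simp: preorder_on_def)
  qed simp
  ultimately have "card (set (orderings n)) \<le> card ?P" by (metis card_inj_on_le)
  then show ?thesis unfolding ordered_bell_def using distinct_card[OF distinct_orderings] by metis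
qed

text \<open>A further variable either joins the class of a variable with the same value or opens a
  class just below the lowest class with a larger value.\<close>

lemma orderings_complete:
  assumes wo: "Well_order r"
  shows "(\<And>i. i < m \<Longrightarrow> \<sigma> i \<in> Field r) \<Longrightarrow>
    \<exists>(p, w) \<in> set (orderings m). \<forall>i<m. \<forall>j<m. w ! i \<le> w ! j \<longleftrightarrow> (\<sigma> i, \<sigma> j) \<in> r"
proof (induction m)
  case (Suc m)
  have tot: "total_on (Field r) r" and tr: "Relation.trans r" and an: "antisym r" and rf: "refl_on (Field r) r"
    using wo by (auto simp: well_order_on_def order_on_defs)
  obtain p w where pw: "(p, w) \<in> set (orderings m)" and ord: "\<And>i j. i < m \<Longrightarrow> j < m \<Longrightarrow> w ! i \<le> w ! j \<longleftrightarrow> (\<sigma> i, \<sigma> j) \<in> r"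
    using Suc by fastforce
  note W = orderings_wf[OF pw]
  let ?x = "\<sigma> m"
  have lt: "w ! i < p" if "i < m" for i using W that nth_mem by fastforce
  have xx: "(?x, ?x) \<in> r" using rf Suc.prems[of m] by (auto simp: refl_on_def)
  have cmp: "(\<sigma> i, ?x) \<in> r \<or> (?x, \<sigma> i) \<in> r" if "i < m" for i
    using tot Suc.prems[of i] Suc.prems[of m] that xx by (metis less_Suc_eq lessI total_on_def)
  show ?case
  proof (cases "\<exists>i<m. \<sigma> i = ?x")
    case True
    then obtain i where i: "i < m" "\<sigma> i = ?x" by blast
    have "(p, w @ [w ! i]) \<in> set (orderings (Suc m))"
      using pw lt[OF i(1)] by (auto simp: set_extensions simp del: split_paired_Ex intro!: bexI[of _ "(p, w)"])
    moreover have "\<forall>a<Suc m. \<forall>b<Suc m. (w @ [w ! i]) ! a \<le> (w @ [w ! i]) ! b \<longleftrightarrow> (\<sigma> a, \<sigma> b) \<in> r"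
      using ord i W xx by (auto simp: nth_append less_Suc_eq)
    ultimately show ?thesis by blast
  next
    case False
    \<comment> \<open>The lowest class that lies above the new value, or \<open>p\<close> if there
      is none.\<close>
    define c where "c = (LEAST v. v = p \<or> (\<exists>i<m. w ! i = v \<and> (?x, \<sigma> i) \<in> r))"
    have cP: "c = p \<or> (\<exists>i<m. w ! i = c \<and> (?x, \<sigma> i) \<in> r)"
      unfolding c_def by (rule LeastI[of _ p]) simp
    have cp: "c \<le> p" unfolding c_def by (rule Least_le) simp
    have above: "(?x, \<sigma> i) \<in> r" if i: "i < m" "c \<le> w ! i" for i
    proof -
      have "c \<noteq> p" using lt[OF i(1)] i(2) by simp
      then obtain i0 where "i0 < m" "w ! i0 = c" "(?x, \<sigma> i0) \<in> r" using cP by blast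
      then show ?thesis using ord[of i0 i] i tr by (metis transD)
    qed
    have below: "(?x, \<sigma> i) \<notin> r" if "i < m" "w ! i < c" for i
      using not_less_Least[of "w ! i" "\<lambda>v. v = p \<or> (\<exists>i<m. w ! i = v \<and> (?x, \<sigma> i) \<in> r)"] that
      unfolding c_def by blast
    have iff: "(?x, \<sigma> i) \<in> r \<longleftrightarrow> c \<le> w ! i" "(\<sigma> i, ?x) \<in> r \<longleftrightarrow> w ! i < c" if "i < m" for i
      using above[OF that] below[OF that] cmp[OF that] False that an by (metis antisymD not_le)+
    let ?w = "map (shift c) w @ [c]"
    have "(Suc p, ?w) \<in> set (orderings (Suc m))"
      using pw cp by (auto simp: set_extensions simp del: split_paired_Ex intro!: bexI[of _ "(p, w)"])
    moreover have "\<forall>a<Suc m. \<forall>b<Suc m. ?w ! a \<le> ?w ! b \<longleftrightarrow> (\<sigma> a, \<sigma> b) \<in> r"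
    proof (intro allI impI)
      fix a b assume ab: "a < Suc m" "b < Suc m"
      consider "a < m" "b < m" | "a < m" "b = m" | "a = m" "b < m" | "a = m" "b = m" using ab by linarith
      then show "?w ! a \<le> ?w ! b \<longleftrightarrow> (\<sigma> a, \<sigma> b) \<in> r"
      proof cases
        case 1
        then show ?thesis using ord[of a b] W by (auto simp: nth_append shift_def)
      next
        case 2
        then show ?thesis using iff[of a] W by (auto simp: nth_append shift_def)
      next
        case 3
        then show ?thesis using iff[of b] W by (auto simp: nth_append shift_def)
      next
        case 4
        then show ?thesis using xx by simp
      qed
    qed
    ultimately show ?thesis by blast
  qed
qed simp

section \<open>The number of orderings\<close>

lemma length_extensions: "length (extensions (p, w)) = 2 * p + 1"
proof -
  \<comment> \<open>Every \<open>c\<close> opens a new class, and every \<open>c < p\<close> also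
    allows joining an old one.\<close>
  have "length (concat (map (insertions p w) [0..<k])) = k + min k p" for k
    by (induction k) (auto simp: insertions_def)
  from this[of "Suc p"] show ?thesis by (simp add: extensions_def)
qed

lemma length_orderings_Suc:
  "length (orderings m) \<le> length (orderings (Suc m))"
  "length (orderings (Suc m)) \<le> (2 * m + 1) * length (orderings m)"
proof -
  have len: "length (orderings (Suc m)) = (\<Sum>pw\<leftarrow>orderings m. 2 * fst pw + 1)"
    using length_extensions by (simp add: length_concat comp_def) (metis (mono_tags, lifting) add.commute plus_1_eq_Suc prod.collapse)
  have "(\<Sum>pw\<leftarrow>xs. 2 * fst pw + 1) \<ge> length xs" for xs :: "(nat \<times> nat list) list"
    by (induction xs) auto
  then show "length (orderings m) \<le> length (orderings (Suc m))" using len by simp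
  have "(\<And>pw. pw \<in> set xs \<Longrightarrow> fst pw \<le> m) \<Longrightarrow> (\<Sum>pw\<leftarrow>xs. 2 * fst pw + 1) \<le> (2 * m + 1) * length xs"
    for xs :: "(nat \<times> nat list) list"
    by (induction xs) fastforce+
  moreover have "pw \<in> set (orderings m) \<Longrightarrow> fst pw \<le> m" for pw using orderings_wf by (cases pw) auto
  ultimately show "length (orderings (Suc m)) \<le> (2 * m + 1) * length (orderings m)" using len by metis
qed

lemma length_orderings_mono: "m \<le> n \<Longrightarrow> length (orderings m) \<le> length (orderings n)"
  using length_orderings_Suc(1) by (rule lift_Suc_mono_le)

lemma orderings_pos: "1 \<le> length (orderings n)"
  using length_orderings_mono[of 0 n] by simp

text \<open>As \<open>(1 + 1/n)\<^sup>n \<ge> 9/4\<close> for \<open>n \<ge> 2\<close>, the number of orderings is at most \<open>2 (8/9)\<^sup>n n\<^sup>n\<close>, so that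
  the square leaves room for a polynomial below \<open>n\<^sup>2\<^sup>n\<close>.\<close>

lemma binomial_three: "n^j * (2 * n^2 + 2 * j * n + j * (j - 1)) \<le> 2 * n^2 * (n + 1)^j" for n j :: nat
proof (induction j)
  case (Suc j)
  \<comment> \<open>Divided by \<open>2 * n^2 * n^j\<close>, the claim bounds
    \<open>(1 + 1/n)^j\<close> from below by the first three terms of its expansion. Here one more
    factor is multiplied out; only the constant \<open>j * (j - 1)\<close> is lost.\<close>
  have "n * (2 * n^2 + 2 * Suc j * n + Suc j * j) + j * (j - 1) = (n + 1) * (2 * n^2 + 2 * j * n + j * (j - 1))"
    by (cases j) (simp_all add: power2_eq_square algebra_simps)
  then have "n * (2 * n^2 + 2 * Suc j * n + Suc j * j) \<le> (n + 1) * (2 * n^2 + 2 * j * n + j * (j - 1))"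
    by linarith
  then have "n^j * (n * (2 * n^2 + 2 * Suc j * n + Suc j * j)) \<le> n^j * ((n + 1) * (2 * n^2 + 2 * j * n + j * (j - 1)))"
    by (rule mult_le_mono2)
  also have "\<dots> = (n + 1) * (n^j * (2 * n^2 + 2 * j * n + j * (j - 1)))" by (rule mult.left_commute)
  also have "\<dots> \<le> (n + 1) * (2 * n^2 * (n + 1)^j)" using Suc.IH by (rule mult_le_mono2)
  finally show ?case by (simp only: power_Suc ac_simps diff_Suc_1)
qed simp

text \<open>For the exponent \<open>n\<close>, the three terms add up to 5/2 - 1/(2n), which is 9/4
  at \<open>n = 2\<close> and increases with \<open>n\<close>.\<close>

lemma nine_fourths:
  fixes n :: nat
  assumes "2 \<le> n"
  shows "9 * n^n \<le> 4 * (n + 1)^n"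
proof -
  have "9 * n^2 \<le> 2 * (2 * n^2 + 2 * n * n + n * (n - 1))"
  proof -
    obtain k where "n = Suc (Suc k)" using assms by (metis add_2_eq_Suc le_Suc_ex)
    then show ?thesis by (simp add: power2_eq_square algebra_simps)
  qed
  then have "n^n * (9 * n^2) \<le> n^n * (2 * (2 * n^2 + 2 * n * n + n * (n - 1)))" by (rule mult_le_mono2)
  also have "\<dots> = 2 * (n^n * (2 * n^2 + 2 * n * n + n * (n - 1)))" by simp
  also have "\<dots> \<le> 2 * (2 * n^2 * (n + 1)^n)" using binomial_three[of n n] by (rule mult_le_mono2)
  finally have "n^2 * (9 * n^n) \<le> n^2 * (4 * (n + 1)^n)" by (simp add: ac_simps)
  then show ?thesis using assms by simp
qed

text \<open>From \<open>n\<close> to \<open>n + 1\<close> the count grows at most by the factor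
  \<open>2 * (n + 1)\<close>, while the power \<open>n^n\<close> grows at least by 9/4 times
  \<open>n + 1\<close>; the quotient of the two is 8/9. The step from 1 to 2 is computed, as
  \<open>nine_fourths\<close> starts from 2.\<close>

lemma orderings_bound: "1 \<le> n \<Longrightarrow> length (orderings n) * 9^n \<le> 2 * 8^n * n^n"
proof (induction n rule: nat_induct_at_least)
  case base
  show ?case by (simp add: extensions_def insertions_def)
next
  case (Suc n)
  show ?case
  proof (cases "n = 1")
    case True
    then show ?thesis by (simp add: extensions_def insertions_def numeral_2_eq_2 upt_rec)
  next
    case False
    then have n2: "2 \<le> n" using Suc by simp
    have "length (orderings (Suc n)) * 9^Suc n \<le> (2 * n + 1) * length (orderings n) * 9^Suc n"
      using length_orderings_Suc(2)[of n] by (rule mult_le_mono1)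
    also have "\<dots> = 9 * (2 * n + 1) * (length (orderings n) * 9^n)" by (simp only: power_Suc ac_simps)
    also have "\<dots> \<le> 9 * (2 * n + 1) * (2 * 8^n * n^n)" using Suc.IH by (rule mult_le_mono2)
    also have "\<dots> = 2 * 8^n * ((2 * n + 1) * (9 * n^n))" by (simp only: ac_simps)
    also have "\<dots> \<le> 2 * 8^n * ((2 * (n + 1)) * (4 * (n + 1)^n))"
      by (rule mult_le_mono2, rule mult_le_mono) (use nine_fourths[OF n2] in auto)
    also have "\<dots> = 2 * 8^Suc n * Suc n^Suc n" by (simp add: ac_simps)
    finally show ?thesis .
  qed
qed

text \<open>81/64 exceeds the fifth power of 100/99, so five copies of the linear bound
  \<open>b\<close> absorb \<open>n^5\<close>.\<close>

lemma power_exponential: "n^5 * 64^n \<le> 100^5 * 81^n" for n :: nat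
proof -
  have b: "n * 99^n \<le> 100 * 100^n" for n :: nat
  proof -
    \<comment> \<open>Strengthened by the summand \<open>99^n\<close>, which the induction step uses
      up.\<close>
    have "99^n + n * 99^n \<le> 100 * 100^n"
    proof (induction n)
      case (Suc n)
      have "99^Suc n + Suc n * 99^Suc n = 99 * (99^n + n * 99^n) + 99 * (99^n :: nat)"
        by (simp add: algebra_simps)
      moreover have "(99^n :: nat) \<le> 100^n" by (intro power_mono) auto
      ultimately show ?case using Suc.IH by simp
    qed simp
    then show ?thesis by simp
  qed
  have "(n * 99^n)^5 * 64^n \<le> (100 * 100^n)^5 * (64^n :: nat)"
    using b by (intro mult_le_mono1 power_mono) auto
  also have "\<dots> = 100^5 * (100^5 * 64)^n"
    by (simp only: power_mult_distrib power_mult[symmetric] ac_simps)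
  also have "\<dots> \<le> 100^5 * (99^5 * 81)^n" by (intro mult_le_mono2 power_mono) auto
  finally have "(n^5 * 64^n) * 99^(5 * n) \<le> (100^5 * 81^n) * 99^(5 * n)"
    by (simp only: power_mult_distrib power_mult[symmetric] ac_simps)
  then show ?thesis by simp
qed

text \<open>The square of \<open>orderings_bound\<close> leaves the slack (81/64)^n. It absorbs
  \<open>n^5\<close>, and the sixth factor \<open>n\<close> is the 1 in the exponent
  \<open>2 * n + 1\<close>.\<close>

lemma orderings_square:
  assumes "1 \<le> n"
  shows "length (orderings n)^2 * n^6 \<le> 4 * 100^5 * n^(2 * n + 1)"
proof -
  let ?K = "length (orderings n)"
  have sq: "(b^n)^2 = (b^2)^n" for b :: nat by (metis power_mult mult.commute)
  have e: "n^6 = n * n^5" "n^(2 * n + 1) = (n^n)^2 * n"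
    by (simp_all add: power_mult[symmetric] mult.commute[of n 2] numeral_eq_Suc power_add)
  have "(?K * 9^n)^2 * n^6 \<le> (2 * 8^n * n^n)^2 * n^6"
    using orderings_bound[OF assms] by (intro mult_le_mono1 power_mono) auto
  also have "\<dots> = 4 * n^(2 * n + 1) * (n^5 * 64^n)"
    unfolding e power_mult_distrib sq[of 8] by simp
  also have "\<dots> \<le> 4 * n^(2 * n + 1) * (100^5 * 81^n)" using power_exponential by (rule mult_le_mono2)
  finally have "(?K^2 * 81^n) * n^6 \<le> 4 * n^(2 * n + 1) * (100^5 * 81^n)"
    unfolding power_mult_distrib sq[of 9] by simp
  then have "(?K^2 * n^6) * 81^n \<le> (4 * 100^5 * n^(2 * n + 1)) * 81^n" by (simp only: ac_simps)
  then show ?thesis by simp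
qed

section \<open>Enumeration of the orderings\<close>

abbreviation (input) RP :: nat where "RP \<equiv> 49"
abbreviation (input) LO :: nat where "LO \<equiv> 50"
abbreviation (input) HI :: nat where "HI \<equiv> 51"
abbreviation (input) EP :: nat where "EP \<equiv> 52"
abbreviation (input) LP :: nat where "LP \<equiv> 53"
abbreviation (input) MI :: nat where "MI \<equiv> 54"
abbreviation (input) CC :: nat where "CC \<equiv> 55"
abbreviation (input) PP :: nat where "PP \<equiv> 56"
abbreviation (input) H0 :: nat where "H0 \<equiv> 57"
abbreviation (input) HH :: nat where "HH \<equiv> 58"

definition emit :: "exp \<Rightarrow> exp \<Rightarrow> com" where
  "emit d p = For I (Var MI) (Write RK (Var EP + Var I) d) ;; Write RK (Var EP + Var MI) (Var CC) ;;
     Write RP (Var HI) p ;; Set HI (Var HI + Const 1) ;; Set EP (Var EP + Var NN)"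

text \<open>\<open>r + (1 - (c - r))\<close> is \<open>shift c r\<close>: the inner difference is 0
  exactly if \<open>c \<le> r\<close>, and any positive value cancels the 1.\<close>

definition emit_insertions :: com where
  "emit_insertions =
     emit (Read RK (Var LP + Var I) + (Const 1 - (Var CC - Read RK (Var LP + Var I)))) (Var PP + Const 1) ;;
     If (Var PP - Var CC) (emit (Read RK (Var LP + Var I)) (Var PP)) Skip"

definition emit_extensions :: com where
  "emit_extensions = Set PP (Read RP (Var LO)) ;; For CC (Var PP + Const 1) emit_insertions ;;
     Set LO (Var LO + Const 1) ;; Set LP (Var LP + Var NN)"

text \<open>The orderings form a queue, one generation for each number of variables.
  \<open>H0\<close> keeps the size of the current generation, because \<open>HI\<close> grows while
  that generation is processed.\<close>

definition enumerate_orderings :: com where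
  "enumerate_orderings = (Set LO (Const 0) ;; Set HI (Const 1) ;; Set EP (Var NN) ;; Set LP (Const 0) ;;
     Write RP (Const 0) (Const 0)) ;;
     For MI (Var NN) (Set H0 (Var HI - Var LO) ;; For HH (Var H0) emit_extensions)"

lemma mods_enum [simp]:
  "mods (emit d p) = {I, RK, RP, HI, EP}" "mods emit_insertions = {I, RK, RP, HI, EP}"
  "mods emit_extensions = {I, RK, RP, HI, EP, PP, CC, LO, LP}"
  "mods enumerate_orderings = {I, RK, RP, HI, EP, PP, CC, LO, LP, HH, H0, MI}"
  by (auto simp: emit_def emit_insertions_def emit_extensions_def enumerate_orderings_def)

text \<open>Every ordering gets \<open>n\<close> cells, however many variables it has yet. So
  positions are multiples of \<open>n\<close>, and the last generation already is the table of ranks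
  that the nodes point into.\<close>

definition stored :: "nat \<Rightarrow> (nat \<times> nat list) list \<Rightarrow> mem \<Rightarrow> bool" where
  "stored n Q M \<longleftrightarrow> M NN 0 = n \<and> M HI 0 = length Q \<and> M EP 0 = length Q * n \<and>
     (\<forall>h<length Q. M RP h = fst (Q ! h) \<and> length (snd (Q ! h)) \<le> n \<and>
       (\<forall>i<length (snd (Q ! h)). M RK (h * n + i) = snd (Q ! h) ! i))"

lemma stored_cong:
  assumes "stored n Q M" "\<And>a. a \<in> {NN, HI, EP, RP, RK} \<Longrightarrow> M' a = M a"
  shows "stored n Q M'"
  using assms(1) by (simp add: stored_def assms(2))

text \<open>Old and new orderings share the array \<open>RK\<close>, so while the copy is made,
  \<open>d\<close> may rely only on the cells in front of the new block.\<close>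

lemma ho_emit:
  assumes s: "stored n Q M" and m: "M MI 0 = m" "m < n" and c: "M CC 0 = c" and w: "length w = m"
    and d: "\<And>i M'. i < m \<Longrightarrow> M' I 0 = i \<Longrightarrow> (\<And>a. a \<notin> {I, RK} \<Longrightarrow> M' a = M a) \<Longrightarrow>
      (\<And>x. x < length Q * n \<Longrightarrow> M' RK x = M RK x) \<Longrightarrow> eval_exp d M' = w ! i"
    and p: "\<And>M'. (\<And>a. a \<notin> {I, RK} \<Longrightarrow> M' a = M a) \<Longrightarrow> eval_exp pe M' = p"
  shows "ho (emit d pe) M (n * 3 + 6) (stored n (Q @ [(p, w @ [c])]))"
  unfolding emit_def
proof (rule ho_Seq[where ?b1.0 = "m * 3 + 2" and ?b2.0 = 4])
  let ?e = "length Q * n"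
  let ?J = "\<lambda>i M'. (\<forall>j<i. M' RK (?e + j) = w ! j) \<and> (\<forall>x<?e. M' RK x = M RK x)"
  show "ho (For I (Var MI) (Write RK (Var EP + Var I) d)) M (m * 3 + 2) (?J m)"
  proof (rule ho_For[where k = m and b = 1 and I = ?J], goal_cases)
    case (5 i M')
    have fr: "a \<notin> {I, RK} \<Longrightarrow> M' a = M a" for a using 5(3)[of a] by simp
    have "eval_exp d M' = w ! i" by (rule d[where i = i and M' = M']) (use 5 fr in auto)
    moreover have "M' EP 0 = ?e" using fr s by (simp add: stored_def)
    ultimately show ?case using 5(2,4) by (intro ho_loop_free) (auto simp: less_Suc_eq)
  qed (use m in auto)
  fix M1 assume 1: "?J m M1" and "\<And>a. a \<notin> mods (For I (Var MI) (Write RK (Var EP + Var I) d)) \<Longrightarrow> M1 a = M a"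
  then have fr: "a \<notin> {I, RK} \<Longrightarrow> M1 a = M a" for a by simp
  define M2 where "M2 = sem (Write RK (Var EP + Var MI) (Var CC)) M1"
  let ?w = "w @ [c]"
  have v: "M1 EP 0 = ?e" "M1 MI 0 = m" "M1 CC 0 = c" "M1 HI 0 = length Q" "M1 NN 0 = n"
    using fr s m c by (auto simp: stored_def)
  have p': "eval_exp pe M2 = p" by (rule p) (use fr in \<open>auto simp: M2_def\<close>)
  let ?M = "sem (Write RK (Var EP + Var MI) (Var CC) ;;
     Write RP (Var HI) pe ;; Set HI (Var HI + Const 1) ;; Set EP (Var EP + Var NN)) M1"
  have M: "?M RK = (M1 RK)(?e + m := c)" "?M RP = (M RP)(length Q := p)" "?M HI 0 = Suc (length Q)"
    "?M EP 0 = ?e + n" "?M NN 0 = n"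
    using p' fr v by (auto simp: M2_def)
  have "stored n (Q @ [(p, ?w)]) ?M"
    unfolding stored_def
  proof (intro conjI allI impI)
    fix h assume h: "h < length (Q @ [(p, ?w)])"
    show "?M RP h = fst ((Q @ [(p, ?w)]) ! h)"
      using M s h by (cases "h = length Q") (auto simp: stored_def nth_append)
    show "length (snd ((Q @ [(p, ?w)]) ! h)) \<le> n"
      using s h m w by (cases "h = length Q") (auto simp: stored_def nth_append)
    fix i assume i: "i < length (snd ((Q @ [(p, ?w)]) ! h))"
    show "?M RK (h * n + i) = snd ((Q @ [(p, ?w)]) ! h) ! i"
    proof (cases "h = length Q")
      case True
      then show ?thesis using i w 1 unfolding M by (auto simp: nth_append less_Suc_eq)
    next
      case False
      then have hQ: "h < length Q" using h by simp
      then have "length (snd (Q ! h)) \<le> n" "M RK (h * n + i) = snd (Q ! h) ! i" "i < n"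
        using s i by (auto simp: stored_def nth_append)
      moreover have "h * n + i < ?e" by (rule index_less[OF hQ]) fact
      ultimately show ?thesis using 1 hQ unfolding M by (simp add: nth_append)
    qed
  qed (use M in auto)
  then show "ho (Write RK (Var EP + Var MI) (Var CC) ;;
     Write RP (Var HI) pe ;; Set HI (Var HI + Const 1) ;; Set EP (Var EP + Var NN)) M1 4 (stored n (Q @ [(p, ?w)]))"
    by (rule ho_loop_free[rotated]) simp_all
qed (use m in simp)

lemma ho_emit_insertions:
  assumes s: "stored n Q M" and m: "M MI 0 = m" "m < n" and c: "M CC 0 = c" and p: "M PP 0 = p"
    and h: "h < length Q" "Q ! h = (p, w)" "length w = m" and lp: "M LP 0 = h * n"
  shows "ho emit_insertions M (n * 6 + 13) (stored n (Q @ insertions p w c))"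
proof -
  have rd: "M' RK (h * n + i) = w ! i" if "i < m" "\<And>x. x < length Q * n \<Longrightarrow> M' RK x = M RK x" for i and M' :: mem
  proof -
    have "h * n + i < length Q * n" using index_less[OF h(1), of i n] that(1) m by simp
    then show ?thesis using that s h unfolding stored_def by (metis snd_conv)
  qed
  let ?d = "Read RK (Var LP + Var I) + (Const 1 - (Var CC - Read RK (Var LP + Var I)))"
  have "ho (emit ?d (Var PP + Const 1)) M (n * 3 + 6) (stored n (Q @ [(Suc p, map (shift c) w @ [c])]))"
  proof (rule ho_emit[OF s m c], goal_cases)
    case (2 i M')
    have "M' RK (h * n + i) = w ! i" by (rule rd) (use 2 in auto)
    moreover have "M' LP 0 = h * n" "M' CC 0 = c" using 2(3) lp c by auto
    ultimately show ?case using 2 h by (simp add: shift_def)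
  qed (use h p in auto)
  then show ?thesis
    unfolding emit_insertions_def
  proof (rule ho_Seq[where ?b2.0 = "n * 3 + 7"])
    let ?Q = "Q @ [(Suc p, map (shift c) w @ [c])]"
    fix M1 assume s1: "stored n ?Q M1"
      and "\<And>a. a \<notin> mods (emit ?d (Var PP + Const 1)) \<Longrightarrow> M1 a = M a"
    then have fr: "a \<notin> {I, RK, RP, HI, EP} \<Longrightarrow> M1 a = M a" for a by simp
    have v: "M1 MI 0 = m" "M1 CC 0 = c" "M1 PP 0 = p" "M1 LP 0 = h * n" using fr m c p lp by auto
    have h1: "h < length ?Q" "?Q ! h = (p, w)" using h by (auto simp: nth_append)
    have rd1: "M' RK (h * n + i) = w ! i" if "i < m" "\<And>x. x < length ?Q * n \<Longrightarrow> M' RK x = M1 RK x" for i and M' :: mem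
    proof -
      have "h * n + i < length ?Q * n" using index_less[OF h1(1), of i n] that(1) m by simp
      then show ?thesis using that s1 h1 h(3) unfolding stored_def by (metis snd_conv)
    qed
    show "ho (If (Var PP - Var CC) (emit (Read RK (Var LP + Var I)) (Var PP)) Skip) M1 (n * 3 + 7)
      (stored n (Q @ insertions p w c))"
    proof (rule ho_If[where b = "n * 3 + 6"])
      assume "eval_exp (Var PP - Var CC) M1 \<noteq> 0"
      then have "insertions p w c = [(Suc p, map (shift c) w @ [c]), (p, w @ [c])]"
        using v by (simp add: insertions_def)
      then have "Q @ insertions p w c = ?Q @ [(p, w @ [c])]" by simp
      moreover have "ho (emit (Read RK (Var LP + Var I)) (Var PP)) M1 (n * 3 + 6) (stored n (?Q @ [(p, w @ [c])]))"
      proof (rule ho_emit[OF s1 v(1) m(2) v(2)], goal_cases)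
        case (2 i M')
        have "M' RK (h * n + i) = w ! i" by (rule rd1) (use 2 in auto)
        then show ?case using 2(2) 2(3)[of LP] v by simp
      qed (use h v in auto)
      ultimately show "ho (emit (Read RK (Var LP + Var I)) (Var PP)) M1 (n * 3 + 6)
        (stored n (Q @ insertions p w c))" by simp
    next
      assume "eval_exp (Var PP - Var CC) M1 = 0"
      then show "ho Skip M1 (n * 3 + 6) (stored n (Q @ insertions p w c))"
        using v s1 by (intro ho_loop_free) (auto simp: insertions_def)
    qed simp
  qed simp
qed

lemma ho_emit_extensions:
  assumes s: "stored n Q M" and m: "M MI 0 = m" "m < n" and h: "h < length Q" "Q ! h = (p, w)" "length w = m" "p \<le> m"
    and lo: "M LO 0 = h" "M LP 0 = h * n"
  shows "ho emit_extensions M (n * (n * 6 + 15) + 5) (\<lambda>M'. stored n (Q @ extensions (p, w)) M' \<and>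
     M' LO 0 = Suc h \<and> M' LP 0 = Suc h * n)" (is "ho _ _ _ ?R")
proof -
  let ?M = "sem (Set PP (Read RP (Var LO))) M"
  have P: "?M PP 0 = p" using s h lo by (auto simp: stored_def)
  have s0: "stored n Q ?M" by (rule stored_cong[OF s]) auto
  let ?I = "\<lambda>c. stored n (Q @ concat (map (insertions p w) [0..<c]))"
  have "ho (For CC (Var PP + Const 1) emit_insertions) ?M (Suc p * (n * 6 + 15) + 2) (?I (Suc p))"
  proof (rule ho_For[where k = "Suc p" and b = "n * 6 + 13" and I = ?I], goal_cases)
    case (5 c M')
    have fr: "a \<notin> {I, RK, RP, HI, EP, CC} \<Longrightarrow> M' a = ?M a" for a using 5(3)[of a] by simp
    have "ho emit_insertions M' (n * 6 + 13) (stored n ((Q @ concat (map (insertions p w) [0..<c])) @ insertions p w c))"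
      by (rule ho_emit_insertions[OF 5(4) _ m(2) 5(2)])
        (use fr m P h lo in \<open>auto simp: nth_append\<close>)
    then show ?case by simp
  qed (use s0 P in \<open>auto simp: stored_def\<close>)
  then have main: "ho (For CC (Var PP + Const 1) emit_insertions ;; Set LO (Var LO + Const 1) ;; Set LP (Var LP + Var NN))
    ?M (Suc p * (n * 6 + 15) + 2 + 2) ?R"
  proof (rule ho_Seq)
    fix M1 assume 1: "?I (Suc p) M1" and fr: "\<And>a. a \<notin> mods (For CC (Var PP + Const 1) emit_insertions) \<Longrightarrow> M1 a = ?M a"
    have v: "M1 LO 0 = h" "M1 LP 0 = h * n" "M1 NN 0 = n" using fr lo s by (auto simp: stored_def)
    have "stored n (Q @ extensions (p, w)) M1" using 1 by (simp add: extensions_def)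
    then have "stored n (Q @ extensions (p, w)) (sem (Set LO (Var LO + Const 1) ;; Set LP (Var LP + Var NN)) M1)"
      by (rule stored_cong) auto
    then show "ho (Set LO (Var LO + Const 1) ;; Set LP (Var LP + Var NN)) M1 2 ?R"
      using v by (intro ho_loop_free) auto
  qed simp
  have "Suc p * (n * 6 + 15) \<le> n * (n * 6 + 15)" by (rule mult_le_mono1) (use h m in simp)
  then show ?thesis unfolding emit_extensions_def
    by (intro ho_Seq_loop_free[OF _ main]) simp_all
qed

definition enum_cost :: "nat \<Rightarrow> nat" where
  "enum_cost n = n * (length (orderings n) * (n * (n * 6 + 15) + 7) + 5) + 7"

lemma ho_enumerate:
  assumes n: "M NN 0 = n" "1 \<le> n"
  shows "ho enumerate_orderings M (enum_cost n) (\<lambda>M'. \<exists>h. M' LO 0 = h \<and> M' LP 0 = h * n \<and>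
    M' HI 0 = h + length (orderings n) \<and>
    (\<forall>j<length (orderings n). \<forall>i<n. M' RK ((h + j) * n + i) = snd (orderings n ! j) ! i))"
    (is "ho _ _ _ ?R")
proof -
  let ?init = "Set LO (Const 0) ;; Set HI (Const 1) ;; Set EP (Var NN) ;; Set LP (Const 0) ;; Write RP (Const 0) (Const 0)"
  define M0 where "M0 = sem ?init M"
  have s0: "stored n (orderings 0) M0" "M0 LO 0 = 0" "M0 LP 0 = 0" "M0 NN 0 = n"
    using n by (auto simp: stored_def M0_def)
  \<comment> \<open>\<open>pre\<close> consists of the earlier generations, which stay in the array
    in front of the current one.\<close>
  let ?I = "\<lambda>m M'. \<exists>pre. stored n (pre @ orderings m) M' \<and> M' LO 0 = length pre \<and> M' LP 0 = length pre * n"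
  have "ho (For MI (Var NN) (Set H0 (Var HI - Var LO) ;; For HH (Var H0) emit_extensions)) M0
    (n * (length (orderings n) * (n * (n * 6 + 15) + 7) + 5) + 2) ?R"
  proof (rule ho_For[where k = n and b = "length (orderings n) * (n * (n * 6 + 15) + 7) + 3" and I = ?I], goal_cases)
    case (3 i j M')
    show ?case by (simp add: stored_def)
  next
    case 4
    then show ?case using s0 by (intro exI[of _ "[]"]) simp
  next
    case (5 m M1)
    then obtain pre where pre: "stored n (pre @ orderings m) M1" "M1 LO 0 = length pre" "M1 LP 0 = length pre * n"
      by blast
    let ?K = "length (orderings m)"
    let ?M = "sem (Set H0 (Var HI - Var LO)) M1"
    have H: "?M H0 0 = ?K" using pre by (simp add: stored_def)
    let ?J = "\<lambda>h M'. stored n (pre @ orderings m @ concat (map extensions (take h (orderings m)))) M' \<and>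
      M' LO 0 = length pre + h \<and> M' LP 0 = (length pre + h) * n"
    have "ho (For HH (Var H0) emit_extensions) ?M (?K * (n * (n * 6 + 15) + 7) + 2) (?J ?K)"
    proof (rule ho_For[where k = ?K and b = "n * (n * 6 + 15) + 5" and I = ?J], goal_cases)
      case (3 i j M')
      show ?case by (simp add: stored_def)
    next
      case 4
      have "stored n (pre @ orderings m) ?M" by (rule stored_cong[OF pre(1)]) auto
      then show ?case using pre by simp
    next
      case (5 h M2)
      obtain p w where pw: "orderings m ! h = (p, w)" by (cases "orderings m ! h")
      then have "(p, w) \<in> set (orderings m)" using 5(1) by (metis nth_mem)
      note wf = orderings_wf[OF this]
      have "M2 MI 0 = m" using 5(3)[of MI] \<open>M1 MI 0 = m\<close> by simp
      let ?Q = "pre @ orderings m @ concat (map extensions (take h (orderings m)))"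
      have "ho emit_extensions M2 (n * (n * 6 + 15) + 5) (\<lambda>M'. stored n (?Q @ extensions (p, w)) M' \<and>
         M' LO 0 = Suc (length pre + h) \<and> M' LP 0 = Suc (length pre + h) * n)"
        by (rule ho_emit_extensions[where m = m and M = M2 and n = n, OF _ \<open>M2 MI 0 = m\<close> \<open>m < n\<close>])
          (use 5(1,4) pw wf in \<open>auto simp: nth_append\<close>)
      moreover have "take (Suc h) (orderings m) = take h (orderings m) @ [(p, w)]"
        using 5(1) pw by (simp add: take_Suc_conv_app_nth)
      ultimately show ?case by simp
    qed (use H in auto)
    then have main: "ho (For HH (Var H0) emit_extensions) ?M (?K * (n * (n * 6 + 15) + 7) + 2) (?I (Suc m))"
      by (rule ho_conseq) (auto intro!: exI[of _ "pre @ orderings m"])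
    have "?K * (n * (n * 6 + 15) + 7) \<le> length (orderings n) * (n * (n * 6 + 15) + 7)"
      using length_orderings_mono[of m n] 5(1) by (intro mult_le_mono1) simp
    then show ?case by (intro ho_Seq_loop_free[OF _ main]) simp_all
  next
    case (6 M')
    then obtain pre where pre: "stored n (pre @ orderings n) M'" "M' LO 0 = length pre" "M' LP 0 = length pre * n"
      by blast
    have "M' RK ((length pre + j) * n + i) = snd (orderings n ! j) ! i" if "j < length (orderings n)" "i < n" for i j
    proof -
      have "length (snd (orderings n ! j)) = n" using orderings_wf nth_mem[OF that(1)] by (metis prod.collapse)
      moreover have "(pre @ orderings n) ! (length pre + j) = orderings n ! j" by simp
      ultimately show ?thesis using pre(1) that unfolding stored_def
        by (metis add_less_cancel_left length_append)
    qed
    then show ?case using pre by (intro exI[of _ "length pre"]) (simp add: stored_def)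
  qed (use s0 in \<open>auto simp: algebra_simps\<close>)
  then show ?thesis unfolding M0_def enumerate_orderings_def
    by (rule ho_Seq_loop_free[rotated]) (simp_all add: enum_cost_def)
qed

section \<open>The tables of nodes and arcs\<close>

abbreviation (input) KK :: nat where "KK \<equiv> 59"
abbreviation (input) N2 :: nat where "N2 \<equiv> 60"
abbreviation (input) TK :: nat where "TK \<equiv> 61"
abbreviation (input) QC :: nat where "QC \<equiv> 62"
abbreviation (input) IP :: nat where "IP \<equiv> 63"
abbreviation (input) FI :: nat where "FI \<equiv> 64"
abbreviation (input) RB :: nat where "RB \<equiv> 65"
abbreviation (input) WI :: nat where "WI \<equiv> 66"
abbreviation (input) EC :: nat where "EC \<equiv> 67"
abbreviation (input) AI :: nat where "AI \<equiv> 68"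
abbreviation (input) WJ :: nat where "WJ \<equiv> 69"
abbreviation (input) SZ :: nat where "SZ \<equiv> 70"

definition square_table :: com where
  "square_table = Set N2 (Const 0) ;; For I (Var NN) (Set N2 (Var N2 + Var NN))"

definition multiples :: "nat \<Rightarrow> exp \<Rightarrow> nat \<Rightarrow> com" where
  "multiples t sz k = Write t (Const 0) (Const 0) ;;
     For I sz (Write t (Var I + Const 1) (Read t (Var I) + Var k))"

definition node_row :: com where
  "node_row = Set RB (Var LP) ;;
     For WI (Var KK) (Write QR (Var QC) (Var RB) ;; Write QI (Var QC) (Var IP) ;;
       Set QC (Var QC + Const 1) ;; Set RB (Var RB + Var NN)) ;;
     Set IP (Var IP + Var N2)"

definition arc_entry :: com where
  "arc_entry = Write ES (Var EC) (Read TK (Read 0 (Var IP)) + Var WI) ;;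
     Write ED (Var EC) (Read TK (Read 0 (Var IP + Const 1)) + Var WJ) ;;
     Write EG (Var EC) (Var IP + Const 2) ;; Write EA (Var EC) (Const 1) ;; Set EC (Var EC + Const 1)"

text \<open>Copy \<open>(a * K + w) * K + w'\<close> of arc \<open>a\<close> joins the
  \<open>w\<close>-th node of its source to the \<open>w'\<close>-th node of its target. An arc
  occupies two numbers for its ends and \<open>4 * n^2\<close> matrix entries, which is how far
  \<open>IP\<close> moves.\<close>

definition arc_row :: com where
  "arc_row = For WI (Var KK) (For WJ (Var KK) arc_entry) ;;
     Set IP (Var IP + Const 2 + (Var N2 + Var N2 + (Var N2 + Var N2)))"

text \<open>\<open>SZ\<close> has to cover every argument of the table of multiples: arc numbers for
  \<open>TT\<close>, node numbers, and doubled row indices below \<open>4 * n\<close>.\<close>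

definition tables :: com where
  "tables = Set KK (Var HI - Var LO) ;; square_table ;; multiples TK (Read 0 (Const 1)) KK ;;
     Set VN (Read TK (Read 0 (Const 1))) ;;
     Set QC (Const 0) ;; Set IP (Const 3) ;; For FI (Read 0 (Const 1)) node_row ;;
     Set EC (Const 0) ;; For AI (Read 0 (Const 2)) arc_row ;;
     Set EN (Var EC) ;; Set NM (Var NN + Var NN) ;; Set SZ (Var EN + Var VN + (Var NM + Var NM)) ;;
     multiples TN (Var SZ) NN"

lemma mods_tables [simp]:
  "mods square_table = {N2, I}" "mods (multiples t s k) = {t, I}"
  "mods node_row = {RB, WI, QR, QI, QC, IP}" "mods arc_entry = {ES, ED, EG, EA, EC}"
  "mods arc_row = {WI, WJ, ES, ED, EG, EA, EC, IP}"
  "mods tables = {KK, N2, I, TK, VN, QC, IP, FI, RB, WI, QR, QI, EC, AI, WJ, ES, ED, EG, EA, EN, NM, SZ, TN}"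
  by (auto simp: square_table_def multiples_def node_row_def arc_entry_def arc_row_def tables_def)

lemma ho_square_table:
  assumes "M NN 0 = n"
  shows "ho square_table M (n * 3 + 3) (\<lambda>M'. M' N2 0 = n * n)"
  unfolding square_table_def
proof (rule ho_Seq_loop_free)
  show "ho (For I (Var NN) (Set N2 (Var N2 + Var NN))) (sem (Set N2 (Const 0)) M) (n * 3 + 2) (\<lambda>M'. M' N2 0 = n * n)"
  proof (rule ho_For[where k = n and b = 1 and I = "\<lambda>i M'. M' N2 0 = i * n"], goal_cases)
    case (5 i M')
    then show ?case using assms by (intro ho_loop_free) auto
  qed (use assms in auto)
qed simp_all

lemma ho_multiples:
  assumes k: "M k 0 = c" "k \<noteq> t" "k \<noteq> I" "t \<noteq> I"
    and s: "\<And>M'. (\<And>a. a \<notin> {t, I} \<Longrightarrow> M' a = M a) \<Longrightarrow> eval_exp sz M' = S"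
  shows "ho (multiples t sz k) M (S * 3 + 3) (\<lambda>M'. \<forall>x\<le>S. M' t x = x * c)"
  unfolding multiples_def
proof (rule ho_Seq_loop_free)
  let ?M = "sem (Write t (Const 0) (Const 0)) M"
  show "ho (For I sz (Write t (Var I + Const 1) (Read t (Var I) + Var k))) ?M (S * 3 + 2) (\<lambda>M'. \<forall>x\<le>S. M' t x = x * c)"
  proof (rule ho_For[where k = S and b = 1 and I = "\<lambda>i M'. \<forall>x\<le>i. M' t x = x * c"], goal_cases)
    case (2 M')
    show ?case by (rule s) (use 2 in auto)
  next
    case (3 i j M')
    then show ?case using k by simp
  next
    case (5 i M')
    then have "M' k 0 = c" "M' t i = i * c" using k 5(3)[of k] by auto
    then show ?case using 5(2,4) by (intro ho_loop_free) (auto simp: le_Suc_eq)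
  qed (use k in auto)
qed simp_all

lemma ho_nodes:
  assumes v: "M KK 0 = K" "M NN 0 = n" "M N2 0 = n2" "M LP 0 = lp" "M 0 1 = F"
    and i: "M QC 0 = 0" "M IP 0 = 3"
  shows "ho (For FI (Read 0 (Const 1)) node_row) M (F * (K * 6 + 6) + 2) (\<lambda>M'. M' IP 0 = 3 + F * n2 \<and>
    (\<forall>q<F * K. M' QR q = lp + q mod K * n \<and> M' QI q = 3 + q div K * n2))"
proof -
  let ?J = "\<lambda>f w M'. M' QC 0 = f * K + w \<and> M' IP 0 = 3 + f * n2 \<and>
    (\<forall>q<f * K + w. M' QR q = lp + q mod K * n \<and> M' QI q = 3 + q div K * n2)"
  show ?thesis
  proof (rule ho_For[where k = F and b = "K * 6 + 4" and I = "\<lambda>f. ?J f 0"], goal_cases)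
    case (5 f M1)
    have fr: "a \<notin> {RB, WI, QR, QI, QC, IP, FI} \<Longrightarrow> M1 a = M a" for a using 5(3)[of a] by simp
    have v1: "M1 KK 0 = K" "M1 NN 0 = n" "M1 N2 0 = n2" "M1 LP 0 = lp" using fr v by auto
    let ?M = "sem (Set RB (Var LP)) M1"
    let ?c = "Write QR (Var QC) (Var RB) ;; Write QI (Var QC) (Var IP) ;;
       Set QC (Var QC + Const 1) ;; Set RB (Var RB + Var NN)"
    have "ho (For WI (Var KK) ?c) ?M (K * 6 + 2) (?J f K)"
    proof (rule ho_For[where k = K and b = 4 and I = "\<lambda>w M'. ?J f w M' \<and> M' RB 0 = lp + w * n"], goal_cases)
      case (5 w M2)
      have "M2 NN 0 = n" using 5(3)[of NN] v1 by simp
      then show ?case using 5(1,4) by (intro ho_loop_free) (auto simp: less_Suc_eq)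
    qed (use v1 5(4) in auto)
    then have "ho (For WI (Var KK) ?c ;; Set IP (Var IP + Var N2)) ?M (K * 6 + 2 + 1) (?J (Suc f) 0)"
    proof (rule ho_Seq)
      fix M3 assume 3: "?J f K M3" and fr3: "\<And>a. a \<notin> mods (For WI (Var KK) ?c) \<Longrightarrow> M3 a = ?M a"
      have "M3 N2 0 = n2" using fr3 v1 by simp
      then show "ho (Set IP (Var IP + Var N2)) M3 1 (?J (Suc f) 0)"
        using 3 by (intro ho_loop_free) (auto simp: algebra_simps)
    qed simp
    then show ?case unfolding node_row_def by (rule ho_Seq_loop_free[rotated]) simp_all
  qed (use v i in auto)
qed

lemma ho_arcs:
  assumes v: "M KK 0 = K" "M N2 0 = n2" "M 0 2 = L" "M EC 0 = 0" "M IP 0 = b0"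
    and tk: "\<And>a. a < L \<Longrightarrow> M TK (M 0 (b0 + a * (2 + 4 * n2))) = M 0 (b0 + a * (2 + 4 * n2)) * K"
      "\<And>a. a < L \<Longrightarrow> M TK (M 0 (b0 + a * (2 + 4 * n2) + 1)) = M 0 (b0 + a * (2 + 4 * n2) + 1) * K"
  shows "ho (For AI (Read 0 (Const 2)) arc_row) M (L * (K * (K * 7 + 4) + 5) + 2) (\<lambda>M'. M' EC 0 = L * K * K \<and>
    (\<forall>e<L * K * K. let b = b0 + e div K div K * (2 + 4 * n2) in M' ES e = M 0 b * K + e div K mod K \<and>
      M' ED e = M 0 (b + 1) * K + e mod K \<and> M' EG e = b + 2 \<and> M' EA e \<noteq> 0))"
proof -
  let ?P = "\<lambda>M' e. let b = b0 + e div K div K * (2 + 4 * n2) in M' ES e = M 0 b * K + e div K mod K \<and>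
      M' ED e = M 0 (b + 1) * K + e mod K \<and> M' EG e = b + 2 \<and> M' EA e \<noteq> 0"
  let ?J = "\<lambda>a w w' M'. M' IP 0 = b0 + a * (2 + 4 * n2) \<and> M' EC 0 = (a * K + w) * K + w' \<and>
    (\<forall>e<(a * K + w) * K + w'. ?P M' e)"
  have "ho (For AI (Read 0 (Const 2)) arc_row) M (L * (K * (K * 7 + 4) + 5) + 2) (?J L 0 0)"
  proof (rule ho_For[where k = L and b = "K * (K * 7 + 4) + 3" and I = "\<lambda>a. ?J a 0 0"], goal_cases)
    case (5 a M1)
    have fr1: "x \<notin> {WI, WJ, ES, ED, EG, EA, EC, IP, AI} \<Longrightarrow> M1 x = M x" for x using 5(3)[of x] by simp
    let ?b = "b0 + a * (2 + 4 * n2)"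
    have "ho (For WI (Var KK) (For WJ (Var KK) arc_entry)) M1 (K * (K * 7 + 4) + 2) (?J a K 0)"
    proof (rule ho_For[where k = K and b = "K * 7 + 2" and I = "\<lambda>w. ?J a w 0"], goal_cases)
      case (5 w M2)
      have fr2: "x \<notin> {WI, WJ, ES, ED, EG, EA, EC, IP, AI} \<Longrightarrow> M2 x = M x" for x using 5(3)[of x] fr1[of x] by simp
      show ?case
      proof (rule ho_For[where k = K and b = 5 and I = "?J a w"], goal_cases)
        case (5 w' M3)
        have fr3: "x \<notin> {WI, WJ, ES, ED, EG, EA, EC, IP, AI} \<Longrightarrow> M3 x = M x" for x using 5(3)[of x] fr2[of x] by simp
        have w: "w < K" "w' < K" "M3 WI 0 = w" "M3 WJ 0 = w'" using 5(1,2) 5(3)[of WI] \<open>w < K\<close> \<open>M2 WI 0 = w\<close> by auto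
        let ?e = "(a * K + w) * K + w'"
        have e: "?e div K = a * K + w" "?e mod K = w'" "?e div K div K = a" "?e div K mod K = w"
          using w by auto
        have ip: "M3 IP 0 = ?b" "M3 EC 0 = ?e" using 5(4) by auto
        have t: "M3 TK (M3 0 ?b) = M 0 ?b * K" "M3 TK (M3 0 (?b + 1)) = M 0 (?b + 1) * K"
          using fr3 tk \<open>a < L\<close> by auto
        have p: "?P (sem arc_entry M3) ?e" unfolding Let_def e using ip t w by (simp add: arc_entry_def)
        have o: "sem arc_entry M3 ES x = M3 ES x \<and> sem arc_entry M3 ED x = M3 ED x \<and>
          sem arc_entry M3 EG x = M3 EG x \<and> sem arc_entry M3 EA x = M3 EA x" if "x \<noteq> ?e" for x
          using that ip by (simp add: arc_entry_def)
        have "?J a w (Suc w') (sem arc_entry M3)"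
        proof (intro conjI allI impI)
          show "sem arc_entry M3 IP 0 = ?b" "sem arc_entry M3 EC 0 = (a * K + w) * K + Suc w'"
            using ip by (simp_all add: arc_entry_def)
          fix x assume "x < (a * K + w) * K + Suc w'"
          then show "?P (sem arc_entry M3) x"
            using p o[of x] 5(4) by (cases "x = ?e") (simp_all add: Let_def)
        qed
        note J = this
        have "loop_free arc_entry" "steps arc_entry \<le> 5" by (simp_all add: arc_entry_def)
        then show ?case by (intro ho_loop_free J)
      next
        case (6 M')
        have "(a * K + w) * K + K = (a * K + Suc w) * K + 0" by simp
        note eq = this
        show ?case by (rule 6(1)[unfolded eq])
      next
        case 7
        show ?case by simp
      qed (use fr2 v 5(4) in auto)
    next
      case 7
      show ?case by (simp add: algebra_simps)
    qed (use fr1 v 5(4) in auto)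
    then show ?case unfolding arc_row_def
    proof (rule ho_Seq[where ?b2.0 = 1])
      fix M3 assume 3: "?J a K 0 M3" and fr3: "\<And>x. x \<notin> mods (For WI (Var KK) (For WJ (Var KK) arc_entry)) \<Longrightarrow> M3 x = M1 x"
      have n2: "M3 N2 0 = n2" using fr3 fr1 v by simp
      have eq: "(a * K + K) * K + 0 = (Suc a * K + 0) * K + 0" by simp
      have ip: "b0 + a * (2 + 4 * n2) + 2 + (n2 + n2 + (n2 + n2)) = b0 + Suc a * (2 + 4 * n2)" by simp
      then show "ho (Set IP (Var IP + Const 2 + (Var N2 + Var N2 + (Var N2 + Var N2)))) M3 1 (?J (Suc a) 0 0)"
        using n2 3[unfolded eq] ip by (intro ho_loop_free) simp_all
    qed simp
  qed (use v in auto)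
  then show ?thesis by (rule ho_conseq) simp_all
qed

locale encoded_input =
  fixes n F L :: nat and inp :: "nat \<Rightarrow> nat"
  assumes n: "1 \<le> n" and hd: "inp 0 = n" "inp 1 = F" "inp 2 = L"
    and ends_F: "a < L \<Longrightarrow> inp (3 + F * (n * n) + a * (2 + 4 * (n * n))) < F"
      "a < L \<Longrightarrow> inp (3 + F * (n * n) + a * (2 + 4 * (n * n)) + 1) < F"
begin

abbreviation "K \<equiv> length (orderings n)"

definition arc_base :: "nat \<Rightarrow> nat" where
  "arc_base a = 3 + F * (n * n) + a * (2 + 4 * (n * n))"

definition "src e = inp (arc_base (e div K div K)) * K + e div K mod K"
definition "dst e = inp (arc_base (e div K div K) + 1) * K + e mod K"
definition "rk q i = snd (orderings n ! (q mod K)) ! i"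
definition "g e u v = inp (arc_base (e div K div K) + 2 + (u * (2 * n) + v))"
definition "ic q i j = inp (3 + q div K * (n * n) + (i * n + j))"

lemma K_pos: "0 < K"
  using orderings_pos[of n] by linarith

lemma arc_index: "e < L * K * K \<Longrightarrow> e div K div K < L"
  by (simp add: less_mult_imp_div_less)

sublocale program_data n "F * K" "L * K * K" src dst rk g ic "L * K * K + F * K + 4 * n"
proof
  fix e assume "e < L * K * K"
  note a = arc_index[OF this]
  show "src e < F * K" unfolding src_def arc_base_def
    by (rule index_less) (use ends_F(1)[OF a] K_pos in auto)
  show "dst e < F * K" unfolding dst_def arc_base_def
    by (rule index_less) (use ends_F(2)[OF a] K_pos in auto)
qed (use n in auto)

definition tables_cost :: nat where
  "tables_cost = n * 15 + F * (K * 9 + 9) + L * (K * (K * 10 + 4) + 5) + 40"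

lemma ho_tables:
  assumes M: "M 0 = inp" "M NN 0 = n"
    and e: "M LO 0 = h" "M LP 0 = h * n" "M HI 0 = h + K"
      "\<forall>j<K. \<forall>i<n. M RK ((h + j) * n + i) = snd (orderings n ! j) ! i"
  shows "ho tables M tables_cost (\<lambda>M'. static M' \<and> (\<forall>e<L * K * K. M' EA e \<noteq> 0) \<and> M' KK 0 = K)"
    (is "ho _ _ _ ?R")
proof -
  let ?c8 = "multiples TN (Var SZ) NN"
  let ?c7 = "Set EN (Var EC) ;; Set NM (Var NN + Var NN) ;; Set SZ (Var EN + Var VN + (Var NM + Var NM)) ;; ?c8"
  let ?c6 = "For AI (Read 0 (Const 2)) arc_row ;; ?c7"
  let ?c5 = "For FI (Read 0 (Const 1)) node_row ;; Set EC (Const 0) ;; ?c6"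
  let ?S = "L * K * K + F * K + 4 * n"
  let ?b8 = "?S * 3 + 3"
  let ?b6 = "L * (K * (K * 7 + 4) + 5) + 2 + (3 + ?b8)"
  let ?b5 = "F * (K * 6 + 6) + 2 + (1 + ?b6)"
  define M1 where "M1 = sem (Set KK (Var HI - Var LO)) M"
  have M1: "M1 KK 0 = K" "a \<noteq> KK \<Longrightarrow> M1 a = M a" for a using e by (auto simp: M1_def)
  have NN1: "M1 NN 0 = n" using M M1 by simp
  have "ho (square_table ;; multiples TK (Read 0 (Const 1)) KK ;; Set VN (Read TK (Read 0 (Const 1))) ;;
     Set QC (Const 0) ;; Set IP (Const 3) ;; ?c5) M1 (n * 3 + 3 + (F * 3 + 3 + (3 + ?b5))) ?R"
  proof (rule ho_Seq[OF ho_square_table[where M = M1 and n = n, OF NN1]])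
    fix M2 assume 2: "M2 N2 0 = n * n" and fr2: "\<And>a. a \<notin> mods square_table \<Longrightarrow> M2 a = M1 a"
    show "ho (multiples TK (Read 0 (Const 1)) KK ;; Set VN (Read TK (Read 0 (Const 1))) ;;
     Set QC (Const 0) ;; Set IP (Const 3) ;; ?c5) M2 (F * 3 + 3 + (3 + ?b5)) ?R"
    proof (rule ho_Seq[OF ho_multiples[where c = K and S = F]])
      fix M3 assume 3: "\<forall>x\<le>F. M3 TK x = x * K" and fr3: "\<And>a. a \<notin> mods (multiples TK (Read 0 (Const 1)) KK) \<Longrightarrow> M3 a = M2 a"
      define M4 where "M4 = sem (Set VN (Read TK (Read 0 (Const 1))) ;; Set QC (Const 0) ;; Set IP (Const 3)) M3"
      have M3: "M3 0 = inp" "M3 KK 0 = K" "M3 NN 0 = n" "M3 N2 0 = n * n" "M3 LP 0 = h * n" "M3 RK = M RK"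
        using fr3 fr2 2 M1 M e by auto
      have M4: "M4 VN 0 = F * K" "M4 QC 0 = 0" "M4 IP 0 = 3" "a \<notin> {VN, QC, IP} \<Longrightarrow> M4 a = M3 a" for a
        using 3 M3 hd by (auto simp: M4_def)
      have v4: "M4 KK 0 = K" "M4 NN 0 = n" "M4 N2 0 = n * n" "M4 LP 0 = h * n" "M4 0 1 = F"
        using M4(4) M3 hd by auto
      have "ho ?c5 M4 ?b5 ?R"
      proof (rule ho_Seq[OF ho_nodes[OF v4 M4(2,3)]])
        fix M5 assume 5: "M5 IP 0 = 3 + F * (n * n) \<and> (\<forall>q<F * K. M5 QR q = h * n + q mod K * n \<and> M5 QI q = 3 + q div K * (n * n))"
          and fr5: "\<And>a. a \<notin> mods (For FI (Read 0 (Const 1)) node_row) \<Longrightarrow> M5 a = M4 a"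
        let ?M = "sem (Set EC (Const 0)) M5"
        have v5: "?M KK 0 = K" "?M N2 0 = n * n" "?M 0 2 = L" "?M EC 0 = 0" "?M IP 0 = 3 + F * (n * n)"
          using fr5 v4 M4(4) M3 hd 5 by auto
        have z5: "M5 0 = inp" "M5 TK = M3 TK" using fr5 M4(4) M3 by auto
        have "ho ?c6 ?M ?b6 ?R"
        proof (rule ho_Seq[OF ho_arcs[OF v5]])
          fix a assume "a < L"
          then show "?M TK (?M 0 (3 + F * (n * n) + a * (2 + 4 * (n * n)))) = ?M 0 (3 + F * (n * n) + a * (2 + 4 * (n * n))) * K"
            "?M TK (?M 0 (3 + F * (n * n) + a * (2 + 4 * (n * n)) + 1)) = ?M 0 (3 + F * (n * n) + a * (2 + 4 * (n * n)) + 1) * K"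
            using ends_F[of a] 3 z5 by (simp_all add: less_imp_le)
        next
          fix M6 assume "M6 EC 0 = L * K * K \<and> (\<forall>e<L * K * K. let b = 3 + F * (n * n) + e div K div K * (2 + 4 * (n * n)) in
              M6 ES e = ?M 0 b * K + e div K mod K \<and>
              M6 ED e = ?M 0 (b + 1) * K + e mod K \<and> M6 EG e = b + 2 \<and> M6 EA e \<noteq> 0)"
            and fr6: "\<And>a. a \<notin> mods (For AI (Read 0 (Const 2)) arc_row) \<Longrightarrow> M6 a = ?M a"
          then have 6: "M6 EC 0 = L * K * K" "\<And>e. e < L * K * K \<Longrightarrow> M6 ES e = src e \<and> M6 ED e = dst e \<and>
              M6 EG e = arc_base (e div K div K) + 2 \<and> M6 EA e \<noteq> 0"
            using z5 by (auto simp: src_def dst_def arc_base_def Let_def)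
          define M7 where "M7 = sem (Set EN (Var EC) ;; Set NM (Var NN + Var NN) ;; Set SZ (Var EN + Var VN + (Var NM + Var NM))) M6"
          have v6: "M6 0 = inp" "M6 NN 0 = n" "M6 VN 0 = F * K" "M6 KK 0 = K" "M6 RK = M RK"
            "M6 QR = M5 QR" "M6 QI = M5 QI"
            using fr6 fr5 M4 v4 z5 M3 by auto
          have M7: "M7 EN 0 = L * K * K" "M7 NM 0 = 2 * n" "M7 SZ 0 = ?S" "a \<notin> {EN, NM, SZ} \<Longrightarrow> M7 a = M6 a" for a
            using 6 v6 by (auto simp: M7_def)
          have main: "ho ?c8 M7 ?b8 ?R"
          proof (rule ho_conseq[OF ho_multiples[where c = n and S = ?S]])
            fix M8 assume 8: "\<forall>x\<le>?S. M8 TN x = x * n" and fr8: "\<And>a. a \<notin> mods ?c8 \<Longrightarrow> M8 a = M7 a"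
            have s: "static M8"
              unfolding static_def
            proof (intro conjI allI impI)
              fix q i assume q: "q < F * K" "i < n"
              have "q mod K < K" using K_pos by simp
              then have "M RK ((h + q mod K) * n + i) = rk q i" using e(4) q(2) by (simp add: rk_def)
              moreover have "M8 QR q = h * n + q mod K * n" using fr8 M7 v6 5 q by simp
              moreover have "M8 RK = M RK" using fr8 M7 v6 by simp
              ultimately show "M8 RK (M8 QR q + i) = rk q i" by (simp add: algebra_simps)
            next
              fix q i j assume "q < F * K" "i < n" "j < n"
              then show "M8 0 (M8 QI q + (i * n + j)) = ic q i j" using fr8 M7 v6 5 by (simp add: ic_def)
            next
              fix e assume e: "e < L * K * K"
              then show "M8 ES e = src e" "M8 ED e = dst e" using fr8 M7 6 by auto
              fix u v
              show "M8 0 (M8 EG e + (u * (2 * n) + v)) = g e u v"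
                using fr8 M7 6 v6 e by (simp add: g_def)
            next
              fix x assume "x \<le> ?S"
              then show "M8 TN x = x * n" using 8 by blast
            qed (use fr8 M7 v6 in auto)
            have "\<forall>e<L * K * K. M8 EA e \<noteq> 0" "M8 KK 0 = K" using fr8 M7 6 v6 by auto
            then show "?R M8" using s by blast
          qed (use M7 v6 in auto)
          show "ho ?c7 M6 (3 + ?b8) ?R"
            by (rule ho_Seq_loop_free[OF _ ho_Seq_loop_free[OF _ ho_Seq_loop_free[OF _ main[unfolded M7_def sem.simps(3)] order_refl] order_refl]])
              simp_all
        qed simp_all
        then show "ho (Set EC (Const 0) ;; ?c6) M5 (1 + ?b6) ?R"
          by (rule ho_Seq_loop_free[rotated]) simp_all
      qed simp_all
      note main = this[unfolded M4_def sem.simps(3)]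
      show "ho (Set VN (Read TK (Read 0 (Const 1))) ;; Set QC (Const 0) ;; Set IP (Const 3) ;; ?c5) M3 (3 + ?b5) ?R"
        by (rule ho_Seq_loop_free[OF _ ho_Seq_loop_free[OF _ ho_Seq_loop_free[OF _ main order_refl] order_refl]])
          simp_all
    qed (use fr2 M1 M hd in auto)
  qed simp_all
  then show ?thesis unfolding tables_def M1_def
    by (rule ho_Seq_loop_free[rotated]) (simp_all add: tables_cost_def algebra_simps)
qed

end

section \<open>Writing the description\<close>

abbreviation (input) OP :: nat where "OP \<equiv> 71"

definition put :: "exp \<Rightarrow> com" where
  "put e = Write 1 (Var OP) e ;; Set OP (Var OP + Const 1)"

definition outp :: "mem \<Rightarrow> nat list \<Rightarrow> bool" where
  "outp M xs \<longleftrightarrow> M OP 0 = length xs \<and> (\<forall>i<length xs. M 1 i = xs ! i)"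

lemma mods_put [simp]: "mods (put e) = {1, OP}"
  by (auto simp: put_def)

lemma outp_wr [simp]: "a \<noteq> 1 \<Longrightarrow> a \<noteq> OP \<Longrightarrow> outp (wr M a i v) xs = outp M xs"
  by (simp add: outp_def)

lemma outp_cong: "outp M xs \<Longrightarrow> M' 1 = M 1 \<Longrightarrow> M' OP = M OP \<Longrightarrow> outp M' xs"
  by (simp add: outp_def)

lemma ho_put:
  assumes "outp M xs" "eval_exp e M = v"
  shows "ho (put e) M 2 (\<lambda>M'. outp M' (xs @ [v]))"
  unfolding put_def
  by (rule ho_loop_free) (use assms in \<open>auto simp: outp_def nth_append less_Suc_eq\<close>)

lemma ho_For_put:
  assumes x: "x \<notin> mods c" "x \<noteq> 1" "x \<noteq> OP"
    and N: "\<And>M'. (\<And>a. a \<notin> mods c \<Longrightarrow> a \<noteq> x \<Longrightarrow> M' a = M a) \<Longrightarrow> eval_exp N M' = k"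
    and out: "outp M xs"
    and P: "\<And>i j M'. P i (wr M' x 0 j) = P i M'" "P 0 M"
    and step: "\<And>i M' zs. i < k \<Longrightarrow> M' x 0 = i \<Longrightarrow> (\<And>a. a \<notin> mods c \<Longrightarrow> a \<noteq> x \<Longrightarrow> M' a = M a) \<Longrightarrow>
      outp M' zs \<Longrightarrow> P i M' \<Longrightarrow> ho c M' b (\<lambda>M''. outp M'' (zs @ ys i) \<and> P (Suc i) M'')"
    and b: "k * (b + 2) + 2 \<le> b'"
  shows "ho (For x N c) M b' (\<lambda>M'. outp M' (xs @ concat (map ys [0..<k])) \<and> P k M')"
proof (rule ho_For[where k = k and b = b and I = "\<lambda>i M'. outp M' (xs @ concat (map ys [0..<i])) \<and> P i M'"], goal_cases)
  case (5 i M')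
  then show ?case using step[of i M' "xs @ concat (map ys [0..<i])"] by simp
qed (use assms in auto)

text \<open>Entry 2 becomes code 3, since a region lists both the weak and the strict constraint for
  a strict pair.\<close>

definition code_exp :: exp where
  "code_exp = (let s = Min2 (rank_exp QC (Var I) + Const 1 - rank_exp QC (Var J)) in s + (s - Const 1))"

definition base_exp :: exp where
  "base_exp = Read TN (Var QC) + Var QC"

text \<open>The first level without a choice determines the length: two entries for each earlier
  level and the final integer.\<close>

definition put_vector :: com where
  "put_vector = Set LV (Const 0) ;; While (Read VV (base_exp + Var LV)) (Set LV (Var LV + Const 1)) ;;
     put (Var LV + Var LV + Const 1) ;;
     For J (Var LV) (put (Read CP (base_exp + Var J)) ;; put (Read VV (base_exp + Var J))) ;;
     put (Read CP (base_exp + Var LV))"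

definition put_node :: com where
  "put_node = For I (Var NN) (For J (Var NN) (put code_exp)) ;; put_vector ;; Set QC (Var QC + Const 1)"

definition put_all :: com where
  "put_all = Set OP (Const 0) ;; Set QC (Const 0) ;;
     For FI (Read 0 (Const 1)) (put (Var KK) ;; For WI (Var KK) put_node)"

lemma mods_put_node [simp]: "mods put_vector = {1, OP, LV, J}" "mods put_node = {1, OP, LV, J, I, QC}"
  by (auto simp: put_vector_def put_node_def)

lemma mods_put_all [simp]: "mods put_all = {1, OP, LV, J, I, QC, FI, WI}"
  by (auto simp: put_all_def)

definition vector_code :: "(nat \<Rightarrow> nat) \<Rightarrow> (nat \<Rightarrow> nat) \<Rightarrow> nat list" where
  "vector_code c v = (let k = (LEAST l. v l = 0) in
     [k + k + 1] @ concat (map (\<lambda>l. [c l, v l]) [0..<k]) @ [c k])"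

definition rank_code :: "nat \<Rightarrow> (nat \<Rightarrow> nat) \<Rightarrow> nat list" where
  "rank_code n w = concat (map (\<lambda>i. concat (map (\<lambda>j.
     [min (Suc (w i) - w j) 2 + (min (Suc (w i) - w j) 2 - 1)]) [0..<n])) [0..<n])"

lemma ho_put_vector:
  assumes q: "M QC 0 = q" "M TN q = q * n"
    and v: "\<And>l. l \<le> n \<Longrightarrow> M VV (q * n + q + l) = v l" "\<And>l. l \<le> n \<Longrightarrow> M CP (q * n + q + l) = c l"
    and z: "l0 \<le> n" "v l0 = 0" and out: "outp M xs"
  shows "ho put_vector M (n * 8 + 8) (\<lambda>M'. outp M' (xs @ vector_code c v))"
proof -
  define k where "k = (LEAST l. v l = 0)"
  have k0: "v k = 0" unfolding k_def using z(2) by (rule LeastI)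
  have kn: "k \<le> n" unfolding k_def using Least_le[of "\<lambda>l. v l = 0", OF z(2)] z(1) by simp
  have less: "l < k \<Longrightarrow> v l \<noteq> 0" for l unfolding k_def by (rule not_less_Least)
  have base: "eval_exp base_exp M' = q * n + q" if "M' QC = M QC" "M' TN = M TN" for M'
    using that q by (simp add: base_exp_def)
  have rd: "M' VV (q * n + q + l) = v l" "M' CP (q * n + q + l) = c l"
    if "M' VV = M VV" "M' CP = M CP" "l \<le> n" for M' l using that v by auto
  let ?c3 = "For J (Var LV) (put (Read CP (base_exp + Var J)) ;; put (Read VV (base_exp + Var J)))"
  let ?c2 = "put (Var LV + Var LV + Const 1) ;; ?c3 ;; put (Read CP (base_exp + Var LV))"
  let ?w = "While (Read VV (base_exp + Var LV)) (Set LV (Var LV + Const 1))"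
  define M1 where "M1 = sem (Set LV (Const 0)) M"
  have "ho (?w ;; ?c2) M1 (k * 2 + 1 + (2 + (k * 6 + 2 + 2))) (\<lambda>M'. outp M' (xs @ vector_code c v))"
  proof (rule ho_Seq[where ?b1.0 = "k * 2 + 1" and ?b2.0 = "2 + (k * 6 + 2 + 2)" and R = "\<lambda>M'. M' LV 0 = k"])
    show "ho ?w M1 (k * 2 + 1) (\<lambda>M'. M' LV 0 = k)"
    proof (rule ho_While_ghost[where b = 1 and k = k and I = "\<lambda>d M'. M' LV 0 + d = k"], goal_cases)
      case 1
      show ?case by (simp add: M1_def)
    next
      case (2 d M')
      have M': "M' QC = M QC" "M' TN = M TN" "M' VV = M VV" "M' CP = M CP"
        using 2(2) by (auto simp: M1_def)
      have "M' LV 0 \<le> n" using 2(1) kn by simp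
      then have "v (M' LV 0) \<noteq> 0" using 2(3) base[OF M'(1,2)] rd(1)[OF M'(3,4), of "M' LV 0"] by simp
      then have "d \<noteq> 0" using 2(1) k0 by (metis add_0_right)
      then show ?case using 2(1) by (intro ho_loop_free) (auto intro!: exI[of _ "d - 1"])
    next
      case (3 d M')
      have M': "M' QC = M QC" "M' TN = M TN" "M' VV = M VV" "M' CP = M CP"
        using 3(2) by (auto simp: M1_def)
      have "M' LV 0 \<le> n" using 3(1) kn by simp
      then have "v (M' LV 0) = 0" using 3(3) base[OF M'(1,2)] rd(1)[OF M'(3,4), of "M' LV 0"] by simp
      then show ?case using less[of "M' LV 0"] 3(1) by (metis le_add1 le_neq_implies_less)
    qed simp
  next
    fix M2 assume k2: "M2 LV 0 = k" and fr2: "\<And>a. a \<notin> mods ?w \<Longrightarrow> M2 a = M1 a"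
    have M2: "a \<noteq> LV \<Longrightarrow> M2 a = M a" for a using fr2[of a] by (simp add: M1_def)
    have o2: "outp M2 xs" by (rule outp_cong[OF out]) (simp_all add: M2)
    show "ho ?c2 M2 (2 + (k * 6 + 2 + 2)) (\<lambda>M'. outp M' (xs @ vector_code c v))"
    proof (rule ho_Seq[OF ho_put[where M = M2 and xs = xs and v = "k + k + 1"]])
      fix M3 assume o3: "outp M3 (xs @ [k + k + 1])" and fr3: "\<And>a. a \<notin> mods (put (Var LV + Var LV + Const 1)) \<Longrightarrow> M3 a = M2 a"
      have M3: "a \<notin> {LV, 1, OP} \<Longrightarrow> M3 a = M a" "M3 LV 0 = k" for a using fr3 M2 k2 by simp_all
      show "ho (?c3 ;; put (Read CP (base_exp + Var LV))) M3 (k * 6 + 2 + 2) (\<lambda>M'. outp M' (xs @ vector_code c v))"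
      proof (rule ho_Seq[where ?b2.0 = 2, OF ho_For_put[where k = k and b = 4 and ys = "\<lambda>l. [c l, v l]" and P = "\<lambda>_ _. True" and xs = "xs @ [k + k + 1]" and b' = "k * 6 + 2"]], goal_cases)
        case (8 l M4 zs)
        have fr4: "a \<notin> {LV, 1, OP, J} \<Longrightarrow> M4 a = M a" for a using 8(3)[of a] M3 by simp
        have l: "l \<le> n" using 8(1) kn by simp
        show ?case
        proof (rule ho_Seq[OF ho_put[where M = M4 and xs = zs and v = "c l"]])
          show "eval_exp (Read CP (base_exp + Var J)) M4 = c l"
            using base[of M4] fr4 rd(2)[of M4 l] l 8(2) by simp
          fix M5 assume o5: "outp M5 (zs @ [c l])" and fr5: "\<And>a. a \<notin> mods (put (Read CP (base_exp + Var J))) \<Longrightarrow> M5 a = M4 a"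
          have "ho (put (Read VV (base_exp + Var J))) M5 2 (\<lambda>M'. outp M' ((zs @ [c l]) @ [v l]))"
            by (rule ho_put[OF o5]) (use base[of M5] fr4 fr5 rd(1)[of M5 l] l 8(2) in simp)
          then show "ho (put (Read VV (base_exp + Var J))) M5 2 (\<lambda>M''. outp M'' (zs @ [c l, v l]) \<and> True)"
            by simp
        qed (use 8 in simp_all)
      next
        case (10 M6)
        have "ho (put (Read CP (base_exp + Var LV))) M6 2
          (\<lambda>M'. outp M' (((xs @ [k + k + 1]) @ concat (map (\<lambda>l. [c l, v l]) [0..<k])) @ [c k]))"
          by (rule ho_put) (use 10 M3 base[of M6] rd(2)[of M6 k] kn in simp_all)
        then show ?case by (simp add: vector_code_def k_def Let_def)
      qed (use M3 o3 in simp_all)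
    qed (use o2 k2 in simp_all)
  qed simp
  then show ?thesis unfolding put_vector_def M1_def
    by (rule ho_Seq_loop_free[rotated]) (use kn in simp_all)
qed

context encoded_input
begin

definition node_code :: "(nat \<Rightarrow> nat \<Rightarrow> nat) \<Rightarrow> (nat \<Rightarrow> nat \<Rightarrow> nat) \<Rightarrow> nat \<Rightarrow> nat list" where
  "node_code cp vv q = rank_code n (rk q) @ vector_code (\<lambda>l. cp l q) (\<lambda>l. vv l q)"

lemma ho_put_node:
  assumes s: "static M" and q: "q < F * K" "M QC 0 = q"
    and v: "\<And>l. l \<le> n \<Longrightarrow> M VV (q * n + q + l) = vv l q" "\<And>l. l \<le> n \<Longrightarrow> M CP (q * n + q + l) = cp l q"
    and z: "l0 \<le> n" "vv l0 q = 0" and out: "outp M xs"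
  shows "ho put_node M (n * (n * 4 + 4) + 2 + (n * 8 + 9))
    (\<lambda>M'. outp M' (xs @ node_code cp vv q) \<and> M' QC 0 = Suc q)"
proof -
  let ?f = "\<lambda>i j. [min (Suc (rk q i) - rk q j) 2 + (min (Suc (rk q i) - rk q j) 2 - 1)]"
  have tn: "M TN q = q * n" using TN[OF s] q by simp
  have nn: "M NN 0 = n" and rk: "i < n \<Longrightarrow> M RK (M QR q + i) = rk q i" for i
    using s q by (auto simp: static_def)
  let ?c1 = "For I (Var NN) (For J (Var NN) (put code_exp))"
  show ?thesis
    unfolding put_node_def node_code_def rank_code_def
  proof (rule ho_Seq[where ?b2.0 = "n * 8 + 9", OF ho_For_put[where k = n and b = "n * 4 + 2" and P = "\<lambda>_ _. True" and xs = xs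
        and b' = "n * (n * 4 + 4) + 2" and ys = "\<lambda>i. concat (map (?f i) [0..<n])"]], goal_cases)
    case (8 i M1 zs)
    show ?case
    proof (rule ho_For_put[where k = n and b = 2 and P = "\<lambda>_ _. True" and ys = "?f i"], goal_cases)
      case (8 j M2 ws)
      have fr: "a \<notin> {1, OP, J, I} \<Longrightarrow> M2 a = M a" for a using 8(3)[of a] \<open>_ \<Longrightarrow> _ \<Longrightarrow> M1 a = M a\<close> by simp
      have "M2 I 0 = i" using 8(3)[of I] \<open>M1 I 0 = i\<close> by simp
      then have "ho (put code_exp) M2 2 (\<lambda>M'. outp M' (ws @ ?f i j))"
        by (intro ho_put) (use 8 fr q rk[of i] rk[of j] \<open>i < n\<close> in \<open>simp_all add: code_exp_def rank_exp_def Let_def\<close>)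
      then show ?case by simp
    qed (use 8 nn in simp_all)
  next
    case (10 M1)
    have fr: "a \<notin> {1, OP, J, I} \<Longrightarrow> M1 a = M a" for a using 10(2)[of a] by simp
    have o: "outp M1 (xs @ rank_code n (rk q))" using 10 by (simp add: rank_code_def)
    show ?case
    proof (rule ho_Seq[where ?b2.0 = 1, OF ho_put_vector[where M = M1 and q = q and n = n and v = "\<lambda>l. vv l q" and c = "\<lambda>l. cp l q", OF _ _ _ _ z o]], goal_cases)
      case (5 M2)
      have "M2 QC 0 = q" using 5(2)[of QC] fr[of QC] q by simp
      then show ?case using 5(1) by (intro ho_loop_free) (simp_all add: rank_code_def)
    qed (use fr tn q v in simp_all)
  qed (use nn out in \<open>simp_all add: algebra_simps\<close>)
qed

definition output_cost :: nat where
  "output_cost = F * (K * (n * (n * 4 + 12) + 13) + 6) + 4"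

text \<open>The nodes are written in the order of their numbers \<open>f * K + w\<close>, so
  \<open>QC\<close> just counts up through both loops.\<close>

lemma ho_output:
  assumes s: "static M" and K: "M KK 0 = K" and M0: "M 0 1 = F"
    and v: "\<And>q l. q < F * K \<Longrightarrow> l \<le> n \<Longrightarrow> M VV (q * n + q + l) = vv l q \<and> M CP (q * n + q + l) = cp l q"
    and z: "\<And>q. q < F * K \<Longrightarrow> \<exists>l\<le>n. vv l q = 0"
  shows "ho put_all M output_cost (\<lambda>M'. outp M'
    (concat (map (\<lambda>f. K # concat (map (\<lambda>w. node_code cp vv (f * K + w)) [0..<K])) [0..<F])))"
proof -
  let ?b = "n * (n * 4 + 4) + 2 + (n * 8 + 9)"
  let ?ys = "\<lambda>f. K # concat (map (\<lambda>w. node_code cp vv (f * K + w)) [0..<K])"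
  let ?m = "{1, OP, LV, J, I, QC, FI, WI}"
  define M1 where "M1 = sem (Set OP (Const 0) ;; Set QC (Const 0)) M"
  have M1: "M1 OP 0 = 0" "M1 QC 0 = 0" "a \<notin> {OP, QC} \<Longrightarrow> M1 a = M a" for a by (auto simp: M1_def)
  have "ho (For FI (Read 0 (Const 1)) (put (Var KK) ;; For WI (Var KK) put_node)) M1
    (F * (K * (?b + 2) + 6) + 2) (\<lambda>M'. outp M' ([] @ concat (map ?ys [0..<F])) \<and> M' QC 0 = F * K)"
  proof (rule ho_For_put[where k = F and b = "2 + (K * (?b + 2) + 2)" and P = "\<lambda>f M'. M' QC 0 = f * K"], goal_cases)
    case (8 f M2 zs)
    have fr2: "a \<notin> ?m \<Longrightarrow> M2 a = M a" for a using 8(3)[of a] M1 by simp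
    show ?case
    proof (rule ho_Seq[OF ho_put[where M = M2 and xs = zs and v = K]])
      fix M3 assume o3: "outp M3 (zs @ [K])" and fr3: "\<And>a. a \<notin> mods (put (Var KK)) \<Longrightarrow> M3 a = M2 a"
      have fr3': "a \<notin> ?m \<Longrightarrow> M3 a = M a" for a using fr3[of a] fr2 by simp
      have q3: "M3 QC 0 = f * K" using fr3[of QC] 8 by simp
      have "ho (For WI (Var KK) put_node) M3 (K * (?b + 2) + 2)
        (\<lambda>M'. outp M' ((zs @ [K]) @ concat (map (\<lambda>w. node_code cp vv (f * K + w)) [0..<K])) \<and> M' QC 0 = f * K + K)"
      proof (rule ho_For_put[where k = K and b = ?b and P = "\<lambda>w M'. M' QC 0 = f * K + w"], goal_cases)
        case w: (8 w M4 ws)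
        have fr4: "a \<notin> ?m \<Longrightarrow> M4 a = M a" for a using w(3)[of a] fr3' by simp
        have q: "f * K + w < F * K" by (rule index_less[OF 8(1) w(1)])
        obtain l where l: "l \<le> n" "vv l (f * K + w) = 0" using z[OF q] by blast
        have s4: "static M4" by (rule static_cong[OF s]) (use fr4 in auto)
        have "ho put_node M4 ?b (\<lambda>M'. outp M' (ws @ node_code cp vv (f * K + w)) \<and> M' QC 0 = Suc (f * K + w))"
          by (rule ho_put_node[where M = M4 and q = "f * K + w" and cp = cp and vv = vv and xs = ws, OF s4 q w(5) _ _ l w(4)]) (use v[OF q] fr4 in simp_all)
        then show ?case by simp
      qed (use o3 q3 fr3' K in simp_all)
      then show "ho (For WI (Var KK) put_node) M3 (K * (?b + 2) + 2) (\<lambda>M'. outp M' (zs @ ?ys f) \<and> M' QC 0 = Suc f * K)"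
        by (simp add: add.commute)
    qed (use 8 fr2 K in simp_all)
  qed (use M1 M0 in \<open>simp_all add: outp_def algebra_simps\<close>)
  then have main: "ho (For FI (Read 0 (Const 1)) (put (Var KK) ;; For WI (Var KK) put_node)) M1
    (F * (K * (?b + 2) + 6) + 2) (\<lambda>M'. outp M' (concat (map ?ys [0..<F])))" (is "ho ?c _ ?b1 ?Q")
    by (rule ho_conseq) auto
  have "ho (Set OP (Const 0) ;; Set QC (Const 0) ;; ?c) M (1 + (1 + ?b1)) ?Q"
    by (rule ho_Seq_loop_free[OF _ ho_Seq_loop_free[OF _ main[unfolded M1_def sem.simps(3)] order_refl]])
      simp_all
  then show ?thesis unfolding put_all_def
    by (rule ho_conseq) (simp_all add: output_cost_def algebra_simps)
qed

end

section \<open>The vectors and their encoding\<close>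

context elab
begin

lemma vv_distinct:
  assumes l: "is_level l As cp vv T" and q: "q < V" and v: "vv l q \<noteq> 0" "l' < l"
  shows "vv l' q \<noteq> vv l q"
proof
  assume eq: "vv l' q = vv l q"
  have "vv l q \<le> n" "\<not> unsafe vv l (As (Suc l)) T q (vv l q - 1)"
    using l[unfolded is_level_def Let_def] q v(1) by blast+
  moreover have "fixed vv l q (vv l q - 1)" unfolding fixed_def using eq v(2) by metis
  ultimately show False using unsafe.fixed[OF q, of "vv l q - 1" vv l] v(1) by simp
qed

text \<open>Pigeonhole: choices at \<open>n + 1\<close> levels would be \<open>n + 1\<close>
  different variables out of \<open>n\<close>.\<close>

lemma exists_vv_zero:
  assumes l: "\<And>l. l \<le> n \<Longrightarrow> is_level l As cp vv (T l)" and q: "q < V"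
  shows "\<exists>l\<le>n. vv l q = 0"
proof (rule ccontr)
  assume "\<not> (\<exists>l\<le>n. vv l q = 0)"
  then have nz: "vv l q \<noteq> 0" if "l \<le> n" for l using that by simp
  have "inj_on (\<lambda>l. vv l q) {..n}"
  proof (rule linorder_inj_onI')
    fix i j assume "i \<in> {..n}" "j \<in> {..n}" and ij: "i < j"
    then have j: "j \<le> n" by simp
    show "vv i q \<noteq> vv j q" by (rule vv_distinct[OF l[OF j] q nz[OF j] ij])
  qed
  moreover have "(\<lambda>l. vv l q) ` {..n} \<subseteq> {1..n}"
  proof -
    have "vv l q \<le> n" if "l \<le> n" for l using l[OF that, unfolded is_level_def Let_def] q by blast
    then show ?thesis using nz by (auto simp: Suc_le_eq)
  qed
  ultimately have "card {..n} \<le> card {1..n}" by (rule card_inj_on_le) simp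
  then show False by simp
qed

lemma vector_from_eq:
  "(\<And>l'. l' < k \<Longrightarrow> vv (l + l') q \<noteq> 0) \<Longrightarrow> vv (l + k) q = 0 \<Longrightarrow> k < d \<Longrightarrow>
   vector_from cp vv d l q =
     concat (map (\<lambda>l'. [Inl (cp l' q), Inr (vv l' q)]) [l..<l + k]) @ [Inl (cp (l + k) q)]"
proof (induction k arbitrary: l d)
  case 0
  then show ?case by (cases d) auto
next
  case (Suc k)
  then obtain d' where d: "d = Suc d'" by (cases d) auto
  have "vector_from cp vv d' (Suc l) q =
     concat (map (\<lambda>l'. [Inl (cp l' q), Inr (vv l' q)]) [Suc l..<Suc l + k]) @ [Inl (cp (Suc l + k) q)]"
  proof (rule Suc.IH)
    fix l' assume "l' < k"
    then show "vv (Suc l + l') q \<noteq> 0" using Suc.prems(1)[of "Suc l'"] by simp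
  qed (use Suc.prems d in auto)
  moreover have "vv l q \<noteq> 0" using Suc.prems(1)[of 0] by simp
  moreover have "[l..<l + Suc k] = l # [Suc l..<Suc l + k]" by (simp add: upt_conv_Cons del: upt_Suc)
  ultimately show ?case using d by (simp del: upt_Suc)
qed

text \<open>The second part, on the variables that occur, is what carries distinctness through the
  induction.\<close>

lemma vector_from_in_vectors:
  "(\<And>l'. l \<le> l' \<Longrightarrow> l' < l + d \<Longrightarrow> cp l' q \<le> b \<and> vv l' q \<le> n) \<Longrightarrow>
   (\<And>i j. l \<le> i \<Longrightarrow> i < j \<Longrightarrow> j < l + d \<Longrightarrow> vv j q \<noteq> 0 \<Longrightarrow> vv i q \<noteq> vv j q) \<Longrightarrow>
   vector_from cp vv d l q \<in> vectors n b \<and>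
   (\<forall>x. Inr x \<in> set (vector_from cp vv d l q) \<longrightarrow> (\<exists>l'. l \<le> l' \<and> l' < l + d \<and> x = vv l' q \<and> x \<noteq> 0))"
proof (induction d arbitrary: l)
  case 0
  show ?case by (simp add: vectors_def)
next
  case (Suc d)
  let ?w = "vector_from cp vv d (Suc l) q"
  have cv: "cp l q \<le> b" "vv l q \<le> n" using Suc.prems(1)[of l] by auto
  have IH: "?w \<in> vectors n b \<and>
   (\<forall>x. Inr x \<in> set ?w \<longrightarrow> (\<exists>l'. Suc l \<le> l' \<and> l' < Suc l + d \<and> x = vv l' q \<and> x \<noteq> 0))"
    by (rule Suc.IH) (use Suc.prems in auto)
  show ?case
  proof (cases "vv l q = 0")
    case True
    then show ?thesis using cv by (simp add: vectors_def)
  next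
    case False
    have "Inr (vv l q) \<notin> set ?w"
    proof
      assume "Inr (vv l q) \<in> set ?w"
      then obtain l' where "Suc l \<le> l'" "l' < Suc l + d" "vv l q = vv l' q" using IH by blast
      then show False using Suc.prems(2)[of l l'] False by simp
    qed
    moreover have "(Inl (cp l q) # Inr (vv l q) # ?w) ! k \<in> (if even k then Inl ` {0..b} else Inr ` {1..n})"
      if "k < length (Inl (cp l q) # Inr (vv l q) # ?w)" for k
    proof -
      consider "k = 0" | "k = 1" | i where "k = Suc (Suc i)" "i < length ?w"
        using \<open>k < _\<close> by (cases k; cases "k - 1") auto
      then show ?thesis
      proof cases
        case 3
        then show ?thesis using IH by (auto simp: vectors_def)
      qed (use cv False in auto)
    qed
    ultimately have "Inl (cp l q) # Inr (vv l q) # ?w \<in> vectors n b"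
      using IH unfolding vectors_def by auto
    moreover have "\<exists>l'. l \<le> l' \<and> l' < l + Suc d \<and> x = vv l' q \<and> x \<noteq> 0"
      if x: "Inr x \<in> set (Inl (cp l q) # Inr (vv l q) # ?w)" for x
    proof (cases "x = vv l q")
      case True
      then show ?thesis using False by (intro exI[of _ l]) simp
    next
      case neq: False
      then obtain l' where "Suc l \<le> l'" "l' < Suc l + d" "x = vv l' q \<and> x \<noteq> 0" using IH x by auto
      then show ?thesis by (intro exI[of _ l']) simp
    qed
    ultimately show ?thesis using False by simp
  qed
qed

lemma vector_code:
  assumes "\<exists>l\<le>n. vv l q = 0"
  shows "vector_code (\<lambda>l. cp l q) (\<lambda>l. vv l q) =
    length (vector_from cp vv (Suc n) 0 q) # map (case_sum id id) (vector_from cp vv (Suc n) 0 q)"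
proof -
  define k where "k = (LEAST l. vv l q = 0)"
  obtain l where l: "l \<le> n" "vv l q = 0" using assms by blast
  have k: "vv k q = 0" "k \<le> n" "\<And>l. l < k \<Longrightarrow> vv l q \<noteq> 0"
    unfolding k_def using l LeastI[of "\<lambda>l. vv l q = 0"] Least_le[of "\<lambda>l. vv l q = 0", OF l(2)] not_less_Least by auto
  have "vector_from cp vv (Suc n) 0 q =
     concat (map (\<lambda>l'. [Inl (cp l' q), Inr (vv l' q)]) [0..<k]) @ [Inl (cp k q)]"
    using vector_from_eq[of k vv 0 q "Suc n" cp] k by simp
  then show ?thesis
    unfolding vector_code_def k_def[symmetric] Let_def
    by (simp add: map_concat length_concat comp_def sum_list_triv)
qed

end

text \<open>The full order diagram of one ordering. Regions of different orderings are disjoint by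
  \<open>region_unique\<close>, and they cover all states by \<open>region_exists\<close>.\<close>

definition region :: "nat \<Rightarrow> (nat \<Rightarrow> nat) \<Rightarrow> nat ocon set" where
  "region n w = {Ge (Suc i) (Suc j) | i j. i < n \<and> j < n \<and> w j \<le> w i} \<union>
     {Gt (Suc i) (Suc j) | i j. i < n \<and> j < n \<and> w j < w i}"

lemma models_region:
  "models r \<sigma> (region n w) \<longleftrightarrow> (\<forall>i<n. \<forall>j<n. (w j \<le> w i \<longrightarrow> (\<sigma> (Suc j), \<sigma> (Suc i)) \<in> r) \<and>
    (w j < w i \<longrightarrow> \<sigma> (Suc j) \<noteq> \<sigma> (Suc i)))"
proof -
  have "models r \<sigma> (region n w) \<longleftrightarrow> (\<forall>i<n. \<forall>j<n. (w j \<le> w i \<longrightarrow> holds r \<sigma> (Ge (Suc i) (Suc j))) \<and>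
    (w j < w i \<longrightarrow> holds r \<sigma> (Gt (Suc i) (Suc j))))"
    unfolding models_def region_def by blast
  then show ?thesis by auto
qed

lemma over_region: "over {1..n} (region n w)"
  by (auto simp: over_def region_def)

lemma concat_map_nth:
  assumes "\<And>x. x \<in> set xs \<Longrightarrow> length (f x) = d"
  shows "length (concat (map f xs)) = length xs * d"
    and "a < length xs \<Longrightarrow> j < d \<Longrightarrow> concat (map f xs) ! (a * d + j) = f (xs ! a) ! j"
  using assms
proof (induction xs arbitrary: a)
  case (Cons x xs)
  { case 1 then show ?case using Cons by simp }
  { case 2 then show ?case using Cons by (cases a) (auto simp: nth_append ac_simps) }
qed auto

definition bits :: "'x ocon set \<Rightarrow> 'x \<Rightarrow> 'x \<Rightarrow> nat" where
  "bits S u v = (if Ge u v \<in> S then 1 else 0) + (if Gt u v \<in> S then 2 else 0)"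

lemma encode_ocons_eq: "encode_ocons xs S = concat (map (\<lambda>u. map (bits S u) xs) xs)"
  by (simp add: encode_ocons_def bits_def[abs_def])

lemma encode_ocons_nth:
  "length (encode_ocons xs S) = length xs * length xs"
  "i < length xs \<Longrightarrow> j < length xs \<Longrightarrow> encode_ocons xs S ! (i * length xs + j) = bits S (xs ! i) (xs ! j)"
  unfolding encode_ocons_eq using concat_map_nth[of xs "\<lambda>u. map (bits S u) xs" "length xs"] by auto

lemma encode_region: "encode_ocons [1..<Suc n] (region n w) = rank_code n w"
proof -
  have "bits (region n w) (Suc i) (Suc j) = min (Suc (w i) - w j) 2 + (min (Suc (w i) - w j) 2 - 1)"
    if "i < n" "j < n" for i j
    using that by (auto simp: bits_def region_def)
  moreover have "[1..<Suc n] = map Suc [0..<n]" by (simp add: map_Suc_upt)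
  ultimately show ?thesis
    unfolding encode_ocons_eq rank_code_def
    by (auto simp: comp_def concat_map_singleton intro!: arg_cong[of _ _ concat])
qed

lemma index_of:
  assumes "f \<in> set fs"
  shows "index_of fs f < length fs" "fs ! index_of fs f = f"
proof -
  obtain i where "i < length fs \<and> fs ! i = f" using assms by (auto simp: in_set_conv_nth)
  then have "index_of fs f < length fs \<and> fs ! index_of fs f = f"
    unfolding index_of_def by (rule LeastI)
  then show "index_of fs f < length fs" "fs ! index_of fs f = f" by auto
qed

abbreviation tvars :: "nat \<Rightarrow> tvar list" where
  "tvars n \<equiv> map Cur [1..<Suc n] @ map Nxt [1..<Suc n]"

lemma tvars_nth: "u < 2 * n \<Longrightarrow> tvars n ! u = (if u < n then Cur (Suc u) else Nxt (Suc (u - n)))"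
  by (simp add: nth_append del: upt_Suc)

text \<open>The program addresses its input by position. After three header cells come blocks of
  fixed length, \<open>n * n\<close> for an invariant and \<open>2 + 4 * (n * n)\<close> for an
  arc.\<close>

lemma encode_mcs_nth:
  fixes n :: nat and B :: "'f mcs" and fs :: "'f list"
  defines "w \<equiv> encode_mcs n fs B"
  shows "w ! 0 = n" "w ! 1 = length fs" "w ! 2 = mcs_size B"
    "length w = 3 + length fs * (n * n) + mcs_size B * (2 + 4 * (n * n))"
    and "f < length fs \<Longrightarrow> i < n \<Longrightarrow> j < n \<Longrightarrow>
      w ! (3 + f * (n * n) + (i * n + j)) = bits (invar B (fs ! f)) (Suc i) (Suc j)"
    and "a < mcs_size B \<Longrightarrow> arcs B ! a = (p, G, q) \<Longrightarrow>
      w ! (3 + length fs * (n * n) + a * (2 + 4 * (n * n))) = index_of fs p \<and>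
      w ! (3 + length fs * (n * n) + a * (2 + 4 * (n * n)) + 1) = index_of fs q \<and>
      (\<forall>u<2*n. \<forall>v<2*n. w ! (3 + length fs * (n * n) + a * (2 + 4 * (n * n)) + 2 + (u * (2 * n) + v)) =
         bits G (tvars n ! u) (tvars n ! v))"
proof -
  let ?f = "\<lambda>f. encode_ocons [1..<Suc n] (invar B f)"
  let ?g = "\<lambda>(f, G, g). index_of fs f # index_of fs g # encode_ocons (tvars n) G"
  let ?W1 = "concat (map ?f fs)" and ?W2 = "concat (map ?g (arcs B))"
  have w: "w = [n, length fs, mcs_size B] @ ?W1 @ ?W2" by (simp add: w_def encode_mcs_def)
  have f: "length (?f p) = n * n" for p by (simp add: encode_ocons_nth del: upt_Suc)
  have g: "length (?g p) = 2 + 4 * (n * n)" for p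
    by (cases p) (simp add: encode_ocons_nth algebra_simps del: upt_Suc)
  note W1 = concat_map_nth[of fs ?f, OF f] and W2 = concat_map_nth[of "arcs B" ?g, OF g]
  have "([n, length fs, mcs_size B] @ xs @ ys) ! (3 + x) = (if x < length xs then xs ! x else ys ! (x - length xs))"
    for xs ys :: "nat list" and x by (simp add: nth_append)
  note at = this[of ?W1 ?W2, folded w, unfolded W1(1)]
  have t: "length (tvars n) = 2 * n" by (simp del: upt_Suc)
  show "w ! 0 = n" "w ! 1 = length fs" "w ! 2 = mcs_size B" by (simp_all add: w)
  show "length w = 3 + length fs * (n * n) + mcs_size B * (2 + 4 * (n * n))"
    unfolding w length_append W1(1) W2(1) by simp
  show "w ! (3 + f * (n * n) + (i * n + j)) = bits (invar B (fs ! f)) (Suc i) (Suc j)"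
    if "f < length fs" "i < n" "j < n"
  proof -
    have ij: "i * n + j < n * n" using that by (intro index_less)
    then have "f * (n * n) + (i * n + j) < length fs * (n * n)" using that by (intro index_less)
    then have "w ! (3 + f * (n * n) + (i * n + j)) = ?W1 ! (f * (n * n) + (i * n + j))"
      using at[of "f * (n * n) + (i * n + j)"] by (simp only: add.assoc if_True)
    also have "\<dots> = ?f (fs ! f) ! (i * n + j)" by (rule W1(2)[OF that(1) ij])
    also have "\<dots> = bits (invar B (fs ! f)) (Suc i) (Suc j)"
      using encode_ocons_nth(2)[of i "[1..<Suc n]" j "invar B (fs ! f)"] that by (simp del: upt_Suc)
    finally show ?thesis .
  qed
  show "w ! (3 + length fs * (n * n) + a * (2 + 4 * (n * n))) = index_of fs p \<and>
      w ! (3 + length fs * (n * n) + a * (2 + 4 * (n * n)) + 1) = index_of fs q \<and>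
      (\<forall>u<2*n. \<forall>v<2*n. w ! (3 + length fs * (n * n) + a * (2 + 4 * (n * n)) + 2 + (u * (2 * n) + v)) =
         bits G (tvars n ! u) (tvars n ! v))"
    if "a < mcs_size B" "arcs B ! a = (p, G, q)"
  proof -
    have *: "w ! (3 + length fs * (n * n) + a * (2 + 4 * (n * n)) + j) = ?g (p, G, q) ! j" if "j < 2 + 4 * (n * n)" for j
    proof -
      have "w ! (3 + length fs * (n * n) + a * (2 + 4 * (n * n)) + j) = ?W2 ! (a * (2 + 4 * (n * n)) + j)"
        using at[of "length fs * (n * n) + (a * (2 + 4 * (n * n)) + j)"] by (simp add: add.assoc)
      also have "\<dots> = ?g (arcs B ! a) ! j" by (rule W2(2)[OF \<open>a < _\<close> that])
      finally show ?thesis using \<open>arcs B ! a = _\<close> by simp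
    qed
    have "w ! (3 + length fs * (n * n) + a * (2 + 4 * (n * n)) + 2 + (u * (2 * n) + v)) =
         bits G (tvars n ! u) (tvars n ! v)" if "u < 2 * n" "v < 2 * n" for u v
    proof -
      have "u * (2 * n) + v < 2 * n * (2 * n)" using that by (intro index_less)
      then have "w ! (3 + length fs * (n * n) + a * (2 + 4 * (n * n)) + (2 + (u * (2 * n) + v))) =
        encode_ocons (tvars n) G ! (u * (2 * n) + v)"
        by (subst *) (simp_all del: upt_Suc)
      also have "\<dots> = bits G (tvars n ! u) (tvars n ! v)"
        using encode_ocons_nth(2)[of u "tvars n" v G] that unfolding t by blast
      finally show ?thesis by (simp only: add.assoc)
    qed
    then show ?thesis using *[of 0] *[of 1] by simp
  qed
qed

section \<open>Lexicographic descent on vectors\<close>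

text \<open>Integers and values are never related to each other, so the two well-founded parts do
  not interact.\<close>

lemma wf_entry_less:
  assumes "Well_order r"
  shows "wf (entry_less r)"
proof -
  have "wf (map_prod Inl Inl ` less_than :: (nat + 'a) rel)" "wf (map_prod Inr Inr ` (r - Id) :: (nat + 'a) rel)"
    using assms by (auto intro!: wf_map_prod_image simp: well_order_on_def)
  then have "wf (map_prod Inl Inl ` less_than \<union> map_prod Inr Inr ` (r - Id) :: (nat + 'a) rel)"
    by (rule wf_Un) auto
  moreover have "entry_less r \<subseteq> map_prod Inl Inl ` less_than \<union> map_prod Inr Inr ` (r - Id)"
    by (auto simp: entry_less_def map_prod_def image_iff)
  ultimately show ?thesis by (rule wf_subset)
qed

text \<open>Padding with a new least entry turns the order on lists of bounded length into the
  order on lists of one length.\<close>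

lemma wf_lexord_bounded:
  assumes "wf R" "\<And>v. v \<in> W \<Longrightarrow> length v \<le> N"
  shows "wf (lexord R \<inter> W \<times> W)"
proof -
  define R' where "R' = range (\<lambda>x. (None, Some x)) \<union> map_prod Some Some ` R"
  define pad where "pad v = map Some v @ replicate (N - length v) None" for v :: "'a list"
  have "wf (range (\<lambda>x. (None, Some x)) :: 'a option rel)"
    by (rule wf_subset[OF wf_measure[of "\<lambda>x. if x = None then 0 else 1"]]) auto
  moreover have "wf (map_prod Some Some ` R)" using assms(1) by (rule wf_map_prod_image) simp
  ultimately have "wf R'" unfolding R'_def by (rule wf_Un) auto
  then have "wf (inv_image (lexn R' N) pad)" by (intro wf_inv_image wf_lexn)
  moreover have "lexord R \<inter> W \<times> W \<subseteq> inv_image (lexn R' N) pad"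
  proof clarsimp
    fix u v assume uv: "(u, v) \<in> lexord R" "u \<in> W" "v \<in> W"
    have len: "length (pad u) = N" "length (pad v) = N" using assms(2) uv by (simp_all add: pad_def)
    consider a x where "v = u @ a # x" | w a b x y where "(a, b) \<in> R" "u = w @ a # x" "v = w @ b # y"
      using uv(1) unfolding lexord_def by blast
    then show "(pad u, pad v) \<in> lexn R' N"
    proof cases
      case 1
      then have "length u < N" using assms(2)[OF uv(3)] by simp
      then have "pad u = map Some u @ None # replicate (N - Suc (length u)) None"
        by (simp add: pad_def flip: replicate_Suc Suc_diff_Suc)
      moreover have "pad v = map Some u @ Some a # (map Some x @ replicate (N - length v) None)"
        using 1 by (simp add: pad_def)
      moreover have "(None, Some a) \<in> R'" by (simp add: R'_def)
      ultimately show ?thesis unfolding lexn_conv using len by blast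
    next
      case 2
      then have "pad u = map Some w @ Some a # (map Some x @ replicate (N - length u) None)"
        "pad v = map Some w @ Some b # (map Some y @ replicate (N - length v) None)"
        by (simp_all add: pad_def)
      moreover have "(Some a, Some b) \<in> R'" using 2(1) by (auto simp: R'_def)
      ultimately show ?thesis unfolding lexn_conv using len by blast
    qed
  qed
  ultimately show ?thesis by (rule wf_subset)
qed

text \<open>Every second entry is a variable, and none is repeated; so there are at most
  \<open>n\<close> pairs and one more integer.\<close>

lemma length_vectors:
  assumes "v \<in> vectors n b"
  shows "length v \<le> 2 * n + 1"
proof -
  have v: "k < length v \<Longrightarrow> v ! k \<in> (if even k then Inl ` {0..b} else Inr ` {1..n})" for k
    using assms by (simp add: vectors_def)
  have "(\<lambda>i. 2 * i + 1) ` {..<length v div 2} \<subseteq> {k. k < length v \<and> \<not> isl (v ! k)}"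
  proof clarify
    fix i assume "i < length v div 2"
    then have "2 * i + 1 < length v" by linarith
    then show "2 * i + 1 < length v \<and> \<not> isl (v ! (2 * i + 1))" using v[of "2 * i + 1"] by auto
  qed
  then have "card ((\<lambda>i. 2 * i + 1) ` {..<length v div 2}) \<le> card {k. k < length v \<and> \<not> isl (v ! k)}"
    by (intro card_mono) auto
  then have "length v div 2 \<le> length (filter (\<lambda>e. \<not> isl e) v)"
    by (simp add: length_filter_conv_card card_image inj_on_def)
  also have "length (filter (\<lambda>e. \<not> isl e) v) = card (set (filter (\<lambda>e. \<not> isl e) v))"
    using assms unfolding vectors_def by (metis (mono_tags, lifting) distinct_card mem_Collect_eq)
  also have "\<dots> \<le> card (Inr ` {1..n} :: (nat + nat) set)"
  proof (intro card_mono subsetI)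
    fix e assume "e \<in> set (filter (\<lambda>e. \<not> isl e) v)"
    then obtain k where "k < length v" "e = v ! k" "\<not> isl e" by (auto simp: in_set_conv_nth)
    then show "e \<in> Inr ` {1..n}" using v[of k] by (auto split: if_splits)
  qed simp
  also have "\<dots> = n" by (simp add: card_image)
  finally show ?thesis by linarith
qed

section \<open>Constraint matrices and models\<close>

definition entry_ok :: "'v rel \<Rightarrow> nat \<Rightarrow> 'v \<Rightarrow> 'v \<Rightarrow> bool" where
  "entry_ok r k x y \<longleftrightarrow> (k \<noteq> 0 \<longrightarrow> (y, x) \<in> r) \<and> (2 \<le> k \<longrightarrow> y \<noteq> x)"

text \<open>Maximum is conjunction and capping at 2 keeps the meaning; this lets the matrix
  \<open>m0\<close> be taken apart into its sources.\<close>

lemma entry_ok_simps [simp]: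
  "entry_ok r 0 x y" "entry_ok r (max k l) x y \<longleftrightarrow> entry_ok r k x y \<and> entry_ok r l x y"
  "entry_ok r (min k 2) x y \<longleftrightarrow> entry_ok r k x y"
  by (auto simp: entry_ok_def max_def min_def)

lemma models_bits:
  assumes "over (set xs) S"
  shows "models r a S \<longleftrightarrow> (\<forall>i<length xs. \<forall>j<length xs. entry_ok r (bits S (xs ! i) (xs ! j)) (a (xs ! i)) (a (xs ! j)))"
proof -
  have b: "entry_ok r (bits S u v) (a u) (a v) \<longleftrightarrow>
    (Ge u v \<in> S \<longrightarrow> holds r a (Ge u v)) \<and> (Gt u v \<in> S \<longrightarrow> holds r a (Gt u v))" for u v
    by (auto simp: entry_ok_def bits_def)
  have "models r a S \<longleftrightarrow> (\<forall>u\<in>set xs. \<forall>v\<in>set xs. entry_ok r (bits S u v) (a u) (a v))"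
  proof
    assume "models r a S"
    then show "\<forall>u\<in>set xs. \<forall>v\<in>set xs. entry_ok r (bits S u v) (a u) (a v)"
      unfolding b models_def by blast
  next
    assume R: "\<forall>u\<in>set xs. \<forall>v\<in>set xs. entry_ok r (bits S u v) (a u) (a v)"
    show "models r a S" unfolding models_def
    proof
      fix c assume c: "c \<in> S"
      then have "set_ocon c \<subseteq> set xs" using assms by (simp add: over_def)
      then show "holds r a c" using R[unfolded b] c by (cases c) auto
    qed
  qed
  then show ?thesis by (simp add: all_set_conv_all_nth)
qed

lemma models_region_ok:
  "models r \<sigma> (region n w) \<longleftrightarrow>
    (\<forall>i<n. \<forall>j<n. entry_ok r (Suc (w i) - w j) (\<sigma> (Suc i)) (\<sigma> (Suc j)))"
  unfolding models_region entry_ok_def by (intro all_cong1 imp_cong refl) auto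

lemma sat_entry_ok:
  "sat r n m x y \<longleftrightarrow> (\<forall>u<2*n. \<forall>v<2*n. entry_ok r (m u v)
     (if u < n then x u else y (u - n)) (if v < n then x v else y (v - n)))"
  by (simp add: sat_def entry_ok_def Let_def)

lemma all_less_double:
  "(\<forall>u<2*n. P u) \<longleftrightarrow> (\<forall>i<n. P i) \<and> (\<forall>i<n. P (n + i))" for n :: nat
proof (intro iffI conjI allI impI)
  fix u assume P: "(\<forall>i<n. P i) \<and> (\<forall>i<n. P (n + i))" and "u < 2 * n"
  then have "u < n \<or> u - n < n \<and> u = n + (u - n)" by linarith
  then show "P u" using P by metis
qed auto

context program_data
begin

lemma sat_m0:
  "sat r n (m0 e) x y \<longleftrightarrow> sat r n (g e) x y \<and>
    (\<forall>i<n. \<forall>j<n. entry_ok r (Suc (rk (src e) i) - rk (src e) j) (x i) (x j)) \<and>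
    (\<forall>i<n. \<forall>j<n. entry_ok r (ic (src e) i j) (x i) (x j)) \<and>
    (\<forall>i<n. \<forall>j<n. entry_ok r (Suc (rk (dst e) i) - rk (dst e) j) (y i) (y j)) \<and>
    (\<forall>i<n. \<forall>j<n. entry_ok r (ic (dst e) i j) (y i) (y j))"
  unfolding sat_entry_ok all_less_double m0_def by (auto simp del: diff_Suc_1)

end

section \<open>The program applied to an encoded system\<close>

text \<open>Without arcs the time bound is a constant, which forbids even the enumeration of the
  orderings. In the theorem there are then no flow-points either, so nothing has to be
  written.\<close>

definition ranking_program :: com where
  "ranking_program = If (Read 0 (Const 2)) (Set NN (Read 0 (Const 0)) ;;
     enumerate_orderings ;; tables ;; all_levels ;; put_all) Skip"

lemma index_div:
  fixes u :: nat
  assumes "v < N"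
  shows "(u * N + v) div N = u" "(u * N + v) mod N = v"
  using assms by auto

lemma wf_vector_values:
  assumes "Well_order r"
  shows "wf (lexord (entry_less r) \<inter> vector_values n b r \<times> vector_values n b r)"
  by (rule wf_lexord_bounded[OF wf_entry_less[OF assms], where N = "2 * n + 1"])
    (auto simp: vector_values_def val_def dest: length_vectors)

lemma sat_cong:
  assumes "\<And>i. i < n \<Longrightarrow> x i = x' i" "\<And>i. i < n \<Longrightarrow> y i = y' i"
  shows "sat r n m x y = sat r n m x' y'"
proof -
  have "(if u < n then x u else y (u - n)) = (if u < n then x' u else y' (u - n))" if "u < 2 * n" for u
    using assms that by auto
  then show ?thesis unfolding sat_entry_ok by simp
qed

locale program_input =
  fixes n :: nat and B :: "'f mcs" and fs :: "'f list"
  assumes n_pos: "1 \<le> n" and mcs: "is_mcs n B" and fs: "distinct fs" "set fs = points B"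
begin

abbreviation "inp \<equiv> input_mem (encode_mcs n fs B) 0"

lemma inp: "i < length (encode_mcs n fs B) \<Longrightarrow> inp i = encode_mcs n fs B ! i"
  by (simp add: input_mem_def)

lemma arc_points:
  assumes "a < mcs_size B" "arcs B ! a = (p, G, q)"
  shows "p \<in> points B" "q \<in> points B" "over (set (tvars n)) G"
proof -
  have "(p, G, q) \<in> set (arcs B)" using assms by (metis nth_mem)
  then show "p \<in> points B" "q \<in> points B" "over (set (tvars n)) G"
    using mcs by (auto simp: is_mcs_def atLeastLessThanSuc_atLeastAtMost simp del: upt_Suc)
qed

lemma inp_arc:
  assumes a: "a < mcs_size B" "arcs B ! a = (p, G, q)"
  defines "b \<equiv> 3 + length fs * (n * n) + a * (2 + 4 * (n * n))"
  shows "inp b = index_of fs p" "inp (b + 1) = index_of fs q"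
    "u < 2 * n \<Longrightarrow> v < 2 * n \<Longrightarrow> inp (b + 2 + (u * (2 * n) + v)) = bits G (tvars n ! u) (tvars n ! v)"
proof -
  have le: "b + k < length (encode_mcs n fs B)" if "k < 2 + 4 * (n * n)" for k
    unfolding b_def encode_mcs_nth(4) using index_less[OF a(1) that] by simp
  note nth = encode_mcs_nth(6)[where n = n and fs = fs, OF a, folded b_def]
  show "inp b = index_of fs p" "inp (b + 1) = index_of fs q"
    using nth le[of 0] le[of 1] by (simp_all add: inp)
  assume uv: "u < 2 * n" "v < 2 * n"
  then have "u * (2 * n) + v < 2 * n * (2 * n)" by (intro index_less)
  then have "b + (2 + (u * (2 * n) + v)) < length (encode_mcs n fs B)" by (intro le) simp
  then show "inp (b + 2 + (u * (2 * n) + v)) = bits G (tvars n ! u) (tvars n ! v)"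
    using nth uv by (simp add: inp add.assoc)
qed

lemma inp_invar:
  assumes "f < length fs" "i < n" "j < n"
  shows "inp (3 + f * (n * n) + (i * n + j)) = bits (invar B (fs ! f)) (Suc i) (Suc j)"
proof -
  have "i * n + j < n * n" using assms by (intro index_less)
  then have "f * (n * n) + (i * n + j) < length fs * (n * n)" using assms by (intro index_less)
  then have "3 + f * (n * n) + (i * n + j) < length (encode_mcs n fs B)"
    unfolding encode_mcs_nth(4) by simp
  then show ?thesis using encode_mcs_nth(5)[OF assms] by (simp add: inp)
qed

sublocale encoded_input n "length fs" "mcs_size B" inp
proof
  fix a assume a: "a < mcs_size B"
  obtain p G q where G: "arcs B ! a = (p, G, q)" by (cases "arcs B ! a")
  show "inp (3 + length fs * (n * n) + a * (2 + 4 * (n * n))) < length fs"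
    "inp (3 + length fs * (n * n) + a * (2 + 4 * (n * n)) + 1) < length fs"
    unfolding inp_arc(1,2)[OF a G]
    using index_of(1)[of p fs] index_of(1)[of q fs] arc_points(1,2)[OF a G] fs(2) by simp_all
qed (use n_pos encode_mcs_nth(1-4)[of n fs B] in \<open>simp_all add: inp\<close>)

lemma index_points: "f \<in> points B \<Longrightarrow> index_of fs f < length fs \<and> fs ! index_of fs f = f"
  using index_of[of f fs] fs(2) by simp

lemma src_dst:
  assumes e: "e < mcs_size B * K * K" and G: "arcs B ! (e div K div K) = (p, G, q)"
  shows "src e = index_of fs p * K + e div K mod K" "dst e = index_of fs q * K + e mod K"
  using inp_arc(1,2)[OF arc_index[OF e] G] by (simp_all add: src_def dst_def arc_base_def)

lemma models_invar:
  assumes p: "p \<in> points B" and j: "j < K"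
  shows "(\<forall>i<n. \<forall>i'<n. entry_ok r (ic (index_of fs p * K + j) i i') (\<sigma> (Suc i)) (\<sigma> (Suc i'))) \<longleftrightarrow>
    models r \<sigma> (invar B p)"
proof -
  have "over (set [1..<Suc n]) (invar B p)"
    using mcs p by (simp add: is_mcs_def atLeastLessThanSuc_atLeastAtMost del: upt_Suc)
  moreover have "ic (index_of fs p * K + j) i i' = bits (invar B p) (Suc i) (Suc i')" if "i < n" "i' < n" for i i'
  proof -
    have "(index_of fs p * K + j) div K = index_of fs p" using j K_pos by simp
    then show ?thesis using inp_invar[of "index_of fs p" i i'] index_points[OF p] that by (simp add: ic_def)
  qed
  ultimately show ?thesis
    using models_bits[of "[1..<Suc n]" "invar B p" r \<sigma>] by (simp del: upt_Suc)
qed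

text \<open>A copy of an arc describes the transitions of the arc that start and end in the regions
  of its two nodes.\<close>

lemma sat_models:
  assumes e: "e < mcs_size B * K * K" and G: "arcs B ! (e div K div K) = (p, G, q)"
  shows "sat r n (m0 e) (\<lambda>i. \<sigma> (Suc i)) (\<lambda>i. \<sigma>' (Suc i)) \<longleftrightarrow>
    models r (case_tvar \<sigma> \<sigma>') G \<and> models r \<sigma> (invar B p) \<and> models r \<sigma>' (invar B q) \<and>
    models r \<sigma> (region n (rk (src e))) \<and> models r \<sigma>' (region n (rk (dst e)))"
proof -
  note a = arc_index[OF e]
  note pq = arc_points[OF a G]
  have "sat r n (g e) (\<lambda>i. \<sigma> (Suc i)) (\<lambda>i. \<sigma>' (Suc i)) \<longleftrightarrow>
    (\<forall>u<2*n. \<forall>v<2*n. entry_ok r (bits G (tvars n ! u) (tvars n ! v))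
      (case_tvar \<sigma> \<sigma>' (tvars n ! u)) (case_tvar \<sigma> \<sigma>' (tvars n ! v)))"
    unfolding sat_entry_ok
  proof (intro all_cong1 imp_cong refl arg_cong3[where f = "entry_ok r"])
    fix u v assume uv: "u < 2 * n" "v < 2 * n"
    show "g e u v = bits G (tvars n ! u) (tvars n ! v)"
      using inp_arc(3)[OF a G uv] by (simp add: g_def arc_base_def)
    show "(if u < n then \<sigma> (Suc u) else \<sigma>' (Suc (u - n))) = case_tvar \<sigma> \<sigma>' (tvars n ! u)"
      "(if v < n then \<sigma> (Suc v) else \<sigma>' (Suc (v - n))) = case_tvar \<sigma> \<sigma>' (tvars n ! v)"
      using tvars_nth uv by simp_all
  qed
  also have "\<dots> \<longleftrightarrow> models r (case_tvar \<sigma> \<sigma>') G"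
    unfolding models_bits[OF pq(3)] by (simp del: upt_Suc add: mult_2)
  finally have g: "sat r n (g e) (\<lambda>i. \<sigma> (Suc i)) (\<lambda>i. \<sigma>' (Suc i)) \<longleftrightarrow> models r (case_tvar \<sigma> \<sigma>') G" .
  have K: "e div K mod K < K" "e mod K < K" using K_pos by simp_all
  show ?thesis
    unfolding sat_m0 g models_region_ok
    unfolding src_dst[OF e G] models_invar[OF pq(1) K(1)] models_invar[OF pq(2) K(2)] by blast
qed

text \<open>A satisfying valuation along a path of copies is a run of the original system; dividing
  a node number by \<open>K\<close> gives back its flow-point.\<close>

lemma no_sat_run:
  assumes tm: "terminating n B"
  shows "\<not> (\<exists>es x. (\<forall>t. es t < mcs_size B * K * K \<and> dst (es t) = src (es (Suc t))) \<and>
    (\<forall>t::nat. sat lex_nat n (m0 (es t)) (x t) (x (Suc t))))"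
proof
  assume "\<exists>es x. (\<forall>t. es t < mcs_size B * K * K \<and> dst (es t) = src (es (Suc t))) \<and>
    (\<forall>t::nat. sat lex_nat n (m0 (es t)) (x t) (x (Suc t)))"
  then obtain es x where es: "\<And>t. es t < mcs_size B * K * K" "\<And>t. dst (es t) = src (es (Suc t))"
    and x: "\<And>t::nat. sat lex_nat n (m0 (es t)) (x t) (x (Suc t))" by blast
  define \<sigma> where "\<sigma> t = (\<lambda>i\<in>{1..n}. x t (i - 1))" for t
  define s where "s t = (fs ! (src (es t) div K), \<sigma> t)" for t
  have "(s t, s (Suc t)) \<in> transitions n lex_nat B" for t
  proof -
    let ?a = "es t div K div K"
    obtain p G q where G: "arcs B ! ?a = (p, G, q)" by (cases "arcs B ! ?a")
    note a = arc_index[OF es(1)[of t]]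
    note pq = arc_points[OF a G]
    have "src (es t) div K = index_of fs p" "src (es (Suc t)) div K = index_of fs q"
      using src_dst[OF es(1) G] K_pos es(2)[of t] by simp_all
    then have s: "s t = (p, \<sigma> t)" "s (Suc t) = (q, \<sigma> (Suc t))"
      using index_points pq by (simp_all add: s_def)
    have "sat lex_nat n (m0 (es t)) (\<lambda>i. \<sigma> t (Suc i)) (\<lambda>i. \<sigma> (Suc t) (Suc i))"
      using x[of t] by (subst sat_cong[where x' = "x t" and y' = "x (Suc t)"]) (simp_all add: \<sigma>_def)
    note M = this[unfolded sat_models[OF es(1) G]]
    have "\<sigma> t' \<in> {1..n} \<rightarrow>\<^sub>E Field lex_nat" for t'
      using Well_order_lex_nat(2) by (auto simp: \<sigma>_def)
    moreover have "(p, G, q) \<in> set (arcs B)" using a G by (metis nth_mem)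
    ultimately show ?thesis using M pq s by (auto simp: transitions_def states_def)
  qed
  then have "\<exists>s. \<forall>t::nat. (s t, s (Suc t)) \<in> transitions n lex_nat B" by blast
  then show False
    using tm Well_order_lex_nat(1) unfolding terminating_def no_infinite_run_def by blast
qed

section \<open>The description and its regions\<close>

definition description_of :: "(nat \<Rightarrow> nat \<Rightarrow> nat) \<Rightarrow> (nat \<Rightarrow> nat \<Rightarrow> nat) \<Rightarrow> 'f description" where
  "description_of cp vv f = map (\<lambda>j. (region n (rk j), vector_from cp vv (Suc n) 0 (index_of fs f * K + j))) [0..<K]"

lemma rk_node: "j < K \<Longrightarrow> rk (f * K + j) = rk j"
  by (simp add: rk_def fun_eq_iff)

lemma region_exists:
  assumes wo: "Well_order r" and \<sigma>: "\<sigma> \<in> {1..n} \<rightarrow>\<^sub>E Field r"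
  shows "\<exists>j<K. models r \<sigma> (region n (rk j))"
proof -
  have "\<sigma> (Suc i) \<in> Field r" if "i < n" for i using \<sigma> that by auto
  from orderings_complete[OF wo, of n "\<lambda>i. \<sigma> (Suc i)", OF this]
  obtain p w where w: "(p, w) \<in> set (orderings n)"
    "\<And>i j. i < n \<Longrightarrow> j < n \<Longrightarrow> w ! i \<le> w ! j \<longleftrightarrow> (\<sigma> (Suc i), \<sigma> (Suc j)) \<in> r" by blast
  then obtain k where k: "k < K" "orderings n ! k = (p, w)" by (auto simp: in_set_conv_nth)
  have "models r \<sigma> (region n (rk k))"
    unfolding models_region
  proof (intro allI impI conjI)
    fix i j assume ij: "i < n" "j < n"
    show "(\<sigma> (Suc j), \<sigma> (Suc i)) \<in> r" if "rk k j \<le> rk k i" using w(2)[of j i] ij that k by (simp add: rk_def)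
    show "\<sigma> (Suc j) \<noteq> \<sigma> (Suc i)" if "rk k j < rk k i"
      using w(2)[of j i] w(2)[of i j] ij that k by (auto simp: rk_def)
  qed
  then show ?thesis using k(1) by blast
qed

text \<open>A region determines the order of the values, the order determines the ranks by
  \<open>rank_unique\<close>, and no ordering is listed twice.\<close>

lemma region_unique:
  assumes wo: "Well_order r" and k: "k < K" "k' < K"
    and m: "models r \<sigma> (region n (rk k))" "models r \<sigma> (region n (rk k'))"
  shows "k = k'"
proof -
  have anti: "antisym r" using wo by (simp add: order_on_defs)
  have iff: "rk k i \<le> rk k j \<longleftrightarrow> (\<sigma> (Suc i), \<sigma> (Suc j)) \<in> r"
    if "models r \<sigma> (region n (rk k))" "i < n" "j < n" for k i j
  proof
    assume "(\<sigma> (Suc i), \<sigma> (Suc j)) \<in> r"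
    then show "rk k i \<le> rk k j"
      using that antisymD[OF anti] unfolding models_region by (metis less_imp_le not_le)
  qed (use that in \<open>auto simp: models_region\<close>)
  obtain p w p' w' where w: "orderings n ! k = (p, w)" "orderings n ! k' = (p', w')" by fastforce
  have wf: "length w = n \<and> set w = {0..<p}" "length w' = n \<and> set w' = {0..<p'}"
    using orderings_wf nth_mem[OF k(1)] nth_mem[OF k(2)] w by auto
  have "w = w'"
  proof (rule rank_unique)
    fix i j assume ij: "i < n" "j < n"
    show "w ! i \<le> w ! j \<longleftrightarrow> w' ! i \<le> w' ! j"
      using iff[OF m(1) ij] iff[OF m(2) ij] k w by (simp add: rk_def)
  qed (use wf in auto)
  moreover from this have "p = p'" using wf by (metis card_atLeastLessThan diff_zero)
  ultimately have "orderings n ! k = orderings n ! k'" using w by simp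
  then show ?thesis using k distinct_orderings by (simp add: nth_eq_iff_index_eq)
qed

end

locale program_result = program_input + 
  fixes As cp vv T
  assumes tm: "terminating n B"
    and lv: "As 0 = {..<mcs_size B * K * K}" "l \<le> n \<Longrightarrow> is_level l As cp vv (T l)"
begin

sublocale levels n "length fs * K" "mcs_size B * K * K" src dst rk m0 As cp vv T
  using lv no_sat_run[OF tm] by unfold_locales auto

abbreviation "vec q \<equiv> vector_from cp vv (Suc n) 0 q"

lemma vec_in_vectors:
  assumes "q < length fs * K" "length fs * K \<le> b"
  shows "vec q \<in> vectors n b"
proof -
  have lev: "vv l q \<le> n" "cp l q < length fs * K" if "l \<le> n" for l
    using lv(2)[OF that, unfolded is_level_def Let_def] assms(1) by blast+
  have "vector_from cp vv (Suc n) 0 q \<in> vectors n b \<and> (\<forall>x. Inr x \<in> set (vector_from cp vv (Suc n) 0 q) \<longrightarrow>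
      (\<exists>l'. 0 \<le> l' \<and> l' < 0 + Suc n \<and> x = vv l' q \<and> x \<noteq> 0))"
  proof (rule vector_from_in_vectors)
    fix l assume "l < 0 + Suc n"
    then have "l \<le> n" by simp
    then show "cp l q \<le> b \<and> vv l q \<le> n" using lev assms(2) by fastforce
  next
    fix i j assume ij: "i < j" "j < 0 + Suc n" "vv j q \<noteq> 0"
    then have "j \<le> n" by simp
    from vv_distinct[OF lv(2)[OF this] assms(1) ij(3,1)] show "vv i q \<noteq> vv j q" .
  qed
  then show ?thesis by blast
qed

lemma encode: "encode_description n fs (description_of cp vv) =
  concat (map (\<lambda>f. K # concat (map (\<lambda>w. node_code cp vv (f * K + w)) [0..<K])) [0..<length fs])"
proof -
  let ?h = "\<lambda>f. length (description_of cp vv f) # concat (map (\<lambda>(R, v). encode_ocons [1..<Suc n] R @ length v # map (case_sum id id) v)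
          (description_of cp vv f))"
  have h: "?h (fs ! f) = K # concat (map (\<lambda>w. node_code cp vv (f * K + w)) [0..<K])" if "f < length fs" for f
  proof -
    have "fs ! f \<in> points B" using that fs(2) by (metis nth_mem)
    then have ix: "index_of fs (fs ! f) = f"
      using index_points that nth_eq_iff_index_eq[OF fs(1)] by blast
    have node: "encode_ocons [1..<Suc n] (region n (rk j)) @ length (vec (f * K + j)) # map (case_sum id id) (vec (f * K + j)) =
      node_code cp vv (f * K + j)" if "j < K" for j
    proof -
      have "f * K + j < length fs * K" by (rule index_less) fact+
      then have "\<exists>l\<le>n. vv l (f * K + j) = 0" by (rule exists_vv_zero[of As cp vv T, rotated]) (rule lv(2))
      from vector_code[where vv = vv and cp = cp and q = "f * K + j", OF this] show ?thesis
        unfolding encode_region node_code_def rk_node[OF that] by simp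
    qed
    have "map (\<lambda>(R, v). encode_ocons [1..<Suc n] R @ length v # map (case_sum id id) v) (description_of cp vv (fs ! f)) =
      map (\<lambda>w. node_code cp vv (f * K + w)) [0..<K]"
      unfolding description_of_def ix map_map
      by (rule map_cong[OF refl]) (use node in \<open>simp del: upt_Suc vector_from.simps\<close>)
    then show ?thesis by (simp only:) (simp add: description_of_def)
  qed
  have "encode_description n fs (description_of cp vv) = concat (map ?h (map (nth fs) [0..<length fs]))"
    unfolding encode_description_def map_nth ..
  also have "\<dots> = concat (map (\<lambda>f. ?h (fs ! f)) [0..<length fs])" by (simp add: comp_def)
  also have "\<dots> = concat (map (\<lambda>f. K # concat (map (\<lambda>w. node_code cp vv (f * K + w)) [0..<K])) [0..<length fs])"
    using h by (intro arg_cong[of _ _ concat] map_cong) auto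
  finally show ?thesis .
qed

lemma card_points: "card (points B) = length fs"
  using fs distinct_card by metis

lemma node_less: "f \<in> points B \<Longrightarrow> j < K \<Longrightarrow> index_of fs f * K + j < length fs * K"
  using index_points by (intro index_less) auto

lemma description_over: "description_over n (card (points B) * ordered_bell n) B (description_of cp vv)"
proof -
  have "length fs * K \<le> card (points B) * ordered_bell n"
    unfolding card_points by (intro mult_le_mono2 orderings_le_bell)
  then show ?thesis
    using vec_in_vectors node_less over_region
    by (auto simp: description_over_def description_of_def simp del: One_nat_def vector_from.simps)
qed

definition ranking where
  "ranking r = (\<lambda>(f, \<sigma>). val \<sigma> (vec (index_of fs f * K + (SOME j. j < K \<and> models r \<sigma> (region n (rk j))))))"

lemma ranking_eq:
  assumes "Well_order r" "j < K" "models r \<sigma> (region n (rk j))"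
  shows "ranking r (f, \<sigma>) = val \<sigma> (vec (index_of fs f * K + j))"
proof -
  have "(SOME j. j < K \<and> models r \<sigma> (region n (rk j))) = j"
    by (rule some_equality) (use assms region_unique[OF assms(1)] in blast)+
  then show ?thesis by (simp add: ranking_def)
qed

lemma defined_by:
  assumes "Well_order r"
  shows "defined_by n r B (ranking r) (description_of cp vv)"
proof -
  have "(\<exists>(R, v) \<in> set (description_of cp vv f). models r \<sigma> R) \<and>
    (\<forall>(R, v) \<in> set (description_of cp vv f). models r \<sigma> R \<longrightarrow> ranking r (f, \<sigma>) = val \<sigma> v)"
    if "(f, \<sigma>) \<in> states n r B" for f \<sigma>
  proof
    obtain j where j: "j < K" "models r \<sigma> (region n (rk j))"
      using region_exists[OF assms, of \<sigma>] \<open>(f, \<sigma>) \<in> _\<close> by (auto simp: states_def)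
    then have "(region n (rk j), vec (index_of fs f * K + j)) \<in> set (description_of cp vv f)"
      unfolding description_of_def set_map set_upt by (intro image_eqI[of _ _ j]) simp_all
    then show "\<exists>(R, v) \<in> set (description_of cp vv f). models r \<sigma> R" using j(2) by blast
  next
    show "\<forall>(R, v) \<in> set (description_of cp vv f). models r \<sigma> R \<longrightarrow> ranking r (f, \<sigma>) = val \<sigma> v"
      using ranking_eq[OF assms] by (auto simp: description_of_def simp del: vector_from.simps)
  qed
  then show ?thesis unfolding defined_by_def by blast
qed

lemma ranking_function:
  assumes wo: "Well_order r"
  shows "global_ranking_function n r B (vector_values n (card (points B) * ordered_bell n) r)
    (lexord (entry_less r)) (ranking r)"
  unfolding global_ranking_function_def
proof (intro conjI)
  let ?b = "card (points B) * ordered_bell n"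
  let ?W = "vector_values n ?b r"
  show "ranking r ` states n r B \<subseteq> ?W"
  proof clarify
    fix f \<sigma> assume s: "(f, \<sigma>) \<in> states n r B"
    then obtain j where j: "j < K" "models r \<sigma> (region n (rk j))"
      using region_exists[OF wo, of \<sigma>] by (auto simp: states_def)
    have "length fs * K \<le> ?b" unfolding card_points by (intro mult_le_mono2 orderings_le_bell)
    then have "vec (index_of fs f * K + j) \<in> vectors n ?b"
      using node_less[OF _ j(1)] s by (intro vec_in_vectors) (auto simp: states_def)
    then show "ranking r (f, \<sigma>) \<in> ?W"
      unfolding ranking_eq[OF wo j] vector_values_def using s unfolding states_def by blast
  qed
  show "wf (lexord (entry_less r) \<inter> ?W \<times> ?W)"
    by (rule wf_vector_values[OF wo])
  show "\<forall>(s, s')\<in>transitions n r B. (ranking r s', ranking r s) \<in> lexord (entry_less r)"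
  proof clarify
    fix f \<sigma> f' \<sigma>' assume tr: "((f, \<sigma>), (f', \<sigma>')) \<in> transitions n r B"
    then obtain G where G: "(f, G, f') \<in> set (arcs B)" and M: "models r \<sigma> (invar B f)"
      "models r \<sigma>' (invar B f')" "models r (case_tvar \<sigma> \<sigma>') G" "\<sigma> \<in> {1..n} \<rightarrow>\<^sub>E Field r" "\<sigma>' \<in> {1..n} \<rightarrow>\<^sub>E Field r"
      by (auto simp: transitions_def states_def)
    obtain a where a: "a < mcs_size B" "arcs B ! a = (f, G, f')" using G by (auto simp: in_set_conv_nth)
    obtain j j' where j: "j < K" "models r \<sigma> (region n (rk j))" and j': "j' < K" "models r \<sigma>' (region n (rk j'))"
      using region_exists[OF wo] M by meson
    \<comment> \<open>The copy of arc \<open>a\<close> between the nodes of the orderings that hold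
      before and after the transition.\<close>
    define e where "e = (a * K + j) * K + j'"
    have e: "e < mcs_size B * K * K" unfolding e_def by (intro index_less a j(1) j'(1))
    have ed: "e div K div K = a" "e div K mod K = j" "e mod K = j'" by (simp_all only: e_def index_div[OF j(1)] index_div[OF j'(1)])
    have G': "arcs B ! (e div K div K) = (f, G, f')" using a ed by simp
    have sd: "src e = index_of fs f * K + j" "dst e = index_of fs f' * K + j'"
      using src_dst[OF e G'] ed by simp_all
    have "sat r n (m0 e) (\<lambda>i. \<sigma> (Suc i)) (\<lambda>i. \<sigma>' (Suc i))"
      unfolding sat_models[OF e G'] sd rk_node[OF j(1)] rk_node[OF j'(1)] using M j j' by blast
    moreover have "lmat vv 0 e = m0 e" by (simp add: lmat_def fun_eq_iff)
    ultimately have "(val \<sigma>' (vec (dst e)), val \<sigma> (vec (src e))) \<in> lexord (entry_less r)"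
      using vector_decreases[OF wo, of 0 e \<sigma> \<sigma>'] e lv(1) by simp
    then show "(ranking r (f', \<sigma>'), ranking r (f, \<sigma>)) \<in> lexord (entry_less r)"
      unfolding ranking_eq[OF wo j] ranking_eq[OF wo j'] sd .
  qed
qed

lemma card_vectors: "card (snd ` set (description_of cp vv f)) \<le> ordered_bell n"
proof -
  have "card (snd ` set (description_of cp vv f)) \<le> length (description_of cp vv f)"
    by (metis card_length length_map list.set_map)
  then show ?thesis using orderings_le_bell[of n] by (simp add: description_of_def)
qed

end

section \<open>The running time of the whole program\<close>

context program_input
begin

definition total_cost :: nat where
  "total_cost = 2 + (enum_cost n + (tables_cost + ((n + 1) * (level_cost + 2) + 2 + output_cost)))"

lemma ho_ranking_program:
  assumes L: "mcs_size B \<noteq> 0"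
  shows "ho ranking_program (input_mem (encode_mcs n fs B)) total_cost
    (\<lambda>M. \<exists>As cp vv T. As 0 = {..<mcs_size B * K * K} \<and> (\<forall>l\<le>n. is_level l As cp vv (T l)) \<and>
       outp M (concat (map (\<lambda>f. K # concat (map (\<lambda>w. node_code cp vv (f * K + w)) [0..<K])) [0..<length fs])))"
    (is "ho _ ?M0 _ ?R")
proof -
  define M1 where "M1 = sem (Set NN (Read 0 (Const 0))) ?M0"
  have M1: "M1 0 = inp" "M1 NN 0 = n" using hd by (simp_all add: M1_def)
  have "ho (enumerate_orderings ;; tables ;; all_levels ;; put_all) M1
    (enum_cost n + (tables_cost + ((n + 1) * (level_cost + 2) + 2 + output_cost))) ?R"
  proof (rule ho_Seq[OF ho_enumerate[where M = M1 and n = n, OF M1(2) n_pos] _ order_refl])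
    fix M2 assume "\<exists>h. M2 LO 0 = h \<and> M2 LP 0 = h * n \<and> M2 HI 0 = h + K \<and>
      (\<forall>j<K. \<forall>i<n. M2 RK ((h + j) * n + i) = snd (orderings n ! j) ! i)"
      and fr2: "\<And>a. a \<notin> mods enumerate_orderings \<Longrightarrow> M2 a = M1 a"
    then obtain h where h: "M2 LO 0 = h" "M2 LP 0 = h * n" "M2 HI 0 = h + K"
      "\<forall>j<K. \<forall>i<n. M2 RK ((h + j) * n + i) = snd (orderings n ! j) ! i" by blast
    have M2: "M2 0 = inp" "M2 NN 0 = n" using fr2 M1 by simp_all
    show "ho (tables ;; all_levels ;; put_all) M2 (tables_cost + ((n + 1) * (level_cost + 2) + 2 + output_cost)) ?R"
    proof (rule ho_Seq[OF ho_tables[where M = M2, OF M2 h] _ order_refl])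
      fix M3 assume M3: "static M3 \<and> (\<forall>e<mcs_size B * K * K. M3 EA e \<noteq> 0) \<and> M3 KK 0 = K"
        and fr3: "\<And>a. a \<notin> mods tables \<Longrightarrow> M3 a = M2 a"
      show "ho (all_levels ;; put_all) M3 ((n + 1) * (level_cost + 2) + 2 + output_cost) ?R"
      proof (rule ho_Seq[OF ho_all_levels[where M = M3] _ order_refl])
        fix M4 assume d: "levels_done (n + 1) M4" and fr4: "\<And>a. a \<notin> mods all_levels \<Longrightarrow> M4 a = M3 a"
        obtain As cp vv T where As: "As 0 = {..<mcs_size B * K * K}" "\<forall>l<n + 1. is_level l As cp vv (T l)"
          "\<forall>q<length fs * K. \<forall>l<n + 1. vv l q \<le> n \<and> M4 VV (q * n + q + l) = vv l q \<and> M4 CP (q * n + q + l) = cp l q"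
          using d unfolding levels_done_def by blast
        have lev: "\<And>l. l \<le> n \<Longrightarrow> is_level l As cp vv (T l)" using As(2) by simp
        have s4: "static M4" by (rule static_cong[of M3]) (use M3 fr4 in \<open>auto simp: all_levels_def\<close>)
        have "M4 0 = inp" "M4 KK 0 = K" using fr4 fr3 M3 M2 by (auto simp: all_levels_def)
        then have M4: "M4 KK 0 = K" "M4 0 1 = length fs" using hd by simp_all
        show "ho put_all M4 output_cost ?R"
        proof (rule ho_conseq[OF ho_output[where M = M4 and vv = vv and cp = cp, OF s4 M4] _ order_refl])
          fix M' assume "outp M' (concat (map (\<lambda>f. K # concat (map (\<lambda>w. node_code cp vv (f * K + w)) [0..<K])) [0..<length fs]))"
          then show "?R M'" using As(1) lev by blast
        next
          fix q assume "q < length fs * K"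
          then show "\<exists>l\<le>n. vv l q = 0" by (rule exists_vv_zero[of As cp vv T, rotated]) (rule lev)
        qed (use As(3) in simp)
      qed (use M3 in simp_all)
    qed
  qed
  then have "ho (Set NN (Read 0 (Const 0)) ;; enumerate_orderings ;; tables ;; all_levels ;; put_all) ?M0
    (1 + (enum_cost n + (tables_cost + ((n + 1) * (level_cost + 2) + 2 + output_cost)))) ?R"
    unfolding M1_def by (rule ho_Seq_loop_free[rotated]) simp_all
  then show ?thesis
    unfolding ranking_program_def total_cost_def using L hd by (intro ho_If) auto
qed

text \<open>As there are no more flow-points than arcs, the number \<open>e\<close> of copies of
  arcs also dominates the numbers of nodes, flow-points and orderings. Each part is written as a
  polynomial and bounded by the sum of its coefficients times the leading term.\<close>

lemma total_cost_bound:
  assumes F: "length fs \<le> mcs_size B" and L: "mcs_size B \<noteq> 0"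
  shows "total_cost \<le> 14400 * 100^5 * (mcs_size B * n^(2 * n + 1))"
proof -
  define F' L' e where "F' = length fs" and "L' = mcs_size B" and "e = L' * K * K"
  have pos: "1 \<le> K" "1 \<le> L'" "F' \<le> L'" using orderings_pos[of n] F L unfolding F'_def L'_def by linarith+
  have LK: "L' * K \<le> e" "F' * K \<le> e" "L' \<le> e" "F' \<le> e" "K \<le> e"
  proof -
    show 1: "L' * K \<le> e" using mult_le_mono2[OF pos(1), of "L' * K"] by (simp add: e_def)
    show "F' * K \<le> e" using mult_le_mono1[OF pos(3), of K] 1 by linarith
    have 2: "L' \<le> L' * K" using mult_le_mono2[OF pos(1), of L'] by simp
    then show "L' \<le> e" "F' \<le> e" using 1 pos(3) by linarith+
    show "K \<le> e" using mult_le_mono1[OF pos(2), of K] 1 by linarith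
  qed
  then have e1: "1 \<le> e" using pos by linarith
  have pow: "i \<le> j \<Longrightarrow> n^i \<le> n^j" for i j using n_pos by (rule power_increasing[rotated])
  have p5: "1 \<le> n^5" "n \<le> n^5" "n^2 \<le> n^5" "n^3 \<le> n^5" using pow[of 0 5] pow[of 1 5] pow[of 2 5] pow[of 3 5] by simp_all
  have p6: "1 \<le> n^6" "n \<le> n^6" "n^2 \<le> n^6" "n^3 \<le> n^6" using pow[of 0 6] pow[of 1 6] pow[of 2 6] pow[of 3 6] by simp_all
  let ?X = "e * n^6"
  have X: "e \<le> ?X" "1 \<le> ?X" "n \<le> ?X" "K * n^6 \<le> ?X"
    using mult_le_mono2[OF p6(1), of e] e1 mult_le_mono[OF e1 p6(2)] mult_le_mono1[OF LK(5), of "n^6"] by linarith+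
  have arc: "arc_cost \<le> 1220 * n^5"
  proof -
    \<comment> \<open>\<open>896 = 14 * 2 * 2^5\<close>: at most 14 steps per closure iteration, two
      improvements per entry, and a matrix of size \<open>2 * n\<close>.\<close>
    have "arc_cost = 896 * n^5 + 112 * n^3 + 182 * n^2 + 30" unfolding arc_cost_def by algebra
    then show ?thesis using p5 by linarith
  qed
  have level: "level_cost \<le> 1687 * (e * n^5)"
  proof -
    have 1: "arc_cost + n * 18 + 100 \<le> 1338 * n^5" using arc p5 by linarith
    have "n * (n * 19 + 30) + 100 = 19 * n^2 + 30 * n + 100" by algebra
    then have 2: "n * (n * 19 + 30) + 100 \<le> 149 * n^5" using p5 by linarith
    have 3: "1 \<le> e * n^5" using mult_le_mono[OF e1 p5(1)] by simp
    have "level_cost = e * (arc_cost + n * 18 + 100) + F' * K * (n * (n * 19 + 30) + 100) + 200"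
      by (simp only: level_cost_def F'_def L'_def e_def)
    then have "level_cost \<le> e * (1338 * n^5) + e * (149 * n^5) + 200"
      using mult_le_mono2[OF 1, of e] mult_le_mono[OF LK(2) 2] by linarith
    then show ?thesis using 3 by linarith
  qed
  have levels: "(n + 1) * (level_cost + 2) + 2 \<le> 3380 * ?X"
  proof -
    have "1 \<le> e * n^5" using mult_le_mono[OF e1 p5(1)] by simp
    then have "level_cost + 2 \<le> 1689 * (e * n^5)" using level by linarith
    then have "(n + 1) * (level_cost + 2) \<le> (2 * n) * (1689 * (e * n^5))" using n_pos by (intro mult_le_mono) simp_all
    also have "\<dots> = 3378 * ?X" by algebra
    finally show ?thesis using X by linarith
  qed
  have enum: "enum_cost n \<le> 40 * ?X"
  proof -
    have "enum_cost n = 6 * (K * n^3) + 15 * (K * n^2) + 7 * (K * n) + 5 * n + 7"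
      unfolding enum_cost_def by algebra
    then show ?thesis
      using mult_le_mono2[OF p6(2), of K] mult_le_mono2[OF p6(3), of K] mult_le_mono2[OF p6(4), of K] X by linarith
  qed
  have tab: "tables_cost \<le> 92 * ?X"
  proof -
    have "tables_cost = n * 15 + 9 * (F' * K) + 9 * F' + 10 * e + 4 * (L' * K) + 5 * L' + 40"
      unfolding tables_cost_def F'_def L'_def e_def by algebra
    then show ?thesis using LK X by linarith
  qed
  have out: "output_cost \<le> 39 * ?X"
  proof -
    have "output_cost = 4 * (F' * K * n^2) + 12 * (F' * K * n) + 13 * (F' * K) + 6 * F' + 4"
      unfolding output_cost_def F'_def by algebra
    then show ?thesis
      using mult_le_mono[OF LK(2) p6(2)] mult_le_mono[OF LK(2) p6(3)] LK X by linarith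
  qed
  \<comment> \<open>The parts add up to 2 + 40 + 92 + 3380 + 39 = 3553. The factor 4 of
    \<open>orderings_square\<close> then turns 3600 into 14400.\<close>
  have "total_cost \<le> 3600 * ?X"
    unfolding total_cost_def using levels enum tab out X by linarith
  also have "?X = L' * (K^2 * n^6)" by (simp add: e_def power2_eq_square)
  also have "3600 * (L' * (K^2 * n^6)) \<le> 3600 * (L' * (4 * 100^5 * n^(2 * n + 1)))"
    by (intro mult_le_mono2 orderings_square n_pos)
  also have "\<dots> = 14400 * 100^5 * (mcs_size B * n^(2 * n + 1))" by (simp add: L'_def)
  finally show ?thesis .
qed

end

theorem theorem6p17:
  shows "\<exists>(P :: com) (c :: nat). \<forall>(n :: nat) (B :: 'f mcs) (fs :: 'f list).
    1 \<le> n \<and> is_mcs n B \<and> card (points B) \<le> mcs_size B \<and> terminating n B \<and>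
    distinct fs \<and> set fs = points B \<longrightarrow>
    (\<exists>(D :: 'f description) (t :: nat).
       description_over n (card (points B) * ordered_bell n) B D \<and>
       (\<forall>f \<in> points B. card (snd ` set (D f)) \<le> ordered_bell n) \<and>
       (\<forall>r :: 'v rel. Well_order r \<longrightarrow>
          (\<exists>\<rho>. global_ranking_function n r B
                  (vector_values n (card (points B) * ordered_bell n) r)
                  (lexord (entry_less r)) \<rho> \<and>
               defined_by n r B \<rho> D)) \<and>
       computes P (encode_mcs n fs B) t (encode_description n fs D) \<and>
       t \<le> c * (mcs_size B * n ^ (2 * n + 1) + 1))"
proof (rule exI[of _ ranking_program], rule exI[of _ "14400 * 100^5"], intro allI impI)
  fix n :: nat and B :: "'f mcs" and fs :: "'f list"
  let ?b = "card (points B) * ordered_bell n"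
  let ?goal = "\<lambda>(D :: 'f description) (t :: nat). description_over n ?b B D \<and>
    (\<forall>f \<in> points B. card (snd ` set (D f)) \<le> ordered_bell n) \<and>
    (\<forall>r :: 'v rel. Well_order r \<longrightarrow> (\<exists>\<rho>. global_ranking_function n r B (vector_values n ?b r)
      (lexord (entry_less r)) \<rho> \<and> defined_by n r B \<rho> D)) \<and>
    computes ranking_program (encode_mcs n fs B) t (encode_description n fs D) \<and>
    t \<le> 14400 * 100^5 * (mcs_size B * n ^ (2 * n + 1) + 1)"
  assume H: "1 \<le> n \<and> is_mcs n B \<and> card (points B) \<le> mcs_size B \<and> terminating n B \<and>
    distinct fs \<and> set fs = points B"
  interpret program_input n B fs using H by unfold_locales auto
  have F: "length fs \<le> mcs_size B" using H distinct_card by metis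
  show "\<exists>D t. ?goal D t"
  proof (cases "mcs_size B = 0")
    \<comment> \<open>Without arcs there are no flow-points, so the empty description does and there
      are no states to rank.\<close>
    case True
    then have e: "points B = {}" "fs = []" using F H by auto
    have st: "states n r B = {}" "transitions n r B = {}" for r :: "'v rel"
      using e by (auto simp: states_def transitions_def)
    have "exec ranking_program (input_mem (encode_mcs n fs B)) (Suc 1) (input_mem (encode_mcs n fs B))"
      unfolding ranking_program_def using True hd(3) by (intro exec.IfFalse exec.Skip) simp
    then have "computes ranking_program (encode_mcs n fs B) (Suc 1) (encode_description n fs (\<lambda>_. []))"
      using e by (auto simp: computes_def encode_description_def)
    then have "?goal (\<lambda>_. []) (Suc 1)"
      using e st wf_vector_values
      by (auto simp: description_over_def global_ranking_function_def defined_by_def)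
    then show ?thesis by blast
  next
    case False
    obtain t M As cp vv T where t: "exec ranking_program (input_mem (encode_mcs n fs B)) t M" "t \<le> total_cost"
      and As: "As 0 = {..<mcs_size B * K * K}" "\<forall>l\<le>n. is_level l As cp vv (T l)"
      and out: "outp M (concat (map (\<lambda>f. K # concat (map (\<lambda>w. node_code cp vv (f * K + w)) [0..<K])) [0..<length fs]))"
      using ho_ranking_program[OF False] unfolding ho_def by blast
    interpret program_result n B fs As cp vv T using H As by unfold_locales auto
    have "computes ranking_program (encode_mcs n fs B) t (encode_description n fs (description_of cp vv))"
      unfolding computes_def encode using t(1) out unfolding outp_def by blast
    moreover have "t \<le> 14400 * 100^5 * (mcs_size B * n ^ (2 * n + 1) + 1)"
      using t(2) total_cost_bound[OF F False] by simp
    ultimately have "?goal (description_of cp vv) t"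
      using description_over card_vectors ranking_function defined_by by blast
    then show ?thesis by blast
  qed
qed

end
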